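(* For $\gamma\in[0,1)$ and $\varepsilon>0$ let $\mathcal G^\gamma_\varepsilon:\mathbf L^p_{\mathsf{pot}}(\Omega)\otimes L^p(\mathbb R^d)\to L^p(\Omega\times\varepsilon\mathbb Z^d)$, and for $\gamma\in(0,1)$ let $\mathcal F^\gamma_\varepsilon:L^p_{\mathsf{inv}}(\Omega)\otimes L^p(\mathbb R^d)\to L^p(\Omega\times\varepsilon\mathbb Z^d)$, be the recovery operators described in the context. (i) The mapping $(L^p_{\mathsf{inv}}(\Omega)\otimes W^{1,p}(\mathbb R^d))\times(\mathbf L^p_{\mathsf{pot}}(\Omega)\otimes L^p(\mathbb R^d))\to L^p(\Omega\times\varepsilon\mathbb Z^d)$, $(U,\chi)\mapsto u_\varepsilon(U,\chi):=\mathcal F_\varepsilon U+\mathcal G^0_\varepsilon\chi$, is linear and bounded, and $$u_\varepsilon(U,\chi)\overset{2}{\to}U\text{ in }L^p(\Omega\times\mathbb R^d),\qquad \nabla^\varepsilon u_\varepsilon(U,\chi)\overset{2}{\to}\nabla U+\chi\text{ in }L^p(\Omega\times\mathbb R^d)^d .$$ Moreover, its operator norm is bounded uniformly in $0<\varepsilon\le1$. (ii) Let $\gamma\in(0,1)$. The mapping $(L^p_{\mathsf{inv}}(\Omega)\otimes L^p(\mathbb R^d))\times(\mathbf L^p_{\mathsf{pot}}(\Omega)\otimes L^p(\mathbb R^d))\to L^p(\Omega\times\varepsilon\mathbb Z^d)$, $(U,\chi)\mapsto u_\varepsilon(U,\chi):=\mathcal F^\gamma_\varepsilon U+\mathcal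 G^\gamma_\varepsilon\chi$, is linear and bounded, and $$u_\varepsilon(U,\chi)\overset{2}{\to}U\text{ in }L^p(\Omega\times\mathbb R^d),\qquad \varepsilon^\gamma\nabla^\varepsilon u_\varepsilon(U,\chi)\overset{2}{\to}\chi\text{ in }L^p(\Omega\times\mathbb R^d)^d .$$ Moreover, its operator norm is bounded uniformly in $0<\varepsilon\le1$. Let in addition $O\subset\mathbb R^d$ be open and bounded with Lipschitz boundary. (iii) For any $(U,\chi)\in(L^p_{\mathsf{inv}}(\Omega)\otimes W^{1,p}_0(O))\times(\mathbf L^p_{\mathsf{pot}}(\Omega)\otimes L^p(O))$ there exists a sequence $u_\varepsilon\in L^p(\Omega)\otimes L^p_0(O\cap\varepsilon\mathbb Z^d)$ such that $$u_\varepsilon\overset{2}{\to}U\text{ in }L^p(\Omega\times\mathbb R^d),\qquad \nabla^\varepsilon u_\varepsilon\overset{2}{\to}\nabla U+\chi\text{ in }L^p(\Omega\times\mathbb R^d)^d .$$ (iv) Let $\gamma\in(0,1)$. There exists a mapping $(L^p_{\mathsf{inv}}(\Omega)\otimes L^p(O))\times(\mathbf L^p_{\mathsf{pot}}(\Omega)\otimes L^p(O))\to L^p(\Omega)\otimes L^p_0(O\cap\varepsilon\mathbb Z^d)$, $(U,\chi)\mapsto u_\varepsilon(U,\chi)$, which is linear and bounded, and $$u_\varepsilon(U,\chi)\overset{2}{\to}U\text{ in }L^p(\Omega\times\mathbb R^d),\qquad \varepsilon^\gamma\nabla^\varepsilon u_\varepsilon(U,\chi)\overset{2}{\to}\chi\text{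 in }L^p(\Omega\times\mathbb R^d)^d .$$ Moreover, its operator norm is bounded uniformly in $0<\varepsilon\le1$.
   Context: Probability setting: $p,q\in(1,\infty)$ with $\frac1p+\frac1q=1$. $(\Omega,\mathcal F,P)$ is a probability space which is a separable measure space (so $L^p(\Omega)$ is separable), $\langle\cdot\rangle$ denotes expectation, and $(T_x)_{x\in\mathbb Z^d}$ is a measure preserving dynamical system: each $T_x:\Omega\to\Omega$ is measurable, $T_0=\mathrm{Id}$, $T_{x+y}=T_x\circ T_y$, and $P(T_xA)=P(A)$ for all $A\in\mathcal F$, $x,y\in\mathbb Z^d$. $e_1,\dots,e_d$ is the standard basis of $\mathbb R^d$. For $\varphi:\Omega\to\mathbb R$, $D_i\varphi(\omega)=\varphi(T_{e_i}\omega)-\varphi(\omega)$ and $D\varphi=(D_1\varphi,\dots,D_d\varphi)$. $L^p_{\mathsf{inv}}(\Omega)=\{\varphi\in L^p(\Omega):\varphi(T_x\omega)=\varphi(\omega)\ \forall x\in\mathbb Z^d,\text{ a.e. }\omega\}$; $\mathbf L^p_{\mathsf{pot}}(\Omega)$ is the closure of $\{D\varphi:\varphi\in L^p(\Omega)\}$ in $L^p(\Omega)^d$. Discrete setting: for $\varepsilon>0$, $m_\varepsilon=\varepsilon^d\sum_{x\in\varepsilon\mathbb Z^d}\delta_x$; $L^p(\varepsilon\mathbb Z^d)$ and $L^p(\Omega\times\varepsilon\mathbb Z^d)$ are the $L^p$-spaces for $m_\varepsilon$ and $P\otimes m_\varepsilon$. $\nabla^\varepsilon u=(\nabla^\varepsilon_1u,\dots,\nabla^\varepsilon_du)$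 with $\nabla^\varepsilon_iu(x)=\frac{u(x+\varepsilon e_i)-u(x)}{\varepsilon}$. $L^p_0(O\cap\varepsilon\mathbb Z^d)=\{u\in L^p(\varepsilon\mathbb Z^d):u=0\text{ on }\varepsilon\mathbb Z^d\setminus O\}$. Tensor products: for linear subspaces $X$ of $L^p(\Omega)$ (or $L^p(\Omega)^d$) and $Y$ of $L^p(\mathbb R^d)$ (resp. $L^p(\varepsilon\mathbb Z^d)$), $X\otimes Y$ is the closure of the linear span of $\{\varphi\eta:\varphi\in X,\eta\in Y\}$ in $L^p(\Omega\times\mathbb R^d)$ (resp. $L^p(\Omega\times\varepsilon\mathbb Z^d)$), or its $d$-vector version; if $Y\subset W^{1,p}(\mathbb R^d)$ is a Sobolev space the closure is taken in $L^p(\Omega,W^{1,p}(\mathbb R^d))$. Functions in $L^p(O)$ and in $W^{1,p}_0(O)$ (closure of $C_c^\infty(O)$ in $W^{1,p}(O)$) are identified with their extension by $0$ to $\mathbb R^d$. $\nabla U$ is the weak gradient in $x$. Unfolding and folding: with $\Box=[-\frac12,\frac12)^d$, $\overline u(x)=u(\lfloor x\rfloor_\varepsilon)$ is the piecewise-constant interpolation of $u:\varepsilon\mathbb Z^d\to\mathbb R$, where $\lfloor x\rfloor_\varepsilon\in\varepsilon\mathbb Z^d$ is defined by $x-\lfloor x\rfloor_\varepsilon\in\varepsilon\Box$. $(\widetilde{\mathcal T}_\varepsilon u)(\omega,x)=u(T_{-x/\varepsilon}\omega,x)$ for $x\in\varepsilon\mathbb Z^d$, and $\mathcal T_\varepsilon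 u=\overline{\widetilde{\mathcal T}_\varepsilon u}$, a linear isometry $L^p(\Omega\times\varepsilon\mathbb Z^d)\to L^p(\Omega\times\mathbb R^d)$. $u_\varepsilon\overset{2}{\to}U$ in $L^p(\Omega\times\mathbb R^d)$ means $\mathcal T_\varepsilon u_\varepsilon\to U$ strongly in $L^p(\Omega\times\mathbb R^d)$ as $\varepsilon\to0$, componentwise for vector-valued functions. The folding operator is $\mathcal F_\varepsilon=\widetilde{\mathcal T}_\varepsilon^{-1}\circ\pi_\varepsilon:L^p(\Omega\times\mathbb R^d)\to L^p(\Omega\times\varepsilon\mathbb Z^d)$, with $(\pi_\varepsilon U)(x)=\varepsilon^{-d}\int_{x+\varepsilon\Box}U(y)\,dy$, i.e. $(\mathcal F_\varepsilon U)(\omega,x)=(\pi_\varepsilon U)(T_{x/\varepsilon}\omega,x)$. Recovery operators: for $\gamma\in[0,1)$, $\mathcal G^\gamma_\varepsilon$ are linear bounded operators, with operator norms bounded independently of $0<\varepsilon\le1$, such that for all $\chi\in\mathbf L^p_{\mathsf{pot}}(\Omega)\otimes L^p(\mathbb R^d)$: $\mathcal G^\gamma_\varepsilon\chi\overset{2}{\to}0$ in $L^p(\Omega\times\mathbb R^d)$ and $\varepsilon^\gamma\nabla^\varepsilon\mathcal G^\gamma_\varepsilon\chi\overset{2}{\to}\chi$ in $L^p(\Omega\times\mathbb R^d)^d$. For $\gamma\in(0,1)$, $\mathcal F^\gamma_\varepsilon$ are linear bounded operators, with operator norms bounded independently of $0<\varepsilon\le1$, such that for all $U\in L^p_{\mathsf{inv}}(\Omega)\otimes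 L^p(\mathbb R^d)$: $\mathcal F^\gamma_\varepsilon U\overset{2}{\to}U$ in $L^p(\Omega\times\mathbb R^d)$ and $\varepsilon^\gamma\nabla^\varepsilon\mathcal F^\gamma_\varepsilon U\overset{2}{\to}0$ in $L^p(\Omega\times\mathbb R^d)^d$. (Such families exist; this is a separate proposition of the paper.) *)

theory Defs
  imports "HOL-Probability.Probability"
begin

text \<open>
  Elements of $L^p$ are represented by measurable functions; the almost everywhere
  identification is made explicit in every notion below (closures, convergence, linearity).
\<close>

definition Lp_space :: "real \<Rightarrow> 'a measure \<Rightarrow> ('a \<Rightarrow> 'b::euclidean_space) set" where
  "Lp_space p N = {f \<in> borel_measurable N. integrable N (\<lambda>x. norm (f x) powr p)}"

definition Lp_norm :: "real \<Rightarrow> 'a measure \<Rightarrow> ('a \<Rightarrow> 'b::euclidean_space) \<Rightarrow> real" where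
  "Lp_norm p N f = (\<integral>x. norm (f x) powr p \<partial>N) powr (1 / p)"

definition Lp_closure ::
    "real \<Rightarrow> 'a measure \<Rightarrow> ('a \<Rightarrow> 'b::euclidean_space) set \<Rightarrow> ('a \<Rightarrow> 'b) set" where
  "Lp_closure p N A = {f \<in> Lp_space p N. \<forall>\<delta>>0. \<exists>g\<in>A. Lp_norm p N (\<lambda>x. f x - g x) < \<delta>}"

definition Lp_tendsto ::
    "real \<Rightarrow> 'a measure \<Rightarrow> ('i \<Rightarrow> 'a \<Rightarrow> 'b::euclidean_space) \<Rightarrow> ('a \<Rightarrow> 'b) \<Rightarrow> 'i filter \<Rightarrow> bool" where
  "Lp_tendsto p N f l F \<longleftrightarrow>
     (\<forall>\<^sub>F \<epsilon> in F. f \<epsilon> \<in> Lp_space p N) \<and> l \<in> Lp_space p N \<and>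
     ((\<lambda>\<epsilon>. Lp_norm p N (\<lambda>x. f \<epsilon> x - l x)) \<longlongrightarrow> 0) F"

text \<open>
  Bounded linear operators from a subspace \<open>X\<close> of $L^p(N)$ to $L^p(N')$. Linearity is linearity
  of the induced map on classes; that the map respects classes follows from linearity and
  boundedness.
\<close>

definition Lp_bounded_linear ::
    "real \<Rightarrow> 'a measure \<Rightarrow> ('a \<Rightarrow> 'b::euclidean_space) set \<Rightarrow>
     'c measure \<Rightarrow> (('a \<Rightarrow> 'b) \<Rightarrow> 'c \<Rightarrow> 'd::euclidean_space) \<Rightarrow> bool" where
  "Lp_bounded_linear p N X N' A \<longleftrightarrow>
     (\<forall>f\<in>X. A f \<in> Lp_space p N') \<and>
     (\<forall>f\<in>X. \<forall>g\<in>X. AE z in N'. A (\<lambda>x. f x + g x) z = A f z + A g z) \<and>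
     (\<forall>f\<in>X. \<forall>c::real. AE z in N'. A (\<lambda>x. c *\<^sub>R f x) z = c *\<^sub>R A f z) \<and>
     (\<exists>C. \<forall>f\<in>X. Lp_norm p N' (A f) \<le> C * Lp_norm p N f)"

text \<open>
  Bounded linear maps from the product of two function spaces \<open>X\<close>, \<open>Y\<close>, seminormed by \<open>\<nu>X\<close>
  and \<open>\<nu>Y\<close>, to a subspace \<open>Z\<close> of $L^p(N)$; the product carries the sum of the two norms.
\<close>

definition pair_bounded_linear ::
    "('a \<Rightarrow> 'b::euclidean_space) set \<Rightarrow> (('a \<Rightarrow> 'b) \<Rightarrow> real) \<Rightarrow>
     ('a \<Rightarrow> 'c::euclidean_space) set \<Rightarrow> (('a \<Rightarrow> 'c) \<Rightarrow> real) \<Rightarrow>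
     real \<Rightarrow> 'e measure \<Rightarrow> ('e \<Rightarrow> 'd::euclidean_space) set \<Rightarrow>
     (('a \<Rightarrow> 'b) \<Rightarrow> ('a \<Rightarrow> 'c) \<Rightarrow> 'e \<Rightarrow> 'd) \<Rightarrow> bool" where
  "pair_bounded_linear X \<nu>X Y \<nu>Y p N Z A \<longleftrightarrow>
     (\<forall>f\<in>X. \<forall>g\<in>Y. A f g \<in> Z) \<and>
     (\<forall>f\<in>X. \<forall>f'\<in>X. \<forall>g\<in>Y. \<forall>g'\<in>Y.
        AE z in N. A (\<lambda>x. f x + f' x) (\<lambda>x. g x + g' x) z = A f g z + A f' g' z) \<and>
     (\<forall>f\<in>X. \<forall>g\<in>Y. \<forall>c::real.
        AE z in N. A (\<lambda>x. c *\<^sub>R f x) (\<lambda>x. c *\<^sub>R g x) z = c *\<^sub>R A f g z) \<and>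
     (\<exists>C. \<forall>f\<in>X. \<forall>g\<in>Y. Lp_norm p N (A f g) \<le> C * (\<nu>X f + \<nu>Y g))"

definition partial_deriv :: "'n \<Rightarrow> (real ^ 'n \<Rightarrow> real) \<Rightarrow> real ^ 'n \<Rightarrow> real" where
  "partial_deriv i f x = frechet_derivative f (at x) (axis i 1)"

primrec Ck_function :: "nat \<Rightarrow> (real ^ 'n \<Rightarrow> real) \<Rightarrow> bool" where
  "Ck_function 0 f \<longleftrightarrow> continuous_on UNIV f"
| "Ck_function (Suc k) f \<longleftrightarrow>
     f differentiable_on UNIV \<and> (\<forall>i. Ck_function k (partial_deriv i f))"

definition test_functions :: "(real ^ 'n) set \<Rightarrow> (real ^ 'n \<Rightarrow> real) set" where
  "test_functions S =
     {\<psi>. (\<forall>k. Ck_function k \<psi>) \<and> compact (closure {x. \<psi> x \<noteq> 0}) \<and> closure {x. \<psi> x \<noteq> 0} \<subseteq> S}"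

text \<open>Functions on \<open>S\<close> are identified with their extension by zero to the whole space.\<close>

definition Lp_on :: "real \<Rightarrow> (real ^ 'n) set \<Rightarrow> (real ^ 'n \<Rightarrow> 'b::euclidean_space) set" where
  "Lp_on p S = {\<eta> \<in> Lp_space p lborel. AE x in lborel. x \<notin> S \<longrightarrow> \<eta> x = 0}"

definition is_weak_gradient ::
    "(real ^ 'n) set \<Rightarrow> (real ^ 'n \<Rightarrow> real) \<Rightarrow> (real ^ 'n \<Rightarrow> real ^ 'n) \<Rightarrow> bool" where
  "is_weak_gradient S \<eta> V \<longleftrightarrow>
     (\<forall>\<psi>\<in>test_functions S. \<forall>i.
        (\<integral>x. \<eta> x * partial_deriv i \<psi> x \<partial>lborel) = - (\<integral>x. V x $ i * \<psi> x \<partial>lborel))"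

definition W1p :: "real \<Rightarrow> (real ^ 'n) set \<Rightarrow> (real ^ 'n \<Rightarrow> real) set" where
  "W1p p S = {\<eta> \<in> Lp_on p S. \<exists>V\<in>Lp_on p S. is_weak_gradient S \<eta> V}"

definition weak_gradient ::
    "real \<Rightarrow> (real ^ 'n) set \<Rightarrow> (real ^ 'n \<Rightarrow> real) \<Rightarrow> real ^ 'n \<Rightarrow> real ^ 'n" where
  "weak_gradient p S \<eta> = (SOME V. V \<in> Lp_on p S \<and> is_weak_gradient S \<eta> V)"

definition W1p_norm :: "real \<Rightarrow> (real ^ 'n) set \<Rightarrow> (real ^ 'n \<Rightarrow> real) \<Rightarrow> real" where
  "W1p_norm p S \<eta> =
     (Lp_norm p lborel \<eta> powr p + Lp_norm p lborel (weak_gradient p S \<eta>) powr p) powr (1 / p)"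

definition W1p_0 :: "real \<Rightarrow> (real ^ 'n) set \<Rightarrow> (real ^ 'n \<Rightarrow> real) set" where
  "W1p_0 p S =
     {\<eta> \<in> W1p p S. \<forall>\<delta>>0. \<exists>\<psi>\<in>test_functions S. W1p_norm p S (\<lambda>x. \<eta> x - \<psi> x) < \<delta>}"

text \<open>
  The Bochner space $L^p(\Omega, W^{1,p}(R^d))$, realised inside $L^p(\Omega \times R^d)$: almost
  every section is weakly differentiable, with a jointly measurable $p$-integrable gradient.
  By Fubini its norm is the one given by the two $L^p(\Omega \times R^d)$-norms.
\<close>

definition is_weak_gradient_x ::
    "'w measure \<Rightarrow> ('w \<times> (real ^ 'n) \<Rightarrow> real) \<Rightarrow> ('w \<times> (real ^ 'n) \<Rightarrow> real ^ 'n) \<Rightarrow> bool" where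
  "is_weak_gradient_x M U V \<longleftrightarrow>
     (AE \<omega> in M. is_weak_gradient UNIV (\<lambda>x. U (\<omega>, x)) (\<lambda>x. V (\<omega>, x)))"

definition Lp_W1p :: "real \<Rightarrow> 'w measure \<Rightarrow> ('w \<times> (real ^ 'n) \<Rightarrow> real) set" where
  "Lp_W1p p M =
     {U \<in> Lp_space p (M \<Otimes>\<^sub>M lborel).
        \<exists>V\<in>Lp_space p (M \<Otimes>\<^sub>M lborel). is_weak_gradient_x M U V}"

definition weak_gradient_x ::
    "real \<Rightarrow> 'w measure \<Rightarrow> ('w \<times> (real ^ 'n) \<Rightarrow> real) \<Rightarrow> 'w \<times> (real ^ 'n) \<Rightarrow> real ^ 'n" where
  "weak_gradient_x p M U =
     (SOME V. V \<in> Lp_space p (M \<Otimes>\<^sub>M lborel) \<and> is_weak_gradient_x M U V)"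

definition Lp_W1p_norm :: "real \<Rightarrow> 'w measure \<Rightarrow> ('w \<times> (real ^ 'n) \<Rightarrow> real) \<Rightarrow> real" where
  "Lp_W1p_norm p M U =
     (Lp_norm p (M \<Otimes>\<^sub>M lborel) U powr p +
      Lp_norm p (M \<Otimes>\<^sub>M lborel) (weak_gradient_x p M U) powr p) powr (1 / p)"

definition tensor_span ::
    "('w \<Rightarrow> 'b::euclidean_space) set \<Rightarrow> ('x \<Rightarrow> real) set \<Rightarrow> ('w \<times> 'x \<Rightarrow> 'b) set" where
  "tensor_span X Y =
     {g. \<exists>(m::nat) c \<phi> \<eta>. (\<forall>j<m. \<phi> j \<in> X \<and> \<eta> j \<in> Y) \<and>
           g = (\<lambda>(\<omega>, x). \<Sum>j<m. c j *\<^sub>R (\<eta> j x *\<^sub>R \<phi> j \<omega>))}"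

definition tensor ::
    "real \<Rightarrow> 'w measure \<Rightarrow> 'x measure \<Rightarrow> ('w \<Rightarrow> 'b::euclidean_space) set \<Rightarrow> ('x \<Rightarrow> real) set \<Rightarrow>
     ('w \<times> 'x \<Rightarrow> 'b) set" where
  "tensor p M N X Y = Lp_closure p (M \<Otimes>\<^sub>M N) (tensor_span X Y)"

definition sobolev_tensor ::
    "real \<Rightarrow> 'w measure \<Rightarrow> ('w \<Rightarrow> real) set \<Rightarrow> (real ^ 'n \<Rightarrow> real) set \<Rightarrow>
     ('w \<times> (real ^ 'n) \<Rightarrow> real) set" where
  "sobolev_tensor p M X Y =
     {U \<in> Lp_W1p p M. \<forall>\<delta>>0. \<exists>g\<in>tensor_span X Y. Lp_W1p_norm p M (\<lambda>z. U z - g z) < \<delta>}"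

definition int_lattice :: "(real ^ 'n) set" where
  "int_lattice = {x. \<forall>i. x $ i \<in> \<int>}"

definition scaled_lattice :: "real \<Rightarrow> (real ^ 'n) set" where
  "scaled_lattice \<epsilon> = (\<lambda>k. \<epsilon> *\<^sub>R k) ` int_lattice"

text \<open>$m_\varepsilon$, as a measure on the set $\varepsilon Z^d$.\<close>

definition lattice_measure :: "real \<Rightarrow> (real ^ 'n) measure" where
  "lattice_measure \<epsilon> = density (count_space (scaled_lattice \<epsilon>)) (\<lambda>_. ennreal (\<epsilon> ^ CARD('n)))"

definition Lp_lattice_0 :: "real \<Rightarrow> real \<Rightarrow> (real ^ 'n) set \<Rightarrow> (real ^ 'n \<Rightarrow> real) set" where
  "Lp_lattice_0 p \<epsilon> S = {u \<in> Lp_space p (lattice_measure \<epsilon>). \<forall>x \<in> scaled_lattice \<epsilon> - S. u x = 0}"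

definition discrete_gradient ::
    "real \<Rightarrow> ('w \<times> (real ^ 'n) \<Rightarrow> real) \<Rightarrow> 'w \<times> (real ^ 'n) \<Rightarrow> real ^ 'n" where
  "discrete_gradient \<epsilon> u = (\<lambda>(\<omega>, x). \<chi> i. (u (\<omega>, x + \<epsilon> *\<^sub>R axis i 1) - u (\<omega>, x)) / \<epsilon>)"

definition unit_cell :: "(real ^ 'n) set" where
  "unit_cell = {x. \<forall>i. - 1/2 \<le> x $ i \<and> x $ i < 1/2}"

definition lattice_floor :: "real \<Rightarrow> real ^ 'n \<Rightarrow> real ^ 'n" where
  "lattice_floor \<epsilon> x = (THE y. y \<in> scaled_lattice \<epsilon> \<and> x - y \<in> (\<lambda>z. \<epsilon> *\<^sub>R z) ` unit_cell)"

lemma lattice_floor_eq: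
  fixes x :: "real ^ 'n"
  assumes "\<epsilon> > 0"
  shows "lattice_floor \<epsilon> x = (\<chi> i. \<epsilon> * of_int (round (x $ i / \<epsilon>)))"
  unfolding lattice_floor_def
proof (rule the_equality)
  let ?y = "(\<chi> i. \<epsilon> * of_int (round (x $ i / \<epsilon>))) :: real ^ 'n"
  have "?y = \<epsilon> *\<^sub>R (\<chi> i. of_int (round (x $ i / \<epsilon>)))"
    by (simp add: vec_eq_iff)
  then have 1: "?y \<in> scaled_lattice \<epsilon>"
    unfolding scaled_lattice_def int_lattice_def by auto
  have "x - ?y = \<epsilon> *\<^sub>R (\<chi> i. x $ i / \<epsilon> - of_int (round (x $ i / \<epsilon>)))"
    using assms by (simp add: vec_eq_iff right_diff_distrib)
  moreover have "(\<chi> i. x $ i / \<epsilon> - of_int (round (x $ i / \<epsilon>))) \<in> unit_cell"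
    unfolding unit_cell_def
  proof (rule CollectI, rule allI)
    fix i
    have "- 1/2 \<le> t - of_int (round t) \<and> t - of_int (round t) < 1/2" for t :: real
      using of_int_round_le[of t] of_int_round_gt[of t] by (simp add: field_simps)
    then show "- 1/2 \<le> (\<chi> i. x $ i / \<epsilon> - of_int (round (x $ i / \<epsilon>))) $ i \<and>
        (\<chi> i. x $ i / \<epsilon> - of_int (round (x $ i / \<epsilon>))) $ i < 1/2"
      by (simp only: vec_lambda_beta)
  qed
  ultimately show "?y \<in> scaled_lattice \<epsilon> \<and> x - ?y \<in> (\<lambda>z. \<epsilon> *\<^sub>R z) ` unit_cell"
    using 1 by blast
next
  fix y :: "real ^ 'n"
  assume "y \<in> scaled_lattice \<epsilon> \<and> x - y \<in> (\<lambda>z. \<epsilon> *\<^sub>R z) ` unit_cell"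
  then obtain k z where k: "\<forall>i. k $ i \<in> \<int>" "y = \<epsilon> *\<^sub>R k"
    and z: "\<forall>i. - 1/2 \<le> z $ i \<and> z $ i < 1/2" "x - y = \<epsilon> *\<^sub>R z"
    unfolding scaled_lattice_def int_lattice_def unit_cell_def by auto
  show "y = (\<chi> i. \<epsilon> * of_int (round (x $ i / \<epsilon>)))"
  proof (clarsimp simp: vec_eq_iff)
    fix i
    from k(1) obtain n where n: "k $ i = of_int n" by (metis Ints_cases)
    have "x = y + \<epsilon> *\<^sub>R z" using z(2) by (metis add.commute diff_add_cancel)
    then have "x $ i / \<epsilon> = of_int n + z $ i"
      using assms k(2) n by (simp add: field_simps)
    moreover have "- 1/2 \<le> z $ i" "z $ i < 1/2" using z(1) by auto
    ultimately have "round (x $ i / \<epsilon>) = n"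
      unfolding round_def by (intro floor_unique) auto
    then show "y $ i = \<epsilon> * of_int (round (x $ i / \<epsilon>))"
      using k(2) n by simp
  qed
qed

definition separable_measure :: "'w measure \<Rightarrow> bool" where
  "separable_measure M \<longleftrightarrow>
     (\<exists>\<A>. countable \<A> \<and> \<A> \<subseteq> sets M \<and>
        (\<forall>B\<in>sets M. \<forall>\<delta>>0. \<exists>A\<in>\<A>. measure M ((A - B) \<union> (B - A)) < \<delta>))"

text \<open>The action \<open>T\<close> is only used at points of \<open>int_lattice\<close>.\<close>

locale measure_preserving_system = prob_space M
  for M :: "'w measure" and T :: "real ^ 'n \<Rightarrow> 'w \<Rightarrow> 'w" +
  assumes separable: "separable_measure M"
    and T_measurable: "x \<in> int_lattice \<Longrightarrow> T x \<in> measurable M M"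
    and T_zero: "\<omega> \<in> space M \<Longrightarrow> T 0 \<omega> = \<omega>"
    and T_add: "x \<in> int_lattice \<Longrightarrow> y \<in> int_lattice \<Longrightarrow> \<omega> \<in> space M \<Longrightarrow>
                  T (x + y) \<omega> = T x (T y \<omega>)"
    and T_preserving: "x \<in> int_lattice \<Longrightarrow> A \<in> sets M \<Longrightarrow> emeasure M (T x ` A) = emeasure M A"

definition Lp_inv ::
    "real \<Rightarrow> 'w measure \<Rightarrow> (real ^ 'n \<Rightarrow> 'w \<Rightarrow> 'w) \<Rightarrow> ('w \<Rightarrow> real) set" where
  "Lp_inv p M T = {\<phi> \<in> Lp_space p M. \<forall>x\<in>int_lattice. AE \<omega> in M. \<phi> (T x \<omega>) = \<phi> \<omega>}"

definition horizontal_gradient ::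
    "(real ^ 'n \<Rightarrow> 'w \<Rightarrow> 'w) \<Rightarrow> ('w \<Rightarrow> real) \<Rightarrow> 'w \<Rightarrow> real ^ 'n" where
  "horizontal_gradient T \<phi> \<omega> = (\<chi> i. \<phi> (T (axis i 1) \<omega>) - \<phi> \<omega>)"

definition Lp_pot ::
    "real \<Rightarrow> 'w measure \<Rightarrow> (real ^ 'n \<Rightarrow> 'w \<Rightarrow> 'w) \<Rightarrow> ('w \<Rightarrow> real ^ 'n) set" where
  "Lp_pot p M T = Lp_closure p M (horizontal_gradient T ` Lp_space p M)"

definition unfold_discrete ::
    "(real ^ 'n \<Rightarrow> 'w \<Rightarrow> 'w) \<Rightarrow> real \<Rightarrow> ('w \<times> (real ^ 'n) \<Rightarrow> 'b) \<Rightarrow> 'w \<times> (real ^ 'n) \<Rightarrow> 'b" where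
  "unfold_discrete T \<epsilon> u = (\<lambda>(\<omega>, x). u (T (- x /\<^sub>R \<epsilon>) \<omega>, x))"

definition unfold ::
    "(real ^ 'n \<Rightarrow> 'w \<Rightarrow> 'w) \<Rightarrow> real \<Rightarrow> ('w \<times> (real ^ 'n) \<Rightarrow> 'b) \<Rightarrow> 'w \<times> (real ^ 'n) \<Rightarrow> 'b" where
  "unfold T \<epsilon> u = (\<lambda>(\<omega>, x). unfold_discrete T \<epsilon> u (\<omega>, lattice_floor \<epsilon> x))"

definition cell_average ::
    "real \<Rightarrow> ('w \<times> (real ^ 'n) \<Rightarrow> real) \<Rightarrow> 'w \<times> (real ^ 'n) \<Rightarrow> real" where
  "cell_average \<epsilon> U =
     (\<lambda>(\<omega>, x). (LINT y:(\<lambda>z. x + \<epsilon> *\<^sub>R z) ` unit_cell|lborel. U (\<omega>, y)) / \<epsilon> ^ CARD('n))"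

definition folding_op ::
    "(real ^ 'n \<Rightarrow> 'w \<Rightarrow> 'w) \<Rightarrow> real \<Rightarrow> ('w \<times> (real ^ 'n) \<Rightarrow> real) \<Rightarrow> 'w \<times> (real ^ 'n) \<Rightarrow> real" where
  "folding_op T \<epsilon> U = (\<lambda>(\<omega>, x). cell_average \<epsilon> U (T (x /\<^sub>R \<epsilon>) \<omega>, x))"

definition two_scale_tendsto ::
    "real \<Rightarrow> 'w measure \<Rightarrow> (real ^ 'n \<Rightarrow> 'w \<Rightarrow> 'w) \<Rightarrow>
     (real \<Rightarrow> 'w \<times> (real ^ 'n) \<Rightarrow> 'b::euclidean_space) \<Rightarrow> ('w \<times> (real ^ 'n) \<Rightarrow> 'b) \<Rightarrow> bool" where
  "two_scale_tendsto p M T u U \<longleftrightarrow>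
     Lp_tendsto p (M \<Otimes>\<^sub>M lborel) (\<lambda>\<epsilon>. unfold T \<epsilon> (u \<epsilon>)) U (at_right 0)"

definition pot_recovery_operators ::
    "real \<Rightarrow> 'w measure \<Rightarrow> (real ^ 'n \<Rightarrow> 'w \<Rightarrow> 'w) \<Rightarrow> real \<Rightarrow>
     (real \<Rightarrow> ('w \<times> (real ^ 'n) \<Rightarrow> real ^ 'n) \<Rightarrow> 'w \<times> (real ^ 'n) \<Rightarrow> real) \<Rightarrow> bool" where
  "pot_recovery_operators p M T \<gamma> G \<longleftrightarrow>
     (let X = tensor p M lborel (Lp_pot p M T) (Lp_space p lborel) in
      (\<forall>\<epsilon>>0. Lp_bounded_linear p (M \<Otimes>\<^sub>M lborel) X (M \<Otimes>\<^sub>M lattice_measure \<epsilon>) (G \<epsilon>)) \<and>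
      (\<exists>C. \<forall>\<epsilon>\<in>{0<..1}. \<forall>\<xi>\<in>X.
         Lp_norm p (M \<Otimes>\<^sub>M lattice_measure \<epsilon>) (G \<epsilon> \<xi>) \<le> C * Lp_norm p (M \<Otimes>\<^sub>M lborel) \<xi>) \<and>
      (\<forall>\<xi>\<in>X.
         two_scale_tendsto p M T (\<lambda>\<epsilon>. G \<epsilon> \<xi>) (\<lambda>_. 0) \<and>
         two_scale_tendsto p M T
           (\<lambda>\<epsilon> z. (\<epsilon> powr \<gamma>) *\<^sub>R discrete_gradient \<epsilon> (G \<epsilon> \<xi>) z) \<xi>))"

definition inv_recovery_operators ::
    "real \<Rightarrow> 'w measure \<Rightarrow> (real ^ 'n \<Rightarrow> 'w \<Rightarrow> 'w) \<Rightarrow> real \<Rightarrow>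
     (real \<Rightarrow> ('w \<times> (real ^ 'n) \<Rightarrow> real) \<Rightarrow> 'w \<times> (real ^ 'n) \<Rightarrow> real) \<Rightarrow> bool" where
  "inv_recovery_operators p M T \<gamma> F \<longleftrightarrow>
     (let X = tensor p M lborel (Lp_inv p M T) (Lp_space p lborel) in
      (\<forall>\<epsilon>>0. Lp_bounded_linear p (M \<Otimes>\<^sub>M lborel) X (M \<Otimes>\<^sub>M lattice_measure \<epsilon>) (F \<epsilon>)) \<and>
      (\<exists>C. \<forall>\<epsilon>\<in>{0<..1}. \<forall>U\<in>X.
         Lp_norm p (M \<Otimes>\<^sub>M lattice_measure \<epsilon>) (F \<epsilon> U) \<le> C * Lp_norm p (M \<Otimes>\<^sub>M lborel) U) \<and>
      (\<forall>U\<in>X.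
         two_scale_tendsto p M T (\<lambda>\<epsilon>. F \<epsilon> U) U \<and>
         two_scale_tendsto p M T
           (\<lambda>\<epsilon> z. (\<epsilon> powr \<gamma>) *\<^sub>R discrete_gradient \<epsilon> (F \<epsilon> U) z) (\<lambda>_. 0)))"

text \<open>
  Near each boundary point the set is the strict epigraph, in the direction of a unit vector
  \<open>\<nu>\<close>, of a Lipschitz function on the hyperplane orthogonal to \<open>\<nu>\<close>.
\<close>

definition lipschitz_boundary :: "(real ^ 'n) set \<Rightarrow> bool" where
  "lipschitz_boundary S \<longleftrightarrow>
     (\<forall>x\<in>frontier S. \<exists>r>0. \<exists>\<nu> h L. norm \<nu> = 1 \<and> L-lipschitz_on {y. y \<bullet> \<nu> = 0} h \<and>
        S \<inter> ball x r = {y \<in> ball x r. h (y - (y \<bullet> \<nu>) *\<^sub>R \<nu>) < y \<bullet> \<nu>})"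

end

theory Submission
  imports Defs
begin

text \<open>
  All convergence statements concern unfolded functions on $\Omega \times R^d$. Unfolding is
  composition with the map $(\omega, x) \mapsto (T_{-k/\varepsilon}\omega, k)$, where
  $k = \lfloor x\rfloor_\varepsilon$. This map carries $P \otimes$ Lebesgue measure to
  $P \otimes m_\varepsilon$, so unfolding is a linear isometry (\<open>Lp_energy_unfold\<close>), and it
  turns multiplication by $\zeta(x)$ into multiplication by $\zeta(k)$.

  The folding of $U$ unfolds to the average of $U$ over the $\varepsilon$-cell of $x$, because the
  two shifts cancel (\<open>unfold_folding\<close>). The difference quotient of the folding in direction
  $e_i$ compares $U(T_{e_i}\omega, \cdot)$ on the next cell with $U(\omega, \cdot)$ on this one.
  When $U$ is shift invariant the two arguments in $\Omega$ agree, and the difference of the two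
  cell averages is $\varepsilon$ times the average of the $i$-th component of $\nabla U$ over the
  points $k + \varepsilon z + t\varepsilon e_i$ with $z$ in the unit cell and $t \in [0,1]$
  (\<open>cell_difference_formula\<close>, \<open>folding_gradient_eq\<close>). Both averages are expectations: for
  random $z$ and $t$ the point $k + \varepsilon z + t\varepsilon e_i$ is again distributed by
  Lebesgue measure when $x$ is, and it is within a multiple of $\varepsilon$ of $x$. For such pairs
  of points, $f$ at one point and $f$ at the other become equal in $L^p$
  (\<open>gap_tendsto_zero\<close>), first for indicators of open sets and then, by regularity and density,
  for all $f \in L^p$; Jensen's inequality passes this on to the averages
  (\<open>moving_average_tendsto\<close>). Adding $\mathcal G^0_\varepsilon\chi$ gives the first statement;
  the second is a sum of the two given families.

  For functions supported in $O$, a lattice function $v_\varepsilon$ is multiplied by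
  $\zeta(x) = \min(1, dist(x, O^c)/\delta_\varepsilon)$. By the discrete product rule this adds
  to $\varepsilon^\gamma\nabla^\varepsilon v_\varepsilon$ a term of size at most
  $\varepsilon^\gamma\delta_\varepsilon^{-1}\|v_\varepsilon\|$, while $\zeta \to 1$ in $O$, where
  the limits live (\<open>cutoff_two_scale\<close>). For $\gamma > 0$ the choice
  $\delta_\varepsilon = \varepsilon^{\gamma/2}$ makes the extra term vanish and keeps the
  construction linear. For $\gamma = 0$ it works for $v_\varepsilon = \mathcal G^0_\varepsilon\chi$,
  which tends to $0$, with $\delta_\varepsilon = \|v_\varepsilon\|^{1/2} + \varepsilon$. The folding
  of $U$ does not tend to $0$; there $U$ is approximated by sums of products of invariant functions
  with test functions, whose foldings vanish outside $O$ once $\varepsilon$ is small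
  (\<open>folding_eventually_supported\<close>), and lattice functions that nearly minimise the total error
  among those supported in $O$ form the required sequence (\<open>supported_recovery_sequence\<close>).

  Weak derivatives enter through explicit bump functions, products of $e^{-1/t}$, which converge
  boundedly to indicators of boxes. They give the formula for cells, and they show that a function
  orthogonal to all test functions on an open set vanishes there (\<open>fundamental_lemma\<close>).
\<close>

section \<open>Power integrals\<close>

text \<open>
  The $p$-th power of the norm, with values in the extended nonnegative reals. It makes sense for
  every function, so estimates and Tonelli's theorem need no integrability conditions, and a
  measurable function is in $L^p$ exactly when it is finite.
\<close>

definition Lp_energy :: "real \<Rightarrow> 'a measure \<Rightarrow> ('a \<Rightarrow> 'b::euclidean_space) \<Rightarrow> ennreal" where
  "Lp_energy p N f = (\<integral>\<^sup>+x. ennreal (norm (f x) powr p) \<partial>N)"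

lemma Lp_space_iff: "f \<in> Lp_space p N \<longleftrightarrow> f \<in> borel_measurable N \<and> Lp_energy p N f < \<infinity>"
  unfolding Lp_space_def Lp_energy_def by (auto simp: integrable_iff_bounded)

lemma Lp_spaceI: "f \<in> borel_measurable N \<Longrightarrow> Lp_energy p N f < \<infinity> \<Longrightarrow> f \<in> Lp_space p N"
  by (simp add: Lp_space_iff)

lemma Lp_space_measurable [measurable_dest]: "f \<in> Lp_space p N \<Longrightarrow> f \<in> borel_measurable N"
  by (simp add: Lp_space_iff)

lemma Lp_norm_nonneg [simp]: "0 \<le> Lp_norm p N f"
  by (simp add: Lp_norm_def)

lemma Lp_energy_eq_norm:
  assumes "0 < p" "f \<in> Lp_space p N"
  shows "Lp_energy p N f = ennreal (Lp_norm p N f powr p)"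
proof -
  have "Lp_energy p N f = ennreal (\<integral>x. norm (f x) powr p \<partial>N)"
    using assms unfolding Lp_energy_def Lp_space_def by (intro nn_integral_eq_integral) auto
  moreover have "0 \<le> (\<integral>x. norm (f x) powr p \<partial>N)" by simp
  ultimately show ?thesis using assms(1) by (simp add: Lp_norm_def powr_powr)
qed

lemma Lp_norm_le_of_energy:
  assumes "0 < p" "f \<in> borel_measurable N" "Lp_energy p N f \<le> ennreal (c powr p)" "0 \<le> c"
  shows "Lp_norm p N f \<le> c"
proof -
  have "f \<in> Lp_space p N"
    using assms by (intro Lp_spaceI) (auto intro: le_less_trans)
  then have "ennreal (Lp_norm p N f powr p) \<le> ennreal (c powr p)"
    using assms Lp_energy_eq_norm by metis
  then have "Lp_norm p N f powr p \<le> c powr p" by simp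
  then show ?thesis using assms by (meson Lp_norm_nonneg linorder_not_less powr_less_mono2)
qed

lemma Lp_norm_mono_energy:
  assumes "0 < p" "f \<in> borel_measurable N" "g \<in> Lp_space p N'"
    and "Lp_energy p N f \<le> Lp_energy p N' g"
  shows "Lp_norm p N f \<le> Lp_norm p N' g"
  using assms by (intro Lp_norm_le_of_energy) (auto simp: Lp_energy_eq_norm)

lemma Lp_energy_mono:
  assumes "0 \<le> p" "\<And>x. x \<in> space N \<Longrightarrow> norm (f x) \<le> norm (g x)"
  shows "Lp_energy p N f \<le> Lp_energy p N g"
  unfolding Lp_energy_def using assms by (intro nn_integral_mono ennreal_leI powr_mono2) auto

lemma Lp_energy_cong_AE:
  "AE x in N. f x = g x \<Longrightarrow> Lp_energy p N f = Lp_energy p N g"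
  unfolding Lp_energy_def by (rule nn_integral_cong_AE) auto

lemma Lp_energy_cong:
  "(\<And>x. x \<in> space N \<Longrightarrow> f x = g x) \<Longrightarrow> Lp_energy p N f = Lp_energy p N g"
  unfolding Lp_energy_def by (rule nn_integral_cong) auto

lemma powr_sum_le:
  assumes "0 \<le> a" "0 \<le> b" "0 \<le> (p::real)"
  shows "(a + b) powr p \<le> 2 powr p * (a powr p + b powr p)"
proof -
  have "(a + b) powr p \<le> (2 * max a b) powr p" using assms by (intro powr_mono2) auto
  also have "\<dots> = 2 powr p * (max a b) powr p" using assms by (simp add: powr_mult)
  also have "\<dots> \<le> 2 powr p * (a powr p + b powr p)"
    by (intro mult_left_mono) (auto simp: max_def)
  finally show ?thesis .
qed

lemma Lp_energy_add:
  fixes f g :: "'a \<Rightarrow> 'b::euclidean_space"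
  assumes [measurable]: "f \<in> borel_measurable N" "g \<in> borel_measurable N" and "0 \<le> p"
  shows "Lp_energy p N (\<lambda>x. f x + g x) \<le> ennreal (2 powr p) * (Lp_energy p N f + Lp_energy p N g)"
proof -
  have "norm (f x + g x) powr p \<le> 2 powr p * (norm (f x) powr p + norm (g x) powr p)" for x
  proof -
    have "norm (f x + g x) powr p \<le> (norm (f x) + norm (g x)) powr p"
      using assms by (intro powr_mono2) (auto intro: norm_triangle_ineq)
    then show ?thesis using powr_sum_le[of "norm (f x)" "norm (g x)" p] assms by simp
  qed
  then have "Lp_energy p N (\<lambda>x. f x + g x) \<le>
      (\<integral>\<^sup>+x. ennreal (2 powr p) * (ennreal (norm (f x) powr p) + ennreal (norm (g x) powr p)) \<partial>N)"
    unfolding Lp_energy_def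
    by (intro nn_integral_mono) (auto simp flip: ennreal_mult' ennreal_plus intro!: ennreal_leI)
  also have "\<dots> = ennreal (2 powr p) * (Lp_energy p N f + Lp_energy p N g)"
    unfolding Lp_energy_def by (simp add: nn_integral_cmult nn_integral_add)
  finally show ?thesis .
qed

lemma Lp_energy_scaleR:
  assumes [measurable]: "f \<in> borel_measurable N"
  shows "Lp_energy p N (\<lambda>x. c *\<^sub>R f x) = ennreal (\<bar>c\<bar> powr p) * Lp_energy p N f"
  unfolding Lp_energy_def by (simp add: powr_mult ennreal_mult nn_integral_cmult)

lemma Lp_energy_uminus: "Lp_energy p N (\<lambda>x. - f x) = Lp_energy p N f"
  by (simp add: Lp_energy_def)

lemma Lp_energy_minus_commute: "Lp_energy p N (\<lambda>x. f x - g x) = Lp_energy p N (\<lambda>x. g x - f x)"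
  by (simp add: Lp_energy_def norm_minus_commute)

lemma Lp_energy_diff:
  fixes f g :: "'a \<Rightarrow> 'b::euclidean_space"
  assumes "f \<in> borel_measurable N" "g \<in> borel_measurable N" "0 \<le> p"
  shows "Lp_energy p N (\<lambda>x. f x - g x) \<le> ennreal (2 powr p) * (Lp_energy p N f + Lp_energy p N g)"
  using Lp_energy_add[of f N "\<lambda>x. - g x" p] assms by (simp add: Lp_energy_uminus)

lemma Lp_energy_triangle:
  fixes f g :: "'a \<Rightarrow> 'b::euclidean_space"
  assumes "f \<in> borel_measurable N" "g \<in> borel_measurable N" "h \<in> borel_measurable N" "0 \<le> p"
  shows "Lp_energy p N (\<lambda>x. f x - h x) \<le>
    ennreal (2 powr p) * (Lp_energy p N (\<lambda>x. f x - g x) + Lp_energy p N (\<lambda>x. g x - h x))"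
  using Lp_energy_add[of "\<lambda>x. f x - g x" N "\<lambda>x. g x - h x" p] assms by simp

lemma Lp_energy_zero [simp]: "Lp_energy p N (\<lambda>x. 0) = 0"
  by (simp add: Lp_energy_def)

lemma Lp_space_zero [simp]: "(\<lambda>x. 0) \<in> Lp_space p N"
  by (simp add: Lp_space_iff)

lemma Lp_space_add:
  assumes "0 \<le> p" "f \<in> Lp_space p N" "g \<in> Lp_space p N"
  shows "(\<lambda>x. f x + g x) \<in> Lp_space p N"
proof (rule Lp_spaceI)
  show "(\<lambda>x. f x + g x) \<in> borel_measurable N" using assms by (auto simp: Lp_space_iff)
  have "ennreal (2 powr p) * (Lp_energy p N f + Lp_energy p N g) < \<infinity>"
    using assms by (auto simp: Lp_space_iff ennreal_mult_less_top)
  then show "Lp_energy p N (\<lambda>x. f x + g x) < \<infinity>"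
    using Lp_energy_add[of f N g p] assms by (auto simp: Lp_space_iff intro: le_less_trans)
qed

lemma Lp_space_scaleR:
  "f \<in> Lp_space p N \<Longrightarrow> (\<lambda>x. c *\<^sub>R f x) \<in> Lp_space p N"
  by (auto simp: Lp_space_iff Lp_energy_scaleR ennreal_mult_less_top)

lemma Lp_space_diff:
  assumes "0 \<le> p" "f \<in> Lp_space p N" "g \<in> Lp_space p N"
  shows "(\<lambda>x. f x - g x) \<in> Lp_space p N"
  using Lp_space_add[OF assms(1,2) Lp_space_scaleR[OF assms(3), of "-1"]] by simp

lemma Lp_space_sum:
  assumes "0 \<le> p" "\<And>i. i \<in> I \<Longrightarrow> f i \<in> Lp_space p N"
  shows "(\<lambda>x. \<Sum>i\<in>I. f i x) \<in> Lp_space p N"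
  using assms(2) by (induction I rule: infinite_finite_induct) (auto intro!: Lp_space_add assms(1))

lemma Lp_space_mono:
  assumes "0 \<le> p" "f \<in> borel_measurable N" "g \<in> Lp_space p N"
    and "\<And>x. x \<in> space N \<Longrightarrow> norm (f x) \<le> norm (g x)"
  shows "f \<in> Lp_space p N"
  using Lp_energy_mono[of p N f g] assms by (auto simp: Lp_space_iff)

lemma Lp_norm_scaleR:
  assumes "0 < p"
  shows "Lp_norm p N (\<lambda>x. c *\<^sub>R f x) = \<bar>c\<bar> * Lp_norm p N f"
proof -
  have "Lp_norm p N (\<lambda>x. c *\<^sub>R f x) = (\<bar>c\<bar> powr p * (\<integral>x. norm (f x) powr p \<partial>N)) powr (1/p)"
    unfolding Lp_norm_def by (simp add: powr_mult)
  then show ?thesis using assms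
    unfolding Lp_norm_def by (simp add: powr_mult powr_powr)
qed

text \<open>
  The triangle inequality up to the factor \<open>2\<close>, from
  $|a + b|^p \le 2^p (|a|^p + |b|^p)$. All operator bounds are claimed up to constants, so the
  factor is harmless.
\<close>

lemma Lp_norm_add_le:
  assumes "1 \<le> p" "f \<in> Lp_space p N" "g \<in> Lp_space p N"
  shows "Lp_norm p N (\<lambda>x. f x + g x) \<le> 2 * (Lp_norm p N f + Lp_norm p N g)"
proof (rule Lp_norm_le_of_energy)
  let ?a = "Lp_norm p N f" and ?b = "Lp_norm p N g"
  have "?a powr p + ?b powr p \<le> (?a + ?b) powr p"
  proof (cases "?a + ?b = 0")
    case True
    then have "?a = 0" "?b = 0" using Lp_norm_nonneg by (metis add_nonneg_eq_0_iff)+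
    then show ?thesis by simp
  next
    case False
    then have pos: "?a + ?b > 0" using Lp_norm_nonneg[of p N f] Lp_norm_nonneg[of p N g] by linarith
    \<comment> \<open>by homogeneity only the case \<open>a + b = 1\<close> matters, where both terms are at most \<open>1\<close>\<close>
    have le: "t powr p \<le> t" if "0 \<le> t" "t \<le> 1" for t :: real
      using that assms(1) powr_mono'[of 1 p t] by (cases "t = 0") auto
    have "(?a / (?a + ?b)) powr p + (?b / (?a + ?b)) powr p \<le> ?a / (?a + ?b) + ?b / (?a + ?b)"
      using pos by (intro add_mono le) (auto simp: divide_simps)
    also have "\<dots> = 1" using pos by (simp add: add_divide_distrib[symmetric])
    finally show ?thesis using pos by (simp add: powr_divide add_divide_distrib[symmetric])
  qed
  then have "2 powr p * (?a powr p + ?b powr p) \<le> (2 * (?a + ?b)) powr p"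
    by (subst powr_mult) auto
  moreover have "Lp_energy p N (\<lambda>x. f x + g x) \<le> ennreal (2 powr p * (?a powr p + ?b powr p))"
    using Lp_energy_add[of f N g p] assms
    by (simp add: Lp_energy_eq_norm Lp_space_measurable ennreal_mult)
  ultimately show "Lp_energy p N (\<lambda>x. f x + g x) \<le> ennreal ((2 * (?a + ?b)) powr p)"
    by (meson ennreal_leI order_trans)
qed (use assms in \<open>auto simp: Lp_space_iff\<close>)

lemma ennreal_tendsto_zeroI:
  fixes f :: "'a \<Rightarrow> ennreal"
  assumes "\<And>\<delta>::real. 0 < \<delta> \<Longrightarrow> \<forall>\<^sub>F x in F. f x \<le> ennreal \<delta>"
  shows "(f \<longlongrightarrow> 0) F"
proof (rule order_tendstoI)
  fix a :: ennreal assume "0 < a"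
  then obtain b where b: "0 < b" "b < a" using dense by blast
  then obtain r where r: "b = ennreal r" "0 < r"
    by (cases b) (auto simp: ennreal_less_zero_iff)
  show "\<forall>\<^sub>F x in F. f x < a"
    using assms[OF r(2)] by eventually_elim (use b r in auto)
qed simp

lemma ennreal_tendsto_zeroD:
  fixes f :: "'a \<Rightarrow> ennreal"
  assumes "(f \<longlongrightarrow> 0) F" "0 < (\<delta>::real)"
  shows "\<forall>\<^sub>F x in F. f x < ennreal \<delta>"
  using assms by (auto simp: order_tendsto_iff)

lemma ennreal_tendsto_zero_mono:
  fixes f :: "'a \<Rightarrow> ennreal"
  assumes "(g \<longlongrightarrow> 0) F" "\<forall>\<^sub>F x in F. f x \<le> g x"
  shows "(f \<longlongrightarrow> 0) F"
  by (rule tendsto_sandwich[OF _ assms(2) tendsto_const assms(1)]) simp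

lemma ennreal_tendsto_zero_cmult:
  fixes f :: "'a \<Rightarrow> ennreal"
  assumes "(f \<longlongrightarrow> 0) F" "c < \<infinity>"
  shows "((\<lambda>x. c * f x) \<longlongrightarrow> 0) F"
  using tendsto_mult_ennreal[OF tendsto_const assms(1), of c] assms(2) by auto

lemma Lp_norm_tendsto_zero_iff:
  assumes "0 < p" "\<forall>\<^sub>F i in F. f i \<in> Lp_space p N"
  shows "((\<lambda>i. Lp_norm p N (f i)) \<longlongrightarrow> 0) F \<longleftrightarrow> ((\<lambda>i. Lp_energy p N (f i)) \<longlongrightarrow> 0) F"
proof -
  have ev: "\<forall>\<^sub>F i in F. Lp_energy p N (f i) = ennreal (Lp_norm p N (f i) powr p)"
    using assms(2) by eventually_elim (use assms(1) Lp_energy_eq_norm in auto)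
  have 1: "((\<lambda>i. Lp_energy p N (f i)) \<longlongrightarrow> 0) F \<longleftrightarrow>
     ((\<lambda>i. ennreal (Lp_norm p N (f i) powr p)) \<longlongrightarrow> ennreal 0) F"
    using tendsto_cong[OF ev] by simp
  have 2: "\<dots> \<longleftrightarrow> ((\<lambda>i. Lp_norm p N (f i) powr p) \<longlongrightarrow> 0) F"
    by (rule tendsto_ennreal_iff) auto
  have 3: "\<dots> \<longleftrightarrow> ((\<lambda>i. Lp_norm p N (f i)) \<longlongrightarrow> 0) F"
  proof
    assume "((\<lambda>i. Lp_norm p N (f i) powr p) \<longlongrightarrow> 0) F"
    then have "((\<lambda>i. (Lp_norm p N (f i) powr p) powr (1/p)) \<longlongrightarrow> 0 powr (1/p)) F"
      using assms(1) by (intro tendsto_powr') auto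
    then show "((\<lambda>i. Lp_norm p N (f i)) \<longlongrightarrow> 0) F"
      using assms(1) by (simp add: powr_powr)
  next
    assume "((\<lambda>i. Lp_norm p N (f i)) \<longlongrightarrow> 0) F"
    then have "((\<lambda>i. Lp_norm p N (f i) powr p) \<longlongrightarrow> 0 powr p) F"
      using assms(1) by (intro tendsto_powr') auto
    then show "((\<lambda>i. Lp_norm p N (f i) powr p) \<longlongrightarrow> 0) F" by simp
  qed
  show ?thesis using 1 2 3 by simp
qed

lemma Lp_tendsto_iff_energy:
  assumes "0 < p"
  shows "Lp_tendsto p N f l F \<longleftrightarrow> (\<forall>\<^sub>F i in F. f i \<in> Lp_space p N) \<and> l \<in> Lp_space p N \<and>
     ((\<lambda>i. Lp_energy p N (\<lambda>x. f i x - l x)) \<longlongrightarrow> 0) F"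
proof -
  have "((\<lambda>i. Lp_norm p N (\<lambda>x. f i x - l x)) \<longlongrightarrow> 0) F \<longleftrightarrow>
      ((\<lambda>i. Lp_energy p N (\<lambda>x. f i x - l x)) \<longlongrightarrow> 0) F"
    if "\<forall>\<^sub>F i in F. f i \<in> Lp_space p N" "l \<in> Lp_space p N"
    using that(1)
    by (intro Lp_norm_tendsto_zero_iff assms) (auto elim!: eventually_mono intro!: Lp_space_diff that assms less_imp_le)
  then show ?thesis unfolding Lp_tendsto_def by blast
qed

lemma Lp_tendsto_add:
  assumes "0 < p" "Lp_tendsto p N f l F" "Lp_tendsto p N g m F"
  shows "Lp_tendsto p N (\<lambda>i x. f i x + g i x) (\<lambda>x. l x + m x) F"
proof -
  note f = assms(2)[unfolded Lp_tendsto_iff_energy[OF assms(1)]]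
  note g = assms(3)[unfolded Lp_tendsto_iff_energy[OF assms(1)]]
  have p: "0 \<le> p" using assms by simp
  have "((\<lambda>i. ennreal (2 powr p) * (Lp_energy p N (\<lambda>x. f i x - l x) + Lp_energy p N (\<lambda>x. g i x - m x))) \<longlongrightarrow> 0) F"
    using tendsto_add[of _ 0 F _ 0] f g by (intro ennreal_tendsto_zero_cmult) force+
  moreover have "\<forall>\<^sub>F i in F. Lp_energy p N (\<lambda>x. (f i x + g i x) - (l x + m x)) \<le>
      ennreal (2 powr p) * (Lp_energy p N (\<lambda>x. f i x - l x) + Lp_energy p N (\<lambda>x. g i x - m x))"
    using f[THEN conjunct1] g[THEN conjunct1]
  proof eventually_elim
    case (elim i)
    then have "(\<lambda>x. f i x - l x) \<in> borel_measurable N" "(\<lambda>x. g i x - m x) \<in> borel_measurable N"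
      using f g by (auto simp: Lp_space_iff)
    moreover have "(\<lambda>x. (f i x + g i x) - (l x + m x)) = (\<lambda>x. (f i x - l x) + (g i x - m x))"
      by auto
    ultimately show ?case using Lp_energy_add[of "\<lambda>x. f i x - l x" N "\<lambda>x. g i x - m x" p] p by metis
  qed
  ultimately have "((\<lambda>i. Lp_energy p N (\<lambda>x. (f i x + g i x) - (l x + m x))) \<longlongrightarrow> 0) F"
    by (rule ennreal_tendsto_zero_mono)
  moreover have "\<forall>\<^sub>F i in F. (\<lambda>x. f i x + g i x) \<in> Lp_space p N"
    using f[THEN conjunct1] g[THEN conjunct1] by eventually_elim (rule Lp_space_add[OF p])
  moreover have "(\<lambda>x. l x + m x) \<in> Lp_space p N"
    using f g by (intro Lp_space_add p) auto
  ultimately show ?thesis using assms(1) by (simp add: Lp_tendsto_iff_energy)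
qed

lemma Lp_tendsto_cong:
  assumes "0 < p" and "Lp_tendsto p N f l F"
    and "\<forall>\<^sub>F i in F. g i \<in> borel_measurable N \<and> (AE x in N. g i x = f i x)"
  shows "Lp_tendsto p N g l F"
proof -
  note f = assms(2)[unfolded Lp_tendsto_iff_energy[OF assms(1)]]
  have "\<forall>\<^sub>F i in F. g i \<in> Lp_space p N"
    using f[THEN conjunct1] assms(3)
    by eventually_elim (auto simp: Lp_space_iff dest: Lp_energy_cong_AE[where p=p])
  moreover have "\<forall>\<^sub>F i in F. Lp_energy p N (\<lambda>x. g i x - l x) \<le> Lp_energy p N (\<lambda>x. f i x - l x)"
    using assms(3) by eventually_elim (auto intro!: eq_refl Lp_energy_cong_AE)
  ultimately show ?thesis using f assms(1)
    by (auto simp: Lp_tendsto_iff_energy intro: ennreal_tendsto_zero_mono)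
qed

lemma Lp_energy_component_le:
  fixes f :: "'a \<Rightarrow> real ^ 'n"
  assumes "0 \<le> p"
  shows "Lp_energy p N (\<lambda>x. f x $ i) \<le> Lp_energy p N f"
  using assms by (intro Lp_energy_mono) (auto simp: component_le_norm_cart)

text \<open>
  The Euclidean norm is at most the dimension times the largest component; with the preceding
  lemma, everything about vector fields can be checked componentwise.
\<close>

lemma Lp_energy_vec_le:
  fixes f :: "'a \<Rightarrow> real ^ 'n"
  assumes [measurable]: "\<And>i. (\<lambda>x. f x $ i) \<in> borel_measurable N" and "0 \<le> p"
  shows "Lp_energy p N f \<le> ennreal (real CARD('n) powr p) * (\<Sum>i\<in>UNIV. Lp_energy p N (\<lambda>x. f x $ i))"
proof -
  have "norm v powr p \<le> real CARD('n) powr p * (\<Sum>i\<in>UNIV. \<bar>v $ i\<bar> powr p)" for v :: "real ^ 'n"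
  proof -
    have "Max (range (\<lambda>i. \<bar>v $ i\<bar>)) \<in> range (\<lambda>i. \<bar>v $ i\<bar>)" by (intro Max_in) auto
    then obtain j where "Max (range (\<lambda>i. \<bar>v $ i\<bar>)) = \<bar>v $ j\<bar>" by blast
    then have j: "\<bar>v $ i\<bar> \<le> \<bar>v $ j\<bar>" for i
      using Max_ge[of "range (\<lambda>i. \<bar>v $ i\<bar>)" "\<bar>v $ i\<bar>"] by simp
    have "norm v \<le> (\<Sum>i\<in>UNIV. \<bar>v $ i\<bar>)" by (rule norm_le_l1_cart)
    also have "\<dots> \<le> real CARD('n) * \<bar>v $ j\<bar>"
      using sum_bounded_above[of UNIV "\<lambda>i. \<bar>v $ i\<bar>" "\<bar>v $ j\<bar>"] j by simp
    finally have "norm v powr p \<le> (real CARD('n) * \<bar>v $ j\<bar>) powr p"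
      using assms by (intro powr_mono2) auto
    also have "\<dots> = real CARD('n) powr p * \<bar>v $ j\<bar> powr p" by (simp add: powr_mult)
    also have "\<dots> \<le> real CARD('n) powr p * (\<Sum>i\<in>UNIV. \<bar>v $ i\<bar> powr p)"
      by (intro mult_left_mono member_le_sum) auto
    finally show ?thesis .
  qed
  then have "Lp_energy p N f \<le>
      (\<integral>\<^sup>+x. ennreal (real CARD('n) powr p) * (\<Sum>i\<in>UNIV. ennreal (\<bar>f x $ i\<bar> powr p)) \<partial>N)"
    unfolding Lp_energy_def
    by (intro nn_integral_mono) (simp flip: ennreal_mult' add: sum_nonneg)
  also have "\<dots> = ennreal (real CARD('n) powr p) * (\<Sum>i\<in>UNIV. Lp_energy p N (\<lambda>x. f x $ i))"
    unfolding Lp_energy_def by (simp add: nn_integral_cmult nn_integral_sum del: sum_ennreal)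
  finally show ?thesis .
qed

lemma measurable_vec_iff:
  fixes f :: "'a \<Rightarrow> real ^ 'n"
  shows "f \<in> borel_measurable N \<longleftrightarrow> (\<forall>i. (\<lambda>x. f x $ i) \<in> borel_measurable N)"
proof
  assume [measurable]: "f \<in> borel_measurable N"
  have "(\<lambda>x. f x \<bullet> axis i 1) \<in> borel_measurable N" for i by measurable
  then show "\<forall>i. (\<lambda>x. f x $ i) \<in> borel_measurable N" by (simp add: inner_axis)
next
  assume *: "\<forall>i. (\<lambda>x. f x $ i) \<in> borel_measurable N"
  show "f \<in> borel_measurable N"
    by (subst borel_measurable_euclidean_space) (use * in \<open>auto simp: Basis_vec_def inner_axis\<close>)
qed

lemma Lp_space_vec_iff:
  fixes f :: "'a \<Rightarrow> real ^ 'n"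
  assumes "0 \<le> p"
  shows "f \<in> Lp_space p N \<longleftrightarrow> (\<forall>i. (\<lambda>x. f x $ i) \<in> Lp_space p N)"
proof
  assume "f \<in> Lp_space p N"
  then show "\<forall>i. (\<lambda>x. f x $ i) \<in> Lp_space p N"
    using Lp_energy_component_le[OF assms, of N f]
    by (auto simp: Lp_space_iff measurable_vec_iff[of f N] intro: le_less_trans)
next
  assume *: "\<forall>i. (\<lambda>x. f x $ i) \<in> Lp_space p N"
  then have "ennreal (real CARD('n) powr p) * (\<Sum>i\<in>UNIV. Lp_energy p N (\<lambda>x. f x $ i)) < \<infinity>"
    by (auto simp: Lp_space_iff ennreal_mult_less_top)
  with * show "f \<in> Lp_space p N"
    using Lp_energy_vec_le[of f N p] assms
    by (auto simp: Lp_space_iff measurable_vec_iff[of f N] intro: le_less_trans)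
qed

lemma Lp_tendsto_vecI:
  fixes f :: "'i \<Rightarrow> 'a \<Rightarrow> real ^ 'n"
  assumes "0 < p" "\<And>j. Lp_tendsto p N (\<lambda>i x. f i x $ j) (\<lambda>x. l x $ j) F"
  shows "Lp_tendsto p N f l F"
proof -
  have p: "0 \<le> p" using assms by simp
  note f = assms(2)[unfolded Lp_tendsto_iff_energy[OF assms(1)]]
  have ev: "\<forall>\<^sub>F i in F. \<forall>j. (\<lambda>x. f i x $ j) \<in> Lp_space p N"
    using f by (simp add: eventually_all_finite)
  have l: "l \<in> Lp_space p N" using f p by (simp add: Lp_space_vec_iff)
  have "((\<lambda>i. ennreal (real CARD('n) powr p) * (\<Sum>j\<in>UNIV. Lp_energy p N (\<lambda>x. f i x $ j - l x $ j))) \<longlongrightarrow> 0) F"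
  proof (intro ennreal_tendsto_zero_cmult)
    have "((\<lambda>i. \<Sum>j\<in>UNIV. Lp_energy p N (\<lambda>x. f i x $ j - l x $ j)) \<longlongrightarrow> (\<Sum>j\<in>(UNIV::'n set). 0)) F"
      using f by (intro tendsto_sum) auto
    then show "((\<lambda>i. \<Sum>j\<in>UNIV. Lp_energy p N (\<lambda>x. f i x $ j - l x $ j)) \<longlongrightarrow> 0) F" by simp
  qed simp
  moreover have "\<forall>\<^sub>F i in F. Lp_energy p N (\<lambda>x. f i x - l x) \<le>
     ennreal (real CARD('n) powr p) * (\<Sum>j\<in>UNIV. Lp_energy p N (\<lambda>x. f i x $ j - l x $ j))"
    using ev
  proof eventually_elim
    case (elim i)
    have "(\<lambda>x. l x $ j) \<in> borel_measurable N" for j using f by (auto simp: Lp_space_iff)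
    then have "(\<lambda>x. (f i x - l x) $ j) \<in> borel_measurable N" for j
      using elim by (auto simp: Lp_space_iff intro!: borel_measurable_diff)
    from Lp_energy_vec_le[OF this p] show ?case by simp
  qed
  ultimately have "((\<lambda>i. Lp_energy p N (\<lambda>x. f i x - l x)) \<longlongrightarrow> 0) F"
    by (rule ennreal_tendsto_zero_mono)
  then show ?thesis using ev l p assms(1) by (simp add: Lp_tendsto_iff_energy Lp_space_vec_iff)
qed

section \<open>Jensen's inequality and sections\<close>

lemma le_one_add_powr:
  fixes t p :: real
  assumes "0 \<le> t" "1 \<le> p"
  shows "t \<le> 1 + t powr p"
proof (cases "t \<le> 1")
  case True
  then show ?thesis using powr_ge_zero[of t p] by linarith
next
  case False
  then show ?thesis using powr_mono[of 1 p t] assms by simp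
qed

text \<open>
  Jensen's inequality for $t \mapsto |t|^p$. The tangent line at $m = |E X|$ lies below the
  function by Young's inequality for $|t|$ and $m^{p-1}$; integrating it gives the claim.
\<close>

lemma (in prob_space) powr_abs_expectation_le:
  fixes X :: "'a \<Rightarrow> real"
  assumes [measurable]: "X \<in> borel_measurable M" and p: "1 < p"
  shows "ennreal (\<bar>expectation X\<bar> powr p) \<le> (\<integral>\<^sup>+x. ennreal (\<bar>X x\<bar> powr p) \<partial>M)"
proof (cases "(\<integral>\<^sup>+x. ennreal (\<bar>X x\<bar> powr p) \<partial>M) = \<infinity>")
  case False
  then have int_p: "integrable M (\<lambda>x. \<bar>X x\<bar> powr p)"
    by (auto simp: integrable_iff_bounded less_top)
  have "\<bar>t\<bar> \<le> 1 + \<bar>t\<bar> powr p" for t :: real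
    using p by (intro le_one_add_powr) auto
  moreover have "integrable M (\<lambda>x. 1 + \<bar>X x\<bar> powr p)" using int_p by auto
  ultimately have int: "integrable M X"
    by (auto intro: Bochner_Integration.integrable_bound[where f="\<lambda>x. 1 + \<bar>X x\<bar> powr p"])
  define m where "m = \<bar>expectation X\<bar>"
  define q where "q = p / (p - 1)"
  have m: "0 \<le> m" "m \<le> expectation (\<lambda>x. \<bar>X x\<bar>)" by (auto simp: m_def)
  have q: "1 < q" "1/p + 1/q = 1" "(p - 1) * q = p"
    using p by (auto simp: q_def field_simps)
  have tangent: "p * (\<bar>t\<bar> * m powr (p - 1)) - (p - 1) * m powr p \<le> \<bar>t\<bar> powr p" for t :: real
  proof -
    have "\<bar>t\<bar> * m powr (p - 1) \<le> \<bar>t\<bar> powr p / p + (m powr (p - 1)) powr q / q"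
      using p q by (intro Youngs_inequality) auto
    also have "(m powr (p - 1)) powr q = m powr p" using q by (simp add: powr_powr)
    finally have "p * (\<bar>t\<bar> * m powr (p - 1)) \<le> p * (\<bar>t\<bar> powr p / p + m powr p / q)"
      using p by (intro mult_left_mono) auto
    also have "\<dots> = \<bar>t\<bar> powr p + (p - 1) * m powr p"
      using p by (simp add: q_def field_simps)
    finally show ?thesis by simp
  qed
  have "m powr p = p * (m * m powr (p - 1)) - (p - 1) * m powr p"
    using m(1) powr_mult_base[of m "p - 1"] p by (cases "m = 0") (auto simp: algebra_simps)
  also have "\<dots> \<le> p * (expectation (\<lambda>x. \<bar>X x\<bar>) * m powr (p - 1)) - (p - 1) * m powr p"
    using m p by (intro diff_right_mono mult_left_mono mult_right_mono) auto
  also have "\<dots> = expectation (\<lambda>x. p * (\<bar>X x\<bar> * m powr (p - 1)) - (p - 1) * m powr p)"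
    using int by (simp add: prob_space)
  also have "\<dots> \<le> expectation (\<lambda>x. \<bar>X x\<bar> powr p)"
    using int int_p tangent by (intro integral_mono) auto
  finally have "ennreal (m powr p) \<le> ennreal (expectation (\<lambda>x. \<bar>X x\<bar> powr p))" by (rule ennreal_leI)
  also have "\<dots> = (\<integral>\<^sup>+x. ennreal (\<bar>X x\<bar> powr p) \<partial>M)"
    using int_p by (intro nn_integral_eq_integral[symmetric]) auto
  finally show ?thesis by (simp add: m_def)
qed simp

lemma (in finite_measure) Lp_space_integrable:
  fixes X :: "'a \<Rightarrow> 'b::euclidean_space"
  assumes "X \<in> Lp_space p M" and p: "1 \<le> p"
  shows "integrable M X"
proof -
  have "norm t \<le> 1 + norm t powr p" for t :: 'b
    using p by (intro le_one_add_powr) auto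
  moreover have "integrable M (\<lambda>x. 1 + norm (X x) powr p)" "X \<in> borel_measurable M"
    using assms by (auto simp: Lp_space_def)
  ultimately show ?thesis
    by (auto intro: Bochner_Integration.integrable_bound[where f="\<lambda>x. 1 + norm (X x) powr p"])
qed

text \<open>
  Jensen's inequality in \<open>s\<close>, then Tonelli's theorem.
\<close>

lemma Lp_energy_average_le:
  fixes h :: "'a \<times> 's \<Rightarrow> real"
  assumes "prob_space P" and h[measurable]: "h \<in> borel_measurable (N \<Otimes>\<^sub>M P)" and p: "1 < p"
  shows "Lp_energy p N (\<lambda>x. \<integral>s. h (x, s) \<partial>P) \<le> Lp_energy p (N \<Otimes>\<^sub>M P) h"
proof -
  interpret P: prob_space P by fact
  have "Lp_energy p N (\<lambda>x. \<integral>s. h (x, s) \<partial>P) \<le> (\<integral>\<^sup>+x. \<integral>\<^sup>+s. ennreal (\<bar>h (x, s)\<bar> powr p) \<partial>P \<partial>N)"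
    unfolding Lp_energy_def real_norm_def
    using p by (intro nn_integral_mono P.powr_abs_expectation_le) auto
  also have "\<dots> = Lp_energy p (N \<Otimes>\<^sub>M P) h"
    unfolding Lp_energy_def real_norm_def
    by (subst P.nn_integral_fst[of "\<lambda>z. ennreal (\<bar>h z\<bar> powr p)", symmetric]) auto
  finally show ?thesis .
qed

lemma Lp_space_AE_section:
  fixes h :: "'a \<times> 's \<Rightarrow> 'b::euclidean_space"
  assumes "sigma_finite_measure P" and "h \<in> Lp_space p (N \<Otimes>\<^sub>M P)"
  shows "AE x in N. (\<lambda>s. h (x, s)) \<in> Lp_space p P"
proof -
  interpret P: sigma_finite_measure P by fact
  have h[measurable]: "h \<in> borel_measurable (N \<Otimes>\<^sub>M P)" using assms(2) by (simp add: Lp_space_iff)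
  have "Lp_energy p (N \<Otimes>\<^sub>M P) h = (\<integral>\<^sup>+x. Lp_energy p P (\<lambda>s. h (x, s)) \<partial>N)"
    unfolding Lp_energy_def
    by (subst P.nn_integral_fst[of "\<lambda>z. ennreal (norm (h z) powr p)", symmetric]) auto
  then have "(\<integral>\<^sup>+x. Lp_energy p P (\<lambda>s. h (x, s)) \<partial>N) \<noteq> \<infinity>"
    using assms(2) by (auto simp: Lp_space_iff)
  then have "AE x in N. Lp_energy p P (\<lambda>s. h (x, s)) \<noteq> \<infinity>"
    by (intro nn_integral_noteq_infinite) (auto simp: Lp_energy_def)
  then show ?thesis
    by (rule AE_mp) (auto intro!: AE_I2 simp: Lp_space_iff less_top)
qed

lemma Lp_energy_pair:
  fixes h :: "'a \<times> 's \<Rightarrow> 'b::euclidean_space"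
  assumes "sigma_finite_measure P" and [measurable]: "h \<in> borel_measurable (N \<Otimes>\<^sub>M P)"
  shows "Lp_energy p (N \<Otimes>\<^sub>M P) h = (\<integral>\<^sup>+x. Lp_energy p P (\<lambda>s. h (x, s)) \<partial>N)"
proof -
  interpret P: sigma_finite_measure P by fact
  show ?thesis unfolding Lp_energy_def
    by (subst P.nn_integral_fst[of "\<lambda>z. ennreal (norm (h z) powr p)", symmetric]) auto
qed

section \<open>Pairs of points near the diagonal\<close>

text \<open>
  \<open>X\<close> and \<open>Y \<epsilon>\<close> are two points of the space, functions of the same random input \<open>s\<close>, each
  distributed by Lebesgue measure, whose distance tends to \<open>0\<close>. Both maps then act
  isometrically on $L^p$ by composition, and the section shows that $f \circ X - f \circ Y_\varepsilon$
  tends to \<open>0\<close> for every $f$ in $L^p$.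
\<close>

locale near_diagonal_coupling =
  fixes S :: "'s measure" and X :: "'s \<Rightarrow> 'a::euclidean_space" and Y :: "real \<Rightarrow> 's \<Rightarrow> 'a" and p :: real
  assumes p1: "1 < p"
    and X_measurable [measurable]: "X \<in> borel_measurable S"
    and X_distr: "distr S borel X = lborel"
    and Y_measurable: "\<And>\<epsilon>. 0 < \<epsilon> \<Longrightarrow> Y \<epsilon> \<in> borel_measurable S"
    and Y_distr: "\<And>\<epsilon>. 0 < \<epsilon> \<Longrightarrow> distr S borel (Y \<epsilon>) = lborel"
    and near: "\<And>r. 0 < r \<Longrightarrow> \<forall>\<^sub>F \<epsilon> in at_right 0. AE s in S. dist (X s) (Y \<epsilon> s) < r"
begin

lemma p0: "0 \<le> p" "0 < p" using p1 by auto

lemma eventually_pos: "\<forall>\<^sub>F \<epsilon> in at_right (0::real). 0 < \<epsilon>"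
  by (rule eventually_at_right_less)

lemma energy_X:
  fixes f :: "'a \<Rightarrow> real"
  assumes [measurable]: "f \<in> borel_measurable borel"
  shows "Lp_energy p S (\<lambda>s. f (X s)) = Lp_energy p lborel f"
  unfolding Lp_energy_def X_distr[symmetric] by (subst nn_integral_distr) auto

lemma energy_Y:
  fixes f :: "'a \<Rightarrow> real"
  assumes [measurable]: "f \<in> borel_measurable borel" and "0 < \<epsilon>"
  shows "Lp_energy p S (\<lambda>s. f (Y \<epsilon> s)) = Lp_energy p lborel f"
proof -
  note [measurable] = Y_measurable[OF assms(2)]
  show ?thesis
    unfolding Lp_energy_def Y_distr[OF assms(2), symmetric] by (subst nn_integral_distr) auto
qed

definition gap :: "('a \<Rightarrow> real) \<Rightarrow> real \<Rightarrow> ennreal" where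
  "gap f \<epsilon> = Lp_energy p S (\<lambda>s. f (X s) - f (Y \<epsilon> s))"

text \<open>
  The bound is uniform in \<open>\<epsilon>\<close>; this is what makes convergence for a dense class enough.
\<close>

lemma gap_le:
  assumes [measurable]: "f \<in> borel_measurable borel" and \<epsilon>: "0 < \<epsilon>"
  shows "gap f \<epsilon> \<le> ennreal (2 powr p) * (2 * Lp_energy p lborel f)"
proof -
  note [measurable] = Y_measurable[OF \<epsilon>]
  have "gap f \<epsilon> \<le> ennreal (2 powr p) * (Lp_energy p S (\<lambda>s. f (X s)) + Lp_energy p S (\<lambda>s. f (Y \<epsilon> s)))"
    unfolding gap_def by (intro Lp_energy_diff p0) auto
  then show ?thesis using \<epsilon> by (simp add: energy_X energy_Y mult_2)
qed

lemma gap_approx: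
  assumes f[measurable]: "f \<in> borel_measurable borel"
    and approx: "\<And>\<delta>::real. 0 < \<delta> \<Longrightarrow> \<exists>g\<in>borel_measurable borel. (gap g \<longlongrightarrow> 0) (at_right 0) \<and>
       Lp_energy p lborel (\<lambda>x. f x - g x) \<le> ennreal \<delta>"
  shows "(gap f \<longlongrightarrow> 0) (at_right 0)"
proof (rule ennreal_tendsto_zeroI)
  fix \<delta> :: real assume \<delta>: "0 < \<delta>"
  \<comment> \<open>the factor lost in two uses of the triangle inequality and in \<open>gap_le\<close>\<close>
  define c where "c = 2 powr p * (2 powr p * 2 + 1)"
  have c: "0 < c" by (simp add: c_def add_pos_pos)
  obtain g where g[measurable]: "g \<in> borel_measurable borel" and gap_g: "(gap g \<longlongrightarrow> 0) (at_right 0)"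
    and fg: "Lp_energy p lborel (\<lambda>x. f x - g x) \<le> ennreal (\<delta> / c)"
    using approx[of "\<delta> / c"] \<delta> c by auto
  have "\<forall>\<^sub>F \<epsilon> in at_right 0. gap g \<epsilon> < ennreal (\<delta> / c)"
    using ennreal_tendsto_zeroD[OF gap_g] \<delta> c by simp
  then show "\<forall>\<^sub>F \<epsilon> in at_right 0. gap f \<epsilon> \<le> ennreal \<delta>"
    using eventually_pos
  proof eventually_elim
    case (elim \<epsilon>)
    note [measurable] = Y_measurable[OF elim(2)]
    have "gap f \<epsilon> = Lp_energy p S (\<lambda>s. (f (X s) - g (X s)) - (f (Y \<epsilon> s) - g (Y \<epsilon> s)) + (g (X s) - g (Y \<epsilon> s)))"
      unfolding gap_def by (rule arg_cong[where f="Lp_energy p S"]) auto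
    also have "\<dots> \<le> ennreal (2 powr p) * (Lp_energy p S (\<lambda>s. (f (X s) - g (X s)) - (f (Y \<epsilon> s) - g (Y \<epsilon> s))) + gap g \<epsilon>)"
      unfolding gap_def by (intro Lp_energy_add p0) auto
    also have "\<dots> \<le> ennreal (2 powr p) * (ennreal (2 powr p) * (2 * ennreal (\<delta> / c)) + ennreal (\<delta> / c))"
    proof (intro mult_left_mono add_mono)
      have "Lp_energy p S (\<lambda>s. (f (X s) - g (X s)) - (f (Y \<epsilon> s) - g (Y \<epsilon> s))) \<le>
          ennreal (2 powr p) * (2 * Lp_energy p lborel (\<lambda>x. f x - g x))"
        using gap_le[of "\<lambda>x. f x - g x" \<epsilon>] elim unfolding gap_def by simp
      also have "\<dots> \<le> ennreal (2 powr p) * (2 * ennreal (\<delta> / c))"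
        by (intro mult_left_mono fg) auto
      finally show "Lp_energy p S (\<lambda>s. (f (X s) - g (X s)) - (f (Y \<epsilon> s) - g (Y \<epsilon> s))) \<le>
          ennreal (2 powr p) * (2 * ennreal (\<delta> / c))" .
    qed (use elim in auto)
    also have "\<dots> = ennreal (2 powr p * (2 powr p * (2 * (\<delta> / c)) + \<delta> / c))"
    proof -
      have 1: "2 * ennreal (\<delta> / c) = ennreal (2 * (\<delta> / c))" using \<delta> c by (subst ennreal_mult) auto
      show ?thesis using \<delta> c
        unfolding 1 by (simp add: ennreal_mult[symmetric] ennreal_plus[symmetric] del: ennreal_plus times_divide_eq_right)
    qed
    also have "2 powr p * (2 powr p * (2 * (\<delta> / c)) + \<delta> / c) = c * (\<delta> / c)"
      unfolding c_def by (simp only: distrib_left distrib_right mult.assoc mult_1)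
    also have "c * (\<delta> / c) = \<delta>" using c by simp
    finally show ?case .
  qed
qed

lemma gap_add:
  assumes [measurable]: "f \<in> borel_measurable borel" "g \<in> borel_measurable borel"
    and "(gap f \<longlongrightarrow> 0) (at_right 0)" "(gap g \<longlongrightarrow> 0) (at_right 0)"
  shows "(gap (\<lambda>x. f x + g x) \<longlongrightarrow> 0) (at_right 0)"
proof (rule ennreal_tendsto_zero_mono)
  show "((\<lambda>\<epsilon>. ennreal (2 powr p) * (gap f \<epsilon> + gap g \<epsilon>)) \<longlongrightarrow> 0) (at_right 0)"
    using tendsto_add[OF assms(3,4)] by (intro ennreal_tendsto_zero_cmult) auto
  show "\<forall>\<^sub>F \<epsilon> in at_right 0. gap (\<lambda>x. f x + g x) \<epsilon> \<le> ennreal (2 powr p) * (gap f \<epsilon> + gap g \<epsilon>)"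
    using eventually_pos
  proof eventually_elim
    case (elim \<epsilon>)
    note [measurable] = Y_measurable[OF elim]
    have "gap (\<lambda>x. f x + g x) \<epsilon> = Lp_energy p S (\<lambda>s. (f (X s) - f (Y \<epsilon> s)) + (g (X s) - g (Y \<epsilon> s)))"
      unfolding gap_def by (rule arg_cong[where f="Lp_energy p S"]) auto
    also have "\<dots> \<le> ennreal (2 powr p) * (gap f \<epsilon> + gap g \<epsilon>)"
      unfolding gap_def by (intro Lp_energy_add p0) auto
    finally show ?case .
  qed
qed

lemma gap_cmult:
  assumes [measurable]: "f \<in> borel_measurable borel" and "(gap f \<longlongrightarrow> 0) (at_right 0)"
  shows "(gap (\<lambda>x. c * f x) \<longlongrightarrow> 0) (at_right 0)"
proof (rule ennreal_tendsto_zero_mono)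
  show "((\<lambda>\<epsilon>. ennreal (\<bar>c\<bar> powr p) * gap f \<epsilon>) \<longlongrightarrow> 0) (at_right 0)"
    using assms by (intro ennreal_tendsto_zero_cmult) auto
  show "\<forall>\<^sub>F \<epsilon> in at_right 0. gap (\<lambda>x. c * f x) \<epsilon> \<le> ennreal (\<bar>c\<bar> powr p) * gap f \<epsilon>"
    using eventually_pos
  proof eventually_elim
    case (elim \<epsilon>)
    note [measurable] = Y_measurable[OF elim]
    show ?case
      using Lp_energy_scaleR[of "\<lambda>s. f (X s) - f (Y \<epsilon> s)" S p c]
      unfolding gap_def by (simp add: right_diff_distrib)
  qed
qed

text \<open>
  \<open>X\<close> and \<open>Y\<close> at distance less than $r$ lie on different sides of the boundary only if one of
  them is in \<open>U\<close> and within $r$ of the complement. These layers decrease to the empty set as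
  $r \to 0$, so their measure tends to \<open>0\<close>.
\<close>

lemma gap_indicator_open:
  assumes "open U" "emeasure lborel U < \<infinity>"
  shows "(gap (indicator U) \<longlongrightarrow> 0) (at_right 0)"
proof (rule ennreal_tendsto_zeroI)
  fix \<delta> :: real assume \<delta>: "0 < \<delta>"
  have U[measurable]: "U \<in> sets borel" using assms by simp
  have "emeasure lborel (UNIV :: 'a set) = \<infinity>" by simp
  then have ne: "- U \<noteq> {}" using assms(2) by (metis Compl_empty_eq double_compl less_irrefl)
  define D where "D n = {x \<in> U. infdist x (- U) < 1 / real (Suc n)}" for n
  have D[measurable]: "D n \<in> sets borel" for n
  proof -
    have "D n = U \<inter> (\<lambda>x. infdist x (- U)) -` {..< 1 / real (Suc n)}" by (auto simp: D_def)
    moreover have "open ((\<lambda>x. infdist x (- U)) -` {..< 1 / real (Suc n)})"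
      by (intro open_vimage continuous_intros)
    ultimately show ?thesis using U by auto
  qed
  have "(\<lambda>n. emeasure lborel (D n)) \<longlonglongrightarrow> emeasure lborel (\<Inter>n. D n)"
  proof (rule Lim_emeasure_decseq)
    show "decseq D" unfolding decseq_def D_def
      by (auto elim!: order_less_le_trans intro!: divide_left_mono)
    have "emeasure lborel (D i) \<le> emeasure lborel U" for i
      by (intro emeasure_mono) (auto simp: D_def)
    then show "emeasure lborel (D i) \<noteq> \<infinity>" for i using assms(2) by (metis infinity_ennreal_def leD top.not_eq_extremum)
  qed auto
  moreover have "(\<Inter>n. D n) = {}"
  proof -
    have False if "\<And>n. x \<in> D n" for x
    proof -
      have "x \<in> U" using that by (auto simp: D_def)
      then have "0 < infdist x (- U)"
        using ne assms(1) by (intro infdist_pos_not_in_closed) auto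
      then obtain n where "1 / real (Suc n) < infdist x (- U)"
        using nat_approx_posE by blast
      with that[of n] show False by (auto simp: D_def)
    qed
    then show ?thesis by blast
  qed
  ultimately have "(\<lambda>n. emeasure lborel (D n)) \<longlonglongrightarrow> 0" by simp
  then obtain n where n: "emeasure lborel (D n) < ennreal (\<delta> / 2)"
    using ennreal_tendsto_zeroD[of _ sequentially "\<delta> / 2"] \<delta> eventually_happens'[OF sequentially_bot]
    by (metis half_gt_zero)
  have "\<forall>\<^sub>F \<epsilon> in at_right 0. AE s in S. dist (X s) (Y \<epsilon> s) < 1 / real (Suc n)"
    by (rule near) simp
  then show "\<forall>\<^sub>F \<epsilon> in at_right 0. gap (indicator U) \<epsilon> \<le> ennreal \<delta>"
    using eventually_pos
  proof eventually_elim
    case (elim \<epsilon>)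
    note [measurable] = Y_measurable[OF elim(2)]
    have D_I: "x \<in> D n" if "x \<in> U" "y \<notin> U" "dist x y < 1 / real (Suc n)" for x y
      using infdist_le[of y "- U" x] that by (auto simp: D_def intro: le_less_trans)
    have "AE s in S. ennreal (norm (indicator U (X s) - indicator U (Y \<epsilon> s) :: real) powr p)
        \<le> indicator (D n) (X s) + indicator (D n) (Y \<epsilon> s)"
      using elim(1)
    proof eventually_elim
      case (elim s)
      then show ?case
        using D_I[of "X s" "Y \<epsilon> s"] D_I[of "Y \<epsilon> s" "X s"]
        by (auto simp: indicator_def dist_commute)
    qed
    then have "gap (indicator U) \<epsilon> \<le> (\<integral>\<^sup>+s. indicator (D n) (X s) + indicator (D n) (Y \<epsilon> s) \<partial>S)"
      unfolding gap_def Lp_energy_def by (rule nn_integral_mono_AE)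
    also have "\<dots> = (\<integral>\<^sup>+s. indicator (D n) (X s) \<partial>S) + (\<integral>\<^sup>+s. indicator (D n) (Y \<epsilon> s) \<partial>S)"
      by (rule nn_integral_add) auto
    also have "(\<integral>\<^sup>+s. indicator (D n) (X s) \<partial>S) = emeasure lborel (D n)"
      using nn_integral_distr[of X S borel "indicator (D n)"] by (simp add: X_distr)
    also have "(\<integral>\<^sup>+s. indicator (D n) (Y \<epsilon> s) \<partial>S) = emeasure lborel (D n)"
      using nn_integral_distr[of "Y \<epsilon>" S borel "indicator (D n)"] by (simp add: Y_distr[OF elim(2)])
    also have "emeasure lborel (D n) + emeasure lborel (D n) \<le> ennreal (\<delta> / 2) + ennreal (\<delta> / 2)"
      using n by (intro add_mono) auto
    also have "\<dots> = ennreal \<delta>" using \<delta> by (simp flip: ennreal_plus)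
    finally show ?case .
  qed
qed

lemma energy_indicator: "A \<in> sets lborel \<Longrightarrow> Lp_energy p lborel (indicator A :: 'a \<Rightarrow> real) = emeasure lborel A"
proof -
  assume A: "A \<in> sets lborel"
  have "Lp_energy p lborel (indicator A :: 'a \<Rightarrow> real) = (\<integral>\<^sup>+x. indicator A x \<partial>lborel)"
    unfolding Lp_energy_def using p1 by (intro nn_integral_cong) (auto simp: indicator_def)
  then show ?thesis using A by simp
qed

text \<open>
  A set of finite measure differs from an open superset by a set of small measure.
\<close>

lemma gap_indicator:
  assumes B[measurable]: "B \<in> sets borel" and "emeasure lborel B < \<infinity>"
  shows "(gap (indicator B) \<longlongrightarrow> 0) (at_right 0)"
proof (rule gap_approx)
  fix \<delta> :: real assume "0 < \<delta>"
  then obtain U where U: "open U" "B \<subseteq> U" "emeasure lborel (U - B) < ennreal \<delta>"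
    using outer_regular_lborel[OF B] by blast
  have "emeasure lborel U = emeasure lborel B + emeasure lborel (U - B)"
    using U by (subst plus_emeasure) (auto intro!: arg_cong[where f="emeasure lborel"])
  also have "\<dots> < \<infinity>" using assms(2) U(3) by (auto simp: less_top[symmetric])
  finally have fin: "emeasure lborel U < \<infinity>" .
  have "Lp_energy p lborel (\<lambda>x. indicator B x - indicator U x :: real) = Lp_energy p lborel (indicator (U - B) :: 'a \<Rightarrow> real)"
    unfolding Lp_energy_def using U(2) by (intro nn_integral_cong) (auto simp: indicator_def)
  also have "\<dots> \<le> ennreal \<delta>" using U by (subst energy_indicator) auto
  finally show "\<exists>g\<in>borel_measurable borel. (gap g \<longlongrightarrow> 0) (at_right 0) \<and>
       Lp_energy p lborel (\<lambda>x. indicator B x - g x) \<le> ennreal \<delta>"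
    using gap_indicator_open[OF U(1) fin] U(1) by (intro bexI[of _ "indicator U"]) auto
qed simp

text \<open>
  Monotone approximation by simple functions; the truncations converge in $L^p$ by dominated
  convergence.
\<close>

lemma gap_nonneg:
  assumes "f \<in> borel_measurable borel" "\<And>x. 0 \<le> f x" "f \<in> Lp_space p lborel"
  shows "(gap f \<longlongrightarrow> 0) (at_right 0)"
  using assms
proof (induction f rule: borel_measurable_induct_real)
  case (set A)
  then have "emeasure lborel A < \<infinity>" by (simp add: Lp_space_iff energy_indicator)
  with set show ?case by (intro gap_indicator) auto
next
  case (mult u c)
  show ?case
  proof (cases "c = 0")
    case True
    then show ?thesis using p1 by (simp add: gap_def[abs_def] Lp_energy_def)
  next
    case False
    have "u \<in> Lp_space p lborel"
      using Lp_space_scaleR[OF mult.prems, of "1 / c"] False by simp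
    with mult show ?thesis by (intro gap_cmult) auto
  qed
next
  case (add u v)
  have "u \<in> Lp_space p lborel" "v \<in> Lp_space p lborel"
    using add by (auto intro!: Lp_space_mono[OF p0(1) _ add.prems])
  with add show ?case by (intro gap_add) auto
next
  case (seq U)
  have le: "U i x \<le> f x" for i x
    using seq by (intro incseq_le) (auto simp: incseq_def le_fun_def)
  have [measurable]: "f \<in> borel_measurable borel" using seq.prems by (simp add: Lp_space_iff)
  note [measurable] = seq(1)
  have Lp: "U i \<in> Lp_space p lborel" for i
    using seq le by (intro Lp_space_mono[OF p0(1) _ seq.prems]) (auto intro: order_trans[OF _ abs_ge_self])
  have "(\<lambda>i. \<integral>\<^sup>+x. ennreal (norm (f x - U i x) powr p) \<partial>lborel) \<longlonglongrightarrow> (\<integral>\<^sup>+x. 0 \<partial>(lborel :: 'a measure))"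
  proof (rule nn_integral_dominated_convergence[where w="\<lambda>x. ennreal (norm (f x) powr p)"])
    show "AE x in lborel. ennreal (norm (f x - U j x) powr p) \<le> ennreal (norm (f x) powr p)" for j
    proof -
      have "norm (f x - U j x) \<le> norm (f x)" for x
        using le[of j x] seq(2)[of j x] by (simp add: abs_if)
      then show ?thesis using p0 by (intro AE_I2 ennreal_leI powr_mono2) auto
    qed
    show "(\<integral>\<^sup>+ x. ennreal (norm (f x) powr p) \<partial>lborel) < \<infinity>"
      using seq.prems by (simp add: Lp_space_iff Lp_energy_def)
    show "AE x in lborel. (\<lambda>i. ennreal (norm (f x - U i x) powr p)) \<longlonglongrightarrow> 0"
    proof (rule AE_I2)
      fix x
      have "(\<lambda>i. norm (f x - U i x) powr p) \<longlonglongrightarrow> norm (f x - f x) powr p"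
        using seq p0 by (intro tendsto_powr' tendsto_intros) auto
      then show "(\<lambda>i. ennreal (norm (f x - U i x) powr p)) \<longlonglongrightarrow> 0"
        using tendsto_ennrealI by fastforce
    qed
  qed (use seq(1) in auto)
  then have lim: "(\<lambda>i. Lp_energy p lborel (\<lambda>x. f x - U i x)) \<longlonglongrightarrow> 0"
    unfolding Lp_energy_def by simp
  show ?case
  proof (rule gap_approx)
    fix \<delta> :: real assume "0 < \<delta>"
    from ennreal_tendsto_zeroD[OF lim this] obtain i
      where "Lp_energy p lborel (\<lambda>x. f x - U i x) < ennreal \<delta>"
      using eventually_happens'[OF sequentially_bot] by blast
    then show "\<exists>g\<in>borel_measurable borel. (gap g \<longlongrightarrow> 0) (at_right 0) \<and>
       Lp_energy p lborel (\<lambda>x. f x - g x) \<le> ennreal \<delta>"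
      using seq Lp by (intro bexI[of _ "U i"]) auto
  qed simp
qed

lemma gap_tendsto_zero:
  assumes "f \<in> Lp_space p lborel"
  shows "(gap f \<longlongrightarrow> 0) (at_right 0)"
proof -
  have f[measurable]: "f \<in> borel_measurable borel" using assms by (simp add: Lp_space_iff)
  have "(\<lambda>x. max 0 (f x)) \<in> Lp_space p lborel" "(\<lambda>x. max 0 (- f x)) \<in> Lp_space p lborel"
    using f by (auto intro!: Lp_space_mono[OF p0(1) _ assms])
  then have "(gap (\<lambda>x. max 0 (f x) + (-1) * max 0 (- f x)) \<longlongrightarrow> 0) (at_right 0)"
    by (intro gap_add gap_cmult gap_nonneg) auto
  moreover have "(\<lambda>x. max 0 (f x) + (-1) * max 0 (- f x)) = f" by auto
  ultimately show ?thesis by simp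
qed

text \<open>
  The preceding result holds for almost every section, and \<open>gap_le\<close> provides the integrable
  bound for dominated convergence in \<open>\<omega>\<close>.
\<close>

lemma fibred_gap_tendsto_zero:
  fixes f :: "'w \<times> 'a \<Rightarrow> real"
  assumes "sigma_finite_measure S" and f: "f \<in> Lp_space p (M \<Otimes>\<^sub>M lborel)"
  shows "((\<lambda>\<epsilon>. \<integral>\<^sup>+\<omega>. Lp_energy p S (\<lambda>s. f (\<omega>, X s) - f (\<omega>, Y \<epsilon> s)) \<partial>M) \<longlongrightarrow> 0) (at_right 0)"
proof -
  interpret S: sigma_finite_measure S by fact
  have f_meas: "f \<in> borel_measurable (M \<Otimes>\<^sub>M lborel)" using f by (simp add: Lp_space_iff)
  then have [measurable]: "f \<in> borel_measurable (M \<Otimes>\<^sub>M borel)"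
    using measurable_cong_sets[OF sets_pair_measure_cong[OF refl sets_lborel] refl] by blast
  have sec: "(\<lambda>x. f (\<omega>, x)) \<in> borel_measurable borel" if "\<omega> \<in> space M" for \<omega>
    using that by simp
  show ?thesis
  proof (rule tendsto_at_right_sequentially[of 0 1])
    fix E :: "nat \<Rightarrow> real" assume E: "\<And>n. 0 < E n" "E \<longlonglongrightarrow> 0"
    have lim_E: "filterlim E (at_right 0) sequentially"
      using E by (auto simp: filterlim_at less_imp_neq[THEN not_sym] intro!: always_eventually)
    have "(\<lambda>n. \<integral>\<^sup>+\<omega>. Lp_energy p S (\<lambda>s. f (\<omega>, X s) - f (\<omega>, Y (E n) s)) \<partial>M) \<longlonglongrightarrow> (\<integral>\<^sup>+\<omega>. 0 \<partial>M)"
    proof (rule nn_integral_dominated_convergence[where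
          w="\<lambda>\<omega>. ennreal (2 powr p) * (2 * Lp_energy p lborel (\<lambda>x. f (\<omega>, x)))"])
      show "(\<lambda>\<omega>. Lp_energy p S (\<lambda>s. f (\<omega>, X s) - f (\<omega>, Y (E j) s))) \<in> borel_measurable M" for j
      proof -
        note [measurable] = Y_measurable[OF E(1)[of j]]
        show ?thesis unfolding Lp_energy_def by measurable
      qed
      show "(\<lambda>\<omega>. ennreal (2 powr p) * (2 * Lp_energy p lborel (\<lambda>x. f (\<omega>, x)))) \<in> borel_measurable M"
        unfolding Lp_energy_def by measurable
      show "AE \<omega> in M. Lp_energy p S (\<lambda>s. f (\<omega>, X s) - f (\<omega>, Y (E j) s))
          \<le> ennreal (2 powr p) * (2 * Lp_energy p lborel (\<lambda>x. f (\<omega>, x)))" for j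
        using gap_le[OF sec E(1)] unfolding gap_def by (intro AE_I2) auto
      have "(\<integral>\<^sup>+\<omega>. Lp_energy p lborel (\<lambda>x. f (\<omega>, x)) \<partial>M) < \<infinity>"
        using f Lp_energy_pair[OF sigma_finite_lborel f_meas, of p] by (simp add: Lp_space_iff)
      moreover have "(\<integral>\<^sup>+\<omega>. ennreal (2 powr p) * (2 * Lp_energy p lborel (\<lambda>x. f (\<omega>, x))) \<partial>M) =
         ennreal (2 powr p) * (2 * (\<integral>\<^sup>+\<omega>. Lp_energy p lborel (\<lambda>x. f (\<omega>, x)) \<partial>M))"
        unfolding Lp_energy_def by (simp add: nn_integral_cmult)
      ultimately show "(\<integral>\<^sup>+\<omega>. ennreal (2 powr p) * (2 * Lp_energy p lborel (\<lambda>x. f (\<omega>, x))) \<partial>M) < \<infinity>"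
        by (simp add: ennreal_mult_less_top)
      show "AE \<omega> in M. (\<lambda>n. Lp_energy p S (\<lambda>s. f (\<omega>, X s) - f (\<omega>, Y (E n) s))) \<longlonglongrightarrow> 0"
        using Lp_space_AE_section[OF sigma_finite_lborel f]
      proof eventually_elim
        case (elim \<omega>)
        from filterlim_compose[OF gap_tendsto_zero[OF elim] lim_E] show ?case
          by (simp add: gap_def)
      qed
    qed auto
    then show "(\<lambda>n. \<integral>\<^sup>+\<omega>. Lp_energy p S (\<lambda>s. f (\<omega>, X s) - f (\<omega>, Y (E n) s)) \<partial>M) \<longlonglongrightarrow> 0"
      by simp
  qed simp
qed

end

section \<open>The lattice and unfolding\<close>

lemma countable_int_lattice: "countable (int_lattice :: (real ^ 'n) set)"
proof -
  have "int_lattice \<subseteq> range (\<lambda>k :: 'n \<Rightarrow> int. \<chi> i. real_of_int (k i))"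
  proof
    fix x :: "real ^ 'n" assume "x \<in> int_lattice"
    then have "\<forall>i. \<exists>k. x $ i = of_int k" by (auto simp: int_lattice_def elim: Ints_cases)
    then obtain k where "\<forall>i. x $ i = of_int (k i)" by metis
    then have "x = (\<chi> i. of_int (k i))" by (simp add: vec_eq_iff)
    then show "x \<in> range (\<lambda>k :: 'n \<Rightarrow> int. \<chi> i. real_of_int (k i))" by blast
  qed
  then show ?thesis by (rule countable_subset) simp
qed

lemma countable_scaled_lattice: "countable (scaled_lattice \<epsilon> :: (real ^ 'n) set)"
  unfolding scaled_lattice_def by (intro countable_image countable_int_lattice)

lemma space_lattice_measure [simp]: "space (lattice_measure \<epsilon>) = scaled_lattice \<epsilon>"
  by (simp add: lattice_measure_def)

lemma sets_lattice_measure: "sets (lattice_measure \<epsilon>) = Pow (scaled_lattice \<epsilon>)"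
  by (simp add: lattice_measure_def)

lemma sets_lattice_measure_count_space [measurable_cong]:
  "sets (lattice_measure \<epsilon>) = sets (count_space (scaled_lattice \<epsilon>))"
  by (simp add: lattice_measure_def)

lemma emeasure_lattice_singleton:
  assumes "x \<in> scaled_lattice \<epsilon>"
  shows "emeasure (lattice_measure \<epsilon>) {x :: real ^ 'n} = ennreal (\<epsilon> ^ CARD('n))"
  using assms unfolding lattice_measure_def
  by (subst emeasure_density) (auto simp: nn_integral_count_space_indicator[symmetric] nn_integral_cmult_indicator)

lemma sigma_finite_lattice_measure: "sigma_finite_measure (lattice_measure \<epsilon> :: (real ^ 'n) measure)"
proof
  let ?A = "(\<lambda>x. {x}) ` (scaled_lattice \<epsilon> :: (real ^ 'n) set)"
  have "countable ?A" by (intro countable_image countable_scaled_lattice)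
  moreover have "?A \<subseteq> sets (lattice_measure \<epsilon>)" by (auto simp: sets_lattice_measure)
  moreover have "\<Union>?A = space (lattice_measure \<epsilon>)" by auto
  moreover have "\<forall>a\<in>?A. emeasure (lattice_measure \<epsilon>) a \<noteq> \<infinity>"
    by (auto simp: emeasure_lattice_singleton)
  ultimately show "\<exists>A. countable A \<and> A \<subseteq> sets (lattice_measure \<epsilon>) \<and> \<Union>A = space (lattice_measure \<epsilon>) \<and>
      (\<forall>a\<in>A. emeasure (lattice_measure \<epsilon> :: (real ^ 'n) measure) a \<noteq> \<infinity>)" by blast
qed

lemma axis_in_int_lattice [simp]: "axis i 1 \<in> int_lattice"
  by (auto simp: int_lattice_def axis_def)

lemma int_lattice_add: "x \<in> int_lattice \<Longrightarrow> y \<in> int_lattice \<Longrightarrow> x + y \<in> int_lattice"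
  by (simp add: int_lattice_def)

lemma int_lattice_minus: "x \<in> int_lattice \<Longrightarrow> - x \<in> int_lattice"
  by (simp add: int_lattice_def)

lemma scaled_lattice_iff:
  assumes "0 < \<epsilon>"
  shows "x \<in> scaled_lattice \<epsilon> \<longleftrightarrow> x /\<^sub>R \<epsilon> \<in> int_lattice"
proof
  assume "x /\<^sub>R \<epsilon> \<in> int_lattice"
  then have "\<epsilon> *\<^sub>R (x /\<^sub>R \<epsilon>) \<in> scaled_lattice \<epsilon>" unfolding scaled_lattice_def by blast
  then show "x \<in> scaled_lattice \<epsilon>" using assms by simp
qed (use assms in \<open>auto simp: scaled_lattice_def\<close>)

lemma scaled_lattice_shift:
  assumes "0 < \<epsilon>" "x \<in> scaled_lattice \<epsilon>"
  shows "x + \<epsilon> *\<^sub>R axis i 1 \<in> scaled_lattice \<epsilon>"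
  using assms by (simp add: scaled_lattice_iff scaleR_add_right int_lattice_add)

lemma lattice_floor_in:
  assumes "0 < \<epsilon>"
  shows "lattice_floor \<epsilon> x \<in> scaled_lattice \<epsilon>"
  unfolding lattice_floor_eq[OF assms] scaled_lattice_iff[OF assms]
  using assms by (auto simp: int_lattice_def mult.assoc[symmetric])

definition cell :: "real \<Rightarrow> real ^ 'n \<Rightarrow> (real ^ 'n) set" where
  "cell \<epsilon> y = {x. \<forall>i. y $ i - \<epsilon> / 2 \<le> x $ i \<and> x $ i < y $ i + \<epsilon> / 2}"

lemma cell_eq_image:
  fixes y :: "real ^ 'n"
  assumes "0 < \<epsilon>"
  shows "cell \<epsilon> y = (\<lambda>z. y + \<epsilon> *\<^sub>R z) ` unit_cell"
proof safe
  fix x :: "real ^ 'n" assume "x \<in> cell \<epsilon> y"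
  then have "(1 / \<epsilon>) *\<^sub>R (x - y) \<in> unit_cell"
    using assms by (force simp: cell_def unit_cell_def field_simps)
  moreover have "x = y + \<epsilon> *\<^sub>R ((1 / \<epsilon>) *\<^sub>R (x - y))" using assms by simp
  ultimately show "x \<in> (\<lambda>z. y + \<epsilon> *\<^sub>R z) ` unit_cell" by blast
next
  fix z :: "real ^ 'n" assume "z \<in> unit_cell"
  then have "- 1/2 \<le> z $ i \<and> z $ i < 1/2" for i by (simp add: unit_cell_def)
  then have "\<epsilon> * (- 1/2) \<le> \<epsilon> * z $ i \<and> \<epsilon> * z $ i < \<epsilon> * (1/2)" for i
    using assms by (intro conjI mult_left_mono mult_strict_left_mono) auto
  then show "y + \<epsilon> *\<^sub>R z \<in> cell \<epsilon> y" by (simp add: cell_def)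
qed

lemma lattice_floor_eq_iff:
  assumes "0 < \<epsilon>" "y \<in> scaled_lattice \<epsilon>"
  shows "lattice_floor \<epsilon> x = y \<longleftrightarrow> x \<in> cell \<epsilon> y"
proof
  assume "lattice_floor \<epsilon> x = y"
  then have y: "y $ i = \<epsilon> * of_int (round (x $ i / \<epsilon>))" for i
    using lattice_floor_eq[OF assms(1), of x] by auto
  show "x \<in> cell \<epsilon> y"
    unfolding cell_def
  proof (rule CollectI, rule allI)
    fix i
    have "of_int (round (x $ i / \<epsilon>)) - 1/2 \<le> x $ i / \<epsilon>" "x $ i / \<epsilon> < of_int (round (x $ i / \<epsilon>)) + 1/2"
      using of_int_round_le[of "x $ i / \<epsilon>"] of_int_round_gt[of "x $ i / \<epsilon>"] by (simp_all add: field_simps)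
    then show "y $ i - \<epsilon> / 2 \<le> x $ i \<and> x $ i < y $ i + \<epsilon> / 2"
      using assms(1) by (simp add: y field_simps)
  qed
next
  assume "x \<in> cell \<epsilon> y"
  then have "x \<in> (\<lambda>z. y + \<epsilon> *\<^sub>R z) ` unit_cell" using assms by (simp add: cell_eq_image)
  then have 1: "x - y \<in> (\<lambda>z. \<epsilon> *\<^sub>R z) ` unit_cell" by auto
  have "\<exists>!y. y \<in> scaled_lattice \<epsilon> \<and> x - y \<in> (\<lambda>z. \<epsilon> *\<^sub>R z) ` unit_cell"
  proof (rule ex1I[of _ y])
    fix y' assume y': "y' \<in> scaled_lattice \<epsilon> \<and> x - y' \<in> (\<lambda>z. \<epsilon> *\<^sub>R z) ` unit_cell"
    obtain k k' z z' where *: "y = \<epsilon> *\<^sub>R k" "y' = \<epsilon> *\<^sub>R k'" "x - y = \<epsilon> *\<^sub>R z" "x - y' = \<epsilon> *\<^sub>R z'"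
      "k \<in> int_lattice" "k' \<in> int_lattice" "z \<in> unit_cell" "z' \<in> unit_cell"
      using y' assms 1 by (auto simp: scaled_lattice_def)
    have "k $ i = k' $ i" for i
    proof -
      have "\<epsilon> * (k $ i + z $ i) = \<epsilon> * (k' $ i + z' $ i)"
        using *(1-4) by (metis add_diff_cancel_left' diff_add_cancel distrib_left vector_add_component vector_scaleR_component real_scaleR_def add.commute)
      then have eq: "k $ i + z $ i = k' $ i + z' $ i" using assms by simp
      obtain m m' where m: "k $ i = of_int m" "k' $ i = of_int m'"
        using *(5,6) by (auto simp: int_lattice_def elim!: Ints_cases allE[of _ i])
      have "\<bar>z $ i - z' $ i\<bar> < 1"
        using *(7,8) by (auto simp: unit_cell_def abs_less_iff dest!: spec[of _ i])
      then have "\<bar>m' - m\<bar> < 1" using eq m by linarith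
      then show ?thesis using m by simp
    qed
    then show "y' = y" using * by (simp add: vec_eq_iff)
  qed (use 1 assms in auto)
  then show "lattice_floor \<epsilon> x = y"
    unfolding lattice_floor_def using 1 assms by (intro the1_equality) auto
qed

lemma cell_measurable [measurable]: "cell \<epsilon> y \<in> sets borel"
  unfolding cell_def by measurable

lemma emeasure_cell:
  assumes "0 < \<epsilon>"
  shows "emeasure lborel (cell \<epsilon> (y :: real ^ 'n)) = ennreal (\<epsilon> ^ CARD('n))"
proof -
  let ?l = "\<chi> i. y $ i - \<epsilon> / 2" and ?u = "\<chi> i. y $ i + \<epsilon> / 2"
  have b: "?l \<bullet> b \<le> ?u \<bullet> b" if "b \<in> Basis" for b
    using that assms by (auto simp: Basis_vec_def inner_axis)
  have "(\<Prod>b\<in>Basis. (?u - ?l) \<bullet> b) = (\<Prod>b\<in>(Basis :: (real ^ 'n) set). \<epsilon>)"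
    by (intro prod.cong) (auto simp: Basis_vec_def inner_axis)
  also have "\<dots> = \<epsilon> ^ CARD('n)" by simp
  finally have p: "(\<Prod>b\<in>Basis. (?u - ?l) \<bullet> b) = \<epsilon> ^ CARD('n)" .
  have "emeasure lborel (box ?l ?u) \<le> emeasure lborel (cell \<epsilon> y)"
    by (intro emeasure_mono) (auto simp: cell_def mem_box_cart less_imp_le)
  moreover have "emeasure lborel (cell \<epsilon> y) \<le> emeasure lborel (cbox ?l ?u)"
    by (intro emeasure_mono) (auto simp: cell_def mem_box_cart less_imp_le)
  ultimately show ?thesis
    using b by (simp add: emeasure_lborel_box_eq emeasure_lborel_cbox_eq p del: inner_diff_left)
qed

lemma lattice_floor_measurable:
  assumes "0 < \<epsilon>"
  shows "lattice_floor \<epsilon> \<in> measurable borel (count_space (scaled_lattice \<epsilon> :: (real ^ 'n) set))"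
proof (rule measurableI)
  fix A :: "(real ^ 'n) set" assume "A \<in> sets (count_space (scaled_lattice \<epsilon>))"
  then have A: "A \<subseteq> scaled_lattice \<epsilon>" by simp
  have "lattice_floor \<epsilon> -` A \<inter> space borel = (\<Union>y\<in>A. cell \<epsilon> y)"
    using lattice_floor_eq_iff[OF assms] A by auto
  then show "lattice_floor \<epsilon> -` A \<inter> space borel \<in> sets borel"
    using countable_subset[OF A countable_scaled_lattice] by (auto intro!: sets.countable_UN')
qed (use assms lattice_floor_in in auto)

text \<open>
  A cell has the volume $\varepsilon^d$, which is the mass of its lattice point.
\<close>

lemma distr_lattice_floor:
  assumes \<epsilon>: "0 < \<epsilon>"
  shows "distr lborel (lattice_measure \<epsilon>) (lattice_floor \<epsilon>) = (lattice_measure \<epsilon> :: (real ^ 'n) measure)"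
proof (rule measure_eqI_countable[OF _ sets_lattice_measure countable_scaled_lattice])
  fix y :: "real ^ 'n" assume y: "y \<in> scaled_lattice \<epsilon>"
  note [measurable] = lattice_floor_measurable[OF \<epsilon>]
  have "lattice_floor \<epsilon> -` {y} = cell \<epsilon> y"
    using lattice_floor_eq_iff[OF \<epsilon> y] by auto
  then show "emeasure (distr lborel (lattice_measure \<epsilon>) (lattice_floor \<epsilon>)) {y} = emeasure (lattice_measure \<epsilon>) {y}"
    using y \<epsilon> by (subst emeasure_distr) (auto simp: sets_lattice_measure emeasure_cell emeasure_lattice_singleton)
qed (simp add: sets_lattice_measure)

lemma measurable_pair_lattice:
  assumes "\<And>y. y \<in> scaled_lattice \<epsilon> \<Longrightarrow> (\<lambda>\<omega>. f (\<omega>, y)) \<in> measurable M K"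
  shows "f \<in> measurable (M \<Otimes>\<^sub>M lattice_measure \<epsilon>) K"
proof -
  have "(\<lambda>z. f (fst z, snd z)) \<in> measurable (M \<Otimes>\<^sub>M lattice_measure \<epsilon>) K"
  proof (rule measurable_compose_countable'[where f="\<lambda>y z. f (fst z, y)" and g=snd and I="scaled_lattice \<epsilon>"])
    show "(\<lambda>z. f (fst z, y)) \<in> measurable (M \<Otimes>\<^sub>M lattice_measure \<epsilon>) K" if "y \<in> scaled_lattice \<epsilon>" for y
      using assms[OF that] by (rule measurable_compose[OF measurable_fst])
    show "snd \<in> measurable (M \<Otimes>\<^sub>M lattice_measure \<epsilon>) (count_space (scaled_lattice \<epsilon>))"
      using measurable_snd[of M "lattice_measure \<epsilon>"]
      by (simp cong: measurable_cong_sets add: sets_lattice_measure_count_space)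
  qed (rule countable_scaled_lattice)
  then show ?thesis by simp
qed

lemma measurable_pair_lattice_section:
  assumes "f \<in> measurable (M \<Otimes>\<^sub>M lattice_measure \<epsilon>) K" "y \<in> scaled_lattice \<epsilon>"
  shows "(\<lambda>\<omega>. f (\<omega>, y)) \<in> measurable M K"
  using assms by (intro measurable_compose[OF _ assms(1)]) auto

text \<open>
  There are only countably many sections, so the union of their null sets is null.
\<close>

lemma AE_pair_lattice:
  fixes P :: "'a \<times> (real ^ 'n) \<Rightarrow> bool"
  assumes "\<And>y. y \<in> scaled_lattice \<epsilon> \<Longrightarrow> AE \<omega> in M. P (\<omega>, y)"
  shows "AE z in M \<Otimes>\<^sub>M lattice_measure \<epsilon>. P z"
proof -
  interpret L: sigma_finite_measure "lattice_measure \<epsilon>" by (rule sigma_finite_lattice_measure)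
  have "\<exists>N. N \<in> null_sets M \<and> {\<omega> \<in> space M. \<not> P (\<omega>, y)} \<subseteq> N" if "y \<in> scaled_lattice \<epsilon>" for y
  proof -
    from assms[OF that] obtain N where "\<And>\<omega>. \<omega> \<in> space M - N \<Longrightarrow> P (\<omega>, y)" "N \<in> null_sets M"
      by (rule AE_E3) blast
    then show ?thesis by (intro exI[of _ N]) auto
  qed
  then obtain N where N: "\<And>y. y \<in> scaled_lattice \<epsilon> \<Longrightarrow> N y \<in> null_sets M"
    "\<And>y. y \<in> scaled_lattice \<epsilon> \<Longrightarrow> {\<omega> \<in> space M. \<not> P (\<omega>, y)} \<subseteq> N y" by metis
  have "(\<Union>y\<in>(scaled_lattice \<epsilon> :: (real ^ 'n) set). N y \<times> {y}) \<in> null_sets (M \<Otimes>\<^sub>M lattice_measure \<epsilon>)"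
  proof (rule null_sets_UN'[OF countable_scaled_lattice])
    fix y :: "real ^ 'n" assume y: "y \<in> scaled_lattice \<epsilon>"
    then have "emeasure (M \<Otimes>\<^sub>M lattice_measure \<epsilon>) (N y \<times> {y}) = emeasure M (N y) * emeasure (lattice_measure \<epsilon>) {y}"
      using N(1)[OF y] by (intro L.emeasure_pair_measure_Times) (auto simp: sets_lattice_measure)
    then show "N y \<times> {y} \<in> null_sets (M \<Otimes>\<^sub>M lattice_measure \<epsilon>)"
      using N(1)[OF y] y by (auto simp: null_sets_def sets_lattice_measure)
  qed
  then show ?thesis
    by (rule AE_I') (use N(2) in \<open>fastforce simp: space_pair_measure\<close>)
qed

context measure_preserving_system
begin

text \<open>
  Preservation is assumed for images. The preimage of a set under \<open>T k\<close> is its image under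
  \<open>T (- k)\<close>.
\<close>

lemma distr_T:
  assumes k: "k \<in> int_lattice"
  shows "distr M M (T k) = M"
proof (rule measure_eqI)
  fix A assume "A \<in> sets (distr M M (T k))"
  then have A: "A \<in> sets M" by simp
  have inv: "T l (T (- l) \<omega>) = \<omega>" if "\<omega> \<in> space M" "l \<in> int_lattice" for l \<omega>
  proof -
    have "T (l + - l) \<omega> = T l (T (- l) \<omega>)"
      using that int_lattice_minus by (intro T_add)
    then show ?thesis using T_zero[OF that(1)] by simp
  qed
  have sp: "T l \<omega> \<in> space M" if "\<omega> \<in> space M" "l \<in> int_lattice" for l \<omega>
    using T_measurable[OF that(2)] that(1) by (rule measurable_space)
  have mk: "- k \<in> int_lattice" using k by (rule int_lattice_minus)
  have "T k -` A \<inter> space M = T (- k) ` A"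
  proof safe
    fix \<omega> assume "\<omega> \<in> space M" "T k \<omega> \<in> A"
    then show "\<omega> \<in> T (- k) ` A" using inv[of \<omega> "- k"] mk by (metis image_eqI minus_minus)
  next
    fix a assume "a \<in> A"
    then have "a \<in> space M" using A sets.sets_into_space by blast
    then show "T (- k) a \<in> T k -` A" "T (- k) a \<in> space M" using inv k mk sp \<open>a \<in> A\<close> by auto
  qed
  then show "emeasure (distr M M (T k)) A = emeasure M A"
    using A T_preserving[OF mk A] T_measurable[OF k] by (simp add: emeasure_distr)
qed simp

lemma AE_T:
  assumes "k \<in> int_lattice" "AE \<omega> in M. P \<omega>"
  shows "AE \<omega> in M. P (T k \<omega>)"
proof -
  have "AE \<omega> in distr M M (T k). P \<omega>" using assms(2) by (subst distr_T[OF assms(1)])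
  then show ?thesis by (rule AE_distrD[OF T_measurable[OF assms(1)]])
qed

lemma T_space: "k \<in> int_lattice \<Longrightarrow> \<omega> \<in> space M \<Longrightarrow> T k \<omega> \<in> space M"
  using T_measurable by (meson measurable_space)

text \<open>
  Unfolding is composition with this map.
\<close>

definition unfold_map :: "real \<Rightarrow> 'w \<times> (real ^ 'n) \<Rightarrow> 'w \<times> (real ^ 'n)" where
  "unfold_map \<epsilon> = (\<lambda>(\<omega>, x). (T (- lattice_floor \<epsilon> x /\<^sub>R \<epsilon>) \<omega>, lattice_floor \<epsilon> x))"

lemma unfold_eq: "unfold T \<epsilon> u z = u (unfold_map \<epsilon> z)"
  by (simp add: unfold_def unfold_discrete_def unfold_map_def split_beta)

lemma lattice_index:
  assumes "0 < \<epsilon>" "y \<in> scaled_lattice \<epsilon>"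
  shows "- y /\<^sub>R \<epsilon> \<in> int_lattice" "y /\<^sub>R \<epsilon> \<in> int_lattice"
  using assms int_lattice_minus[of "y /\<^sub>R \<epsilon>"] by (simp_all add: scaled_lattice_iff)

lemma unfold_map_measurable:
  assumes \<epsilon>: "0 < \<epsilon>"
  shows "unfold_map \<epsilon> \<in> measurable (M \<Otimes>\<^sub>M lborel) (M \<Otimes>\<^sub>M lattice_measure \<epsilon>)"
proof -
  note [measurable] = lattice_floor_measurable[OF \<epsilon>]
  have [measurable]: "(\<lambda>z. lattice_floor \<epsilon> (snd z)) \<in> measurable (M \<Otimes>\<^sub>M lborel) (count_space (scaled_lattice \<epsilon>))"
    by measurable
  have "(\<lambda>z. T (- lattice_floor \<epsilon> (snd z) /\<^sub>R \<epsilon>) (fst z)) \<in> measurable (M \<Otimes>\<^sub>M lborel) M"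
  proof (rule measurable_compose_countable'[where f="\<lambda>y z. T (- y /\<^sub>R \<epsilon>) (fst z)"
        and g="\<lambda>z. lattice_floor \<epsilon> (snd z)" and I="scaled_lattice \<epsilon>"])
    show "(\<lambda>z. T (- y /\<^sub>R \<epsilon>) (fst z)) \<in> measurable (M \<Otimes>\<^sub>M lborel) M" if "y \<in> scaled_lattice \<epsilon>" for y
      using T_measurable[OF lattice_index(1)[OF \<epsilon> that]] by (rule measurable_compose[OF measurable_fst])
  qed (auto intro: countable_scaled_lattice)
  then have "(\<lambda>z. (T (- lattice_floor \<epsilon> (snd z) /\<^sub>R \<epsilon>) (fst z), lattice_floor \<epsilon> (snd z)))
      \<in> measurable (M \<Otimes>\<^sub>M lborel) (M \<Otimes>\<^sub>M lattice_measure \<epsilon>)"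
    by measurable
  then show ?thesis by (simp add: unfold_map_def split_beta)
qed

text \<open>
  For fixed $x$ the shift in $\Omega$ is by a fixed lattice vector and preserves $P$; then
  $x$ enters only through its lattice point.
\<close>

lemma nn_integral_unfold_map:
  assumes \<epsilon>: "0 < \<epsilon>" and h[measurable]: "h \<in> borel_measurable (M \<Otimes>\<^sub>M lattice_measure \<epsilon>)"
  shows "(\<integral>\<^sup>+z. h (unfold_map \<epsilon> z) \<partial>(M \<Otimes>\<^sub>M lborel)) = (\<integral>\<^sup>+z. h z \<partial>(M \<Otimes>\<^sub>M lattice_measure \<epsilon>))"
proof -
  interpret L: sigma_finite_measure "lattice_measure \<epsilon>" by (rule sigma_finite_lattice_measure)
  interpret P1: pair_sigma_finite M "lborel :: (real ^ 'n) measure"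
    by (simp add: pair_sigma_finite_def sigma_finite_measure_axioms sigma_finite_lborel)
  interpret P2: pair_sigma_finite M "lattice_measure \<epsilon> :: (real ^ 'n) measure"
    by (simp add: pair_sigma_finite_def sigma_finite_measure_axioms L.sigma_finite_measure_axioms)
  note [measurable] = unfold_map_measurable[OF \<epsilon>] lattice_floor_measurable[OF \<epsilon>]
  have "(\<integral>\<^sup>+z. h (unfold_map \<epsilon> z) \<partial>(M \<Otimes>\<^sub>M lborel)) = (\<integral>\<^sup>+x. \<integral>\<^sup>+\<omega>. h (unfold_map \<epsilon> (\<omega>, x)) \<partial>M \<partial>lborel)"
    by (intro P1.nn_integral_snd[symmetric]) auto
  also have "\<dots> = (\<integral>\<^sup>+x. (\<integral>\<^sup>+\<omega>. h (\<omega>, lattice_floor \<epsilon> x) \<partial>M) \<partial>lborel)"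
  proof (rule nn_integral_cong)
    fix x :: "real ^ 'n"
    let ?y = "lattice_floor \<epsilon> x"
    have y: "?y \<in> scaled_lattice \<epsilon>" using \<epsilon> by (rule lattice_floor_in)
    note [measurable] = T_measurable[OF lattice_index(1)[OF \<epsilon> y]] measurable_pair_lattice_section[OF h y]
    have "(\<integral>\<^sup>+\<omega>. h (\<omega>, ?y) \<partial>M) = (\<integral>\<^sup>+\<omega>. h (\<omega>, ?y) \<partial>(distr M M (T (- ?y /\<^sub>R \<epsilon>))))"
      by (subst distr_T[OF lattice_index(1)[OF \<epsilon> y]]) rule
    also have "\<dots> = (\<integral>\<^sup>+\<omega>. h (T (- ?y /\<^sub>R \<epsilon>) \<omega>, ?y) \<partial>M)"
      by (rule nn_integral_distr) measurable
    finally show "(\<integral>\<^sup>+\<omega>. h (unfold_map \<epsilon> (\<omega>, x)) \<partial>M) = (\<integral>\<^sup>+\<omega>. h (\<omega>, ?y) \<partial>M)"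
      by (simp add: unfold_map_def)
  qed
  also have "\<dots> = (\<integral>\<^sup>+y. (\<integral>\<^sup>+\<omega>. h (\<omega>, y) \<partial>M) \<partial>(distr lborel (lattice_measure \<epsilon>) (lattice_floor \<epsilon>)))"
    by (subst nn_integral_distr) auto
  also have "\<dots> = (\<integral>\<^sup>+z. h z \<partial>(M \<Otimes>\<^sub>M lattice_measure \<epsilon>))"
    unfolding distr_lattice_floor[OF \<epsilon>] by (rule P2.nn_integral_snd) simp
  finally show ?thesis .
qed

lemma unfold_measurable:
  assumes "0 < \<epsilon>" "u \<in> measurable (M \<Otimes>\<^sub>M lattice_measure \<epsilon>) K"
  shows "unfold T \<epsilon> u \<in> measurable (M \<Otimes>\<^sub>M lborel) K"
  using measurable_compose[OF unfold_map_measurable[OF assms(1)] assms(2)]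
  by (simp add: unfold_eq[abs_def])

lemma Lp_energy_unfold:
  fixes u :: "'w \<times> (real ^ 'n) \<Rightarrow> 'b::euclidean_space"
  assumes "0 < \<epsilon>" and [measurable]: "u \<in> borel_measurable (M \<Otimes>\<^sub>M lattice_measure \<epsilon>)"
  shows "Lp_energy p (M \<Otimes>\<^sub>M lborel) (unfold T \<epsilon> u) = Lp_energy p (M \<Otimes>\<^sub>M lattice_measure \<epsilon>) u"
  unfolding Lp_energy_def unfold_eq
  using nn_integral_unfold_map[OF assms(1), of "\<lambda>z. ennreal (norm (u z) powr p)"] by simp

lemma Lp_space_unfold:
  fixes u :: "'w \<times> (real ^ 'n) \<Rightarrow> 'b::euclidean_space"
  assumes "0 < \<epsilon>" "u \<in> Lp_space p (M \<Otimes>\<^sub>M lattice_measure \<epsilon>)"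
  shows "unfold T \<epsilon> u \<in> Lp_space p (M \<Otimes>\<^sub>M lborel)"
  using assms unfold_measurable[OF assms(1), of u borel] by (auto simp: Lp_space_iff Lp_energy_unfold)

lemma discrete_gradient_measurable:
  fixes u :: "'w \<times> (real ^ 'n) \<Rightarrow> real"
  assumes "0 < \<epsilon>" and u: "u \<in> borel_measurable (M \<Otimes>\<^sub>M lattice_measure \<epsilon>)"
  shows "discrete_gradient \<epsilon> u \<in> borel_measurable (M \<Otimes>\<^sub>M lattice_measure \<epsilon>)"
proof (rule measurable_pair_lattice)
  fix y :: "real ^ 'n" assume y: "y \<in> scaled_lattice \<epsilon>"
  note [measurable] = measurable_pair_lattice_section[OF u y]
     measurable_pair_lattice_section[OF u scaled_lattice_shift[OF assms(1) y]]
  show "(\<lambda>\<omega>. discrete_gradient \<epsilon> u (\<omega>, y)) \<in> borel_measurable M"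
    unfolding discrete_gradient_def by (subst measurable_vec_iff) simp
qed

lemma discrete_gradient_add:
  "discrete_gradient \<epsilon> (\<lambda>z. u z + v z) z = discrete_gradient \<epsilon> u z + discrete_gradient \<epsilon> v z"
  by (cases z) (simp add: discrete_gradient_def vec_eq_iff add_divide_distrib diff_divide_distrib)

lemma two_scale_tendsto_add:
  assumes "0 < p" "two_scale_tendsto p M T u U" "two_scale_tendsto p M T v V"
  shows "two_scale_tendsto p M T (\<lambda>\<epsilon> z. u \<epsilon> z + v \<epsilon> z) (\<lambda>z. U z + V z)"
  using Lp_tendsto_add[OF assms(1) assms(2,3)[unfolded two_scale_tendsto_def]]
  unfolding two_scale_tendsto_def unfold_eq .

end

section \<open>Averages over cells\<close>

text \<open>
  A null set times the whole other factor is null; the predicate is arbitrary.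
\<close>

lemma AE_pair_fst:
  assumes "sigma_finite_measure N" "AE x in M. \<forall>y. P (x, y)"
  shows "AE z in M \<Otimes>\<^sub>M N. P z"
proof -
  interpret N: sigma_finite_measure N by fact
  from assms(2) obtain A where A: "\<And>x. x \<in> space M - A \<Longrightarrow> \<forall>y. P (x, y)" "A \<in> null_sets M"
    by (rule AE_E3) blast
  have "emeasure (M \<Otimes>\<^sub>M N) (A \<times> space N) = emeasure M A * emeasure N (space N)"
    using A(2) by (intro N.emeasure_pair_measure_Times) auto
  then have "A \<times> space N \<in> null_sets (M \<Otimes>\<^sub>M N)" using A(2) by (auto simp: null_sets_def)
  then show ?thesis by (rule AE_I') (use A(1) in \<open>auto simp: space_pair_measure\<close>)
qed

lemma AE_pair_snd:
  assumes "sigma_finite_measure N" "AE y in N. P y"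
  shows "AE z in M \<Otimes>\<^sub>M N. P (snd z)"
proof -
  interpret N: sigma_finite_measure N by fact
  from assms(2) obtain A where A: "\<And>y. y \<in> space N - A \<Longrightarrow> P y" "A \<in> null_sets N"
    by (rule AE_E3) blast
  have "emeasure (M \<Otimes>\<^sub>M N) (space M \<times> A) = emeasure M (space M) * emeasure N A"
    using A(2) by (intro N.emeasure_pair_measure_Times) auto
  then have "space M \<times> A \<in> null_sets (M \<Otimes>\<^sub>M N)" using A(2) by (auto simp: null_sets_def)
  then show ?thesis by (rule AE_I') (use A(1) in \<open>fastforce simp: space_pair_measure\<close>)
qed

lemma unit_cell_eq: "unit_cell = cell 1 0"
  by (auto simp: unit_cell_def cell_def)

lemma unit_cell_measurable [measurable]: "unit_cell \<in> sets borel"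
  by (simp add: unit_cell_eq)

lemma emeasure_unit_cell: "emeasure lborel (unit_cell :: (real ^ 'n) set) = 1"
  using emeasure_cell[of 1 "0 :: real ^ 'n"] by (simp add: unit_cell_eq)

definition cell_law :: "(real ^ 'n) measure" where
  "cell_law = uniform_measure lborel unit_cell"

definition time_law :: "real measure" where
  "time_law = uniform_measure lborel {0..1}"

text \<open>
  The law of the random pair $(z, t)$ of a point of the unit cell and a time in $[0,1]$.
\<close>

definition cell_time_law :: "((real ^ 'n) \<times> real) measure" where
  "cell_time_law = cell_law \<Otimes>\<^sub>M time_law"

lemma prob_cell_law: "prob_space (cell_law :: (real ^ 'n) measure)"
  unfolding cell_law_def by (rule prob_space_uniform_measure) (simp_all add: emeasure_unit_cell)

lemma prob_time_law: "prob_space time_law"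
  unfolding time_law_def by (rule prob_space_uniform_measure) simp_all

lemma sets_cell_law [simp, measurable_cong]: "sets cell_law = sets borel"
  by (simp add: cell_law_def)

lemma sets_time_law [simp, measurable_cong]: "sets time_law = sets borel"
  by (simp add: time_law_def)

lemma sets_cell_time_law [measurable_cong]: "sets cell_time_law = sets (borel \<Otimes>\<^sub>M borel)"
  unfolding cell_time_law_def by (intro sets_pair_measure_cong) auto

lemma prob_cell_time_law: "prob_space (cell_time_law :: ((real ^ 'n) \<times> real) measure)"
proof -
  interpret Z: prob_space "cell_law :: (real ^ 'n) measure" by (rule prob_cell_law)
  interpret I: prob_space time_law by (rule prob_time_law)
  interpret pair_prob_space "cell_law :: (real ^ 'n) measure" time_law ..
  show ?thesis unfolding cell_time_law_def by unfold_locales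
qed

text \<open>
  For $a = 0$ a random point of the cell around \<open>k\<close>; for $a = e_i$ this point moved towards the
  next cell by a random fraction of the step $\varepsilon e_i$.
\<close>

definition cell_point :: "real ^ 'n \<Rightarrow> real \<Rightarrow> real ^ 'n \<Rightarrow> (real ^ 'n) \<times> real \<Rightarrow> real ^ 'n" where
  "cell_point a \<epsilon> k q = k + \<epsilon> *\<^sub>R fst q + (snd q * \<epsilon>) *\<^sub>R a"

lemma cell_point_measurable [measurable]:
  assumes [measurable]: "f \<in> borel_measurable N" "g \<in> measurable N (borel \<Otimes>\<^sub>M borel)"
  shows "(\<lambda>x. cell_point a \<epsilon> (f x) (g x)) \<in> borel_measurable N"
  unfolding cell_point_def by measurable

lemma lattice_floor_borel:
  assumes "0 < \<epsilon>"
  shows "lattice_floor \<epsilon> \<in> borel_measurable borel"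
  by (rule measurable_compose[OF lattice_floor_measurable[OF assms]]) simp

lemma nn_integral_affine:
  fixes h :: "'a::euclidean_space \<Rightarrow> ennreal"
  assumes [measurable]: "h \<in> borel_measurable borel" and "0 < \<epsilon>"
  shows "(\<integral>\<^sup>+x. h x \<partial>lborel) = ennreal (\<epsilon> ^ DIM('a)) * (\<integral>\<^sup>+z. h (k + \<epsilon> *\<^sub>R z) \<partial>lborel)"
  using assms(2) by (subst lborel_affine[of \<epsilon> k]) (simp_all add: nn_integral_density nn_integral_distr nn_integral_cmult)

lemma nn_integral_cell_law:
  fixes h :: "real ^ 'n \<Rightarrow> ennreal"
  assumes [measurable]: "h \<in> borel_measurable borel" and \<epsilon>: "0 < \<epsilon>"
  shows "(\<integral>\<^sup>+z. h (k + \<epsilon> *\<^sub>R z) \<partial>cell_law) = (\<integral>\<^sup>+y. h y * indicator (cell \<epsilon> k) y \<partial>lborel) / ennreal (\<epsilon> ^ CARD('n))"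
proof -
  have "k + \<epsilon> *\<^sub>R z \<in> cell \<epsilon> k \<longleftrightarrow> z \<in> unit_cell" for z
    using \<epsilon> by (force simp: cell_eq_image)
  then have ind: "indicator (cell \<epsilon> k) (k + \<epsilon> *\<^sub>R z) = (indicator unit_cell z :: ennreal)" for z
    by (simp add: indicator_def)
  have "(\<integral>\<^sup>+z. h (k + \<epsilon> *\<^sub>R z) \<partial>cell_law) = (\<integral>\<^sup>+z. h (k + \<epsilon> *\<^sub>R z) * indicator unit_cell z \<partial>lborel)"
    unfolding cell_law_def
    by (subst nn_integral_uniform_measure) (auto simp: emeasure_unit_cell divide_ennreal_def ennreal_inverse_1)
  moreover have "(\<integral>\<^sup>+y. h y * indicator (cell \<epsilon> k) y \<partial>lborel) =
      ennreal (\<epsilon> ^ CARD('n)) * (\<integral>\<^sup>+z. h (k + \<epsilon> *\<^sub>R z) * indicator unit_cell z \<partial>lborel)"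
    by (subst nn_integral_affine[OF _ \<epsilon>, of _ k]) (auto simp: ind)
  moreover have "ennreal (\<epsilon> ^ CARD('n)) * X / ennreal (\<epsilon> ^ CARD('n)) = X" for X
    using \<epsilon> by (subst mult.commute) (simp add: mult_divide_eq_ennreal)
  ultimately show ?thesis by simp
qed

text \<open>
  Averaging over cells is integration against the kernel
  $\varepsilon^{-d} 1[\lfloor x\rfloor = \lfloor y\rfloor]$. It is symmetric and has total mass
  \<open>1\<close> in each variable, so by Tonelli it preserves the integral.
\<close>

lemma nn_integral_cell_average:
  fixes h :: "real ^ 'n \<Rightarrow> ennreal"
  assumes h[measurable]: "h \<in> borel_measurable borel" and \<epsilon>: "0 < \<epsilon>"
  shows "(\<integral>\<^sup>+x. \<integral>\<^sup>+z. h (lattice_floor \<epsilon> x + \<epsilon> *\<^sub>R z) \<partial>cell_law \<partial>lborel) = (\<integral>\<^sup>+x. h x \<partial>lborel)"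
proof -
  let ?c = "ennreal (\<epsilon> ^ CARD('n))"
  note [measurable] = lattice_floor_borel[OF \<epsilon>]
  have c: "?c \<noteq> 0" "?c \<noteq> \<infinity>" using \<epsilon> by auto
  have ind: "indicator (cell \<epsilon> (lattice_floor \<epsilon> x)) y = (indicator (cell \<epsilon> (lattice_floor \<epsilon> y)) x :: ennreal)" for x y :: "real ^ 'n"
    using lattice_floor_eq_iff[OF \<epsilon> lattice_floor_in[OF \<epsilon>], of y x] lattice_floor_eq_iff[OF \<epsilon> lattice_floor_in[OF \<epsilon>], of x y]
    by (auto simp: indicator_def)
  have ind': "indicator (cell \<epsilon> (lattice_floor \<epsilon> x)) y = (if lattice_floor \<epsilon> x = lattice_floor \<epsilon> y then 1 else 0 :: ennreal)" for x y :: "real ^ 'n"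
    using lattice_floor_eq_iff[OF \<epsilon> lattice_floor_in[OF \<epsilon>], of y x] by (auto simp: indicator_def)
  have [measurable]: "(\<lambda>(x, y). h y * indicator (cell \<epsilon> (lattice_floor \<epsilon> x)) y / ?c) \<in> borel_measurable (lborel \<Otimes>\<^sub>M lborel)"
    unfolding ind' by measurable
  have "(\<integral>\<^sup>+x. \<integral>\<^sup>+z. h (lattice_floor \<epsilon> x + \<epsilon> *\<^sub>R z) \<partial>cell_law \<partial>lborel) =
     (\<integral>\<^sup>+x. \<integral>\<^sup>+y. h y * indicator (cell \<epsilon> (lattice_floor \<epsilon> x)) y / ?c \<partial>lborel \<partial>lborel)"
    by (simp add: nn_integral_cell_law[OF h \<epsilon>] nn_integral_divide)
  also have "\<dots> = (\<integral>\<^sup>+y. \<integral>\<^sup>+x. h y * indicator (cell \<epsilon> (lattice_floor \<epsilon> x)) y / ?c \<partial>lborel \<partial>lborel)"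
    by (rule lborel_pair.Fubini'[symmetric]) simp
  also have "\<dots> = (\<integral>\<^sup>+y. \<integral>\<^sup>+x. (h y / ?c) * indicator (cell \<epsilon> (lattice_floor \<epsilon> y)) x \<partial>lborel \<partial>lborel)"
    by (intro nn_integral_cong) (simp add: ind ennreal_times_divide mult.commute)
  also have "\<dots> = (\<integral>\<^sup>+y. (h y / ?c) * ?c \<partial>lborel)"
    by (simp add: nn_integral_cmult_indicator emeasure_cell[OF \<epsilon>])
  also have "\<dots> = (\<integral>\<^sup>+x. h x \<partial>lborel)"
    using c by (simp add: ennreal_divide_times ennreal_times_divide mult_divide_eq_ennreal)
  finally show ?thesis .
qed

text \<open>
  For a fixed time the random point is a point of the cell moved by a fixed vector.
\<close>

lemma nn_integral_cell_point:
  fixes h :: "real ^ 'n \<Rightarrow> ennreal"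
  assumes h[measurable]: "h \<in> borel_measurable borel" and \<epsilon>: "0 < \<epsilon>"
  shows "(\<integral>\<^sup>+s. h (cell_point a \<epsilon> (lattice_floor \<epsilon> (fst s)) (snd s)) \<partial>(lborel \<Otimes>\<^sub>M cell_time_law)) = (\<integral>\<^sup>+x. h x \<partial>lborel)"
proof -
  interpret Z: prob_space "cell_law :: (real ^ 'n) measure" by (rule prob_cell_law)
  interpret I: prob_space time_law by (rule prob_time_law)
  interpret ZI: pair_prob_space "cell_law :: (real ^ 'n) measure" time_law ..
  interpret P: prob_space "cell_time_law :: ((real ^ 'n) \<times> real) measure" by (rule prob_cell_time_law)
  interpret LI: pair_sigma_finite "lborel :: (real ^ 'n) measure" time_law
    by (simp add: pair_sigma_finite_def sigma_finite_lborel I.sigma_finite_measure_axioms)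
  note [measurable] = lattice_floor_borel[OF \<epsilon>]
  let ?g = "\<lambda>x z t. h (lattice_floor \<epsilon> x + \<epsilon> *\<^sub>R z + (t * \<epsilon>) *\<^sub>R a)"
  have "(\<integral>\<^sup>+s. h (cell_point a \<epsilon> (lattice_floor \<epsilon> (fst s)) (snd s)) \<partial>(lborel \<Otimes>\<^sub>M cell_time_law)) =
     (\<integral>\<^sup>+x. \<integral>\<^sup>+q. h (cell_point a \<epsilon> (lattice_floor \<epsilon> x) q) \<partial>cell_time_law \<partial>lborel)"
    by (subst P.nn_integral_fst[symmetric]) auto
  also have "\<dots> = (\<integral>\<^sup>+x. \<integral>\<^sup>+t. \<integral>\<^sup>+z. ?g x z t \<partial>cell_law \<partial>time_law \<partial>lborel)"
    unfolding cell_time_law_def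
    by (subst ZI.nn_integral_snd[symmetric]) (auto simp: cell_point_def)
  also have "\<dots> = (\<integral>\<^sup>+t. \<integral>\<^sup>+x. \<integral>\<^sup>+z. ?g x z t \<partial>cell_law \<partial>lborel \<partial>time_law)"
    by (rule LI.Fubini'[symmetric]) measurable
  also have "\<dots> = (\<integral>\<^sup>+t. (\<integral>\<^sup>+x. h x \<partial>lborel) \<partial>time_law)"
  proof (rule nn_integral_cong)
    fix t
    let ?c = "(t * \<epsilon>) *\<^sub>R a"
    have "(\<integral>\<^sup>+x. \<integral>\<^sup>+z. ?g x z t \<partial>cell_law \<partial>lborel) = (\<integral>\<^sup>+x. h (x + ?c) \<partial>lborel)"
      using nn_integral_cell_average[of "\<lambda>y. h (y + ?c)", OF _ \<epsilon>] by simp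
    also have "\<dots> = (\<integral>\<^sup>+x. h x \<partial>lborel)"
      using nn_integral_affine[of h 1 ?c] by (simp add: add.commute)
    finally show "(\<integral>\<^sup>+x. \<integral>\<^sup>+z. ?g x z t \<partial>cell_law \<partial>lborel) = (\<integral>\<^sup>+x. h x \<partial>lborel)" .
  qed
  also have "\<dots> = (\<integral>\<^sup>+x. h x \<partial>lborel)" by (simp add: I.emeasure_space_1)
  finally show ?thesis .
qed

lemma norm_le_of_coordinates:
  fixes v :: "real ^ 'n"
  assumes "\<And>i. \<bar>v $ i\<bar> \<le> r"
  shows "norm v \<le> real CARD('n) * r"
proof -
  have "norm v \<le> (\<Sum>i\<in>UNIV. \<bar>v $ i\<bar>)" by (rule norm_le_l1_cart)
  also have "\<dots> \<le> real CARD('n) * r" using sum_bounded_above[of UNIV "\<lambda>i. \<bar>v $ i\<bar>" r] assms by simp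
  finally show ?thesis .
qed

lemma dist_lattice_floor_le:
  fixes x :: "real ^ 'n"
  assumes "0 < \<epsilon>"
  shows "dist (lattice_floor \<epsilon> x) x \<le> real CARD('n) * \<epsilon>"
proof -
  have "x \<in> cell \<epsilon> (lattice_floor \<epsilon> x)"
    using lattice_floor_eq_iff[OF assms lattice_floor_in[OF assms]] by blast
  then have "lattice_floor \<epsilon> x $ i - \<epsilon> / 2 \<le> x $ i \<and> x $ i < lattice_floor \<epsilon> x $ i + \<epsilon> / 2" for i
    by (simp add: cell_def)
  then have "\<bar>(lattice_floor \<epsilon> x - x) $ i\<bar> \<le> \<epsilon>" for i
    using assms by (simp add: abs_le_iff) (smt (verit, best) field_sum_of_halves)
  from norm_le_of_coordinates[OF this] show ?thesis by (simp add: dist_norm)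
qed

text \<open>
  The random point is distributed by Lebesgue measure by \<open>nn_integral_cell_point\<close>, and its
  distance from $x$ is at most a multiple of \<open>\<epsilon>\<close>.
\<close>

lemma cell_coupling:
  fixes a :: "real ^ 'n"
  assumes "1 < p"
  shows "near_diagonal_coupling (lborel \<Otimes>\<^sub>M cell_time_law) fst
    (\<lambda>\<epsilon> s. cell_point a \<epsilon> (lattice_floor \<epsilon> (fst s)) (snd s)) p"
proof
  interpret P: prob_space "cell_time_law :: ((real ^ 'n) \<times> real) measure" by (rule prob_cell_time_law)
  show "fst \<in> borel_measurable (lborel \<Otimes>\<^sub>M (cell_time_law :: ((real ^ 'n) \<times> real) measure))" by measurable
  show "distr (lborel \<Otimes>\<^sub>M (cell_time_law :: ((real ^ 'n) \<times> real) measure)) borel fst = lborel"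
  proof (rule measure_eqI)
    fix A assume "A \<in> sets (distr (lborel \<Otimes>\<^sub>M (cell_time_law :: ((real ^ 'n) \<times> real) measure)) borel fst)"
    then have A[measurable]: "A \<in> sets borel" by simp
    have "fst -` A \<inter> space (lborel \<Otimes>\<^sub>M (cell_time_law :: ((real ^ 'n) \<times> real) measure)) = A \<times> space cell_time_law"
      by (auto simp: space_pair_measure)
    then show "emeasure (distr (lborel \<Otimes>\<^sub>M (cell_time_law :: ((real ^ 'n) \<times> real) measure)) borel fst) A = emeasure lborel A"
      by (simp add: emeasure_distr P.emeasure_pair_measure_Times P.emeasure_space_1)
  qed simp
  fix \<epsilon> :: real assume \<epsilon>: "0 < \<epsilon>"
  note [measurable] = lattice_floor_borel[OF \<epsilon>]
  show m[measurable]: "(\<lambda>s. cell_point a \<epsilon> (lattice_floor \<epsilon> (fst s)) (snd s)) \<in> borel_measurable (lborel \<Otimes>\<^sub>M cell_time_law)"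
    by measurable
  show "distr (lborel \<Otimes>\<^sub>M cell_time_law) borel (\<lambda>s. cell_point a \<epsilon> (lattice_floor \<epsilon> (fst s)) (snd s)) = lborel"
  proof (rule measure_eqI)
    fix A assume "A \<in> sets (distr (lborel \<Otimes>\<^sub>M cell_time_law) borel (\<lambda>s. cell_point a \<epsilon> (lattice_floor \<epsilon> (fst s)) (snd s)))"
    then have A[measurable]: "A \<in> sets borel" by simp
    have "emeasure (distr (lborel \<Otimes>\<^sub>M cell_time_law) borel (\<lambda>s. cell_point a \<epsilon> (lattice_floor \<epsilon> (fst s)) (snd s))) A =
       (\<integral>\<^sup>+x. indicator A x \<partial>(distr (lborel \<Otimes>\<^sub>M cell_time_law) borel (\<lambda>s. cell_point a \<epsilon> (lattice_floor \<epsilon> (fst s)) (snd s))))"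
      by simp
    also have "\<dots> = (\<integral>\<^sup>+s. indicator A (cell_point a \<epsilon> (lattice_floor \<epsilon> (fst s)) (snd s)) \<partial>(lborel \<Otimes>\<^sub>M cell_time_law))"
      by (rule nn_integral_distr) measurable
    also have "\<dots> = emeasure lborel A" using \<epsilon> by (subst nn_integral_cell_point) auto
    finally show "emeasure (distr (lborel \<Otimes>\<^sub>M cell_time_law) borel (\<lambda>s. cell_point a \<epsilon> (lattice_floor \<epsilon> (fst s)) (snd s))) A = emeasure lborel A" .
  qed simp
next
  interpret Z: prob_space "cell_law :: (real ^ 'n) measure" by (rule prob_cell_law)
  interpret I: prob_space time_law by (rule prob_time_law)
  interpret P: prob_space "cell_time_law :: ((real ^ 'n) \<times> real) measure" by (rule prob_cell_time_law)
  fix r :: real assume r: "0 < r"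
  define C where "C = 2 * real CARD('n) + norm a"
  have C: "0 < C" by (simp add: C_def add_pos_nonneg)
  have "AE z in cell_law. z \<in> (unit_cell :: (real ^ 'n) set)"
    unfolding cell_law_def by (rule AE_uniform_measureI) auto
  then have "AE z in cell_law. norm (z :: real ^ 'n) \<le> real CARD('n) * 1"
  proof eventually_elim
    case (elim z)
    then have "\<bar>z $ i\<bar> \<le> 1" for i by (auto simp: unit_cell_def abs_le_iff dest!: spec[of _ i])
    then show ?case by (rule norm_le_of_coordinates)
  qed
  then have "AE z in cell_law. \<forall>t :: real. norm (z :: real ^ 'n) \<le> real CARD('n)" by simp
  then have 1: "AE q in cell_time_law. norm (fst q :: real ^ 'n) \<le> real CARD('n)"
    unfolding cell_time_law_def
    by (intro AE_pair_fst[OF I.sigma_finite_measure_axioms]) simp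
  have "AE t in time_law. t \<in> {0..1}"
    unfolding time_law_def by (rule AE_uniform_measureI) auto
  then have 2: "AE q in cell_time_law. snd (q :: (real ^ 'n) \<times> real) \<in> {0..1}"
    unfolding cell_time_law_def by (rule AE_pair_snd[OF I.sigma_finite_measure_axioms])
  from 1 2 have "AE q in cell_time_law. norm (fst q :: real ^ 'n) \<le> real CARD('n) \<and> snd q \<in> {0..1}"
    by eventually_elim simp
  then have 3: "AE s in lborel \<Otimes>\<^sub>M cell_time_law. norm (fst (snd s) :: real ^ 'n) \<le> real CARD('n) \<and> snd (snd s) \<in> {0..1}"
    by (rule AE_pair_snd[OF P.sigma_finite_measure_axioms])
  have "\<forall>\<^sub>F \<epsilon> in at_right 0. \<epsilon> < r / C"
    using r C by (intro eventually_at_rightI[of 0 "r / C"]) auto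
  then show "\<forall>\<^sub>F \<epsilon> in at_right 0. AE s in lborel \<Otimes>\<^sub>M cell_time_law.
      dist (fst s) (cell_point a \<epsilon> (lattice_floor \<epsilon> (fst s)) (snd s)) < r"
    using eventually_at_right_less[of "0::real"]
  proof eventually_elim
    case (elim \<epsilon>)
    show ?case
      using 3
    proof eventually_elim
      case (elim s)
      let ?k = "lattice_floor \<epsilon> (fst s)"
      have "dist (fst s) (cell_point a \<epsilon> ?k (snd s)) = norm ((fst s - ?k) - \<epsilon> *\<^sub>R fst (snd s) - (snd (snd s) * \<epsilon>) *\<^sub>R a)"
        by (simp add: dist_norm cell_point_def algebra_simps)
      also have "\<dots> \<le> norm (fst s - ?k) + norm (\<epsilon> *\<^sub>R fst (snd s)) + norm ((snd (snd s) * \<epsilon>) *\<^sub>R a)"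
        by (intro norm_triangle_le_diff add_mono order_refl norm_triangle_ineq4)
      also have "\<dots> \<le> real CARD('n) * \<epsilon> + \<epsilon> * real CARD('n) + \<epsilon> * norm a"
      proof (intro add_mono)
        show "norm (fst s - ?k) \<le> real CARD('n) * \<epsilon>"
          using dist_lattice_floor_le[OF \<open>0 < \<epsilon>\<close>, of "fst s"] by (simp add: dist_norm norm_minus_commute)
        show "norm (\<epsilon> *\<^sub>R fst (snd s)) \<le> \<epsilon> * real CARD('n)"
          using elim \<open>0 < \<epsilon>\<close> by simp
        have "snd (snd s) * \<epsilon> \<le> 1 * \<epsilon>" using elim \<open>0 < \<epsilon>\<close> by (intro mult_right_mono) auto
        then show "norm ((snd (snd s) * \<epsilon>) *\<^sub>R a) \<le> \<epsilon> * norm a"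
          using elim \<open>0 < \<epsilon>\<close> by (auto intro!: mult_left_le_one_le simp: abs_mult)
      qed
      also have "\<dots> = C * \<epsilon>" by (simp add: C_def algebra_simps)
      also have "\<dots> < r" using \<open>\<epsilon> < r / C\<close> C by (simp add: field_simps)
      finally show ?case .
    qed
  qed
qed (use assms in auto)

text \<open>
  The expectation of $f$ at the random point belonging to $x$. For $a = 0$ it is the cell
  average; for $a = e_i$ it is the average that appears in difference quotients of cell averages.
\<close>

definition moving_average ::
    "real ^ 'n \<Rightarrow> real \<Rightarrow> ('w \<times> (real ^ 'n) \<Rightarrow> real) \<Rightarrow> 'w \<times> (real ^ 'n) \<Rightarrow> real" where
  "moving_average a \<epsilon> f = (\<lambda>(\<omega>, x). \<integral>q. f (\<omega>, cell_point a \<epsilon> (lattice_floor \<epsilon> x) q) \<partial>cell_time_law)"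

lemma moving_average_measurable:
  assumes \<epsilon>: "0 < \<epsilon>" and f: "f \<in> borel_measurable (M \<Otimes>\<^sub>M lborel)"
  shows "moving_average a \<epsilon> f \<in> borel_measurable (M \<Otimes>\<^sub>M lborel)"
proof -
  interpret P: prob_space "cell_time_law :: ((real ^ 'b) \<times> real) measure" by (rule prob_cell_time_law)
  note [measurable] = lattice_floor_borel[OF \<epsilon>]
  have [measurable]: "f \<in> borel_measurable (M \<Otimes>\<^sub>M borel)"
    using f measurable_cong_sets[OF sets_pair_measure_cong[OF refl sets_lborel] refl] by blast
  show ?thesis unfolding moving_average_def by measurable
qed

lemma Lp_energy_moving_average_le:
  fixes f :: "'w \<times> (real ^ 'n) \<Rightarrow> real"
  assumes p: "1 < p" and \<epsilon>: "0 < \<epsilon>" and f: "f \<in> borel_measurable (M \<Otimes>\<^sub>M lborel)"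
  shows "Lp_energy p (M \<Otimes>\<^sub>M lborel) (moving_average a \<epsilon> f) \<le> Lp_energy p (M \<Otimes>\<^sub>M lborel) f"
proof -
  interpret coup: near_diagonal_coupling "lborel \<Otimes>\<^sub>M cell_time_law" fst
    "\<lambda>\<epsilon> s. cell_point a \<epsilon> (lattice_floor \<epsilon> (fst s)) (snd s)" p by (rule cell_coupling[OF p])
  note [measurable] = lattice_floor_borel[OF \<epsilon>]
  have [measurable]: "f \<in> borel_measurable (M \<Otimes>\<^sub>M borel)"
    using f measurable_cong_sets[OF sets_pair_measure_cong[OF refl sets_lborel] refl] by blast
  have "Lp_energy p (M \<Otimes>\<^sub>M lborel) (moving_average a \<epsilon> f) =
     (\<integral>\<^sup>+\<omega>. Lp_energy p lborel (\<lambda>x. moving_average a \<epsilon> f (\<omega>, x)) \<partial>M)"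
    using moving_average_measurable[OF \<epsilon> f] by (intro Lp_energy_pair sigma_finite_lborel)
  also have "\<dots> \<le> (\<integral>\<^sup>+\<omega>. Lp_energy p lborel (\<lambda>x. f (\<omega>, x)) \<partial>M)"
  proof (rule nn_integral_mono)
    fix \<omega> assume [measurable]: "\<omega> \<in> space M"
    have "Lp_energy p lborel (\<lambda>x. moving_average a \<epsilon> f (\<omega>, x)) \<le>
      Lp_energy p (lborel \<Otimes>\<^sub>M cell_time_law) (\<lambda>s. f (\<omega>, cell_point a \<epsilon> (lattice_floor \<epsilon> (fst s)) (snd s)))"
      using Lp_energy_average_le[OF prob_cell_time_law, of "\<lambda>s. f (\<omega>, cell_point a \<epsilon> (lattice_floor \<epsilon> (fst s)) (snd s))" lborel p] p
      by (simp add: moving_average_def)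
    also have "\<dots> = Lp_energy p lborel (\<lambda>x. f (\<omega>, x))"
      by (rule coup.energy_Y[OF _ \<epsilon>]) simp
    finally show "Lp_energy p lborel (\<lambda>x. moving_average a \<epsilon> f (\<omega>, x)) \<le> Lp_energy p lborel (\<lambda>x. f (\<omega>, x))" .
  qed
  also have "\<dots> = Lp_energy p (M \<Otimes>\<^sub>M lborel) f"
    by (rule Lp_energy_pair[symmetric, OF sigma_finite_lborel f])
  finally show ?thesis .
qed

text \<open>
  By Jensen's inequality the error is at most the energy of $f(\omega, x) - f(\omega, y)$ for the
  random point $y$ belonging to $x$, and this tends to \<open>0\<close> by \<open>fibred_gap_tendsto_zero\<close>.
\<close>

lemma moving_average_tendsto:
  fixes f :: "'w \<times> (real ^ 'n) \<Rightarrow> real"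
  assumes p: "1 < p" and f: "f \<in> Lp_space p (M \<Otimes>\<^sub>M lborel)"
  shows "Lp_tendsto p (M \<Otimes>\<^sub>M lborel) (\<lambda>\<epsilon>. moving_average a \<epsilon> f) f (at_right 0)"
proof -
  interpret coup: near_diagonal_coupling "lborel \<Otimes>\<^sub>M cell_time_law" fst
    "\<lambda>\<epsilon> s. cell_point a \<epsilon> (lattice_floor \<epsilon> (fst s)) (snd s)" p by (rule cell_coupling[OF p])
  interpret P: prob_space "cell_time_law :: ((real ^ 'n) \<times> real) measure" by (rule prob_cell_time_law)
  interpret LP: pair_sigma_finite "lborel :: (real ^ 'n) measure" "cell_time_law :: ((real ^ 'n) \<times> real) measure"
    by (simp add: pair_sigma_finite_def sigma_finite_lborel P.sigma_finite_measure_axioms)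
  have f': "f \<in> borel_measurable (M \<Otimes>\<^sub>M lborel)" using f by (simp add: Lp_space_iff)
  have [measurable]: "f \<in> borel_measurable (M \<Otimes>\<^sub>M borel)"
    using f' measurable_cong_sets[OF sets_pair_measure_cong[OF refl sets_lborel] refl] by blast
  have mem: "moving_average a \<epsilon> f \<in> Lp_space p (M \<Otimes>\<^sub>M lborel)" if "0 < \<epsilon>" for \<epsilon>
    using Lp_energy_moving_average_le[OF p that f', of a] moving_average_measurable[OF that f', of a] f
    by (auto simp: Lp_space_iff)
  have "((\<lambda>\<epsilon>. Lp_energy p (M \<Otimes>\<^sub>M lborel) (\<lambda>z. moving_average a \<epsilon> f z - f z)) \<longlongrightarrow> 0) (at_right 0)"
  proof (rule ennreal_tendsto_zero_mono[OF coup.fibred_gap_tendsto_zero[OF LP.sigma_finite_measure_axioms f]])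
    show "\<forall>\<^sub>F \<epsilon> in at_right 0. Lp_energy p (M \<Otimes>\<^sub>M lborel) (\<lambda>z. moving_average a \<epsilon> f z - f z) \<le>
      (\<integral>\<^sup>+\<omega>. Lp_energy p (lborel \<Otimes>\<^sub>M cell_time_law)
        (\<lambda>s. f (\<omega>, fst s) - f (\<omega>, cell_point a \<epsilon> (lattice_floor \<epsilon> (fst s)) (snd s))) \<partial>M)"
      using eventually_at_right_less[of "0::real"]
    proof eventually_elim
      case (elim \<epsilon>)
      note [measurable] = lattice_floor_borel[OF elim] 
      have "Lp_energy p (M \<Otimes>\<^sub>M lborel) (\<lambda>z. moving_average a \<epsilon> f z - f z) =
         (\<integral>\<^sup>+\<omega>. Lp_energy p lborel (\<lambda>x. moving_average a \<epsilon> f (\<omega>, x) - f (\<omega>, x)) \<partial>M)"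
        using moving_average_measurable[OF elim f'] f' by (intro Lp_energy_pair sigma_finite_lborel) auto
      also have "\<dots> \<le> (\<integral>\<^sup>+\<omega>. Lp_energy p (lborel \<Otimes>\<^sub>M cell_time_law)
        (\<lambda>s. f (\<omega>, fst s) - f (\<omega>, cell_point a \<epsilon> (lattice_floor \<epsilon> (fst s)) (snd s))) \<partial>M)"
      proof (rule nn_integral_mono_AE)
        show "AE \<omega> in M. Lp_energy p lborel (\<lambda>x. moving_average a \<epsilon> f (\<omega>, x) - f (\<omega>, x)) \<le>
            Lp_energy p (lborel \<Otimes>\<^sub>M cell_time_law)
              (\<lambda>s. f (\<omega>, fst s) - f (\<omega>, cell_point a \<epsilon> (lattice_floor \<epsilon> (fst s)) (snd s)))"
          using Lp_space_AE_section[OF sigma_finite_lborel f] AE_space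
        proof eventually_elim
          case (elim \<omega>)
          note [measurable] = elim(2)
          have "(\<lambda>s. f (\<omega>, cell_point a \<epsilon> (lattice_floor \<epsilon> (fst s)) (snd s))) \<in> Lp_space p (lborel \<Otimes>\<^sub>M cell_time_law)"
            using elim(1) coup.energy_Y[OF _ \<open>0 < \<epsilon>\<close>, of "\<lambda>x. f (\<omega>, x)"] by (simp add: Lp_space_iff)
          then have "AE x in lborel. (\<lambda>q. f (\<omega>, cell_point a \<epsilon> (lattice_floor \<epsilon> x) q)) \<in> Lp_space p cell_time_law"
            using Lp_space_AE_section[OF P.sigma_finite_measure_axioms] by fastforce
          then have "AE x in lborel. moving_average a \<epsilon> f (\<omega>, x) - f (\<omega>, x) =
             (\<integral>q. f (\<omega>, cell_point a \<epsilon> (lattice_floor \<epsilon> x) q) - f (\<omega>, x) \<partial>cell_time_law)"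
          proof eventually_elim
            case (elim x)
            have "integrable cell_time_law (\<lambda>q. f (\<omega>, cell_point a \<epsilon> (lattice_floor \<epsilon> x) q))"
              using P.Lp_space_integrable[OF elim] p by simp
            then show ?case by (simp add: moving_average_def P.prob_space)
          qed
          then have "Lp_energy p lborel (\<lambda>x. moving_average a \<epsilon> f (\<omega>, x) - f (\<omega>, x)) =
             Lp_energy p lborel (\<lambda>x. \<integral>q. f (\<omega>, cell_point a \<epsilon> (lattice_floor \<epsilon> x) q) - f (\<omega>, x) \<partial>cell_time_law)"
            by (rule Lp_energy_cong_AE)
          also have "\<dots> \<le> Lp_energy p (lborel \<Otimes>\<^sub>M cell_time_law)
              (\<lambda>s. f (\<omega>, cell_point a \<epsilon> (lattice_floor \<epsilon> (fst s)) (snd s)) - f (\<omega>, fst s))"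
            using Lp_energy_average_le[OF prob_cell_time_law,
                of "\<lambda>s. f (\<omega>, cell_point a \<epsilon> (lattice_floor \<epsilon> (fst s)) (snd s)) - f (\<omega>, fst s)" lborel p] p
            by simp
          finally show ?case by (subst Lp_energy_minus_commute)
        qed
      qed
      finally show ?case .
    qed
  qed
  moreover have "\<forall>\<^sub>F \<epsilon> in at_right 0. moving_average a \<epsilon> f \<in> Lp_space p (M \<Otimes>\<^sub>M lborel)"
    using eventually_at_right_less[of "0::real"] by eventually_elim (rule mem)
  ultimately show ?thesis using p f by (simp add: Lp_tendsto_iff_energy)
qed

section \<open>Smooth bumps and test functions\<close>

text \<open>
  The function $t^{-m} e^{-1/t}$, extended by \<open>0\<close> to $t \le 0$. These functions are closed
  under differentiation up to linear combinations, also at $t = 0$.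
\<close>

definition flat_exp :: "nat \<Rightarrow> real \<Rightarrow> real" where
  "flat_exp m t = (if t \<le> 0 then 0 else exp (- 1 / t) / t ^ m)"

lemma flat_exp_tendsto_right: "(flat_exp m \<longlongrightarrow> 0) (at_right 0)"
proof -
  have "((\<lambda>t. (inverse t) ^ m / exp (inverse t)) \<longlongrightarrow> (0::real)) (at_right 0)"
    by (rule filterlim_compose[OF tendsto_power_div_exp_0 filterlim_inverse_at_top_right])
  moreover have "\<forall>\<^sub>F t in at_right 0. (inverse t) ^ m / exp (inverse t) = flat_exp m t"
    using eventually_at_right_less[of "0::real"]
    by eventually_elim (simp add: flat_exp_def exp_minus field_simps)
  ultimately show ?thesis by (rule Lim_transform_eventually)
qed

lemma flat_exp_deriv:
  "(flat_exp m has_real_derivative (flat_exp (m + 2) t - real m * flat_exp (m + 1) t)) (at t)"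
proof -
  consider "t < 0" | "t = 0" | "0 < t" by linarith
  then show ?thesis
  proof cases
    case 1
    have "((\<lambda>t. 0) has_real_derivative 0) (at t)" by simp
    then have "(flat_exp m has_real_derivative 0) (at t)"
      by (rule has_field_derivative_transform_within_open[where S="{..<0}"]) (use 1 in \<open>auto simp: flat_exp_def\<close>)
    with 1 show ?thesis by (simp add: flat_exp_def)
  next
    case 2
    have "((\<lambda>h. flat_exp m h / h) \<longlongrightarrow> 0) (at_right 0)"
    proof (rule Lim_transform_eventually[OF flat_exp_tendsto_right[of "m + 1"]])
      show "\<forall>\<^sub>F h in at_right 0. flat_exp (m + 1) h = flat_exp m h / h"
        using eventually_at_right_less[of "0::real"] by eventually_elim (simp add: flat_exp_def)
    qed
    moreover have "((\<lambda>h. flat_exp m h / h) \<longlongrightarrow> 0) (at_left 0)"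
    proof (rule Lim_transform_eventually[OF tendsto_const])
      show "\<forall>\<^sub>F h in at_left 0. 0 = flat_exp m h / h"
        unfolding eventually_at_filter by (auto intro!: always_eventually simp: flat_exp_def)
    qed
    ultimately have "((\<lambda>h. flat_exp m h / h) \<longlongrightarrow> 0) (at 0)" by (rule filterlim_split_at[rotated])
    with 2 show ?thesis by (simp add: DERIV_def flat_exp_def)
  next
    case 3
    have e: "((\<lambda>t. exp (- 1 / t)) has_real_derivative (exp (- 1 / t) * (1 / t\<^sup>2))) (at t)"
      using 3 by (auto intro!: derivative_eq_intros simp: power2_eq_square)
    have pw: "((\<lambda>t. t ^ m) has_real_derivative (real m * t ^ (m - 1))) (at t)"
      using DERIV_pow[of m t] by simp
    have "(exp (- 1 / t) * (1 / t\<^sup>2) * t ^ m - exp (- 1 / t) * (real m * t ^ (m - 1))) / (t ^ m * t ^ m) =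
        flat_exp (m + 2) t - real m * flat_exp (m + 1) t"
      using 3 by (cases m) (simp_all add: flat_exp_def field_simps power2_eq_square)
    then have "((\<lambda>t. exp (- 1 / t) / t ^ m) has_real_derivative
        (flat_exp (m + 2) t - real m * flat_exp (m + 1) t)) (at t)"
      using DERIV_divide[OF e pw] 3 by simp
    then show ?thesis
      by (rule has_field_derivative_transform_within_open[where S="{0<..}"]) (use 3 in \<open>auto simp: flat_exp_def\<close>)
  qed
qed

text \<open>
  An algebra of functions that is closed under partial derivatives, so that its elements are
  $C^k$ for every $k$ by induction.
\<close>

inductive_set smooth_functions :: "(real ^ 'n \<Rightarrow> real) set" where
  const: "(\<lambda>x. c) \<in> smooth_functions"
| flat: "(\<lambda>x. flat_exp m (c * x $ i + d)) \<in> smooth_functions"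
| add: "f \<in> smooth_functions \<Longrightarrow> g \<in> smooth_functions \<Longrightarrow> (\<lambda>x. f x + g x) \<in> smooth_functions"
| mult: "f \<in> smooth_functions \<Longrightarrow> g \<in> smooth_functions \<Longrightarrow> (\<lambda>x. f x * g x) \<in> smooth_functions"

lemma smooth_functions_has_derivative:
  fixes f :: "real ^ 'n \<Rightarrow> real"
  assumes "f \<in> smooth_functions"
  shows "\<exists>f'. (\<forall>x. (f has_derivative f' x) (at x)) \<and> (\<forall>i. (\<lambda>x. f' x (axis i 1)) \<in> smooth_functions)"
  using assms
proof induction
  case (const c)
  show ?case
    by (rule exI[of _ "\<lambda>x h. 0"]) (auto intro: smooth_functions.const)
next
  case (flat m c i d)
  let ?D = "\<lambda>t. flat_exp (m + 2) t + (- real m) * flat_exp (m + 1) t"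
  let ?f' = "\<lambda>x (h :: real ^ 'n). (c * h $ i) * ?D (c * x $ i + d)"
  have 1: "((\<lambda>x :: real ^ 'n. c * x $ i + d) has_derivative (\<lambda>h. c * h $ i)) (at x)" for x
    by (auto intro!: derivative_eq_intros bounded_linear.has_derivative[OF bounded_linear_vec_nth])
  have "((\<lambda>x. flat_exp m (c * x $ i + d)) has_derivative ?f' x) (at x)" for x
    using DERIV_compose_FDERIV[OF flat_exp_deriv 1] by simp
  moreover have "(\<lambda>x. ?f' x (axis j 1)) \<in> smooth_functions" for j
    by (intro smooth_functions.intros)
  ultimately show ?case by (intro exI[of _ ?f'] conjI allI)
next
  case (add f g)
  then obtain f' g' where "\<forall>x. (f has_derivative f' x) (at x)" "\<forall>i. (\<lambda>x. f' x (axis i 1)) \<in> smooth_functions"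
    "\<forall>x. (g has_derivative g' x) (at x)" "\<forall>i. (\<lambda>x. g' x (axis i 1)) \<in> smooth_functions" by blast
  then show ?case
    by (intro exI[of _ "\<lambda>x h. f' x h + g' x h"]) (auto intro!: has_derivative_add smooth_functions.add)
next
  case (mult f g)
  then obtain f' g' where "\<forall>x. (f has_derivative f' x) (at x)" "\<forall>i. (\<lambda>x. f' x (axis i 1)) \<in> smooth_functions"
    "\<forall>x. (g has_derivative g' x) (at x)" "\<forall>i. (\<lambda>x. g' x (axis i 1)) \<in> smooth_functions" by blast
  with mult show ?case
    by (intro exI[of _ "\<lambda>x h. f x * g' x h + f' x h * g x"])
       (auto intro!: has_derivative_mult smooth_functions.add smooth_functions.mult)
qed

lemma partial_deriv_eq:
  assumes "(f has_derivative f') (at x)"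
  shows "partial_deriv i f x = f' (axis i 1)"
  using frechet_derivative_at[OF assms] by (simp add: partial_deriv_def)

lemma smooth_functions_Ck:
  "f \<in> smooth_functions \<Longrightarrow> Ck_function k f"
proof (induction k arbitrary: f)
  case 0
  then have "f differentiable at x" for x
    using smooth_functions_has_derivative[OF 0] by (auto simp: differentiable_def)
  then show ?case by (simp add: continuous_at_imp_continuous_on differentiable_imp_continuous_within)
next
  case (Suc k)
  obtain f' where f': "\<forall>x. (f has_derivative f' x) (at x)" "\<forall>i. (\<lambda>x. f' x (axis i 1)) \<in> smooth_functions"
    using smooth_functions_has_derivative[OF Suc.prems] by blast
  have "partial_deriv i f = (\<lambda>x. f' x (axis i 1))" for i
    using partial_deriv_eq f'(1) by blast
  then show ?case
    using f' Suc.IH by (auto simp: differentiable_on_def differentiable_def)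
qed

lemma smooth_functions_prod:
  assumes "finite I" "\<And>i. i \<in> I \<Longrightarrow> f i \<in> smooth_functions"
  shows "(\<lambda>x. \<Prod>i\<in>I. f i x) \<in> smooth_functions"
  using assms by (induction I rule: finite_induct) (auto intro: smooth_functions.intros)

text \<open>
  Positive exactly on the box with corners \<open>a\<close> and \<open>b\<close>; as $k \to \infty$ each factor tends to
  \<open>1\<close> where it is positive.
\<close>

definition bump :: "nat \<Rightarrow> real ^ 'n \<Rightarrow> real ^ 'n \<Rightarrow> real ^ 'n \<Rightarrow> real" where
  "bump k a b x = (\<Prod>i\<in>UNIV. flat_exp 0 (real (Suc k) * (x $ i - a $ i)) * flat_exp 0 (real (Suc k) * (b $ i - x $ i)))"

lemma flat_exp_bounds: "0 \<le> flat_exp 0 t" "flat_exp 0 t \<le> 1" "flat_exp 0 t = 0 \<longleftrightarrow> t \<le> 0"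
  by (auto simp: flat_exp_def)

lemma bump_bounds: "0 \<le> bump k a b x" "bump k a b x \<le> 1"
  unfolding bump_def using flat_exp_bounds
  by (auto intro!: prod_nonneg prod_le_1 mult_nonneg_nonneg mult_le_one)

lemma bump_nonzero_iff: "bump k a b x \<noteq> 0 \<longleftrightarrow> x \<in> box a b"
  unfolding bump_def by (auto simp: flat_exp_bounds mem_box_cart mult_le_0_iff not_le less_diff_eq)

lemma bump_tendsto: "(\<lambda>k. bump k a b x) \<longlonglongrightarrow> indicator (box a b) x"
proof (cases "x \<in> box a b")
  case True
  have *: "(\<lambda>k. flat_exp 0 (real (Suc k) * t)) \<longlonglongrightarrow> 1" if "0 < t" for t
  proof -
    have "(\<lambda>k. exp (- (inverse t * inverse (real (Suc k))))) \<longlonglongrightarrow> exp (- (inverse t * 0))"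
      by (intro tendsto_intros LIMSEQ_inverse_real_of_nat)
    moreover have "exp (- (inverse t * inverse (real (Suc k)))) = flat_exp 0 (real (Suc k) * t)" for k
    proof -
      have "0 < real (Suc k) * t" using that by simp
      then show ?thesis by (simp add: flat_exp_def field_simps)
    qed
    ultimately show ?thesis by simp
  qed
  have "(\<lambda>k. bump k a b x) \<longlonglongrightarrow> (\<Prod>i\<in>(UNIV :: 'a set). 1 * 1)"
    unfolding bump_def using True by (intro tendsto_intros *) (auto simp: mem_box_cart)
  then show ?thesis using True by simp
next
  case False
  then have "bump k a b x = 0" for k using bump_nonzero_iff by blast
  then show ?thesis using False by simp
qed

lemma bump_test_function:
  fixes a b :: "real ^ 'n"
  assumes "cbox a b \<subseteq> S"
  shows "bump k a b \<in> test_functions S"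
proof -
  have eq: "bump k a b = (\<lambda>x. \<Prod>i\<in>UNIV. flat_exp 0 (real (Suc k) * x $ i + (- real (Suc k) * a $ i)) *
      flat_exp 0 ((- real (Suc k)) * x $ i + real (Suc k) * b $ i))"
    by (simp add: bump_def fun_eq_iff algebra_simps)
  have "bump k a b \<in> smooth_functions"
    unfolding eq by (intro smooth_functions_prod smooth_functions.intros) auto
  moreover have "{x. bump k a b x \<noteq> 0} = box a b" using bump_nonzero_iff by blast
  then have "closure {x. bump k a b x \<noteq> 0} \<subseteq> cbox a b"
    using closure_minimal[OF box_subset_cbox closed_cbox, of a b] by simp
  moreover then have "compact (closure {x. bump k a b x \<noteq> 0})"
    by (meson bounded_cbox bounded_subset closed_closure compact_eq_bounded_closed)
  ultimately show ?thesis using assms by (auto simp: test_functions_def intro: smooth_functions_Ck)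
qed

lemma test_function_has_derivative:
  assumes "\<psi> \<in> test_functions S"
  shows "(\<psi> has_derivative frechet_derivative \<psi> (at x)) (at x)"
proof -
  have "Ck_function (Suc 0) \<psi>" using assms unfolding test_functions_def by blast
  then show ?thesis by (simp add: differentiable_on_def frechet_derivative_works)
qed

lemma test_function_continuous: "\<psi> \<in> test_functions S \<Longrightarrow> continuous_on UNIV \<psi>"
proof -
  assume "\<psi> \<in> test_functions S"
  then have "Ck_function 0 \<psi>" unfolding test_functions_def by blast
  then show ?thesis by simp
qed

lemma partial_deriv_continuous: "\<psi> \<in> test_functions S \<Longrightarrow> continuous_on UNIV (partial_deriv i \<psi>)"
proof -
  assume "\<psi> \<in> test_functions S"
  then have "Ck_function (Suc 0) \<psi>" unfolding test_functions_def by blast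
  then show ?thesis by simp
qed

lemma test_function_measurable:
  assumes "\<psi> \<in> test_functions S"
  shows "\<psi> \<in> borel_measurable borel" "partial_deriv i \<psi> \<in> borel_measurable borel"
  using assms by (auto intro!: borel_measurable_continuous_onI test_function_continuous partial_deriv_continuous)

lemma test_function_support:
  fixes \<psi> :: "real ^ 'n \<Rightarrow> real"
  assumes \<psi>: "\<psi> \<in> test_functions S"
  obtains K B where "compact K" "K \<subseteq> S" "0 \<le> B" "\<And>x. \<bar>\<psi> x\<bar> \<le> B * indicator K x" "\<And>x i. \<bar>partial_deriv i \<psi> x\<bar> \<le> B * indicator K x"
proof -
  let ?K = "closure {x. \<psi> x \<noteq> 0}"
  have K: "compact ?K" "?K \<subseteq> S" using \<psi> by (auto simp: test_functions_def)
  have z: "\<psi> x = 0" if "x \<notin> ?K" for x using that closure_subset[of "{x. \<psi> x \<noteq> 0}"] by auto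
  have dz: "partial_deriv i \<psi> x = 0" if "x \<notin> ?K" for x i
  proof -
    have "((\<lambda>x. 0) has_derivative (\<lambda>h. 0)) (at x)" by simp
    then have "(\<psi> has_derivative (\<lambda>h. 0)) (at x)"
    proof (rule has_derivative_transform_within_open)
      show "open (- ?K)" by (intro open_Compl closed_closure)
      show "x \<in> - ?K" using that by simp
      show "0 = \<psi> y" if "y \<in> - ?K" for y using z that by (metis ComplD)
    qed
    then show ?thesis by (simp add: partial_deriv_eq)
  qed
  have bdd: "\<exists>B. \<forall>x\<in>?K. \<bar>g x\<bar> \<le> B" if "continuous_on UNIV g" for g :: "real ^ 'n \<Rightarrow> real"
  proof -
    have "compact (g ` ?K)"
      using that K(1) by (meson compact_continuous_image continuous_on_subset top_greatest)
    then show ?thesis using compact_imp_bounded bounded_real by (metis imageI)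
  qed
  obtain B0 where B0: "\<forall>x\<in>?K. \<bar>\<psi> x\<bar> \<le> B0" using bdd[OF test_function_continuous[OF \<psi>]] by blast
  have "\<forall>i. \<exists>B. \<forall>x\<in>?K. \<bar>partial_deriv i \<psi> x\<bar> \<le> B" using bdd[OF partial_deriv_continuous[OF \<psi>]] by blast
  then obtain Bi where Bi: "\<And>i. \<forall>x\<in>?K. \<bar>partial_deriv i \<psi> x\<bar> \<le> Bi i" by metis
  define B where "B = \<bar>B0\<bar> + (\<Sum>i\<in>UNIV. \<bar>Bi i\<bar>)"
  have s: "\<bar>Bi i\<bar> \<le> (\<Sum>i\<in>UNIV. \<bar>Bi i\<bar>)" for i by (rule member_le_sum) auto
  show ?thesis
  proof (rule that[OF K])
    show "0 \<le> B" by (simp add: B_def sum_nonneg)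
    show "\<bar>\<psi> x\<bar> \<le> B * indicator ?K x" for x
    proof (cases "x \<in> ?K")
      case True
      then have "\<bar>\<psi> x\<bar> \<le> B0" using B0 by blast
      moreover have "0 \<le> (\<Sum>i\<in>UNIV. \<bar>Bi i\<bar>)" by (simp add: sum_nonneg)
      ultimately have "\<bar>\<psi> x\<bar> \<le> B" unfolding B_def by linarith
      then show ?thesis using True by simp
    next
      case False
      then show ?thesis using z[OF False] by simp
    qed
    show "\<bar>partial_deriv i \<psi> x\<bar> \<le> B * indicator ?K x" for x i
    proof (cases "x \<in> ?K")
      case True
      then have "\<bar>partial_deriv i \<psi> x\<bar> \<le> Bi i" using Bi by blast
      then show ?thesis using True s[of i] by (simp add: B_def)
    next
      case False
      then show ?thesis using dz[OF False] by simp
    qed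
  qed
qed

lemma partial_deriv_shift:
  fixes \<psi> :: "real ^ 'n \<Rightarrow> real"
  assumes "\<And>x. \<psi> differentiable at x"
  shows "partial_deriv i (\<lambda>x. \<psi> (x - c)) = (\<lambda>x. partial_deriv i \<psi> (x - c))"
proof
  fix x
  have "(\<psi> has_derivative frechet_derivative \<psi> (at (x - c))) (at (x - c))"
    using assms frechet_derivative_works by blast
  moreover have "((\<lambda>x. x - c) has_derivative (\<lambda>h. h)) (at x)"
    by (rule derivative_eq_intros refl)+ simp
  ultimately have "((\<lambda>x. \<psi> (x - c)) has_derivative frechet_derivative \<psi> (at (x - c))) (at x)"
    using has_derivative_compose[of "\<lambda>x. x - c" "\<lambda>h. h" x UNIV \<psi> "frechet_derivative \<psi> (at (x - c))"]
    by blast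
  then show "partial_deriv i (\<lambda>x. \<psi> (x - c)) x = partial_deriv i \<psi> (x - c)"
    using partial_deriv_eq[of "\<lambda>x. \<psi> (x - c)" _ x i] by (simp add: partial_deriv_def[of i \<psi>])
qed

lemma Ck_function_shift:
  "Ck_function k \<psi> \<Longrightarrow> Ck_function k (\<lambda>x. \<psi> (x - c))"
proof (induction k arbitrary: \<psi>)
  case 0
  moreover have "continuous_on UNIV (\<lambda>x. x - c)" by (intro continuous_intros)
  ultimately show ?case using continuous_on_compose2[of UNIV \<psi> UNIV "\<lambda>x. x - c"] by simp
next
  case (Suc k)
  then have d: "\<psi> differentiable at x" for x by (simp add: differentiable_on_def)
  have "(\<lambda>x. \<psi> (x - c)) differentiable at x" for x
    using differentiable_compose[of \<psi> "\<lambda>x. x - c" x UNIV] d by auto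
  then show ?case using Suc d by (simp add: partial_deriv_shift differentiable_on_def)
qed

lemma test_function_shift:
  assumes "\<psi> \<in> test_functions S"
  shows "(\<lambda>x. \<psi> (x - c)) \<in> test_functions UNIV"
proof -
  have "{x. \<psi> (x - c) \<noteq> 0} = (\<lambda>x. c + x) ` {x. \<psi> x \<noteq> 0}"
    by (auto intro!: image_eqI[where x="_ - c"])
  then have "closure {x. \<psi> (x - c) \<noteq> 0} = (\<lambda>x. c + x) ` closure {x. \<psi> x \<noteq> 0}"
    by (simp add: closure_translation)
  then have "compact (closure {x. \<psi> (x - c) \<noteq> 0})"
    using assms unfolding test_functions_def by (metis (mono_tags, lifting) compact_translation mem_Collect_eq)
  then show ?thesis
    using assms unfolding test_functions_def by (simp add: Ck_function_shift)
qed

text \<open>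
  On a compact set, $|\eta| \le 1 + |\eta|^p$ is integrable.
\<close>

lemma Lp_integrable_mult:
  fixes \<eta> :: "real ^ 'n \<Rightarrow> real"
  assumes \<eta>: "\<eta> \<in> Lp_space p lborel" and p: "1 \<le> p" and K: "compact K"
    and \<phi>: "\<phi> \<in> borel_measurable borel" "\<And>x. \<bar>\<phi> x\<bar> \<le> B * indicator K x"
  shows "integrable lborel (\<lambda>x. \<eta> x * \<phi> x)"
proof -
  have [measurable]: "\<eta> \<in> borel_measurable borel" "\<phi> \<in> borel_measurable borel" "K \<in> sets borel"
    using \<eta> \<phi> K by (auto simp: Lp_space_iff compact_imp_closed)
  have int: "integrable lborel (\<lambda>x. B * (indicator K x + norm (\<eta> x) powr p))"
  proof (intro integrable_mult_right Bochner_Integration.integrable_add)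
    show "integrable lborel (\<lambda>x. norm (\<eta> x) powr p)" using \<eta> by (simp add: Lp_space_def)
    show "integrable lborel (indicator K :: real ^ 'n \<Rightarrow> real)"
      using emeasure_lborel_cbox_finite K emeasure_bounded_finite[OF compact_imp_bounded[OF K]] by simp
  qed
  show ?thesis
  proof (rule Bochner_Integration.integrable_bound[OF int])
    show "AE x in lborel. norm (\<eta> x * \<phi> x) \<le> norm (B * (indicator K x + norm (\<eta> x) powr p))"
    proof (rule AE_I2)
      fix x
      show "norm (\<eta> x * \<phi> x) \<le> norm (B * (indicator K x + norm (\<eta> x) powr p))"
      proof (cases "x \<in> K")
        case True
        then have b: "\<bar>\<phi> x\<bar> \<le> B" using \<phi>(2)[of x] by simp
        have "\<bar>\<eta> x\<bar> \<le> 1 + \<bar>\<eta> x\<bar> powr p" using p by (intro le_one_add_powr) auto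
        then have "\<bar>\<eta> x\<bar> * \<bar>\<phi> x\<bar> \<le> (1 + \<bar>\<eta> x\<bar> powr p) * B" using b by (intro mult_mono) auto
        also have "\<dots> \<le> \<bar>B * (1 + \<bar>\<eta> x\<bar> powr p)\<bar>" by (simp add: mult.commute)
        finally show ?thesis using True by (simp add: abs_mult)
      next
        case False
        then have "\<phi> x = 0" using \<phi>(2)[of x] by simp
        then show ?thesis by simp
      qed
    qed
  qed simp
qed

lemma Lp_integrable_test:
  fixes \<eta> :: "real ^ 'n \<Rightarrow> real"
  assumes "\<eta> \<in> Lp_space p lborel" "1 \<le> p" "\<psi> \<in> test_functions S"
  shows "integrable lborel (\<lambda>x. \<eta> x * \<psi> x)" "integrable lborel (\<lambda>x. \<eta> x * partial_deriv i \<psi> x)"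
proof -
  obtain K B where "compact K" "\<And>x. \<bar>\<psi> x\<bar> \<le> B * indicator K x" "\<And>x i. \<bar>partial_deriv i \<psi> x\<bar> \<le> B * indicator K x"
    using test_function_support[OF assms(3)] by metis
  then show "integrable lborel (\<lambda>x. \<eta> x * \<psi> x)" "integrable lborel (\<lambda>x. \<eta> x * partial_deriv i \<psi> x)"
    using test_function_measurable[OF assms(3)] by (auto intro!: Lp_integrable_mult[OF assms(1,2)])
qed

lemma bump_measurable [measurable]: "bump k a b \<in> borel_measurable borel"
  by (rule test_function_measurable(1)[OF bump_test_function[OF order_refl]])

text \<open>
  Testing with bumps is, in the limit, integrating over a box.
\<close>

lemma bump_integral_tendsto:
  fixes f :: "real ^ 'n \<Rightarrow> real"
  assumes f: "f \<in> Lp_space p lborel" and p: "1 \<le> p"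
  shows "(\<lambda>k. \<integral>x. f x * bump k a b x \<partial>lborel) \<longlonglongrightarrow> (\<integral>x. f x * indicator (box a b) x \<partial>lborel)"
proof (rule integral_dominated_convergence[where w="\<lambda>x. \<bar>f x * indicator (cbox a b) x\<bar>"])
  have [measurable]: "f \<in> borel_measurable borel" using f by (simp add: Lp_space_iff)
  show "(\<lambda>x. f x * indicator (box a b) x) \<in> borel_measurable lborel" by measurable
  show "(\<lambda>x. f x * bump k a b x) \<in> borel_measurable lborel" for k by measurable
  show "integrable lborel (\<lambda>x. \<bar>f x * indicator (cbox a b) x\<bar>)"
    by (intro integrable_abs Lp_integrable_mult[OF f p compact_cbox, where B=1]) auto
  show "AE x in lborel. (\<lambda>k. f x * bump k a b x) \<longlonglongrightarrow> f x * indicator (box a b) x"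
    by (intro AE_I2 tendsto_intros bump_tendsto)
  show "AE x in lborel. norm (f x * bump k a b x) \<le> \<bar>f x * indicator (cbox a b) x\<bar>" for k
  proof (rule AE_I2)
    fix x
    have "x \<in> cbox a b" if "bump k a b x \<noteq> 0" using that bump_nonzero_iff box_subset_cbox by blast
    then show "norm (f x * bump k a b x) \<le> \<bar>f x * indicator (cbox a b) x\<bar>"
      using bump_bounds[of k a b x] by (cases "bump k a b x = 0") (auto simp: abs_mult mult_left_le)
  qed
qed

text \<open>
  Boxes are stable under intersection and generate the Borel sets, so all integrals over Borel
  sets vanish, in particular those over $\{g > 0\}$ and $\{g < 0\}$.
\<close>

lemma AE_zero_of_box_integrals:
  fixes g :: "real ^ 'n \<Rightarrow> real"
  assumes g: "integrable lborel g" and all: "(\<integral>x. g x \<partial>lborel) = 0"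
    and box: "\<And>c d. (\<integral>x. g x * indicator (box c d) x \<partial>lborel) = 0"
  shows "AE x in lborel. g x = 0"
proof -
  have [measurable]: "g \<in> borel_measurable borel" using g by simp
  have int: "integrable lborel (\<lambda>x. g x * indicator A x)" if "A \<in> sets borel" for A
    using integrable_mult_indicator[of A lborel g] that g by (simp add: mult.commute)
  have zero: "(\<integral>x. g x * indicator A x \<partial>lborel) = 0" if "A \<in> sets borel" for A
  proof -
    let ?G = "range (\<lambda>(a, b). box a b :: (real ^ 'n) set)"
    have "Int_stable ?G" "?G \<subseteq> Pow UNIV"
      unfolding Int_stable_def by (auto simp: box_Int_box)
    moreover have "A \<in> sigma_sets UNIV ?G" using that by (simp add: borel_eq_box)
    ultimately show ?thesis
    proof (induction rule: sigma_sets_induct_disjoint)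
      case (basic A)
      then show ?case using box by auto
    next
      case empty
      show ?case by simp
    next
      case (compl A)
      then have A: "A \<in> sets borel" by (simp add: borel_eq_box)
      have "(\<integral>x. g x * indicator (UNIV - A) x \<partial>lborel) = (\<integral>x. g x - g x * indicator A x \<partial>lborel)"
        by (intro Bochner_Integration.integral_cong) (auto simp: indicator_def)
      also have "\<dots> = 0" using compl int[OF A] g all by simp
      finally show ?case .
    next
      case (union A)
      then have A: "A i \<in> sets borel" for i by (auto simp: borel_eq_box)
      have "(LINT x:(\<Union>i. A i)|lborel. g x) = (\<Sum>i. LINT x:(A i)|lborel. g x)"
        using union(1) A int[of "\<Union>i. A i"]
        by (intro lebesgue_integral_countable_add)
           (auto simp: disjoint_family_on_def set_integrable_def mult.commute)
      moreover have "(LINT x:(A i)|lborel. g x) = 0" for i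
        using union(3)[of i] by (simp add: set_lebesgue_integral_def mult.commute)
      ultimately show ?case by (simp add: set_lebesgue_integral_def mult.commute)
    qed
  qed
  have pos: "AE x in lborel. h x \<le> 0" if "h = g \<or> h = (\<lambda>x. - g x)" for h
  proof -
    have [measurable]: "h \<in> borel_measurable borel" using that by auto
    have A: "{x. 0 < h x} \<in> sets borel" by measurable
    have "integrable lborel (\<lambda>x. h x * indicator {x. 0 < h x} x)" using that int[OF A] by auto
    moreover have "(\<integral>x. h x * indicator {x. 0 < h x} x \<partial>lborel) = 0" using that zero[OF A] by auto
    ultimately have "AE x in lborel. h x * indicator {x. 0 < h x} x = 0"
      by (subst (asm) integral_nonneg_eq_0_iff_AE) (auto simp: indicator_def)
    then show ?thesis by eventually_elim (auto simp: indicator_def split: if_splits)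
  qed
  from pos[of g] pos[of "\<lambda>x. - g x"] show ?thesis by (auto elim: AE_mp)
qed

text \<open>
  Bumps show that the integral over every box with closure in \<open>S\<close> vanishes, and \<open>S\<close> is a
  countable union of such boxes.
\<close>

lemma fundamental_lemma:
  fixes f :: "real ^ 'n \<Rightarrow> real"
  assumes S: "open S" and f: "f \<in> Lp_space p lborel" and p: "1 \<le> p"
    and zero: "\<And>\<psi>. \<psi> \<in> test_functions S \<Longrightarrow> (\<integral>x. f x * \<psi> x \<partial>lborel) = 0"
  shows "AE x in lborel. x \<in> S \<longrightarrow> f x = 0"
proof -
  have box0: "(\<integral>x. f x * indicator (box a b) x \<partial>lborel) = 0" if "cbox a b \<subseteq> S" for a b
    using bump_integral_tendsto[OF f p, of a b] zero[OF bump_test_function[OF that]]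
    by (simp add: LIMSEQ_const_iff)
  have on_box: "AE x in lborel. x \<in> cbox a b \<longrightarrow> f x = 0" if ab: "cbox a b \<subseteq> S" for a b
  proof -
    let ?g = "\<lambda>x. f x * indicator (box a b) x"
    have "AE x in lborel. ?g x = 0"
    proof (rule AE_zero_of_box_integrals)
      show "integrable lborel ?g"
        by (rule Lp_integrable_mult[OF f p compact_cbox, where B=1]) (auto simp: indicator_def dest: subsetD[OF box_subset_cbox])
      show "(\<integral>x. ?g x \<partial>lborel) = 0" by (rule box0[OF ab])
      fix c d :: "real ^ 'n"
      let ?l = "\<Sum>i\<in>Basis. max (a \<bullet> i) (c \<bullet> i) *\<^sub>R i" and ?u = "\<Sum>i\<in>Basis. min (b \<bullet> i) (d \<bullet> i) *\<^sub>R i"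
      have eq: "box a b \<inter> box c d = box ?l ?u" by (rule box_Int_box)
      have sub: "cbox ?l ?u \<subseteq> cbox a b" by (auto simp: mem_box)
      have "(\<integral>x. ?g x * indicator (box c d) x \<partial>lborel) = (\<integral>x. f x * indicator (box ?l ?u) x \<partial>lborel)"
        unfolding eq[symmetric] by (intro Bochner_Integration.integral_cong) (auto simp: indicator_def)
      also have "\<dots> = 0" by (rule box0) (use sub ab in blast)
      finally show "(\<integral>x. ?g x * indicator (box c d) x \<partial>lborel) = 0" .
    qed
    moreover have "AE x in lborel. x \<notin> cbox a b - box a b"
      by (rule AE_not_in) (simp add: null_sets_def emeasure_lborel_cbox_eq emeasure_lborel_box_eq emeasure_Diff box_subset_cbox)
    ultimately show ?thesis by eventually_elim (auto simp: indicator_def split: if_splits)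
  qed
  obtain \<D> where D: "countable \<D>" "\<D> \<subseteq> Pow S" "\<And>X. X \<in> \<D> \<Longrightarrow> \<exists>a b. X = cbox a b" "\<Union>\<D> = S"
    using open_countable_Union_open_cbox[OF S] by metis
  have "AE x in lborel. \<forall>X\<in>\<D>. x \<in> X \<longrightarrow> f x = 0"
    unfolding AE_ball_countable[OF D(1)]
  proof
    fix X assume X: "X \<in> \<D>"
    then obtain a b where "X = cbox a b" using D(3) by blast
    then show "AE x in lborel. x \<in> X \<longrightarrow> f x = 0" using on_box[of a b] D(2) X by blast
  qed
  then show ?thesis by eventually_elim (use D(4) in blast)
qed

section \<open>Differences of cell averages of weakly differentiable functions\<close>

lemma integral_affine:
  fixes h :: "'a::euclidean_space \<Rightarrow> real"
  assumes [measurable]: "h \<in> borel_measurable borel" and "0 < \<epsilon>"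
  shows "(\<integral>x. h x \<partial>lborel) = \<epsilon> ^ DIM('a) * (\<integral>z. h (k + \<epsilon> *\<^sub>R z) \<partial>lborel)"
proof -
  have "(\<integral>x. h x \<partial>lborel) = (\<integral>x. h x \<partial>(density (distr lborel borel (\<lambda>x. k + \<epsilon> *\<^sub>R x)) (\<lambda>_. ennreal (\<epsilon> ^ DIM('a)))))"
    using assms(2) lborel_affine[of \<epsilon> k] by simp
  also have "\<dots> = \<epsilon> ^ DIM('a) * (\<integral>z. h (k + \<epsilon> *\<^sub>R z) \<partial>lborel)"
    using assms(2) by (simp add: integral_density integral_distr)
  finally show ?thesis .
qed

lemma integral_shift:
  fixes h :: "'a::euclidean_space \<Rightarrow> real"
  assumes [measurable]: "h \<in> borel_measurable borel"
  shows "(\<integral>x. h (x + c) \<partial>lborel) = (\<integral>x. h x \<partial>lborel)"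
  using integral_affine[of h 1 c] by (simp add: add.commute)

lemma Lp_space_shift:
  fixes f :: "'a::euclidean_space \<Rightarrow> real"
  assumes "f \<in> Lp_space p lborel"
  shows "(\<lambda>x. f (x + c)) \<in> Lp_space p lborel" "Lp_energy p lborel (\<lambda>x. f (x + c)) = Lp_energy p lborel f"
proof -
  have [measurable]: "f \<in> borel_measurable borel" using assms by (simp add: Lp_space_iff)
  show 1: "Lp_energy p lborel (\<lambda>x. f (x + c)) = Lp_energy p lborel f"
    unfolding Lp_energy_def
    using nn_integral_affine[of "\<lambda>x. ennreal (norm (f x) powr p)" 1 c] by (simp add: add.commute)
  show "(\<lambda>x. f (x + c)) \<in> Lp_space p lborel" using assms 1 by (simp add: Lp_space_iff)
qed

lemma integral_cell_law:
  fixes f :: "real ^ 'n \<Rightarrow> real"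
  assumes [measurable]: "f \<in> borel_measurable borel" and \<epsilon>: "0 < \<epsilon>"
  shows "(\<integral>z. f (k + \<epsilon> *\<^sub>R z) \<partial>cell_law) = (\<integral>y. f y * indicator (cell \<epsilon> k) y \<partial>lborel) / \<epsilon> ^ CARD('n)"
proof -
  have "k + \<epsilon> *\<^sub>R z \<in> cell \<epsilon> k \<longleftrightarrow> z \<in> unit_cell" for z
    using \<epsilon> by (force simp: cell_eq_image)
  then have ind: "indicator (cell \<epsilon> k) (k + \<epsilon> *\<^sub>R z) = (indicator unit_cell z :: real)" for z
    by (simp add: indicator_def)
  have "cell_law = density lborel (\<lambda>z :: real ^ 'n. ennreal (indicator unit_cell z))"
    unfolding cell_law_def uniform_measure_def
    by (intro density_cong) (auto simp: emeasure_unit_cell indicator_def divide_ennreal_def)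
  then have "(\<integral>z. f (k + \<epsilon> *\<^sub>R z) \<partial>cell_law) =
      (\<integral>z. f (k + \<epsilon> *\<^sub>R z) \<partial>(density lborel (\<lambda>z :: real ^ 'n. ennreal (indicator unit_cell z))))"
    by simp
  also have "\<dots> = (\<integral>z. f (k + \<epsilon> *\<^sub>R z) * indicator unit_cell z \<partial>lborel)"
    by (subst integral_density) (auto simp: mult.commute)
  finally have "(\<integral>z. f (k + \<epsilon> *\<^sub>R z) \<partial>cell_law) = (\<integral>z. f (k + \<epsilon> *\<^sub>R z) * indicator unit_cell z \<partial>lborel)" .
  moreover have "(\<integral>y. f y * indicator (cell \<epsilon> k) y \<partial>lborel) =
      \<epsilon> ^ CARD('n) * (\<integral>z. f (k + \<epsilon> *\<^sub>R z) * indicator unit_cell z \<partial>lborel)"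
    by (subst integral_affine[OF _ \<epsilon>, of _ k]) (auto simp: ind)
  ultimately show ?thesis using \<epsilon> by simp
qed

lemma integral_time_law:
  fixes f :: "real \<Rightarrow> real"
  assumes [measurable]: "f \<in> borel_measurable borel"
  shows "(\<integral>t. f t \<partial>time_law) = (\<integral>t. indicator {0..1} t *\<^sub>R f t \<partial>lborel)"
proof -
  have "time_law = density lborel (\<lambda>t. ennreal (indicator {0..1} t))"
    unfolding time_law_def uniform_measure_def
    by (intro density_cong) (auto simp: indicator_def divide_ennreal_def)
  then have "(\<integral>t. f t \<partial>time_law) = (\<integral>t. f t \<partial>(density lborel (\<lambda>t. ennreal (indicator {0..1} t))))"
    by simp
  also have "\<dots> = (\<integral>t. indicator {0..1} t *\<^sub>R f t \<partial>lborel)"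
    by (subst integral_density) auto
  finally show ?thesis .
qed

lemma integral_cell_point_zero:
  fixes f :: "real ^ 'n \<Rightarrow> real"
  assumes [measurable]: "f \<in> borel_measurable borel"
  shows "(\<integral>q. f (cell_point 0 \<epsilon> k q) \<partial>cell_time_law) = (\<integral>z. f (k + \<epsilon> *\<^sub>R z) \<partial>cell_law)"
proof -
  interpret I: prob_space time_law by (rule prob_time_law)
  interpret Z: prob_space "cell_law :: (real ^ 'n) measure" by (rule prob_cell_law)
  have "(\<integral>z. f (k + \<epsilon> *\<^sub>R z) \<partial>cell_law) = (\<integral>z. f (k + \<epsilon> *\<^sub>R z) \<partial>(distr (cell_law \<Otimes>\<^sub>M time_law) cell_law fst))"
    by (simp add: I.distr_pair_fst)
  also have "\<dots> = (\<integral>q. f (k + \<epsilon> *\<^sub>R fst q) \<partial>(cell_law \<Otimes>\<^sub>M time_law))"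
    by (rule integral_distr) measurable
  finally show ?thesis by (simp add: cell_time_law_def cell_point_def)
qed

text \<open>
  For times in $[0,1]$ all translates of \<open>K\<close> stay in one compact set, the image of
  $K \times [0, \varepsilon]$ under $(x, s) \mapsto x + s e$.
\<close>

lemma integrable_translates:
  fixes \<eta> :: "real ^ 'n \<Rightarrow> real"
  assumes \<eta>: "\<eta> \<in> Lp_space p lborel" and p: "1 \<le> p" and \<epsilon>: "0 < \<epsilon>" and K: "compact K"
    and \<phi>[measurable]: "\<phi> \<in> borel_measurable borel" and bound: "\<And>x. \<bar>\<phi> x\<bar> \<le> B * indicator K x" and B: "0 \<le> B"
  shows "integrable (lborel \<Otimes>\<^sub>M time_law) (\<lambda>(y, t). \<eta> y * \<phi> (y - (t * \<epsilon>) *\<^sub>R e))"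
proof -
  interpret I: prob_space time_law by (rule prob_time_law)
  interpret LI: pair_sigma_finite "lborel :: (real ^ 'n) measure" time_law
    by (simp add: pair_sigma_finite_def sigma_finite_lborel I.sigma_finite_measure_axioms)
  have [measurable]: "\<eta> \<in> borel_measurable borel" using \<eta> by (simp add: Lp_space_iff)
  define K' where "K' = (\<lambda>(x, s). x + s *\<^sub>R e) ` (K \<times> {0..\<epsilon>})"
  have K': "compact K'" unfolding K'_def split_beta
    by (intro compact_continuous_image compact_Times K continuous_intros) auto
  then have [measurable]: "K' \<in> sets borel" by (simp add: compact_imp_closed)
  have int: "integrable (lborel \<Otimes>\<^sub>M time_law) (\<lambda>(y, t). \<eta> y * (B * indicator K' y))"
  proof (rule LI.Fubini_integrable)
    have "integrable lborel (\<lambda>y. \<eta> y * (B * indicator K' y))"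
      by (rule Lp_integrable_mult[OF \<eta> p K', where B=B]) (use B in auto)
    from integrable_norm[OF this]
    show "integrable lborel (\<lambda>y. \<integral>t. norm (case (y, t) of (y, t) \<Rightarrow> \<eta> y * (B * indicator K' y)) \<partial>time_law)"
      by (simp add: I.prob_space)
  qed auto
  show ?thesis
  proof (rule Bochner_Integration.integrable_bound[OF int])
    have "AE t in time_law. t \<in> {0..1}"
      unfolding time_law_def by (rule AE_uniform_measureI) auto
    then have "AE z in lborel \<Otimes>\<^sub>M time_law. snd z \<in> {0..1}"
      by (rule AE_pair_snd[OF I.sigma_finite_measure_axioms])
    then show "AE z in lborel \<Otimes>\<^sub>M time_law. norm (case z of (y, t) \<Rightarrow> \<eta> y * \<phi> (y - (t * \<epsilon>) *\<^sub>R e))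
        \<le> norm (case z of (y, t) \<Rightarrow> \<eta> y * (B * indicator K' y))"
    proof eventually_elim
      case (elim z)
      obtain y t where z: "z = (y, t)" by (cases z)
      have "indicator K (y - (t * \<epsilon>) *\<^sub>R e) \<le> (indicator K' y :: real)"
      proof (cases "y - (t * \<epsilon>) *\<^sub>R e \<in> K")
        case True
        have "t * \<epsilon> \<le> 1 * \<epsilon>" using elim z \<epsilon> by (intro mult_right_mono) auto
        then have "t * \<epsilon> \<in> {0..\<epsilon>}" using elim z \<epsilon> by auto
        moreover have "y = (y - (t * \<epsilon>) *\<^sub>R e) + (t * \<epsilon>) *\<^sub>R e" by simp
        ultimately have "y \<in> K'" unfolding K'_def using True by (intro image_eqI[of _ _ "(y - (t * \<epsilon>) *\<^sub>R e, t * \<epsilon>)"]) auto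
        then show ?thesis by (simp add: indicator_def)
      qed simp
      then have "\<bar>\<phi> (y - (t * \<epsilon>) *\<^sub>R e)\<bar> \<le> B * indicator K' y"
        using bound[of "y - (t * \<epsilon>) *\<^sub>R e"] mult_left_mono[OF _ B] order_trans by blast
      then have "\<bar>\<phi> (y - (t * \<epsilon>) *\<^sub>R e)\<bar> \<le> \<bar>B * indicator K' y\<bar>" by linarith
      then show ?case by (simp add: z abs_mult mult_left_mono del: abs_mult_pos)
    qed
  qed measurable
qed

text \<open>
  The difference $\psi(y - \varepsilon e_i) - \psi(y)$ is the integral of
  $-\varepsilon\,\partial_i\psi(y - t\varepsilon e_i)$ over $t \in [0,1]$. After exchanging the
  integrals, the weak gradient is applied for each $t$ to a translate of \<open>\<psi>\<close>.
\<close>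

lemma translation_formula:
  fixes \<eta> :: "real ^ 'n \<Rightarrow> real"
  assumes \<eta>: "\<eta> \<in> Lp_space p lborel" and p: "1 \<le> p"
    and grad: "is_weak_gradient UNIV \<eta> V" and \<psi>: "\<psi> \<in> test_functions UNIV" and \<epsilon>: "0 < \<epsilon>"
  shows "(\<integral>y. \<eta> y * (\<psi> (y - \<epsilon> *\<^sub>R axis i 1) - \<psi> y) \<partial>lborel) =
    \<epsilon> * (\<integral>t. (\<integral>y. V y $ i * \<psi> (y - (t * \<epsilon>) *\<^sub>R axis i 1) \<partial>lborel) \<partial>time_law)"
proof -
  interpret I: prob_space time_law by (rule prob_time_law)
  interpret LI: pair_sigma_finite "lborel :: (real ^ 'n) measure" time_law
    by (simp add: pair_sigma_finite_def sigma_finite_lborel I.sigma_finite_measure_axioms)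
  let ?e = "axis i 1 :: real ^ 'n"
  let ?d = "partial_deriv i \<psi>"
  have [measurable]: "\<eta> \<in> borel_measurable borel" using \<eta> by (simp add: Lp_space_iff)
  note [measurable] = test_function_measurable[OF \<psi>]
  obtain K B where KB: "compact K" "0 \<le> B" "\<And>x. \<bar>?d x\<bar> \<le> B * indicator K x"
    using test_function_support[OF \<psi>] by metis
  have ftc: "(\<integral>t. ?d (y - (t * \<epsilon>) *\<^sub>R ?e) \<partial>time_law) = (\<psi> y - \<psi> (y - \<epsilon> *\<^sub>R ?e)) / \<epsilon>" for y
  proof -
    let ?F = "\<lambda>t. - \<psi> (y - (t * \<epsilon>) *\<^sub>R ?e) / \<epsilon>"
    have deriv: "(?F has_vector_derivative ?d (y - (t * \<epsilon>) *\<^sub>R ?e)) (at t within {0..1})" for t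
    proof -
      let ?D = "frechet_derivative \<psi> (at (y - (t * \<epsilon>) *\<^sub>R ?e))"
      have "((\<lambda>t. y - (t * \<epsilon>) *\<^sub>R ?e) has_derivative (\<lambda>h. - ((h * \<epsilon>) *\<^sub>R ?e))) (at t within {0..1})"
        by (auto intro!: derivative_eq_intros)
      from has_derivative_compose[OF this test_function_has_derivative[OF \<psi>]]
      have "((\<lambda>t. \<psi> (y - (t * \<epsilon>) *\<^sub>R ?e)) has_derivative (\<lambda>h. ?D (- ((h * \<epsilon>) *\<^sub>R ?e)))) (at t within {0..1})" .
      moreover have "?D (- ((h * \<epsilon>) *\<^sub>R ?e)) = h * (- \<epsilon> * ?d (y - (t * \<epsilon>) *\<^sub>R ?e))" for h
      proof -
        interpret D: bounded_linear ?D
          using test_function_has_derivative[OF \<psi>] by (rule has_derivative_bounded_linear)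
        show ?thesis by (simp add: D.neg D.scaleR partial_deriv_def)
      qed
      ultimately have "((\<lambda>t. \<psi> (y - (t * \<epsilon>) *\<^sub>R ?e)) has_real_derivative (- \<epsilon> * ?d (y - (t * \<epsilon>) *\<^sub>R ?e))) (at t within {0..1})"
      proof -
        assume a: "((\<lambda>t. \<psi> (y - (t * \<epsilon>) *\<^sub>R ?e)) has_derivative (\<lambda>h. ?D (- ((h * \<epsilon>) *\<^sub>R ?e)))) (at t within {0..1})"
          and b: "\<And>h. ?D (- ((h * \<epsilon>) *\<^sub>R ?e)) = h * (- \<epsilon> * ?d (y - (t * \<epsilon>) *\<^sub>R ?e))"
        have "(\<lambda>h. ?D (- ((h * \<epsilon>) *\<^sub>R ?e))) = (*) (- \<epsilon> * ?d (y - (t * \<epsilon>) *\<^sub>R ?e))"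
          by (rule ext) (subst b, rule mult.commute)
        with a show ?thesis by (simp only: has_field_derivative_def)
      qed
      from DERIV_cdivide[OF DERIV_minus[OF this], of \<epsilon>]
      show ?thesis using \<epsilon> by (simp add: has_real_derivative_iff_has_vector_derivative)
    qed
    have cont: "continuous_on {0..1} (\<lambda>t. ?d (y - (t * \<epsilon>) *\<^sub>R ?e))"
      by (rule continuous_on_compose2[OF partial_deriv_continuous[OF \<psi>]]) (auto intro!: continuous_intros)
    have "(\<integral>t. indicator {0..1} t *\<^sub>R ?d (y - (t * \<epsilon>) *\<^sub>R ?e) \<partial>lborel) = ?F 1 - ?F 0"
      by (rule integral_FTC_Icc) (use deriv cont in auto)
    then show ?thesis by (subst integral_time_law) (auto simp: diff_divide_distrib)
  qed
  have "(\<integral>t. (\<integral>y. V y $ i * \<psi> (y - (t * \<epsilon>) *\<^sub>R ?e) \<partial>lborel) \<partial>time_law) =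
     (\<integral>t. - (\<integral>y. \<eta> y * ?d (y - (t * \<epsilon>) *\<^sub>R ?e) \<partial>lborel) \<partial>time_law)"
  proof (rule Bochner_Integration.integral_cong[OF refl])
    fix t
    have d: "\<psi> differentiable at x" for x
      using test_function_has_derivative[OF \<psi>] by (auto simp: differentiable_def)
    show "(\<integral>y. V y $ i * \<psi> (y - (t * \<epsilon>) *\<^sub>R ?e) \<partial>lborel) = - (\<integral>y. \<eta> y * ?d (y - (t * \<epsilon>) *\<^sub>R ?e) \<partial>lborel)"
      using grad test_function_shift[OF \<psi>, of "(t * \<epsilon>) *\<^sub>R ?e"]
      unfolding is_weak_gradient_def by (force simp: partial_deriv_shift[OF d])
  qed
  also have "\<dots> = - (\<integral>t. (\<integral>y. \<eta> y * ?d (y - (t * \<epsilon>) *\<^sub>R ?e) \<partial>lborel) \<partial>time_law)" by simp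
  also have "(\<integral>t. (\<integral>y. \<eta> y * ?d (y - (t * \<epsilon>) *\<^sub>R ?e) \<partial>lborel) \<partial>time_law) =
     (\<integral>y. (\<integral>t. \<eta> y * ?d (y - (t * \<epsilon>) *\<^sub>R ?e) \<partial>time_law) \<partial>lborel)"
    by (rule LI.Fubini_integral) (rule integrable_translates[OF \<eta> p \<epsilon> KB(1) _ KB(3) KB(2)], simp)
  also have "\<dots> = (\<integral>y. (1 / \<epsilon>) * (\<eta> y * (\<psi> y - \<psi> (y - \<epsilon> *\<^sub>R ?e))) \<partial>lborel)"
    by (simp add: ftc)
  also have "\<dots> = (1 / \<epsilon>) * (\<integral>y. \<eta> y * (\<psi> y - \<psi> (y - \<epsilon> *\<^sub>R ?e)) \<partial>lborel)"
    by (rule integral_mult_right_zero)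
  also have "(\<integral>y. \<eta> y * (\<psi> y - \<psi> (y - \<epsilon> *\<^sub>R ?e)) \<partial>lborel) = (\<integral>y. - (\<eta> y * (\<psi> (y - \<epsilon> *\<^sub>R ?e) - \<psi> y)) \<partial>lborel)"
    by (intro Bochner_Integration.integral_cong) (auto simp: algebra_simps)
  also have "\<dots> = - (\<integral>y. \<eta> y * (\<psi> (y - \<epsilon> *\<^sub>R ?e) - \<psi> y) \<partial>lborel)" by simp
  finally show ?thesis using \<epsilon> by simp
qed

text \<open>
  The preceding formula for bumps, in the limit where they become the indicator of a box.
\<close>

lemma box_translation_formula:
  fixes \<eta> :: "real ^ 'n \<Rightarrow> real"
  assumes \<eta>: "\<eta> \<in> Lp_space p lborel" and V: "V \<in> Lp_space p lborel" and p: "1 < p"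
    and grad: "is_weak_gradient UNIV \<eta> V" and \<epsilon>: "0 < \<epsilon>"
  shows "(\<integral>y. \<eta> (y + \<epsilon> *\<^sub>R axis i 1) * indicator (box a b) y \<partial>lborel) - (\<integral>y. \<eta> y * indicator (box a b) y \<partial>lborel) =
    \<epsilon> * (\<integral>t. (\<integral>y. V (y + (t * \<epsilon>) *\<^sub>R axis i 1) $ i * indicator (box a b) y \<partial>lborel) \<partial>time_law)"
proof -
  interpret I: prob_space time_law by (rule prob_time_law)
  let ?e = "axis i 1 :: real ^ 'n"
  let ?v = "\<lambda>y. V y $ i"
  have p1: "1 \<le> p" "0 \<le> p" using p by auto
  have v: "?v \<in> Lp_space p lborel" using V p1 by (simp add: Lp_space_vec_iff)
  have [measurable]: "\<eta> \<in> borel_measurable borel" "?v \<in> borel_measurable borel"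
    using \<eta> v by (auto simp: Lp_space_iff)
  have shift: "(\<integral>y. f y * bump k a b (y - c) \<partial>lborel) = (\<integral>y. f (y + c) * bump k a b y \<partial>lborel)"
    if [measurable]: "f \<in> borel_measurable borel" for f :: "real ^ 'n \<Rightarrow> real" and k c
    using integral_shift[of "\<lambda>y. f y * bump k a b (y - c)" c] by simp
  have eq: "(\<integral>y. \<eta> (y + \<epsilon> *\<^sub>R ?e) * bump k a b y \<partial>lborel) - (\<integral>y. \<eta> y * bump k a b y \<partial>lborel) =
    \<epsilon> * (\<integral>t. (\<integral>y. ?v (y + (t * \<epsilon>) *\<^sub>R ?e) * bump k a b y \<partial>lborel) \<partial>time_law)" for k
  proof -
    have t: "bump k a b \<in> test_functions UNIV" by (rule bump_test_function) simp
    have ts: "(\<lambda>y. bump k a b (y - \<epsilon> *\<^sub>R ?e)) \<in> test_functions UNIV" by (rule test_function_shift[OF t])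
    have "(\<integral>y. \<eta> y * (bump k a b (y - \<epsilon> *\<^sub>R ?e) - bump k a b y) \<partial>lborel) =
       (\<integral>y. \<eta> y * bump k a b (y - \<epsilon> *\<^sub>R ?e) \<partial>lborel) - (\<integral>y. \<eta> y * bump k a b y \<partial>lborel)"
      using Lp_integrable_test(1)[OF \<eta> p1(1) ts] Lp_integrable_test(1)[OF \<eta> p1(1) t]
      by (simp add: right_diff_distrib)
    then show ?thesis
      using translation_formula[OF \<eta> p1(1) grad t \<epsilon>, of i] by (simp add: shift)
  qed
  have lhs: "(\<lambda>k. (\<integral>y. \<eta> (y + \<epsilon> *\<^sub>R ?e) * bump k a b y \<partial>lborel) - (\<integral>y. \<eta> y * bump k a b y \<partial>lborel)) \<longlonglongrightarrow>
    (\<integral>y. \<eta> (y + \<epsilon> *\<^sub>R ?e) * indicator (box a b) y \<partial>lborel) - (\<integral>y. \<eta> y * indicator (box a b) y \<partial>lborel)"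
    by (intro tendsto_intros bump_integral_tendsto[OF _ p1(1)] \<eta> Lp_space_shift)
  have rhs: "(\<lambda>k. \<epsilon> * (\<integral>t. (\<integral>y. ?v (y + (t * \<epsilon>) *\<^sub>R ?e) * bump k a b y \<partial>lborel) \<partial>time_law)) \<longlonglongrightarrow>
    \<epsilon> * (\<integral>t. (\<integral>y. ?v (y + (t * \<epsilon>) *\<^sub>R ?e) * indicator (box a b) y \<partial>lborel) \<partial>time_law)"
  proof (intro tendsto_mult_left integral_dominated_convergence[where
        w="\<lambda>t. measure lborel (cbox a b) + (\<integral>y. \<bar>?v y\<bar> powr p \<partial>lborel)"])
    show "AE t in time_law. (\<lambda>k. \<integral>y. ?v (y + (t * \<epsilon>) *\<^sub>R ?e) * bump k a b y \<partial>lborel) \<longlonglongrightarrow>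
        (\<integral>y. ?v (y + (t * \<epsilon>) *\<^sub>R ?e) * indicator (box a b) y \<partial>lborel)"
      by (intro AE_I2 bump_integral_tendsto[OF _ p1(1)] Lp_space_shift v)
    show "AE t in time_law. norm (\<integral>y. ?v (y + (t * \<epsilon>) *\<^sub>R ?e) * bump k a b y \<partial>lborel)
        \<le> measure lborel (cbox a b) + (\<integral>y. \<bar>?v y\<bar> powr p \<partial>lborel)" for k
    proof (rule AE_I2)
      fix t
      let ?c = "(t * \<epsilon>) *\<^sub>R ?e"
      have v': "(\<lambda>y. ?v (y + ?c)) \<in> Lp_space p lborel" by (intro Lp_space_shift v)
      have int_p: "integrable lborel (\<lambda>y. \<bar>?v (y + ?c)\<bar> powr p)" using v' by (simp add: Lp_space_def)
      have int: "integrable lborel (\<lambda>y. ?v (y + ?c) * bump k a b y)"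
        by (rule Lp_integrable_test(1)[OF v' p1(1) bump_test_function[OF order_refl]])
      have "norm (\<integral>y. ?v (y + ?c) * bump k a b y \<partial>lborel) \<le> (\<integral>y. norm (?v (y + ?c) * bump k a b y) \<partial>lborel)"
        by (rule integral_norm_bound)
      also have "\<dots> \<le> (\<integral>y. indicator (cbox a b) y + \<bar>?v (y + ?c)\<bar> powr p \<partial>lborel)"
      proof (rule integral_mono)
        show "integrable lborel (\<lambda>y. norm (?v (y + ?c) * bump k a b y))" using int by simp
        show "integrable lborel (\<lambda>y. indicator (cbox a b) y + \<bar>?v (y + ?c)\<bar> powr p)"
          using int_p emeasure_lborel_cbox_finite[of a b] by (intro Bochner_Integration.integrable_add) auto
        fix y
        show "norm (?v (y + ?c) * bump k a b y) \<le> indicator (cbox a b) y + \<bar>?v (y + ?c)\<bar> powr p"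
        proof (cases "y \<in> box a b")
          case True
          then have "y \<in> cbox a b" using box_subset_cbox by blast
          moreover have "\<bar>?v (y + ?c)\<bar> * bump k a b y \<le> \<bar>?v (y + ?c)\<bar>"
            using bump_bounds[of k a b y] by (simp add: mult_left_le)
          moreover have "\<bar>?v (y + ?c)\<bar> \<le> 1 + \<bar>?v (y + ?c)\<bar> powr p" using p1 by (intro le_one_add_powr) auto
          ultimately show ?thesis using bump_bounds[of k a b y] by (simp add: abs_mult)
        next
          case False
          then have "bump k a b y = 0" using bump_nonzero_iff by blast
          then show ?thesis by simp
        qed
      qed
      also have "\<dots> = measure lborel (cbox a b) + (\<integral>y. \<bar>?v (y + ?c)\<bar> powr p \<partial>lborel)"
        using int_p emeasure_lborel_cbox_finite[of a b] by (subst Bochner_Integration.integral_add) auto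
      also have "(\<integral>y. \<bar>?v (y + ?c)\<bar> powr p \<partial>lborel) = (\<integral>y. \<bar>?v y\<bar> powr p \<partial>lborel)"
        by (rule integral_shift) measurable
      finally show "norm (\<integral>y. ?v (y + ?c) * bump k a b y \<partial>lborel)
        \<le> measure lborel (cbox a b) + (\<integral>y. \<bar>?v y\<bar> powr p \<partial>lborel)" .
    qed
  qed auto
  from LIMSEQ_unique[OF lhs rhs[folded eq]] show ?thesis .
qed

lemma cell_AE_box:
  fixes k :: "real ^ 'n"
  assumes "0 < \<epsilon>"
  shows "AE y in lborel. indicator (cell \<epsilon> k) y =
    (indicator (box (\<chi> i. k $ i - \<epsilon> / 2) (\<chi> i. k $ i + \<epsilon> / 2)) y :: real)"
proof -
  let ?l = "\<chi> i. k $ i - \<epsilon> / 2" and ?u = "\<chi> i. k $ i + \<epsilon> / 2"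
  have "AE x in lborel. x \<notin> cbox ?l ?u - box ?l ?u"
    by (rule AE_not_in) (simp add: null_sets_def emeasure_lborel_cbox_eq emeasure_lborel_box_eq emeasure_Diff box_subset_cbox)
  then show ?thesis
  proof eventually_elim
    case (elim y)
    have "box ?l ?u \<subseteq> cell \<epsilon> k" "cell \<epsilon> k \<subseteq> cbox ?l ?u"
      by (auto simp: cell_def mem_box_cart less_imp_le)
    with elim show ?case by (auto simp: indicator_def)
  qed
qed

text \<open>
  For each time the integral over the cell is at most $\varepsilon^{-d}$ times the integral over
  the whole space.
\<close>

lemma cell_point_Lp:
  fixes v :: "real ^ 'n \<Rightarrow> real"
  assumes v: "v \<in> Lp_space p lborel" and \<epsilon>: "0 < \<epsilon>"
  shows "(\<lambda>q. v (cell_point a \<epsilon> k q)) \<in> Lp_space p cell_time_law"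
proof (rule Lp_spaceI)
  interpret Z: prob_space "cell_law :: (real ^ 'n) measure" by (rule prob_cell_law)
  interpret I: prob_space time_law by (rule prob_time_law)
  interpret ZI: pair_prob_space "cell_law :: (real ^ 'n) measure" time_law ..
  have [measurable]: "v \<in> borel_measurable borel" using v by (simp add: Lp_space_iff)
  show "(\<lambda>q. v (cell_point a \<epsilon> k q)) \<in> borel_measurable cell_time_law" by measurable
  have le: "(\<integral>\<^sup>+z. ennreal (norm (v (cell_point a \<epsilon> k (z, t))) powr p) \<partial>cell_law) \<le> Lp_energy p lborel v / ennreal (\<epsilon> ^ CARD('n))" for t
  proof -
    let ?c = "(t * \<epsilon>) *\<^sub>R a"
    have "(\<integral>\<^sup>+z. ennreal (norm (v (cell_point a \<epsilon> k (z, t))) powr p) \<partial>cell_law) =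
       (\<integral>\<^sup>+y. ennreal (norm (v (y + ?c)) powr p) * indicator (cell \<epsilon> k) y \<partial>lborel) / ennreal (\<epsilon> ^ CARD('n))"
      using nn_integral_cell_law[of "\<lambda>y. ennreal (norm (v (y + ?c)) powr p)", OF _ \<epsilon>, of k] by (simp add: cell_point_def)
    also have "\<dots> \<le> Lp_energy p lborel (\<lambda>y. v (y + ?c)) / ennreal (\<epsilon> ^ CARD('n))"
      unfolding Lp_energy_def by (intro divide_right_mono_ennreal nn_integral_mono) (auto simp: indicator_def)
    finally show ?thesis using Lp_space_shift(2)[OF v] by simp
  qed
  have "Lp_energy p cell_time_law (\<lambda>q. v (cell_point a \<epsilon> k q)) =
      (\<integral>\<^sup>+t. \<integral>\<^sup>+z. ennreal (norm (v (cell_point a \<epsilon> k (z, t))) powr p) \<partial>cell_law \<partial>time_law)"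
    unfolding Lp_energy_def cell_time_law_def by (subst ZI.nn_integral_snd[symmetric]) auto
  also have "\<dots> \<le> (\<integral>\<^sup>+t. Lp_energy p lborel v / ennreal (\<epsilon> ^ CARD('n)) \<partial>time_law)"
    by (intro nn_integral_mono le)
  also have "\<dots> = Lp_energy p lborel v / ennreal (\<epsilon> ^ CARD('n))" by (simp add: I.emeasure_space_1)
  also have "\<dots> < \<infinity>" using v \<epsilon> by (simp add: Lp_space_iff ennreal_divide_eq_top_iff less_top[symmetric])
  finally show "Lp_energy p cell_time_law (\<lambda>q. v (cell_point a \<epsilon> k q)) < \<infinity>" .
qed

text \<open>
  The difference of the averages over neighbouring cells is the average of the derivative along
  the segments that join them; a cell is a box up to a null set.
\<close>

lemma cell_difference_formula:
  fixes \<eta> :: "real ^ 'n \<Rightarrow> real"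
  assumes \<eta>: "\<eta> \<in> Lp_space p lborel" and V: "V \<in> Lp_space p lborel" and p: "1 < p"
    and grad: "is_weak_gradient UNIV \<eta> V" and \<epsilon>: "0 < \<epsilon>"
  shows "(\<integral>z. \<eta> (k + \<epsilon> *\<^sub>R axis i 1 + \<epsilon> *\<^sub>R z) \<partial>cell_law) - (\<integral>z. \<eta> (k + \<epsilon> *\<^sub>R z) \<partial>cell_law) =
    \<epsilon> * (\<integral>q. V (cell_point (axis i 1) \<epsilon> k q) $ i \<partial>cell_time_law)"
proof -
  interpret Z: prob_space "cell_law :: (real ^ 'n) measure" by (rule prob_cell_law)
  interpret I: prob_space time_law by (rule prob_time_law)
  interpret ZI: pair_prob_space "cell_law :: (real ^ 'n) measure" time_law ..
  interpret P: prob_space "cell_time_law :: ((real ^ 'n) \<times> real) measure" by (rule prob_cell_time_law)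
  let ?e = "axis i 1 :: real ^ 'n"
  let ?v = "\<lambda>y. V y $ i"
  let ?l = "\<chi> i. k $ i - \<epsilon> / 2" and ?u = "\<chi> i. k $ i + \<epsilon> / 2"
  have v: "?v \<in> Lp_space p lborel" using V p by (simp add: Lp_space_vec_iff)
  have [measurable]: "\<eta> \<in> borel_measurable borel" "?v \<in> borel_measurable borel"
    using \<eta> v by (auto simp: Lp_space_iff)
  have cell: "(\<integral>z. f (k + c + \<epsilon> *\<^sub>R z) \<partial>cell_law) = (\<integral>y. f (y + c) * indicator (box ?l ?u) y \<partial>lborel) / \<epsilon> ^ CARD('n)"
    if [measurable]: "f \<in> borel_measurable borel" for f :: "real ^ 'n \<Rightarrow> real" and c
  proof -
    have "(\<integral>y. f (y + c) * indicator (cell \<epsilon> k) y \<partial>lborel) = (\<integral>y. f (y + c) * indicator (box ?l ?u) y \<partial>lborel)"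
      using cell_AE_box[OF \<epsilon>, of k] by (intro integral_cong_AE) (auto elim: AE_mp)
    then show ?thesis using integral_cell_law[of "\<lambda>y. f (y + c)", OF _ \<epsilon>, of k] by (simp add: algebra_simps)
  qed
  have "integrable (cell_law \<Otimes>\<^sub>M time_law) (\<lambda>(z, t). ?v (cell_point ?e \<epsilon> k (z, t)))"
    using P.Lp_space_integrable[OF cell_point_Lp[OF v \<epsilon>, of ?e k]] p by (simp add: cell_time_law_def case_prod_beta')
  from ZI.integral_snd[OF this]
  have "(\<integral>q. ?v (cell_point ?e \<epsilon> k q) \<partial>cell_time_law) =
      (\<integral>t. (\<integral>z. ?v (cell_point ?e \<epsilon> k (z, t)) \<partial>cell_law) \<partial>time_law)"
    by (simp add: cell_time_law_def case_prod_beta')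
  also have "\<dots> = (\<integral>t. (\<integral>y. ?v (y + (t * \<epsilon>) *\<^sub>R ?e) * indicator (box ?l ?u) y \<partial>lborel) / \<epsilon> ^ CARD('n) \<partial>time_law)"
  proof (rule Bochner_Integration.integral_cong[OF refl])
    fix t
    have eq: "k + \<epsilon> *\<^sub>R z + (t * \<epsilon>) *\<^sub>R ?e = k + (t * \<epsilon>) *\<^sub>R ?e + \<epsilon> *\<^sub>R z" for z by (simp add: add_ac)
    show "(\<integral>z. ?v (cell_point ?e \<epsilon> k (z, t)) \<partial>cell_law) =
        (\<integral>y. ?v (y + (t * \<epsilon>) *\<^sub>R ?e) * indicator (box ?l ?u) y \<partial>lborel) / \<epsilon> ^ CARD('n)"
      unfolding cell_point_def fst_conv snd_conv eq by (rule cell) simp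
  qed
  also have "\<dots> = (\<integral>t. (\<integral>y. ?v (y + (t * \<epsilon>) *\<^sub>R ?e) * indicator (box ?l ?u) y \<partial>lborel) \<partial>time_law) / \<epsilon> ^ CARD('n)"
    by simp
  finally have r: "\<epsilon> * (\<integral>q. ?v (cell_point ?e \<epsilon> k q) \<partial>cell_time_law) =
    \<epsilon> * (\<integral>t. (\<integral>y. ?v (y + (t * \<epsilon>) *\<^sub>R ?e) * indicator (box ?l ?u) y \<partial>lborel) \<partial>time_law) / \<epsilon> ^ CARD('n)" by simp
  show ?thesis
    unfolding r using box_translation_formula[OF \<eta> V p grad \<epsilon>, of i ?l ?u] cell[of \<eta> "\<epsilon> *\<^sub>R ?e"] cell[of \<eta> 0]
    by (simp add: diff_divide_distrib[symmetric])
qed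

section \<open>Integration by parts and the space $W^{1,p}_0$\<close>

lemma compactly_supported_Lp:
  fixes f :: "real ^ 'n \<Rightarrow> real"
  assumes f[measurable]: "f \<in> borel_measurable borel" and K: "compact K"
    and bound: "\<And>x. \<bar>f x\<bar> \<le> B * indicator K x" and p: "0 < p"
  shows "f \<in> Lp_space p lborel"
proof (rule Lp_spaceI)
  have [measurable]: "K \<in> sets borel" using K by (simp add: compact_imp_closed)
  have "Lp_energy p lborel f \<le> (\<integral>\<^sup>+x. ennreal (\<bar>B\<bar> powr p) * indicator K x \<partial>lborel)"
    unfolding Lp_energy_def
  proof (rule nn_integral_mono)
    fix x
    show "ennreal (norm (f x) powr p) \<le> ennreal (\<bar>B\<bar> powr p) * indicator K x"
    proof (cases "x \<in> K")
      case True
      then have "norm (f x) \<le> \<bar>B\<bar>" using bound[of x] by simp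
      then show ?thesis using True p by (auto intro!: ennreal_leI powr_mono2)
    next
      case False
      then show ?thesis using bound[of x] by simp
    qed
  qed
  also have "\<dots> = ennreal (\<bar>B\<bar> powr p) * emeasure lborel K" by (simp add: nn_integral_cmult_indicator)
  also have "\<dots> < \<infinity>" using emeasure_bounded_finite[OF compact_imp_bounded[OF K]] by (simp add: ennreal_mult_less_top)
  finally show "Lp_energy p lborel f < \<infinity>" .
qed simp

lemma test_function_Lp:
  fixes \<psi> :: "real ^ 'n \<Rightarrow> real"
  assumes "\<psi> \<in> test_functions S" "0 < p"
  shows "\<psi> \<in> Lp_space p lborel" "partial_deriv i \<psi> \<in> Lp_space p lborel"
proof -
  obtain K B where KB: "compact K" "\<And>x. \<bar>\<psi> x\<bar> \<le> B * indicator K x" "\<And>x i. \<bar>partial_deriv i \<psi> x\<bar> \<le> B * indicator K x"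
    using test_function_support[OF assms(1)] by metis
  show "\<psi> \<in> Lp_space p lborel"
    by (rule compactly_supported_Lp[OF test_function_measurable(1)[OF assms(1)] KB(1,2) assms(2)])
  show "partial_deriv i \<psi> \<in> Lp_space p lborel"
    by (rule compactly_supported_Lp[OF test_function_measurable(2)[OF assms(1)] KB(1,3) assms(2)])
qed

lemma test_function_directional:
  fixes \<psi> :: "real ^ 'n \<Rightarrow> real"
  assumes \<psi>: "\<psi> \<in> test_functions S"
  shows "((\<lambda>s. \<psi> (y + s *\<^sub>R axis i 1)) has_real_derivative partial_deriv i \<psi> (y + s *\<^sub>R axis i 1)) (at s)"
proof -
  let ?e = "axis i 1 :: real ^ 'n"
  let ?D = "frechet_derivative \<psi> (at (y + s *\<^sub>R ?e))"
  have "((\<lambda>s. y + s *\<^sub>R ?e) has_derivative (\<lambda>h. h *\<^sub>R ?e)) (at s)"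
    by (auto intro!: derivative_eq_intros)
  from has_derivative_compose[OF this test_function_has_derivative[OF \<psi>]]
  have 1: "((\<lambda>s. \<psi> (y + s *\<^sub>R ?e)) has_derivative (\<lambda>h. ?D (h *\<^sub>R ?e))) (at s)" .
  interpret D: bounded_linear ?D
    using test_function_has_derivative[OF \<psi>] by (rule has_derivative_bounded_linear)
  have "(\<lambda>h. ?D (h *\<^sub>R ?e)) = (*) (partial_deriv i \<psi> (y + s *\<^sub>R ?e))"
    by (rule ext) (simp add: D.scaleR partial_deriv_def mult.commute)
  with 1 show ?thesis by (simp only: has_field_derivative_def)
qed

text \<open>
  The difference quotients are bounded by a bound for the derivative, so dominated convergence
  applies.
\<close>

lemma difference_quotient_integral:
  fixes \<phi> \<psi> :: "real ^ 'n \<Rightarrow> real"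
  assumes \<phi>: "\<phi> \<in> test_functions S" and \<psi>: "\<psi> \<in> test_functions S'"
    and h: "h \<longlonglongrightarrow> 0" "\<And>k. h k \<noteq> 0"
  shows "(\<lambda>k. \<integral>y. \<phi> y * ((\<psi> (y + h k *\<^sub>R axis i 1) - \<psi> y) / h k) \<partial>lborel) \<longlonglongrightarrow> (\<integral>y. \<phi> y * partial_deriv i \<psi> y \<partial>lborel)"
proof -
  note [measurable] = test_function_measurable[OF \<phi>] test_function_measurable[OF \<psi>]
  obtain K B where KB: "0 \<le> B" "\<And>x i. \<bar>partial_deriv i \<psi> x\<bar> \<le> B * indicator K x"
    using test_function_support[OF \<psi>] by metis
  have B: "\<bar>partial_deriv i \<psi> x\<bar> \<le> B" for x
    using KB(2)[of i x] KB(1) by (cases "x \<in> K") auto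
  obtain K' B' where K': "compact K'" "\<And>x. \<bar>\<phi> x\<bar> \<le> B' * indicator K' x"
    using test_function_support[OF \<phi>] by metis
  have "\<phi> \<in> Lp_space 1 lborel" by (rule test_function_Lp[OF \<phi>]) simp
  then have int: "integrable lborel (\<lambda>x. \<bar>\<phi> x\<bar> * B)" by (simp add: Lp_space_def)
  show ?thesis
  proof (rule integral_dominated_convergence[OF _ _ int])
    show "AE y in lborel. (\<lambda>k. \<phi> y * ((\<psi> (y + h k *\<^sub>R axis i 1) - \<psi> y) / h k)) \<longlonglongrightarrow> \<phi> y * partial_deriv i \<psi> y"
    proof (intro AE_I2 tendsto_mult_left)
      fix y
      have "((\<lambda>t. (\<psi> (y + t *\<^sub>R axis i 1) - \<psi> y) / t) \<longlongrightarrow> partial_deriv i \<psi> y) (at 0)"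
        using test_function_directional[OF \<psi>, of y i 0] by (simp add: DERIV_def)
      moreover have "filterlim h (at 0) sequentially" using h by (simp add: filterlim_at)
      ultimately show "(\<lambda>k. (\<psi> (y + h k *\<^sub>R axis i 1) - \<psi> y) / h k) \<longlonglongrightarrow> partial_deriv i \<psi> y"
        by (rule filterlim_compose)
    qed
    show "AE y in lborel. norm (\<phi> y * ((\<psi> (y + h k *\<^sub>R axis i 1) - \<psi> y) / h k)) \<le> \<bar>\<phi> y\<bar> * B" for k
    proof (rule AE_I2)
      fix y
      have "norm (\<psi> (y + h k *\<^sub>R axis i 1) - \<psi> (y + 0 *\<^sub>R axis i 1)) \<le> B * norm (h k - 0)"
      proof (rule field_differentiable_bound[of UNIV "\<lambda>s. \<psi> (y + s *\<^sub>R axis i 1)"])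
        show "((\<lambda>s. \<psi> (y + s *\<^sub>R axis i 1)) has_real_derivative partial_deriv i \<psi> (y + s *\<^sub>R axis i 1)) (at s within UNIV)" for s
          using test_function_directional[OF \<psi>] by simp
      qed (use B in auto)
      then have "\<bar>(\<psi> (y + h k *\<^sub>R axis i 1) - \<psi> y) / h k\<bar> \<le> B"
        using h(2)[of k] by (simp add: abs_divide divide_le_eq)
      then show "norm (\<phi> y * ((\<psi> (y + h k *\<^sub>R axis i 1) - \<psi> y) / h k)) \<le> \<bar>\<phi> y\<bar> * B"
        unfolding real_norm_def abs_mult by (intro mult_left_mono) auto
    qed
  qed measurable
qed

definition classical_gradient :: "(real ^ 'n \<Rightarrow> real) \<Rightarrow> real ^ 'n \<Rightarrow> real ^ 'n" where
  "classical_gradient \<psi> x = (\<chi> i. partial_deriv i \<psi> x)"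

text \<open>
  By translation invariance a difference quotient moves from one factor to the other with the
  opposite step; now let the step tend to \<open>0\<close>.
\<close>

lemma test_function_integration_by_parts:
  fixes \<phi> \<psi> :: "real ^ 'n \<Rightarrow> real"
  assumes \<psi>: "\<psi> \<in> test_functions S" and \<phi>: "\<phi> \<in> test_functions S'"
  shows "(\<integral>y. \<psi> y * partial_deriv i \<phi> y \<partial>lborel) = - (\<integral>y. partial_deriv i \<psi> y * \<phi> y \<partial>lborel)"
proof -
  let ?e = "axis i 1 :: real ^ 'n"
  note [measurable] = test_function_measurable[OF \<phi>] test_function_measurable[OF \<psi>]
  define h where "h k = inverse (real (Suc k))" for k
  have h: "h \<longlonglongrightarrow> 0" "\<And>k. h k \<noteq> 0" unfolding h_def using LIMSEQ_inverse_real_of_nat by auto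
  have h': "(\<lambda>k. - h k) \<longlonglongrightarrow> 0" "\<And>k. - h k \<noteq> 0" using h tendsto_minus[OF h(1)] by auto
  have \<psi>2: "\<psi> \<in> Lp_space 2 lborel" and \<phi>2: "\<phi> \<in> Lp_space 2 lborel"
    using test_function_Lp(1)[OF \<psi>] test_function_Lp(1)[OF \<phi>] by auto
  have eq: "(\<integral>y. \<psi> y * ((\<phi> (y + h k *\<^sub>R ?e) - \<phi> y) / h k) \<partial>lborel) =
      - (\<integral>y. \<phi> y * ((\<psi> (y + (- h k) *\<^sub>R ?e) - \<psi> y) / (- h k)) \<partial>lborel)" for k
  proof -
    have s1: "(\<lambda>y. \<phi> (y - (- h k *\<^sub>R ?e))) \<in> test_functions UNIV" by (rule test_function_shift[OF \<phi>])
    have s2: "(\<lambda>y. \<psi> (y - h k *\<^sub>R ?e)) \<in> test_functions UNIV" by (rule test_function_shift[OF \<psi>])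
    have i1: "integrable lborel (\<lambda>y. \<psi> y * \<phi> (y + h k *\<^sub>R ?e))" using Lp_integrable_test(1)[OF \<psi>2 _ s1] by simp
    have i2: "integrable lborel (\<lambda>y. \<phi> y * \<psi> (y - h k *\<^sub>R ?e))" using Lp_integrable_test(1)[OF \<phi>2 _ s2] by simp
    have i3: "integrable lborel (\<lambda>y. \<phi> y * \<psi> y)" "integrable lborel (\<lambda>y. \<psi> y * \<phi> y)"
      using Lp_integrable_test(1)[OF \<phi>2 _ \<psi>] Lp_integrable_test(1)[OF \<psi>2 _ \<phi>] by simp_all
    have sh: "(\<integral>y. \<psi> y * \<phi> (y + h k *\<^sub>R ?e) \<partial>lborel) = (\<integral>y. \<phi> y * \<psi> (y - h k *\<^sub>R ?e) \<partial>lborel)"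
      using integral_shift[of "\<lambda>y. \<phi> y * \<psi> (y - h k *\<^sub>R ?e)" "h k *\<^sub>R ?e"] by (simp add: mult.commute)
    have "(\<integral>y. \<psi> y * ((\<phi> (y + h k *\<^sub>R ?e) - \<phi> y) / h k) \<partial>lborel) =
       (\<integral>y. (\<psi> y * \<phi> (y + h k *\<^sub>R ?e) - \<psi> y * \<phi> y) / h k \<partial>lborel)"
      by (intro Bochner_Integration.integral_cong) (auto simp: algebra_simps)
    also have "\<dots> = ((\<integral>y. \<phi> y * \<psi> (y - h k *\<^sub>R ?e) \<partial>lborel) - (\<integral>y. \<phi> y * \<psi> y \<partial>lborel)) / h k"
      using i1 i3 sh by (simp add: mult.commute)
    also have "\<dots> = (\<integral>y. (\<phi> y * \<psi> (y - h k *\<^sub>R ?e) - \<phi> y * \<psi> y) / h k \<partial>lborel)"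
      using i2 i3 by simp
    also have "\<dots> = (\<integral>y. - (\<phi> y * ((\<psi> (y + (- h k) *\<^sub>R ?e) - \<psi> y) / (- h k))) \<partial>lborel)"
      by (intro Bochner_Integration.integral_cong) (auto simp: algebra_simps)
    finally show ?thesis by simp
  qed
  have 1: "(\<lambda>k. - (\<integral>y. \<phi> y * ((\<psi> (y + (- h k) *\<^sub>R ?e) - \<psi> y) / (- h k)) \<partial>lborel)) \<longlonglongrightarrow>
      - (\<integral>y. \<phi> y * partial_deriv i \<psi> y \<partial>lborel)"
    by (intro tendsto_minus difference_quotient_integral[OF \<phi> \<psi> h'])
  have 2: "(\<lambda>k. - (\<integral>y. \<phi> y * ((\<psi> (y + (- h k) *\<^sub>R ?e) - \<psi> y) / (- h k)) \<partial>lborel)) \<longlonglongrightarrow>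
      (\<integral>y. \<psi> y * partial_deriv i \<phi> y \<partial>lborel)"
    using difference_quotient_integral[OF \<psi> \<phi> h, of i] unfolding eq .
  show ?thesis using LIMSEQ_unique[OF 2 1] by (simp add: mult.commute)
qed

lemma classical_is_weak_gradient:
  fixes \<psi> :: "real ^ 'n \<Rightarrow> real"
  assumes "\<psi> \<in> test_functions S'"
  shows "is_weak_gradient S \<psi> (classical_gradient \<psi>)"
  unfolding is_weak_gradient_def classical_gradient_def
  using test_function_integration_by_parts[OF assms] by simp

lemma classical_gradient_Lp:
  fixes \<psi> :: "real ^ 'n \<Rightarrow> real"
  assumes "\<psi> \<in> test_functions S" "0 < p"
  shows "classical_gradient \<psi> \<in> Lp_space p lborel"
proof -
  have "0 \<le> p" using assms by simp
  from Lp_space_vec_iff[OF this, of "classical_gradient \<psi>" lborel] show ?thesis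
    using test_function_Lp(2)[OF assms] by (simp add: classical_gradient_def)
qed

lemma test_function_Lp_on:
  fixes \<psi> :: "real ^ 'n \<Rightarrow> real"
  assumes "\<psi> \<in> test_functions S" "0 < p"
  shows "\<psi> \<in> Lp_on p S" "classical_gradient \<psi> \<in> Lp_on p S"
proof -
  obtain K B where KB: "K \<subseteq> S" "\<And>x. \<bar>\<psi> x\<bar> \<le> B * indicator K x" "\<And>x i. \<bar>partial_deriv i \<psi> x\<bar> \<le> B * indicator K x"
    using test_function_support[OF assms(1)] by metis
  have "\<psi> x = 0" if "x \<notin> S" for x
  proof -
    have "x \<notin> K" using that KB(1) by blast
    then show ?thesis using KB(2)[of x] by simp
  qed
  moreover have "classical_gradient \<psi> x = 0" if "x \<notin> S" for x
  proof -
    have "x \<notin> K" using that KB(1) by blast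
    then have "partial_deriv i \<psi> x = 0" for i using KB(3)[of i x] by simp
    then show ?thesis by (simp add: classical_gradient_def vec_eq_iff)
  qed
  ultimately show "\<psi> \<in> Lp_on p S" "classical_gradient \<psi> \<in> Lp_on p S"
    using test_function_Lp(1)[OF assms] classical_gradient_Lp[OF assms] by (auto simp: Lp_on_def)
qed

lemma is_weak_gradient_add:
  fixes \<eta> \<eta>' :: "real ^ 'n \<Rightarrow> real"
  assumes "is_weak_gradient S \<eta> V" "is_weak_gradient S \<eta>' V'"
    and \<eta>: "\<eta> \<in> Lp_space p lborel" "V \<in> Lp_space p lborel" "\<eta>' \<in> Lp_space p lborel" "V' \<in> Lp_space p lborel"
    and p: "1 \<le> p"
  shows "is_weak_gradient S (\<lambda>x. \<eta> x + \<eta>' x) (\<lambda>x. V x + V' x)"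
  unfolding is_weak_gradient_def
proof (intro ballI allI)
  fix \<psi> :: "real ^ 'n \<Rightarrow> real" and i assume \<psi>: "\<psi> \<in> test_functions S"
  have p0: "0 \<le> p" using p by simp
  have V: "(\<lambda>x. V x $ i) \<in> Lp_space p lborel" "(\<lambda>x. V' x $ i) \<in> Lp_space p lborel"
    using \<eta> by (simp_all add: Lp_space_vec_iff[OF p0])
  show "(\<integral>x. (\<eta> x + \<eta>' x) * partial_deriv i \<psi> x \<partial>lborel) = - (\<integral>x. (V x + V' x) $ i * \<psi> x \<partial>lborel)"
    using assms(1,2) \<psi> Lp_integrable_test[OF \<eta>(1) p \<psi>] Lp_integrable_test[OF \<eta>(3) p \<psi>]
      Lp_integrable_test[OF V(1) p \<psi>] Lp_integrable_test[OF V(2) p \<psi>]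
    by (simp add: is_weak_gradient_def distrib_right)
qed

lemma is_weak_gradient_scaleR:
  assumes "is_weak_gradient S \<eta> V"
  shows "is_weak_gradient S (\<lambda>x. c * \<eta> x) (\<lambda>x. c *\<^sub>R V x)"
  using assms unfolding is_weak_gradient_def by (simp add: mult.assoc)

lemma is_weak_gradient_zero: "is_weak_gradient S (\<lambda>x. 0) (\<lambda>x. 0)"
  by (simp add: is_weak_gradient_def)

lemma is_weak_gradient_diff:
  fixes \<eta> \<eta>' :: "real ^ 'n \<Rightarrow> real"
  assumes "is_weak_gradient S \<eta> V" "is_weak_gradient S \<eta>' V'"
    and "\<eta> \<in> Lp_space p lborel" "V \<in> Lp_space p lborel" "\<eta>' \<in> Lp_space p lborel" "V' \<in> Lp_space p lborel"
    and p: "1 \<le> p"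
  shows "is_weak_gradient S (\<lambda>x. \<eta> x - \<eta>' x) (\<lambda>x. V x - V' x)"
  using is_weak_gradient_add[OF assms(1) is_weak_gradient_scaleR[OF assms(2), of "-1"] assms(3,4) _ _ p]
    Lp_space_scaleR[OF assms(5), of "-1"] Lp_space_scaleR[OF assms(6), of "-1"] by simp

lemma weak_gradient_unique:
  fixes \<eta> :: "real ^ 'n \<Rightarrow> real"
  assumes S: "open S" and p: "1 < p"
    and V: "V \<in> Lp_on p S" "is_weak_gradient S \<eta> V" and V': "V' \<in> Lp_on p S" "is_weak_gradient S \<eta> V'"
  shows "AE x in lborel. V x = V' x"
proof -
  have p1: "1 \<le> p" "0 \<le> p" using p by auto
  have Lp: "V \<in> Lp_space p lborel" "V' \<in> Lp_space p lborel" using V V' by (auto simp: Lp_on_def)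
  have "AE x in lborel. x \<in> S \<longrightarrow> V x $ i - V' x $ i = 0" for i
  proof (rule fundamental_lemma[OF S _ p1(1)])
    have Vi: "(\<lambda>x. V x $ i) \<in> Lp_space p lborel" "(\<lambda>x. V' x $ i) \<in> Lp_space p lborel"
      using Lp by (simp_all add: Lp_space_vec_iff[OF p1(2)])
    then show "(\<lambda>x. V x $ i - V' x $ i) \<in> Lp_space p lborel" by (intro Lp_space_diff p1)
    fix \<psi> :: "real ^ 'n \<Rightarrow> real" assume \<psi>: "\<psi> \<in> test_functions S"
    show "(\<integral>x. (V x $ i - V' x $ i) * \<psi> x \<partial>lborel) = 0"
      using V(2) V'(2) \<psi> Lp_integrable_test(1)[OF Vi(1) p1(1) \<psi>] Lp_integrable_test(1)[OF Vi(2) p1(1) \<psi>]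
      by (simp add: is_weak_gradient_def left_diff_distrib)
  qed
  then have "AE x in lborel. \<forall>i. x \<in> S \<longrightarrow> V x $ i - V' x $ i = 0"
    using AE_finite_allI[of UNIV "\<lambda>i x. x \<in> S \<longrightarrow> V x $ i - V' x $ i = 0" lborel] by simp
  moreover have "AE x in lborel. x \<notin> S \<longrightarrow> V x = 0" "AE x in lborel. x \<notin> S \<longrightarrow> V' x = 0"
    using V V' by (auto simp: Lp_on_def)
  ultimately show ?thesis
    by eventually_elim (auto simp: vec_eq_iff)
qed

text \<open>
  Splitting at the level $t > \|f\|$ gives $|f| \le t + t^{1-p}|f|^p$, and the second term has
  integral at most $t$; then $t \to \|f\|$.
\<close>

lemma Lp_pairing_le:
  fixes f :: "real ^ 'n \<Rightarrow> real"
  assumes f: "f \<in> Lp_space p lborel" and p: "1 < p" and K: "compact K"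
    and \<phi>[measurable]: "\<phi> \<in> borel_measurable borel" and bound: "\<And>x. \<bar>\<phi> x\<bar> \<le> B * indicator K x" and B: "0 \<le> B"
  shows "\<bar>\<integral>x. f x * \<phi> x \<partial>lborel\<bar> \<le> B * (measure lborel K + 1) * Lp_norm p lborel f"
proof -
  let ?N = "Lp_norm p lborel f" and ?I = "\<bar>\<integral>x. f x * \<phi> x \<partial>lborel\<bar>"
  have [measurable]: "f \<in> borel_measurable borel" "K \<in> sets borel" using f K by (auto simp: Lp_space_iff compact_imp_closed)
  have int_p: "integrable lborel (\<lambda>x. \<bar>f x\<bar> powr p)" using f by (simp add: Lp_space_def)
  have K_fin: "emeasure lborel K < \<infinity>" using emeasure_bounded_finite[OF compact_imp_bounded[OF K]] by simp
  have int_K: "integrable lborel (indicator K :: real ^ 'n \<Rightarrow> real)" using K_fin by simp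
  have int: "integrable lborel (\<lambda>x. f x * \<phi> x)" using p bound by (intro Lp_integrable_mult[OF f _ K]) auto
  have N: "(\<integral>x. \<bar>f x\<bar> powr p \<partial>lborel) = ?N powr p" using p by (simp add: Lp_norm_def powr_powr)
  have main: "?I \<le> B * (measure lborel K + 1) * t" if t: "?N < t" for t
  proof -
    have t0: "0 < t" using t Lp_norm_nonneg[of p lborel f] by linarith
    have pw: "\<bar>f x\<bar> \<le> t + t powr (1 - p) * \<bar>f x\<bar> powr p" for x
    proof (cases "\<bar>f x\<bar> \<le> t")
      case True
      then show ?thesis by (simp add: add_increasing2)
    next
      case False
      then have "\<bar>f x\<bar> = \<bar>f x\<bar> powr (1 - p) * \<bar>f x\<bar> powr p" using t0 by (simp flip: powr_add)
      also have "\<dots> \<le> t powr (1 - p) * \<bar>f x\<bar> powr p"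
        using False t0 p by (intro mult_right_mono powr_mono2') auto
      finally show ?thesis using t0 by linarith
    qed
    have "?I \<le> (\<integral>x. \<bar>f x * \<phi> x\<bar> \<partial>lborel)" by (rule integral_abs_bound)
    also have "\<dots> \<le> (\<integral>x. B * (t * indicator K x + t powr (1 - p) * \<bar>f x\<bar> powr p) \<partial>lborel)"
    proof (rule integral_mono)
      show "integrable lborel (\<lambda>x. \<bar>f x * \<phi> x\<bar>)" using int by simp
      show "integrable lborel (\<lambda>x. B * (t * indicator K x + t powr (1 - p) * \<bar>f x\<bar> powr p))"
        using int_K int_p by simp
      fix x
      show "\<bar>f x * \<phi> x\<bar> \<le> B * (t * indicator K x + t powr (1 - p) * \<bar>f x\<bar> powr p)"
      proof (cases "x \<in> K")
        case True
        have "\<bar>f x\<bar> * \<bar>\<phi> x\<bar> \<le> (t + t powr (1 - p) * \<bar>f x\<bar> powr p) * B"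
          using bound[of x] True pw[of x] t0 by (intro mult_mono) auto
        then show ?thesis using True by (simp add: abs_mult mult.commute)
      next
        case False
        then show ?thesis using bound[of x] B by simp
      qed
    qed
    also have "\<dots> = B * (t * measure lborel K + t powr (1 - p) * ?N powr p)"
      using int_K int_p N by simp
    also have "\<dots> \<le> B * (t * measure lborel K + t powr (1 - p) * t powr p)"
      using t B p by (intro mult_left_mono add_left_mono powr_mono2) auto
    also have "\<dots> = B * (measure lborel K + 1) * t"
      using t0 by (simp add: algebra_simps flip: powr_add)
    finally show ?thesis .
  qed
  show ?thesis
  proof (rule tendsto_lowerbound)
    show "((\<lambda>t. B * (measure lborel K + 1) * t) \<longlongrightarrow> B * (measure lborel K + 1) * ?N) (at_right ?N)"
      by (intro tendsto_intros)
    show "\<forall>\<^sub>F t in at_right ?N. ?I \<le> B * (measure lborel K + 1) * t"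
      using eventually_at_right_less[of ?N] by eventually_elim (rule main)
  qed simp
qed

lemma root_sum_powr_ge:
  fixes a b :: real
  assumes "0 \<le> a" "0 \<le> b" "0 < p"
  shows "a \<le> (a powr p + b powr p) powr (1 / p)" "b \<le> (a powr p + b powr p) powr (1 / p)"
proof -
  have "(a powr p) powr (1 / p) \<le> (a powr p + b powr p) powr (1 / p)"
    "(b powr p) powr (1 / p) \<le> (a powr p + b powr p) powr (1 / p)"
    using assms by (auto intro!: powr_mono2)
  then show "a \<le> (a powr p + b powr p) powr (1 / p)" "b \<le> (a powr p + b powr p) powr (1 / p)"
    using assms by (simp_all add: powr_powr)
qed

text \<open>
  Let $\psi_k$ approximate \<open>\<eta>\<close> in $W^{1,p}(S)$ and let
  $W_k$ be the weak gradient of $\eta - \psi_k$ on \<open>S\<close>. By uniqueness on \<open>S\<close>, $W_k + \nabla\psi_k$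
  is almost everywhere independent of $k$. Hence, for a test function on the whole space, the
  defect of integration by parts for $\eta - \psi_k$ and $W_k$ does not depend on $k$ either: the
  difference for two indices concerns only the smooth functions $\psi_k$. As the defect is
  bounded by the norms of $\eta - \psi_k$ and $W_k$, it is zero.
\<close>

lemma W1p_0_approx:
  fixes \<eta> :: "real ^ 'n \<Rightarrow> real"
  assumes S: "open S" and p: "1 < p" and \<eta>: "\<eta> \<in> W1p_0 p S" and \<delta>: "0 < \<delta>"
  shows "\<exists>\<psi>\<in>test_functions S. \<exists>W\<in>Lp_space p lborel. is_weak_gradient UNIV (\<lambda>x. \<eta> x - \<psi> x) W \<and>
    Lp_norm p lborel (\<lambda>x. \<eta> x - \<psi> x) < \<delta> \<and> Lp_norm p lborel W < \<delta>"
proof -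
  have p1: "1 \<le> p" "0 \<le> p" "0 < p" using p by auto
  have "\<exists>\<psi>\<in>test_functions S. W1p_norm p S (\<lambda>x. \<eta> x - \<psi> x) < 1 / real (Suc k)" for k
    using \<eta> by (simp add: W1p_0_def)
  then obtain \<psi> where \<psi>: "\<And>k. \<psi> k \<in> test_functions S"
    and close: "\<And>k. W1p_norm p S (\<lambda>x. \<eta> x - \<psi> k x) < 1 / real (Suc k)" by metis
  obtain V where V: "V \<in> Lp_on p S" "is_weak_gradient S \<eta> V" using \<eta> by (auto simp: W1p_0_def W1p_def)
  have \<eta>_Lp: "\<eta> \<in> Lp_space p lborel" and V_Lp: "V \<in> Lp_space p lborel" using \<eta> V by (auto simp: W1p_0_def W1p_def Lp_on_def)
  have \<psi>_Lp: "\<psi> k \<in> Lp_space p lborel" "classical_gradient (\<psi> k) \<in> Lp_space p lborel" for k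
    using test_function_Lp(1)[OF \<psi> p1(3)] classical_gradient_Lp[OF \<psi> p1(3)] by auto
  define W where "W k = weak_gradient p S (\<lambda>x. \<eta> x - \<psi> k x)" for k
  have W: "W k \<in> Lp_on p S" "is_weak_gradient S (\<lambda>x. \<eta> x - \<psi> k x) (W k)" for k
  proof -
    have "(\<lambda>x. V x - classical_gradient (\<psi> k) x) \<in> Lp_on p S"
      using V(1) test_function_Lp_on(2)[OF \<psi> p1(3), of k] Lp_space_diff[OF p1(2) V_Lp \<psi>_Lp(2)[of k]]
      unfolding Lp_on_def by (auto elim!: AE_mp)
    moreover have "is_weak_gradient S (\<lambda>x. \<eta> x - \<psi> k x) (\<lambda>x. V x - classical_gradient (\<psi> k) x)"
      using V(2) classical_is_weak_gradient[OF \<psi>] by (rule is_weak_gradient_diff[OF _ _ \<eta>_Lp V_Lp \<psi>_Lp p1(1)])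
    ultimately show "W k \<in> Lp_on p S" "is_weak_gradient S (\<lambda>x. \<eta> x - \<psi> k x) (W k)"
      unfolding W_def weak_gradient_def by (metis (mono_tags, lifting) someI)+
  qed
  have W_Lp: "W k \<in> Lp_space p lborel" for k using W(1)[of k] by (simp add: Lp_on_def)
  have diff_Lp: "(\<lambda>x. \<eta> x - \<psi> k x) \<in> Lp_space p lborel" for k by (intro Lp_space_diff p1 \<eta>_Lp \<psi>_Lp)
  have small: "Lp_norm p lborel (\<lambda>x. \<eta> x - \<psi> k x) < 1 / real (Suc k)" "Lp_norm p lborel (W k) < 1 / real (Suc k)" for k
    using close[of k] root_sum_powr_ge[of "Lp_norm p lborel (\<lambda>x. \<eta> x - \<psi> k x)" "Lp_norm p lborel (W k)" p] p1
    unfolding W1p_norm_def W_def[symmetric] by auto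
  have full: "(\<lambda>x. W m x + classical_gradient (\<psi> m) x) \<in> Lp_on p S"
    "is_weak_gradient S \<eta> (\<lambda>x. W m x + classical_gradient (\<psi> m) x)" for m
  proof -
    show "(\<lambda>x. W m x + classical_gradient (\<psi> m) x) \<in> Lp_on p S"
      using W(1)[of m] test_function_Lp_on(2)[OF \<psi> p1(3), of m] Lp_space_add[OF p1(2) W_Lp[of m] \<psi>_Lp(2)[of m]]
      unfolding Lp_on_def by (auto elim!: AE_mp)
    show "is_weak_gradient S \<eta> (\<lambda>x. W m x + classical_gradient (\<psi> m) x)"
      using is_weak_gradient_add[OF W(2)[of m] classical_is_weak_gradient[OF \<psi>[of m]] diff_Lp W_Lp \<psi>_Lp p1(1)] by simp
  qed
  have AE_eq: "AE x in lborel. W k x + classical_gradient (\<psi> k) x = W l x + classical_gradient (\<psi> l) x" for k l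
    by (rule weak_gradient_unique[OF S p full full])
  have global: "is_weak_gradient UNIV (\<lambda>x. \<eta> x - \<psi> k x) (W k)" for k
    unfolding is_weak_gradient_def
  proof (intro ballI allI)
    fix \<phi> :: "real ^ 'n \<Rightarrow> real" and i assume \<phi>: "\<phi> \<in> test_functions UNIV"
    \<comment> \<open>the defect of integration by parts; it is to be zero\<close>
    let ?A = "\<lambda>l. (\<integral>x. (\<eta> x - \<psi> l x) * partial_deriv i \<phi> x \<partial>lborel) + (\<integral>x. W l x $ i * \<phi> x \<partial>lborel)"
    have Wi: "(\<lambda>x. W l x $ i) \<in> Lp_space p lborel" for l using W_Lp by (simp add: Lp_space_vec_iff[OF p1(2)])
    have pdi: "(\<lambda>x. partial_deriv i (\<psi> l) x) \<in> Lp_space p lborel" for l using test_function_Lp(2)[OF \<psi> p1(3)] by simp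
    have same: "?A k = ?A l" for l
    proof -
      have "(\<integral>x. (W l x $ i - W k x $ i) * \<phi> x \<partial>lborel) =
          (\<integral>x. (partial_deriv i (\<psi> k) x - partial_deriv i (\<psi> l) x) * \<phi> x \<partial>lborel)"
      proof (rule integral_cong_AE)
        have m: "(\<lambda>x. W m x $ i) \<in> borel_measurable borel" "partial_deriv i (\<psi> m) \<in> borel_measurable borel" "\<phi> \<in> borel_measurable borel" for m
          using Wi[of m] test_function_measurable[OF \<psi>] test_function_measurable[OF \<phi>] by (auto simp: Lp_space_iff)
        note [measurable] = m
        show "(\<lambda>x. (W l x $ i - W k x $ i) * \<phi> x) \<in> borel_measurable lborel"
          "(\<lambda>x. (partial_deriv i (\<psi> k) x - partial_deriv i (\<psi> l) x) * \<phi> x) \<in> borel_measurable lborel" by measurable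
        show "AE x in lborel. (W l x $ i - W k x $ i) * \<phi> x = (partial_deriv i (\<psi> k) x - partial_deriv i (\<psi> l) x) * \<phi> x"
          using AE_eq[of k l]
        proof eventually_elim
          case (elim x)
          then have "(W k x + classical_gradient (\<psi> k) x) $ i = (W l x + classical_gradient (\<psi> l) x) $ i" by simp
          then have "W l x $ i - W k x $ i = partial_deriv i (\<psi> k) x - partial_deriv i (\<psi> l) x"
            by (simp add: classical_gradient_def)
          then show ?case by simp
        qed
      qed
      then have "(\<integral>x. W l x $ i * \<phi> x \<partial>lborel) - (\<integral>x. W k x $ i * \<phi> x \<partial>lborel) =
        (\<integral>x. partial_deriv i (\<psi> k) x * \<phi> x \<partial>lborel) - (\<integral>x. partial_deriv i (\<psi> l) x * \<phi> x \<partial>lborel)"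
        using Lp_integrable_test(1)[OF Wi p1(1) \<phi>] Lp_integrable_test(1)[OF pdi p1(1) \<phi>]
        by (simp add: left_diff_distrib)
      moreover have "(\<integral>x. (\<eta> x - \<psi> m x) * partial_deriv i \<phi> x \<partial>lborel) =
         (\<integral>x. \<eta> x * partial_deriv i \<phi> x \<partial>lborel) - (\<integral>x. \<psi> m x * partial_deriv i \<phi> x \<partial>lborel)" for m
        using Lp_integrable_test(2)[OF \<eta>_Lp p1(1) \<phi>] Lp_integrable_test(2)[OF \<psi>_Lp(1) p1(1) \<phi>]
        by (simp add: left_diff_distrib)
      ultimately show ?thesis
        using test_function_integration_by_parts[OF \<psi> \<phi>, of k i] test_function_integration_by_parts[OF \<psi> \<phi>, of l i]
        by simp
    qed
    obtain K B where KB: "compact K" "0 \<le> B" "\<And>x. \<bar>\<phi> x\<bar> \<le> B * indicator K x" "\<And>x i. \<bar>partial_deriv i \<phi> x\<bar> \<le> B * indicator K x"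
      using test_function_support[OF \<phi>] by metis
    define c where "c = B * (measure lborel K + 1)"
    have c: "0 \<le> c" using KB(2) by (simp add: c_def)
    have "\<bar>?A k\<bar> \<le> 2 * c * (1 / real (Suc l))" for l
    proof -
      have Wl: "Lp_norm p lborel (\<lambda>x. W l x $ i) \<le> Lp_norm p lborel (W l)"
        using Wi[of l] by (intro Lp_norm_mono_energy[OF p1(3) _ W_Lp] Lp_energy_component_le p1) (simp add: Lp_space_iff)
      have "\<bar>\<integral>x. (\<eta> x - \<psi> l x) * partial_deriv i \<phi> x \<partial>lborel\<bar> \<le> c * Lp_norm p lborel (\<lambda>x. \<eta> x - \<psi> l x)"
        unfolding c_def using test_function_measurable[OF \<phi>] KB by (intro Lp_pairing_le[OF diff_Lp p KB(1)]) auto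
      also have "\<dots> \<le> c * (1 / real (Suc l))" using small(1)[of l] c by (intro mult_left_mono) auto
      finally have 1: "\<bar>\<integral>x. (\<eta> x - \<psi> l x) * partial_deriv i \<phi> x \<partial>lborel\<bar> \<le> c * (1 / real (Suc l))" .
      have "\<bar>\<integral>x. W l x $ i * \<phi> x \<partial>lborel\<bar> \<le> c * Lp_norm p lborel (\<lambda>x. W l x $ i)"
        unfolding c_def using test_function_measurable[OF \<phi>] KB by (intro Lp_pairing_le[OF Wi p KB(1)]) auto
      also have "\<dots> \<le> c * (1 / real (Suc l))" using small(2)[of l] Wl c by (intro mult_left_mono) auto
      finally have 2: "\<bar>\<integral>x. W l x $ i * \<phi> x \<partial>lborel\<bar> \<le> c * (1 / real (Suc l))" .
      show ?thesis using 1 2 unfolding same[of l] by linarith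
    qed
    moreover have "(\<lambda>l. 2 * c * (1 / real (Suc l))) \<longlonglongrightarrow> 2 * c * 0"
      using LIMSEQ_inverse_real_of_nat by (intro tendsto_mult_left) (simp add: inverse_eq_divide)
    ultimately have "\<bar>?A k\<bar> \<le> 2 * c * 0" by (intro LIMSEQ_le_const[of _ "2 * c * 0"]) auto
    then show "(\<integral>x. (\<eta> x - \<psi> k x) * partial_deriv i \<phi> x \<partial>lborel) = - (\<integral>x. W k x $ i * \<phi> x \<partial>lborel)" by simp
  qed
  obtain k where "1 / real (Suc k) < \<delta>" using nat_approx_posE[OF \<delta>] by blast
  then show ?thesis
    using \<psi>[of k] W_Lp[of k] global[of k] small[of k] by (intro bexI[of _ "\<psi> k"] bexI[of _ "W k"]) auto
qed

section \<open>Tensor products\<close>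

lemma ennreal_zero_of_le:
  fixes x :: ennreal
  assumes "\<And>\<delta>::real. 0 < \<delta> \<Longrightarrow> x \<le> ennreal \<delta>"
  shows "x = 0"
proof -
  have "x \<le> 0" by (rule ennreal_le_epsilon) (simp add: assms)
  then show ?thesis by simp
qed

lemma Lp_energy_zero_AE:
  assumes "f \<in> borel_measurable N" "Lp_energy p N f = 0"
  shows "AE x in N. f x = 0"
proof -
  have "AE x in N. ennreal (norm (f x) powr p) = 0"
    using assms nn_integral_0_iff_AE[of "\<lambda>x. ennreal (norm (f x) powr p)" N] unfolding Lp_energy_def by simp
  then show ?thesis by eventually_elim (simp add: ennreal_eq_0_iff)
qed

lemma Lp_closure_approx:
  assumes "f \<in> Lp_closure p N A" "0 < p" "A \<subseteq> Lp_space p N" "0 < (\<delta>::real)"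
  shows "\<exists>g\<in>A. Lp_energy p N (\<lambda>x. f x - g x) \<le> ennreal \<delta>"
proof -
  have f: "f \<in> Lp_space p N" using assms(1) by (simp add: Lp_closure_def)
  have "0 < \<delta> powr (1 / p)" using assms(4) by simp
  then obtain g where g: "g \<in> A" "Lp_norm p N (\<lambda>x. f x - g x) < \<delta> powr (1 / p)"
    using assms(1) unfolding Lp_closure_def by blast
  have "(\<lambda>x. f x - g x) \<in> Lp_space p N" using g(1) assms f by (intro Lp_space_diff) auto
  from Lp_energy_eq_norm[OF assms(2) this]
  have "Lp_energy p N (\<lambda>x. f x - g x) = ennreal (Lp_norm p N (\<lambda>x. f x - g x) powr p)" .
  also have "\<dots> \<le> ennreal ((\<delta> powr (1 / p)) powr p)"
    using g(2) assms(2) by (intro ennreal_leI powr_mono2) auto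
  also have "\<dots> = ennreal \<delta>" using assms(2,4) by (simp add: powr_powr)
  finally show ?thesis using g(1) by blast
qed

lemma Lp_energy_tensor:
  fixes \<phi> :: "'w \<Rightarrow> real" and \<theta> :: "'x \<Rightarrow> 'b::euclidean_space"
  assumes "sigma_finite_measure N" and [measurable]: "\<phi> \<in> borel_measurable M" "\<theta> \<in> borel_measurable N"
  shows "Lp_energy p (M \<Otimes>\<^sub>M N) (\<lambda>(\<omega>, x). \<phi> \<omega> *\<^sub>R \<theta> x) = Lp_energy p M \<phi> * Lp_energy p N \<theta>"
proof -
  have "Lp_energy p (M \<Otimes>\<^sub>M N) (\<lambda>(\<omega>, x). \<phi> \<omega> *\<^sub>R \<theta> x) = (\<integral>\<^sup>+\<omega>. Lp_energy p N (\<lambda>x. \<phi> \<omega> *\<^sub>R \<theta> x) \<partial>M)"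
    by (subst Lp_energy_pair[OF assms(1)]) auto
  also have "\<dots> = (\<integral>\<^sup>+\<omega>. ennreal (norm (\<phi> \<omega>) powr p) * Lp_energy p N \<theta> \<partial>M)"
    by (simp add: Lp_energy_scaleR)
  also have "\<dots> = Lp_energy p M \<phi> * Lp_energy p N \<theta>"
    by (subst Lp_energy_def[of p M]) (simp add: nn_integral_multc)
  finally show ?thesis .
qed

lemma Lp_energy_tensor_swap:
  fixes \<phi> :: "'w \<Rightarrow> 'b::euclidean_space" and \<theta> :: "'x \<Rightarrow> real"
  assumes "sigma_finite_measure N" and [measurable]: "\<phi> \<in> borel_measurable M" "\<theta> \<in> borel_measurable N"
  shows "Lp_energy p (M \<Otimes>\<^sub>M N) (\<lambda>(\<omega>, x). \<theta> x *\<^sub>R \<phi> \<omega>) = Lp_energy p M \<phi> * Lp_energy p N \<theta>"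
proof -
  have "Lp_energy p (M \<Otimes>\<^sub>M N) (\<lambda>(\<omega>, x). \<theta> x *\<^sub>R \<phi> \<omega>) = (\<integral>\<^sup>+\<omega>. Lp_energy p N (\<lambda>x. \<theta> x *\<^sub>R \<phi> \<omega>) \<partial>M)"
    by (subst Lp_energy_pair[OF assms(1)]) auto
  also have "\<dots> = (\<integral>\<^sup>+\<omega>. ennreal (norm (\<phi> \<omega>) powr p) * Lp_energy p N \<theta> \<partial>M)"
    unfolding Lp_energy_def
    by (intro nn_integral_cong)
       (simp add: powr_mult ennreal_mult nn_integral_multc mult.commute)
  also have "\<dots> = Lp_energy p M \<phi> * Lp_energy p N \<theta>"
    by (subst Lp_energy_def[of p M]) (simp add: nn_integral_multc)
  finally show ?thesis .
qed

lemma tensor_product_Lp: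
  fixes \<phi> :: "'w \<Rightarrow> 'b::euclidean_space" and \<theta> :: "'x \<Rightarrow> real"
  assumes "sigma_finite_measure N" "\<phi> \<in> Lp_space p M" "\<theta> \<in> Lp_space p N"
  shows "(\<lambda>(\<omega>, x). \<theta> x *\<^sub>R \<phi> \<omega>) \<in> Lp_space p (M \<Otimes>\<^sub>M N)"
proof (rule Lp_spaceI)
  have [measurable]: "\<phi> \<in> borel_measurable M" "\<theta> \<in> borel_measurable N" using assms by (auto simp: Lp_space_iff)
  show "(\<lambda>(\<omega>, x). \<theta> x *\<^sub>R \<phi> \<omega>) \<in> borel_measurable (M \<Otimes>\<^sub>M N)" by measurable
  show "Lp_energy p (M \<Otimes>\<^sub>M N) (\<lambda>(\<omega>, x). \<theta> x *\<^sub>R \<phi> \<omega>) < \<infinity>"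
    using assms by (subst Lp_energy_tensor_swap) (auto simp: Lp_space_iff ennreal_mult_less_top)
qed

lemma tensor_product_Lp':
  fixes \<phi> :: "'w \<Rightarrow> real" and \<theta> :: "'x \<Rightarrow> 'b::euclidean_space"
  assumes "sigma_finite_measure N" "\<phi> \<in> Lp_space p M" "\<theta> \<in> Lp_space p N"
  shows "(\<lambda>(\<omega>, x). \<phi> \<omega> *\<^sub>R \<theta> x) \<in> Lp_space p (M \<Otimes>\<^sub>M N)"
proof (rule Lp_spaceI)
  have [measurable]: "\<phi> \<in> borel_measurable M" "\<theta> \<in> borel_measurable N" using assms by (auto simp: Lp_space_iff)
  show "(\<lambda>(\<omega>, x). \<phi> \<omega> *\<^sub>R \<theta> x) \<in> borel_measurable (M \<Otimes>\<^sub>M N)" by measurable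
  show "Lp_energy p (M \<Otimes>\<^sub>M N) (\<lambda>(\<omega>, x). \<phi> \<omega> *\<^sub>R \<theta> x) < \<infinity>"
    using assms by (subst Lp_energy_tensor) (auto simp: Lp_space_iff ennreal_mult_less_top)
qed

lemma tensor_span_Lp:
  assumes "sigma_finite_measure N" "X \<subseteq> Lp_space p M" "Y \<subseteq> Lp_space p N" "0 \<le> p"
  shows "tensor_span X Y \<subseteq> Lp_space p (M \<Otimes>\<^sub>M N)"
proof
  fix g assume "g \<in> tensor_span X Y"
  then obtain m :: nat and c \<phi> \<eta> where *: "\<forall>j<m. \<phi> j \<in> X \<and> \<eta> j \<in> Y"
    "g = (\<lambda>(\<omega>, x). \<Sum>j<m. c j *\<^sub>R (\<eta> j x *\<^sub>R \<phi> j \<omega>))"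
    unfolding tensor_span_def by blast
  have "(\<lambda>z. \<Sum>j<m. c j *\<^sub>R (case z of (\<omega>, x) \<Rightarrow> \<eta> j x *\<^sub>R \<phi> j \<omega>)) \<in> Lp_space p (M \<Otimes>\<^sub>M N)"
    using * assms by (intro Lp_space_sum Lp_space_scaleR tensor_product_Lp) auto
  then show "g \<in> Lp_space p (M \<Otimes>\<^sub>M N)" using *(2) by (simp add: case_prod_beta')
qed

lemma tensor_span_mono:
  assumes "X \<subseteq> X'" "Y \<subseteq> Y'"
  shows "tensor_span X Y \<subseteq> tensor_span X' Y'"
proof
  fix g assume "g \<in> tensor_span X Y"
  then obtain m :: nat and c \<phi> \<eta> where *: "\<forall>j<m. \<phi> j \<in> X \<and> \<eta> j \<in> Y"
    "g = (\<lambda>(\<omega>, x). \<Sum>j<m. c j *\<^sub>R (\<eta> j x *\<^sub>R \<phi> j \<omega>))"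
    unfolding tensor_span_def by blast
  then have "\<forall>j<m. \<phi> j \<in> X' \<and> \<eta> j \<in> Y'" using assms by blast
  then show "g \<in> tensor_span X' Y'" unfolding tensor_span_def using *(2) by blast
qed

lemma Lp_closure_mono:
  assumes "A \<subseteq> A'"
  shows "Lp_closure p N A \<subseteq> Lp_closure p N A'"
proof
  fix f assume f: "f \<in> Lp_closure p N A"
  have "\<exists>g\<in>A'. Lp_norm p N (\<lambda>x. f x - g x) < \<delta>" if "0 < \<delta>" for \<delta>
  proof -
    have "\<exists>g\<in>A. Lp_norm p N (\<lambda>x. f x - g x) < \<delta>" using f that by (simp add: Lp_closure_def)
    then show ?thesis using assms by blast
  qed
  then show "f \<in> Lp_closure p N A'" using f by (simp add: Lp_closure_def)
qed

lemma tensor_mono: "X \<subseteq> X' \<Longrightarrow> Y \<subseteq> Y' \<Longrightarrow> tensor p M N X Y \<subseteq> tensor p M N X' Y'"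
  unfolding tensor_def by (intro Lp_closure_mono tensor_span_mono)

lemma tensor_Lp: "tensor p M N X Y \<subseteq> Lp_space p (M \<Otimes>\<^sub>M N)"
  by (auto simp: tensor_def Lp_closure_def)

lemma Lp_W1p_norm_ge:
  assumes "0 < p"
  shows "Lp_norm p (M \<Otimes>\<^sub>M lborel) U \<le> Lp_W1p_norm p M U"
    "Lp_norm p (M \<Otimes>\<^sub>M lborel) (weak_gradient_x p M U) \<le> Lp_W1p_norm p M U"
  unfolding Lp_W1p_norm_def using assms by (auto intro!: root_sum_powr_ge)

lemma sobolev_tensor_subset_tensor:
  assumes "0 < p"
  shows "sobolev_tensor p M X Y \<subseteq> tensor p M lborel X Y"
proof
  fix U assume U: "U \<in> sobolev_tensor p M X Y"
  then have "U \<in> Lp_space p (M \<Otimes>\<^sub>M lborel)" by (simp add: sobolev_tensor_def Lp_W1p_def)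
  moreover have "\<exists>g\<in>tensor_span X Y. Lp_norm p (M \<Otimes>\<^sub>M lborel) (\<lambda>z. U z - g z) < \<delta>" if "0 < \<delta>" for \<delta>
    using U that Lp_W1p_norm_ge(1)[OF assms, of M] unfolding sobolev_tensor_def by (blast intro: le_less_trans)
  ultimately show "U \<in> tensor p M lborel X Y" by (simp add: tensor_def Lp_closure_def)
qed

lemma weak_gradient_x_spec:
  assumes "U \<in> Lp_W1p p M"
  shows "weak_gradient_x p M U \<in> Lp_space p (M \<Otimes>\<^sub>M lborel)" "is_weak_gradient_x M U (weak_gradient_x p M U)"
proof -
  have "\<exists>V. V \<in> Lp_space p (M \<Otimes>\<^sub>M lborel) \<and> is_weak_gradient_x M U V" using assms by (auto simp: Lp_W1p_def)
  from someI_ex[OF this] show "weak_gradient_x p M U \<in> Lp_space p (M \<Otimes>\<^sub>M lborel)" "is_weak_gradient_x M U (weak_gradient_x p M U)"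
    by (simp_all add: weak_gradient_x_def)
qed

text \<open>
  Multiplication by the indicator of the complement of \<open>S\<close> annihilates the span and is a
  contraction, so it annihilates the closure.
\<close>

lemma tensor_vanish:
  fixes U :: "'w \<times> (real ^ 'n) \<Rightarrow> 'b::euclidean_space"
  assumes p: "0 < p" and S: "open S" and X: "X \<subseteq> Lp_space p M" and U: "U \<in> tensor p M lborel X (Lp_on p S)"
  shows "AE z in M \<Otimes>\<^sub>M lborel. snd z \<notin> S \<longrightarrow> U z = 0"
proof -
  have [measurable]: "S \<in> sets borel" using S by simp
  have p0: "0 \<le> p" using p by simp
  have Y: "Lp_on p S \<subseteq> Lp_space p lborel" by (auto simp: Lp_on_def)
  have Lp: "tensor_span X (Lp_on p S) \<subseteq> Lp_space p (M \<Otimes>\<^sub>M lborel)"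
    by (rule tensor_span_Lp[OF sigma_finite_lborel X Y p0])
  have Um: "U \<in> borel_measurable (M \<Otimes>\<^sub>M lborel)" using U tensor_Lp[of p M lborel X "Lp_on p S"] by (auto simp: Lp_space_iff)
  let ?f = "\<lambda>z. indicator (- S) (snd z) *\<^sub>R U z"
  have [measurable]: "U \<in> borel_measurable (M \<Otimes>\<^sub>M lborel)" by fact
  have "Lp_energy p (M \<Otimes>\<^sub>M lborel) ?f \<le> ennreal \<delta>" if \<delta>: "0 < \<delta>" for \<delta>
  proof -
    obtain g where g: "g \<in> tensor_span X (Lp_on p S)" "Lp_energy p (M \<Otimes>\<^sub>M lborel) (\<lambda>x. U x - g x) \<le> ennreal \<delta>"
      using Lp_closure_approx[OF U[unfolded tensor_def] p Lp \<delta>] by blast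
    then obtain m :: nat and c \<phi> \<eta> where *: "\<forall>j<m. \<phi> j \<in> X \<and> \<eta> j \<in> Lp_on p S"
      "g = (\<lambda>(\<omega>, x). \<Sum>j<m. c j *\<^sub>R (\<eta> j x *\<^sub>R \<phi> j \<omega>))"
      unfolding tensor_span_def by blast
    have "AE x in lborel. \<forall>j\<in>{..<m}. x \<notin> S \<longrightarrow> \<eta> j x = 0"
      by (rule AE_finite_allI) (use *(1) in \<open>auto simp: Lp_on_def\<close>)
    then have "AE z in M \<Otimes>\<^sub>M lborel. \<forall>j\<in>{..<m}. snd z \<notin> S \<longrightarrow> \<eta> j (snd z) = 0"
      by (rule AE_pair_snd[OF sigma_finite_lborel])
    then have "AE z in M \<Otimes>\<^sub>M lborel. ?f z = indicator (- S) (snd z) *\<^sub>R (U z - g z)"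
    proof eventually_elim
      case (elim z)
      then show ?case by (cases "snd z \<in> S") (auto simp: *(2) split_beta)
    qed
    then have "Lp_energy p (M \<Otimes>\<^sub>M lborel) ?f = Lp_energy p (M \<Otimes>\<^sub>M lborel) (\<lambda>z. indicator (- S) (snd z) *\<^sub>R (U z - g z))"
      by (rule Lp_energy_cong_AE)
    also have "\<dots> \<le> Lp_energy p (M \<Otimes>\<^sub>M lborel) (\<lambda>z. U z - g z)"
      by (rule Lp_energy_mono[OF p0]) (auto simp: indicator_def)
    finally show ?thesis using g(2) by simp
  qed
  then have "Lp_energy p (M \<Otimes>\<^sub>M lborel) ?f = 0" by (rule ennreal_zero_of_le)
  then have "AE z in M \<Otimes>\<^sub>M lborel. ?f z = 0" by (intro Lp_energy_zero_AE) auto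
  then show ?thesis by eventually_elim (auto simp: indicator_def split: if_splits)
qed

context measure_preserving_system
begin

lemma Lp_inv_Lp: "Lp_inv p M T \<subseteq> Lp_space p M" by (auto simp: Lp_inv_def)

lemma Lp_pot_Lp: "Lp_pot p M T \<subseteq> Lp_space p M" by (auto simp: Lp_pot_def Lp_closure_def)

lemma Lp_energy_T:
  fixes f :: "'w \<times> 'x \<Rightarrow> 'b::euclidean_space"
  assumes "sigma_finite_measure N" and k: "k \<in> int_lattice" and f[measurable]: "f \<in> borel_measurable (M \<Otimes>\<^sub>M N)"
  shows "Lp_energy p (M \<Otimes>\<^sub>M N) (\<lambda>(\<omega>, x). f (T k \<omega>, x)) = Lp_energy p (M \<Otimes>\<^sub>M N) f"
proof -
  interpret N: sigma_finite_measure N by fact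
  note [measurable] = T_measurable[OF k]
  have "Lp_energy p (M \<Otimes>\<^sub>M N) (\<lambda>(\<omega>, x). f (T k \<omega>, x)) = (\<integral>\<^sup>+\<omega>. Lp_energy p N (\<lambda>x. f (T k \<omega>, x)) \<partial>M)"
    by (subst Lp_energy_pair[OF assms(1)]) auto
  also have "\<dots> = (\<integral>\<^sup>+\<omega>. Lp_energy p N (\<lambda>x. f (\<omega>, x)) \<partial>(distr M M (T k)))"
    by (rule nn_integral_distr[symmetric]) (auto simp: Lp_energy_def)
  also have "\<dots> = Lp_energy p (M \<Otimes>\<^sub>M N) f"
    unfolding distr_T[OF k] by (rule Lp_energy_pair[OF assms(1), symmetric]) simp
  finally show ?thesis .
qed

text \<open>
  The shift acts isometrically on $L^p(\Omega \times R^d)$ and fixes the span, hence the closure.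
\<close>

lemma tensor_invariant:
  fixes U :: "'w \<times> (real ^ 'n) \<Rightarrow> real"
  assumes p: "0 < p" and Y: "Y \<subseteq> Lp_space p lborel" and U: "U \<in> tensor p M lborel (Lp_inv p M T) Y" and k: "k \<in> int_lattice"
  shows "AE z in M \<Otimes>\<^sub>M lborel. U (T k (fst z), snd z) = U z"
proof -
  have p0: "0 \<le> p" using p by simp
  have Lp: "tensor_span (Lp_inv p M T) Y \<subseteq> Lp_space p (M \<Otimes>\<^sub>M lborel)"
    by (rule tensor_span_Lp[OF sigma_finite_lborel Lp_inv_Lp Y p0])
  have U_m[measurable]: "U \<in> borel_measurable (M \<Otimes>\<^sub>M lborel)" using U tensor_Lp[of p M lborel "Lp_inv p M T" Y] by (auto simp: Lp_space_iff)
  note [measurable] = T_measurable[OF k]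
  let ?f = "\<lambda>z. U (T k (fst z), snd z) - U z"
  have "Lp_energy p (M \<Otimes>\<^sub>M lborel) ?f \<le> ennreal \<delta>" if "0 < \<delta>" for \<delta>
  proof -
    define d where "d = \<delta> / (2 powr p * 2)"
    have d: "0 < d" "2 powr p * (d + d) = \<delta>" using that by (auto simp: d_def)
    obtain g where g: "g \<in> tensor_span (Lp_inv p M T) Y" "Lp_energy p (M \<Otimes>\<^sub>M lborel) (\<lambda>x. U x - g x) \<le> ennreal d"
      using Lp_closure_approx[OF U[unfolded tensor_def] p Lp d(1)] by blast
    have g_m[measurable]: "g \<in> borel_measurable (M \<Otimes>\<^sub>M lborel)" using g(1) Lp by (auto simp: Lp_space_iff)
    obtain m :: nat and c \<phi> \<eta> where *: "\<forall>j<m. \<phi> j \<in> Lp_inv p M T \<and> \<eta> j \<in> Y"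
      "g = (\<lambda>(\<omega>, x). \<Sum>j<m. c j *\<^sub>R (\<eta> j x *\<^sub>R \<phi> j \<omega>))"
      using g(1) unfolding tensor_span_def by blast
    have "AE \<omega> in M. \<forall>j\<in>{..<m}. \<phi> j (T k \<omega>) = \<phi> j \<omega>"
      by (rule AE_finite_allI) (use *(1) k in \<open>auto simp: Lp_inv_def\<close>)
    then have "AE \<omega> in M. \<forall>x. g (T k \<omega>, x) = g (\<omega>, x)"
      by eventually_elim (simp add: *(2))
    then have "AE z in M \<Otimes>\<^sub>M lborel. g (T k (fst z), snd z) = g z"
      by (intro AE_pair_fst[OF sigma_finite_lborel]) simp
    then have "AE z in M \<Otimes>\<^sub>M lborel. ?f z = (U (T k (fst z), snd z) - g (T k (fst z), snd z)) - (U z - g z)"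
      by eventually_elim simp
    then have "Lp_energy p (M \<Otimes>\<^sub>M lborel) ?f =
        Lp_energy p (M \<Otimes>\<^sub>M lborel) (\<lambda>z. (U (T k (fst z), snd z) - g (T k (fst z), snd z)) - (U z - g z))"
      by (rule Lp_energy_cong_AE)
    also have "\<dots> \<le> ennreal (2 powr p) * (Lp_energy p (M \<Otimes>\<^sub>M lborel) (\<lambda>z. U (T k (fst z), snd z) - g (T k (fst z), snd z))
        + Lp_energy p (M \<Otimes>\<^sub>M lborel) (\<lambda>z. U z - g z))"
      by (intro Lp_energy_diff p0) auto
    also have "Lp_energy p (M \<Otimes>\<^sub>M lborel) (\<lambda>z. U (T k (fst z), snd z) - g (T k (fst z), snd z)) =
        Lp_energy p (M \<Otimes>\<^sub>M lborel) (\<lambda>z. U z - g z)"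
      using Lp_energy_T[OF sigma_finite_lborel k, of "\<lambda>z. U z - g z" p] by (simp add: case_prod_beta')
    also have "ennreal (2 powr p) * (Lp_energy p (M \<Otimes>\<^sub>M lborel) (\<lambda>z. U z - g z) + Lp_energy p (M \<Otimes>\<^sub>M lborel) (\<lambda>z. U z - g z))
       \<le> ennreal (2 powr p) * (ennreal d + ennreal d)"
      using g(2) by (intro mult_left_mono add_mono) auto
    also have "\<dots> = ennreal (2 powr p * (d + d))" using d(1) by (simp add: ennreal_mult del: ennreal_plus add: ennreal_plus[symmetric])
    finally show ?thesis using d(2) by simp
  qed
  then have "Lp_energy p (M \<Otimes>\<^sub>M lborel) ?f = 0" by (rule ennreal_zero_of_le)
  then have "AE z in M \<Otimes>\<^sub>M lborel. ?f z = 0" by (intro Lp_energy_zero_AE) auto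
  then show ?thesis by eventually_elim simp
qed

section \<open>Folding\<close>

lemma section_borel:
  fixes U :: "'w \<times> (real ^ 'n) \<Rightarrow> 'b::topological_space"
  assumes "U \<in> borel_measurable (M \<Otimes>\<^sub>M lborel)" "\<omega> \<in> space M"
  shows "(\<lambda>x. U (\<omega>, x)) \<in> borel_measurable borel"
  using measurable_Pair2[OF assms] by simp

lemma cell_average_eq:
  fixes U :: "'w \<times> (real ^ 'n) \<Rightarrow> real"
  assumes \<epsilon>: "0 < \<epsilon>" and U: "U \<in> borel_measurable (M \<Otimes>\<^sub>M lborel)" and \<omega>: "\<omega> \<in> space M"
  shows "cell_average \<epsilon> U (\<omega>, k) = (\<integral>z. U (\<omega>, k + \<epsilon> *\<^sub>R z) \<partial>cell_law)"
  using integral_cell_law[OF section_borel[OF U \<omega>] \<epsilon>, of k]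
  by (simp add: cell_average_def set_lebesgue_integral_def cell_eq_image[OF \<epsilon>, symmetric] mult.commute)

lemma folding_eq:
  fixes U :: "'w \<times> (real ^ 'n) \<Rightarrow> real"
  assumes \<epsilon>: "0 < \<epsilon>" and U: "U \<in> borel_measurable (M \<Otimes>\<^sub>M lborel)" and \<omega>: "\<omega> \<in> space M" and y: "y \<in> scaled_lattice \<epsilon>"
  shows "folding_op T \<epsilon> U (\<omega>, y) = (\<integral>z. U (T (y /\<^sub>R \<epsilon>) \<omega>, y + \<epsilon> *\<^sub>R z) \<partial>cell_law)"
  using cell_average_eq[OF \<epsilon> U T_space[OF lattice_index(2)[OF \<epsilon> y] \<omega>]] by (simp add: folding_op_def)

text \<open>
  The shift by $k/\varepsilon$ in the folding cancels the shift by $-k/\varepsilon$ in the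
  unfolding.
\<close>

lemma unfold_folding:
  fixes U :: "'w \<times> (real ^ 'n) \<Rightarrow> real"
  assumes \<epsilon>: "0 < \<epsilon>" and U: "U \<in> borel_measurable (M \<Otimes>\<^sub>M lborel)" and \<omega>: "\<omega> \<in> space M"
  shows "unfold T \<epsilon> (folding_op T \<epsilon> U) (\<omega>, x) = moving_average 0 \<epsilon> U (\<omega>, x)"
proof -
  let ?k = "lattice_floor \<epsilon> x"
  have k: "?k \<in> scaled_lattice \<epsilon>" by (rule lattice_floor_in[OF \<epsilon>])
  note idx = lattice_index[OF \<epsilon> k]
  have "T (?k /\<^sub>R \<epsilon>) (T (- ?k /\<^sub>R \<epsilon>) \<omega>) = T (?k /\<^sub>R \<epsilon> + (- ?k /\<^sub>R \<epsilon>)) \<omega>"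
    by (rule T_add[symmetric]) (use idx \<omega> in auto)
  also have "\<dots> = \<omega>" using T_zero[OF \<omega>] by simp
  finally have T: "T (?k /\<^sub>R \<epsilon>) (T (- ?k /\<^sub>R \<epsilon>) \<omega>) = \<omega>" .
  have "unfold T \<epsilon> (folding_op T \<epsilon> U) (\<omega>, x) = folding_op T \<epsilon> U (T (- ?k /\<^sub>R \<epsilon>) \<omega>, ?k)"
    by (simp add: unfold_def unfold_discrete_def)
  also have "\<dots> = (\<integral>z. U (\<omega>, ?k + \<epsilon> *\<^sub>R z) \<partial>cell_law)"
    unfolding folding_eq[OF \<epsilon> U T_space[OF idx(1) \<omega>] k] T ..
  also have "\<dots> = moving_average 0 \<epsilon> U (\<omega>, x)"
    using integral_cell_point_zero[OF section_borel[OF U \<omega>], of \<epsilon> ?k] by (simp add: moving_average_def)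
  finally show ?thesis .
qed

lemma folding_measurable:
  fixes U :: "'w \<times> (real ^ 'n) \<Rightarrow> real"
  assumes \<epsilon>: "0 < \<epsilon>" and U: "U \<in> borel_measurable (M \<Otimes>\<^sub>M lborel)"
  shows "folding_op T \<epsilon> U \<in> borel_measurable (M \<Otimes>\<^sub>M lattice_measure \<epsilon>)"
proof (rule measurable_pair_lattice)
  fix y :: "real ^ 'n" assume y: "y \<in> scaled_lattice \<epsilon>"
  interpret Z: prob_space "cell_law :: (real ^ 'n) measure" by (rule prob_cell_law)
  note [measurable] = T_measurable[OF lattice_index(2)[OF \<epsilon> y]]
  have [measurable]: "U \<in> borel_measurable (M \<Otimes>\<^sub>M borel)"
    using U measurable_cong_sets[OF sets_pair_measure_cong[OF refl sets_lborel] refl] by blast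
  have "(\<lambda>\<omega>. \<integral>z. U (T (y /\<^sub>R \<epsilon>) \<omega>, y + \<epsilon> *\<^sub>R z) \<partial>cell_law) \<in> borel_measurable M" by measurable
  then show "(\<lambda>\<omega>. folding_op T \<epsilon> U (\<omega>, y)) \<in> borel_measurable M"
    by (subst measurable_cong[OF folding_eq[OF \<epsilon> U _ y]])
qed

lemma Lp_energy_folding_le:
  fixes U :: "'w \<times> (real ^ 'n) \<Rightarrow> real"
  assumes p: "1 < p" and \<epsilon>: "0 < \<epsilon>" and U: "U \<in> borel_measurable (M \<Otimes>\<^sub>M lborel)"
  shows "Lp_energy p (M \<Otimes>\<^sub>M lattice_measure \<epsilon>) (folding_op T \<epsilon> U) \<le> Lp_energy p (M \<Otimes>\<^sub>M lborel) U"
proof -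
  have "Lp_energy p (M \<Otimes>\<^sub>M lattice_measure \<epsilon>) (folding_op T \<epsilon> U) = Lp_energy p (M \<Otimes>\<^sub>M lborel) (unfold T \<epsilon> (folding_op T \<epsilon> U))"
    by (rule Lp_energy_unfold[OF \<epsilon> folding_measurable[OF \<epsilon> U], symmetric])
  also have "\<dots> = Lp_energy p (M \<Otimes>\<^sub>M lborel) (moving_average 0 \<epsilon> U)"
    by (rule Lp_energy_cong) (auto simp: space_pair_measure unfold_folding[OF \<epsilon> U])
  also have "\<dots> \<le> Lp_energy p (M \<Otimes>\<^sub>M lborel) U" by (rule Lp_energy_moving_average_le[OF p \<epsilon> U])
  finally show ?thesis .
qed

lemma folding_Lp:
  fixes U :: "'w \<times> (real ^ 'n) \<Rightarrow> real"
  assumes p: "1 < p" and \<epsilon>: "0 < \<epsilon>" and U: "U \<in> Lp_space p (M \<Otimes>\<^sub>M lborel)"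
  shows "folding_op T \<epsilon> U \<in> Lp_space p (M \<Otimes>\<^sub>M lattice_measure \<epsilon>)"
    "Lp_norm p (M \<Otimes>\<^sub>M lattice_measure \<epsilon>) (folding_op T \<epsilon> U) \<le> Lp_norm p (M \<Otimes>\<^sub>M lborel) U"
proof -
  have U': "U \<in> borel_measurable (M \<Otimes>\<^sub>M lborel)" using U by (simp add: Lp_space_iff)
  show "folding_op T \<epsilon> U \<in> Lp_space p (M \<Otimes>\<^sub>M lattice_measure \<epsilon>)"
    using Lp_energy_folding_le[OF p \<epsilon> U'] folding_measurable[OF \<epsilon> U'] U by (auto simp: Lp_space_iff)
  show "Lp_norm p (M \<Otimes>\<^sub>M lattice_measure \<epsilon>) (folding_op T \<epsilon> U) \<le> Lp_norm p (M \<Otimes>\<^sub>M lborel) U"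
    using p by (intro Lp_norm_mono_energy[OF _ folding_measurable[OF \<epsilon> U'] U Lp_energy_folding_le[OF p \<epsilon> U']]) simp
qed

lemma folding_two_scale:
  fixes U :: "'w \<times> (real ^ 'n) \<Rightarrow> real"
  assumes p: "1 < p" and U: "U \<in> Lp_space p (M \<Otimes>\<^sub>M lborel)"
  shows "two_scale_tendsto p M T (\<lambda>\<epsilon>. folding_op T \<epsilon> U) U"
  unfolding two_scale_tendsto_def
proof (rule Lp_tendsto_cong[OF _ moving_average_tendsto[OF p U, of 0]])
  have U': "U \<in> borel_measurable (M \<Otimes>\<^sub>M lborel)" using U by (simp add: Lp_space_iff)
  show "\<forall>\<^sub>F \<epsilon> in at_right 0. unfold T \<epsilon> (folding_op T \<epsilon> U) \<in> borel_measurable (M \<Otimes>\<^sub>M lborel) \<and>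
      (AE z in M \<Otimes>\<^sub>M lborel. unfold T \<epsilon> (folding_op T \<epsilon> U) z = moving_average 0 \<epsilon> U z)"
    using eventually_at_right_less[of "0::real"]
  proof eventually_elim
    case (elim \<epsilon>)
    show ?case
      using unfold_measurable[OF elim folding_measurable[OF elim U']] unfold_folding[OF elim U']
      by (auto intro!: AE_I2 simp: space_pair_measure)
  qed
qed (use p in simp)

text \<open>
  Cell averages are additive only where both functions are integrable on the cell, which is the
  case for almost every \<open>\<omega>\<close>.
\<close>

lemma folding_add:
  fixes U U' :: "'w \<times> (real ^ 'n) \<Rightarrow> real"
  assumes p: "1 < p" and \<epsilon>: "0 < \<epsilon>" and U: "U \<in> Lp_space p (M \<Otimes>\<^sub>M lborel)" "U' \<in> Lp_space p (M \<Otimes>\<^sub>M lborel)"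
  shows "AE z in M \<Otimes>\<^sub>M lattice_measure \<epsilon>. folding_op T \<epsilon> (\<lambda>x. U x + U' x) z = folding_op T \<epsilon> U z + folding_op T \<epsilon> U' z"
proof (rule AE_pair_lattice)
  fix y :: "real ^ 'n" assume y: "y \<in> scaled_lattice \<epsilon>"
  interpret P: prob_space "cell_time_law :: ((real ^ 'n) \<times> real) measure" by (rule prob_cell_time_law)
  note idx = lattice_index(2)[OF \<epsilon> y]
  have Um: "U \<in> borel_measurable (M \<Otimes>\<^sub>M lborel)" "U' \<in> borel_measurable (M \<Otimes>\<^sub>M lborel)" using U by (auto simp: Lp_space_iff)
  then have sm: "(\<lambda>x. U x + U' x) \<in> borel_measurable (M \<Otimes>\<^sub>M lborel)" by simp
  have "AE \<omega> in M. (\<lambda>x. U (\<omega>, x)) \<in> Lp_space p lborel" "AE \<omega> in M. (\<lambda>x. U' (\<omega>, x)) \<in> Lp_space p lborel"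
    using Lp_space_AE_section[OF sigma_finite_lborel] U by auto
  note AE_T[OF idx this(1)] AE_T[OF idx this(2)]
  then show "AE \<omega> in M. folding_op T \<epsilon> (\<lambda>x. U x + U' x) (\<omega>, y) = folding_op T \<epsilon> U (\<omega>, y) + folding_op T \<epsilon> U' (\<omega>, y)"
    using AE_space
  proof eventually_elim
    case (elim \<omega>)
    let ?w = "T (y /\<^sub>R \<epsilon>) \<omega>"
    have \<omega>: "?w \<in> space M" using T_space[OF idx elim(3)] .
    have c: "folding_op T \<epsilon> W (\<omega>, y) = (\<integral>q. W (?w, cell_point 0 \<epsilon> y q) \<partial>cell_time_law)"
      if "W \<in> borel_measurable (M \<Otimes>\<^sub>M lborel)" for W
      using folding_eq[OF \<epsilon> that elim(3) y] integral_cell_point_zero[OF section_borel[OF that \<omega>], of \<epsilon> y] by simp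
    have "integrable cell_time_law (\<lambda>q. U (?w, cell_point 0 \<epsilon> y q))" "integrable cell_time_law (\<lambda>q. U' (?w, cell_point 0 \<epsilon> y q))"
      using P.Lp_space_integrable[OF cell_point_Lp[OF elim(1) \<epsilon>]] P.Lp_space_integrable[OF cell_point_Lp[OF elim(2) \<epsilon>]] p by auto
    then show ?case unfolding c[OF Um(1)] c[OF Um(2)] c[OF sm] by simp
  qed
qed

lemma folding_scale:
  fixes U :: "'w \<times> (real ^ 'n) \<Rightarrow> real"
  shows "folding_op T \<epsilon> (\<lambda>x. c * U x) z = c * folding_op T \<epsilon> U z"
  by (cases z) (simp add: folding_op_def cell_average_def)

text \<open>
  At the neighbouring lattice point the two shifts do not cancel completely: they leave
  $T_{e_i}$, which does not change \<open>U\<close> by invariance. What remains is the difference of two cell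
  averages of the same section, given by \<open>cell_difference_formula\<close>.
\<close>

lemma folding_gradient_eq:
  fixes U :: "'w \<times> (real ^ 'n) \<Rightarrow> real"
  assumes p: "1 < p" and \<epsilon>: "0 < \<epsilon>" and U: "U \<in> Lp_space p (M \<Otimes>\<^sub>M lborel)" and V: "V \<in> Lp_space p (M \<Otimes>\<^sub>M lborel)"
    and grad: "is_weak_gradient_x M U V"
    and inv: "AE z in M \<Otimes>\<^sub>M lborel. U (T (axis i 1) (fst z), snd z) = U z"
  shows "AE z in M \<Otimes>\<^sub>M lborel. unfold T \<epsilon> (discrete_gradient \<epsilon> (folding_op T \<epsilon> U)) z $ i = moving_average (axis i 1) \<epsilon> (\<lambda>z. V z $ i) z"
proof (rule AE_pair_fst[OF sigma_finite_lborel])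
  interpret MB: pair_sigma_finite M "lborel :: (real ^ 'n) measure"
    by (simp add: pair_sigma_finite_def sigma_finite_measure_axioms sigma_finite_lborel)
  let ?e = "axis i 1 :: real ^ 'n"
  have Um: "U \<in> borel_measurable (M \<Otimes>\<^sub>M lborel)" using U by (auto simp: Lp_space_iff)
  have "AE \<omega> in M. AE x in lborel. U (T ?e \<omega>, x) = U (\<omega>, x)" using MB.AE_pair[OF inv] by simp
  then show "AE \<omega> in M. \<forall>x. unfold T \<epsilon> (discrete_gradient \<epsilon> (folding_op T \<epsilon> U)) (\<omega>, x) $ i = moving_average ?e \<epsilon> (\<lambda>z. V z $ i) (\<omega>, x)"
    using Lp_space_AE_section[OF sigma_finite_lborel U] Lp_space_AE_section[OF sigma_finite_lborel V]
      grad[unfolded is_weak_gradient_x_def] AE_space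
  proof eventually_elim
    case (elim \<omega>)
    have e: "?e \<in> int_lattice" by simp
    have \<omega>e: "T ?e \<omega> \<in> space M" by (rule T_space[OF e elim(5)])
    show ?case
    proof
      fix x :: "real ^ 'n"
      let ?k = "lattice_floor \<epsilon> x"
      let ?w = "T (- ?k /\<^sub>R \<epsilon>) \<omega>"
      have k: "?k \<in> scaled_lattice \<epsilon>" by (rule lattice_floor_in[OF \<epsilon>])
      note idx = lattice_index[OF \<epsilon> k]
      have ke: "?k + \<epsilon> *\<^sub>R ?e \<in> scaled_lattice \<epsilon>" by (rule scaled_lattice_shift[OF \<epsilon> k])
      have w: "?w \<in> space M" by (rule T_space[OF idx(1) elim(5)])
      have T0: "T (?k /\<^sub>R \<epsilon>) ?w = \<omega>"
      proof -
        have "T (?k /\<^sub>R \<epsilon>) ?w = T (?k /\<^sub>R \<epsilon> + (- ?k /\<^sub>R \<epsilon>)) \<omega>"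
          by (rule T_add[symmetric]) (use idx elim(5) in auto)
        then show ?thesis using T_zero[OF elim(5)] by simp
      qed
      have T1: "T ((?k + \<epsilon> *\<^sub>R ?e) /\<^sub>R \<epsilon>) ?w = T ?e \<omega>"
      proof -
        have "T ((?k + \<epsilon> *\<^sub>R ?e) /\<^sub>R \<epsilon>) ?w = T ((?k + \<epsilon> *\<^sub>R ?e) /\<^sub>R \<epsilon> + (- ?k /\<^sub>R \<epsilon>)) \<omega>"
          by (rule T_add[symmetric]) (use idx elim(5) lattice_index(2)[OF \<epsilon> ke] in auto)
        also have "(?k + \<epsilon> *\<^sub>R ?e) /\<^sub>R \<epsilon> + (- ?k /\<^sub>R \<epsilon>) = ?e" using \<epsilon> by (simp add: scaleR_add_right)
        finally show ?thesis .
      qed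
      have "folding_op T \<epsilon> U (?w, ?k + \<epsilon> *\<^sub>R ?e) = (\<integral>z. U (T ?e \<omega>, ?k + \<epsilon> *\<^sub>R ?e + \<epsilon> *\<^sub>R z) \<partial>cell_law)"
        unfolding folding_eq[OF \<epsilon> Um w ke] T1 ..
      also have "\<dots> = (\<integral>z. U (\<omega>, ?k + \<epsilon> *\<^sub>R ?e + \<epsilon> *\<^sub>R z) \<partial>cell_law)"
      proof -
        note [measurable] = section_borel[OF Um \<omega>e] section_borel[OF Um elim(5)]
        have "(\<integral>y. U (T ?e \<omega>, y) * indicator (cell \<epsilon> (?k + \<epsilon> *\<^sub>R ?e)) y \<partial>lborel) =
            (\<integral>y. U (\<omega>, y) * indicator (cell \<epsilon> (?k + \<epsilon> *\<^sub>R ?e)) y \<partial>lborel)"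
          using elim(1) by (intro integral_cong_AE) (measurable, auto elim: AE_mp)
        then show ?thesis
          using integral_cell_law[of "\<lambda>y. U (T ?e \<omega>, y)" \<epsilon> "?k + \<epsilon> *\<^sub>R ?e"] integral_cell_law[of "\<lambda>y. U (\<omega>, y)" \<epsilon> "?k + \<epsilon> *\<^sub>R ?e"] \<epsilon>
          by simp
      qed
      finally have 1: "folding_op T \<epsilon> U (?w, ?k + \<epsilon> *\<^sub>R ?e) = (\<integral>z. U (\<omega>, ?k + \<epsilon> *\<^sub>R ?e + \<epsilon> *\<^sub>R z) \<partial>cell_law)" .
      have 2: "folding_op T \<epsilon> U (?w, ?k) = (\<integral>z. U (\<omega>, ?k + \<epsilon> *\<^sub>R z) \<partial>cell_law)"
        unfolding folding_eq[OF \<epsilon> Um w k] T0 ..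
      have "unfold T \<epsilon> (discrete_gradient \<epsilon> (folding_op T \<epsilon> U)) (\<omega>, x) $ i =
        (folding_op T \<epsilon> U (?w, ?k + \<epsilon> *\<^sub>R ?e) - folding_op T \<epsilon> U (?w, ?k)) / \<epsilon>"
        by (simp add: unfold_def unfold_discrete_def discrete_gradient_def)
      also have "\<dots> = moving_average ?e \<epsilon> (\<lambda>z. V z $ i) (\<omega>, x)"
        unfolding 1 2 cell_difference_formula[OF elim(2,3) p elim(4) \<epsilon>] using \<epsilon> by (simp add: moving_average_def)
      finally show "unfold T \<epsilon> (discrete_gradient \<epsilon> (folding_op T \<epsilon> U)) (\<omega>, x) $ i = moving_average ?e \<epsilon> (\<lambda>z. V z $ i) (\<omega>, x)" .
    qed
  qed
qed

lemma folding_gradient_two_scale: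
  fixes U :: "'w \<times> (real ^ 'n) \<Rightarrow> real"
  assumes p: "1 < p" and U: "U \<in> Lp_space p (M \<Otimes>\<^sub>M lborel)" and V: "V \<in> Lp_space p (M \<Otimes>\<^sub>M lborel)"
    and grad: "is_weak_gradient_x M U V"
    and inv: "\<And>k. k \<in> int_lattice \<Longrightarrow> AE z in M \<Otimes>\<^sub>M lborel. U (T k (fst z), snd z) = U z"
  shows "two_scale_tendsto p M T (\<lambda>\<epsilon>. discrete_gradient \<epsilon> (folding_op T \<epsilon> U)) V"
  unfolding two_scale_tendsto_def
proof (rule Lp_tendsto_vecI)
  fix i
  have Vi: "(\<lambda>z. V z $ i) \<in> Lp_space p (M \<Otimes>\<^sub>M lborel)" using V p by (simp add: Lp_space_vec_iff)
  have Um: "U \<in> borel_measurable (M \<Otimes>\<^sub>M lborel)" using U by (simp add: Lp_space_iff)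
  show "Lp_tendsto p (M \<Otimes>\<^sub>M lborel) (\<lambda>\<epsilon> z. unfold T \<epsilon> (discrete_gradient \<epsilon> (folding_op T \<epsilon> U)) z $ i) (\<lambda>z. V z $ i) (at_right 0)"
  proof (rule Lp_tendsto_cong[OF _ moving_average_tendsto[OF p Vi, of "axis i 1"]])
    show "\<forall>\<^sub>F \<epsilon> in at_right 0. (\<lambda>z. unfold T \<epsilon> (discrete_gradient \<epsilon> (folding_op T \<epsilon> U)) z $ i) \<in> borel_measurable (M \<Otimes>\<^sub>M lborel) \<and>
      (AE z in M \<Otimes>\<^sub>M lborel. unfold T \<epsilon> (discrete_gradient \<epsilon> (folding_op T \<epsilon> U)) z $ i = moving_average (axis i 1) \<epsilon> (\<lambda>z. V z $ i) z)"
      using eventually_at_right_less[of "0::real"]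
    proof eventually_elim
      case (elim \<epsilon>)
      show ?case
        using unfold_measurable[OF elim discrete_gradient_measurable[OF elim folding_measurable[OF elim Um]]]
          folding_gradient_eq[OF p elim U V grad inv] measurable_vec_iff by auto
    qed
  qed (use p in simp)
qed (use p in simp)

end

section \<open>Cutoffs and supported lattice functions\<close>

text \<open>
  Where \<open>l\<close> vanishes the multipliers need not converge; this is why the hypothesis is on the
  product. The error splits into $m (f - l)$, which is at most $f - l$, and $m l - l$, which
  tends to \<open>0\<close> by dominated convergence.
\<close>

lemma Lp_tendsto_multiplier:
  fixes f :: "real \<Rightarrow> 'a \<Rightarrow> 'b::euclidean_space"
  assumes p: "0 < p" and f: "Lp_tendsto p N f l (at_right 0)"
    and m_meas: "\<And>\<epsilon>. 0 < \<epsilon> \<Longrightarrow> m \<epsilon> \<in> borel_measurable N"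
    and m_le: "\<And>\<epsilon> z. 0 < \<epsilon> \<Longrightarrow> \<bar>m \<epsilon> z :: real\<bar> \<le> 1"
    and lim: "AE z in N. ((\<lambda>\<epsilon>. m \<epsilon> z *\<^sub>R l z) \<longlongrightarrow> l z) (at_right 0)"
  shows "Lp_tendsto p N (\<lambda>\<epsilon> z. m \<epsilon> z *\<^sub>R f \<epsilon> z) l (at_right 0)"
proof -
  have p0: "0 \<le> p" using p by simp
  note f' = f[unfolded Lp_tendsto_iff_energy[OF p]]
  have l: "l \<in> Lp_space p N" using f' by blast
  have l_meas[measurable]: "l \<in> borel_measurable N" using l by (simp add: Lp_space_iff)
  have mono: "Lp_energy p N (\<lambda>z. m \<epsilon> z *\<^sub>R h z) \<le> Lp_energy p N h" if "0 < \<epsilon>" for h :: "'a \<Rightarrow> 'b" and \<epsilon>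
    using m_le[OF that] by (intro Lp_energy_mono[OF p0]) (simp add: mult_left_le_one_le)
  have pos: "\<forall>\<^sub>F \<epsilon> in at_right (0::real). 0 < \<epsilon>" by (rule eventually_at_right_less)
  have mem: "\<forall>\<^sub>F \<epsilon> in at_right 0. (\<lambda>z. m \<epsilon> z *\<^sub>R f \<epsilon> z) \<in> Lp_space p N"
    using f'[THEN conjunct1] pos
  proof eventually_elim
    case (elim \<epsilon>)
    then show ?case using m_meas[of \<epsilon>] mono[of \<epsilon> "f \<epsilon>"] by (auto simp: Lp_space_iff)
  qed
  have dct: "((\<lambda>\<epsilon>. Lp_energy p N (\<lambda>z. m \<epsilon> z *\<^sub>R l z - l z)) \<longlongrightarrow> 0) (at_right 0)"
  proof (rule tendsto_at_right_sequentially[of 0 1])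
    fix E :: "nat \<Rightarrow> real" assume E: "\<And>n. 0 < E n" "E \<longlonglongrightarrow> 0"
    have lim_E: "filterlim E (at_right 0) sequentially"
      using E by (auto simp: filterlim_at less_imp_neq[THEN not_sym] intro!: always_eventually)
    note [measurable] = m_meas[OF E(1)]
    have "(\<lambda>n. \<integral>\<^sup>+z. ennreal (norm (m (E n) z *\<^sub>R l z - l z) powr p) \<partial>N) \<longlonglongrightarrow> (\<integral>\<^sup>+z. 0 \<partial>N)"
    proof (rule nn_integral_dominated_convergence[where w="\<lambda>z. ennreal (2 powr p) * ennreal (norm (l z) powr p)"])
      show "AE z in N. ennreal (norm (m (E j) z *\<^sub>R l z - l z) powr p) \<le> ennreal (2 powr p) * ennreal (norm (l z) powr p)" for j
      proof (rule AE_I2)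
        fix z
        have "norm (m (E j) z *\<^sub>R l z - l z) \<le> norm (m (E j) z *\<^sub>R l z) + norm (l z)" by (rule norm_triangle_ineq4)
        also have "\<dots> \<le> 2 * norm (l z)" using m_le[OF E(1), of j z] by (simp add: mult_left_le_one_le)
        finally have "norm (m (E j) z *\<^sub>R l z - l z) powr p \<le> (2 * norm (l z)) powr p" using p0 by (intro powr_mono2) auto
        then have "norm (m (E j) z *\<^sub>R l z - l z) powr p \<le> 2 powr p * norm (l z) powr p" by (simp add: powr_mult)
        then show "ennreal (norm (m (E j) z *\<^sub>R l z - l z) powr p) \<le> ennreal (2 powr p) * ennreal (norm (l z) powr p)"
          by (simp flip: ennreal_mult' add: ennreal_leI)
      qed
      have "(\<integral>\<^sup>+z. ennreal (2 powr p) * ennreal (norm (l z) powr p) \<partial>N) = ennreal (2 powr p) * Lp_energy p N l"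
        unfolding Lp_energy_def by (rule nn_integral_cmult) measurable
      then show "(\<integral>\<^sup>+z. ennreal (2 powr p) * ennreal (norm (l z) powr p) \<partial>N) < \<infinity>"
        using l by (simp add: Lp_space_iff ennreal_mult_less_top)
      show "AE z in N. (\<lambda>n. ennreal (norm (m (E n) z *\<^sub>R l z - l z) powr p)) \<longlonglongrightarrow> 0"
        using lim
      proof eventually_elim
        case (elim z)
        have "(\<lambda>n. m (E n) z *\<^sub>R l z - l z) \<longlonglongrightarrow> l z - l z"
          by (intro tendsto_diff filterlim_compose[OF elim lim_E] tendsto_const)
        then have "(\<lambda>n. norm (m (E n) z *\<^sub>R l z - l z)) \<longlonglongrightarrow> 0" using tendsto_norm_zero by fastforce
        then have "(\<lambda>n. norm (m (E n) z *\<^sub>R l z - l z) powr p) \<longlonglongrightarrow> 0 powr p"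
          using p by (intro tendsto_powr') auto
        then have "(\<lambda>n. norm (m (E n) z *\<^sub>R l z - l z) powr p) \<longlonglongrightarrow> 0" by simp
        from tendsto_ennrealI[OF this] show ?case by simp
      qed
    qed measurable
    then show "(\<lambda>n. Lp_energy p N (\<lambda>z. m (E n) z *\<^sub>R l z - l z)) \<longlonglongrightarrow> 0" by (simp add: Lp_energy_def)
  qed simp
  have "((\<lambda>\<epsilon>. ennreal (2 powr p) * (Lp_energy p N (\<lambda>z. f \<epsilon> z - l z) + Lp_energy p N (\<lambda>z. m \<epsilon> z *\<^sub>R l z - l z))) \<longlongrightarrow> 0) (at_right 0)"
    using tendsto_add[OF f'[THEN conjunct2, THEN conjunct2] dct] by (intro ennreal_tendsto_zero_cmult) auto
  moreover have "\<forall>\<^sub>F \<epsilon> in at_right 0. Lp_energy p N (\<lambda>z. m \<epsilon> z *\<^sub>R f \<epsilon> z - l z) \<le>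
      ennreal (2 powr p) * (Lp_energy p N (\<lambda>z. f \<epsilon> z - l z) + Lp_energy p N (\<lambda>z. m \<epsilon> z *\<^sub>R l z - l z))"
    using f'[THEN conjunct1] pos
  proof eventually_elim
    case (elim \<epsilon>)
    have [measurable]: "f \<epsilon> \<in> borel_measurable N" using elim by (simp add: Lp_space_iff)
    note [measurable] = m_meas[OF elim(2)]
    have "Lp_energy p N (\<lambda>z. m \<epsilon> z *\<^sub>R f \<epsilon> z - l z) \<le>
      ennreal (2 powr p) * (Lp_energy p N (\<lambda>z. m \<epsilon> z *\<^sub>R f \<epsilon> z - m \<epsilon> z *\<^sub>R l z) + Lp_energy p N (\<lambda>z. m \<epsilon> z *\<^sub>R l z - l z))"
      by (rule Lp_energy_triangle[OF _ _ _ p0]) measurable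
    also have "Lp_energy p N (\<lambda>z. m \<epsilon> z *\<^sub>R f \<epsilon> z - m \<epsilon> z *\<^sub>R l z) \<le> Lp_energy p N (\<lambda>z. f \<epsilon> z - l z)"
      using mono[OF elim(2), of "\<lambda>z. f \<epsilon> z - l z"] by (simp add: scaleR_diff_right)
    finally show ?case by (simp add: mult_left_mono add_right_mono)
  qed
  ultimately have "((\<lambda>\<epsilon>. Lp_energy p N (\<lambda>z. m \<epsilon> z *\<^sub>R f \<epsilon> z - l z)) \<longlongrightarrow> 0) (at_right 0)"
    by (rule ennreal_tendsto_zero_mono)
  then show ?thesis using mem l by (simp add: Lp_tendsto_iff_energy[OF p])
qed

lemma Lp_tendsto_component:
  fixes f :: "'i \<Rightarrow> 'a \<Rightarrow> real ^ 'n"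
  assumes p: "0 < p" and f: "Lp_tendsto p N f l F"
  shows "Lp_tendsto p N (\<lambda>i x. f i x $ j) (\<lambda>x. l x $ j) F"
proof -
  have p0: "0 \<le> p" using p by simp
  note f' = f[unfolded Lp_tendsto_iff_energy[OF p]]
  have "((\<lambda>i. Lp_energy p N (\<lambda>x. f i x $ j - l x $ j)) \<longlongrightarrow> 0) F"
    by (rule ennreal_tendsto_zero_mono[OF f'[THEN conjunct2, THEN conjunct2]])
       (use Lp_energy_component_le[OF p0, of N "\<lambda>x. f _ x - l x" j] in simp)
  moreover have "\<forall>\<^sub>F i in F. (\<lambda>x. f i x $ j) \<in> Lp_space p N"
    using f'[THEN conjunct1] by eventually_elim (simp add: Lp_space_vec_iff[OF p0])
  ultimately show ?thesis using f' by (simp add: Lp_tendsto_iff_energy[OF p] Lp_space_vec_iff[OF p0])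
qed

text \<open>
  A Lipschitz function with constant $1/\delta$ that vanishes outside \<open>S\<close> and is \<open>1\<close> at distance
  at least \<open>\<delta>\<close> from the complement.
\<close>

definition cutoff :: "(real ^ 'n) set \<Rightarrow> real \<Rightarrow> real ^ 'n \<Rightarrow> real" where
  "cutoff S \<delta> x = min 1 (infdist x (- S) / \<delta>)"

lemma cutoff_bounds:
  assumes "0 < \<delta>"
  shows "0 \<le> cutoff S \<delta> x" "cutoff S \<delta> x \<le> 1" "\<bar>cutoff S \<delta> x\<bar> \<le> 1"
  using assms infdist_nonneg[of x "- S"] by (auto simp: cutoff_def)

lemma cutoff_outside: "x \<notin> S \<Longrightarrow> cutoff S \<delta> x = 0"
  by (simp add: cutoff_def)

lemma cutoff_lipschitz:
  assumes "0 < \<delta>"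
  shows "\<bar>cutoff S \<delta> x - cutoff S \<delta> y\<bar> \<le> dist x y / \<delta>"
proof -
  have "\<bar>cutoff S \<delta> x - cutoff S \<delta> y\<bar> \<le> \<bar>infdist x (- S) / \<delta> - infdist y (- S) / \<delta>\<bar>"
    unfolding cutoff_def by linarith
  also have "\<dots> = \<bar>infdist x (- S) - infdist y (- S)\<bar> / \<delta>" using assms by (simp add: abs_divide flip: diff_divide_distrib)
  also have "\<dots> \<le> dist x y / \<delta>"
    using infdist_triangle_abs[of x "- S" y] assms by (intro divide_right_mono) auto
  finally show ?thesis .
qed

lemma cutoff_measurable [measurable]: "cutoff S \<delta> \<in> borel_measurable borel"
proof -
  have "continuous_on UNIV (\<lambda>x. infdist x (- S))" by (intro continuous_intros)
  then have [measurable]: "(\<lambda>x. infdist x (- S)) \<in> borel_measurable borel" by (rule borel_measurable_continuous_onI)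
  show ?thesis unfolding cutoff_def by measurable
qed

lemma cutoff_eventually_one:
  fixes x :: "real ^ 'n"
  assumes S: "open S" "- S \<noteq> {}" and x: "x \<in> S" and \<delta>: "(\<delta> \<longlongrightarrow> 0) F" "\<forall>\<^sub>F \<epsilon> in F. 0 < \<delta> \<epsilon>"
    and y: "(y \<longlongrightarrow> x) F"
  shows "\<forall>\<^sub>F \<epsilon> in F. cutoff S (\<delta> \<epsilon>) (y \<epsilon>) = 1"
proof -
  define r where "r = infdist x (- S)"
  have r: "0 < r" unfolding r_def using S x by (intro infdist_pos_not_in_closed) auto
  have "\<forall>\<^sub>F \<epsilon> in F. \<delta> \<epsilon> < r / 2" using order_tendstoD(2)[OF \<delta>(1), of "r / 2"] r by simp
  moreover have "\<forall>\<^sub>F \<epsilon> in F. dist (y \<epsilon>) x < r / 2" using tendstoD[OF y, of "r / 2"] r by simp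
  ultimately show ?thesis using \<delta>(2)
  proof eventually_elim
    case (elim \<epsilon>)
    have "r \<le> infdist (y \<epsilon>) (- S) + dist x (y \<epsilon>)" unfolding r_def by (rule infdist_triangle)
    then have "\<delta> \<epsilon> \<le> infdist (y \<epsilon>) (- S)" using elim by (simp add: dist_commute)
    then show ?case using elim by (simp add: cutoff_def)
  qed
qed

lemma lattice_floor_tendsto:
  fixes x :: "real ^ 'n"
  shows "((\<lambda>\<epsilon>. lattice_floor \<epsilon> x) \<longlongrightarrow> x) (at_right 0)"
proof (rule tendstoI)
  fix e :: real assume e: "0 < e"
  have "\<forall>\<^sub>F \<epsilon> in at_right 0. \<epsilon> < e / real CARD('n)"
    using e by (intro eventually_at_rightI[of 0 "e / real CARD('n)"]) auto
  then show "\<forall>\<^sub>F \<epsilon> in at_right 0. dist (lattice_floor \<epsilon> x) x < e"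
    using eventually_at_right_less[of "0::real"]
  proof eventually_elim
    case (elim \<epsilon>)
    then have "real CARD('n) * \<epsilon> < e" by (simp add: field_simps)
    then show ?case using dist_lattice_floor_le[OF elim(2), of x] by simp
  qed
qed

text \<open>
  The coordinates of the lattice points are bounded integer multiples of \<open>\<epsilon>\<close>.
\<close>

lemma finite_lattice_bounded:
  fixes S :: "(real ^ 'n) set"
  assumes "bounded S" and \<epsilon>: "0 < \<epsilon>"
  shows "finite (scaled_lattice \<epsilon> \<inter> S)"
proof -
  obtain R where R: "\<And>x. x \<in> S \<Longrightarrow> norm x \<le> R" using assms(1) by (auto simp: bounded_iff)
  define m where "m = \<lceil>R / \<epsilon>\<rceil>"
  have "finite (PiE (UNIV :: 'n set) (\<lambda>_. {- m..m}))" by (intro finite_PiE) auto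
  moreover have "scaled_lattice \<epsilon> \<inter> S \<subseteq> (\<lambda>f. \<chi> i. \<epsilon> * real_of_int (f i)) ` (PiE (UNIV :: 'n set) (\<lambda>_. {- m..m}))"
  proof
    fix x assume x: "x \<in> scaled_lattice \<epsilon> \<inter> S"
    then have "\<forall>i. \<exists>k. (x /\<^sub>R \<epsilon>) $ i = of_int k"
      using \<epsilon> by (auto simp: scaled_lattice_iff int_lattice_def elim: Ints_cases)
    then obtain f where f: "\<And>i. (x /\<^sub>R \<epsilon>) $ i = real_of_int (f i)" by metis
    have xi: "x $ i = \<epsilon> * real_of_int (f i)" for i using f[of i] \<epsilon> by (simp add: field_simps)
    have "f i \<in> {- m..m}" for i
    proof -
      have "\<bar>x $ i\<bar> \<le> R" using component_le_norm_cart[of x i] R[of x] x by auto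
      then have "\<epsilon> * \<bar>real_of_int (f i)\<bar> \<le> R" using \<epsilon> by (simp add: xi abs_mult)
      then have "\<bar>real_of_int (f i)\<bar> \<le> R / \<epsilon>" using \<epsilon> by (simp add: field_simps)
      also have "\<dots> \<le> real_of_int m" unfolding m_def by (rule le_of_int_ceiling)
      finally have "\<bar>f i\<bar> \<le> m" by linarith
      then show ?thesis by auto
    qed
    moreover have "x = (\<chi> i. \<epsilon> * real_of_int (f i))" by (simp add: vec_eq_iff xi)
    ultimately show "x \<in> (\<lambda>f. \<chi> i. \<epsilon> * real_of_int (f i)) ` (PiE (UNIV :: 'n set) (\<lambda>_. {- m..m}))"
      by (intro image_eqI[of _ _ f]) auto
  qed
  ultimately show ?thesis by (meson finite_imageI finite_subset)
qed

text \<open>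
  Every lattice point has positive mass, so a section is controlled by the whole function.
\<close>

lemma lattice_section_Lp:
  fixes v :: "'w \<times> (real ^ 'n) \<Rightarrow> real"
  assumes "sigma_finite_measure M" and \<epsilon>: "0 < \<epsilon>" and v: "v \<in> Lp_space p (M \<Otimes>\<^sub>M lattice_measure \<epsilon>)" and y: "y \<in> scaled_lattice \<epsilon>"
  shows "(\<lambda>\<omega>. v (\<omega>, y)) \<in> Lp_space p M"
proof (rule Lp_spaceI)
  interpret L: sigma_finite_measure "lattice_measure \<epsilon> :: (real ^ 'n) measure" by (rule sigma_finite_lattice_measure)
  interpret P2: pair_sigma_finite M "lattice_measure \<epsilon> :: (real ^ 'n) measure"
    by (simp add: pair_sigma_finite_def assms(1) L.sigma_finite_measure_axioms)
  have vm[measurable]: "v \<in> borel_measurable (M \<Otimes>\<^sub>M lattice_measure \<epsilon>)" using v by (simp add: Lp_space_iff)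
  show "(\<lambda>\<omega>. v (\<omega>, y)) \<in> borel_measurable M" by (rule measurable_pair_lattice_section[OF vm y])
  let ?H = "\<lambda>y. \<integral>\<^sup>+\<omega>. ennreal (norm (v (\<omega>, y)) powr p) \<partial>M"
  have ys: "{y} \<in> sets (lattice_measure \<epsilon>)" using y by (simp add: sets_lattice_measure)
  have "?H y * ennreal (\<epsilon> ^ CARD('n)) = (\<integral>\<^sup>+x. ?H y * indicator {y} x \<partial>lattice_measure \<epsilon>)"
    by (simp add: nn_integral_cmult_indicator[OF ys] emeasure_lattice_singleton[OF y])
  also have "\<dots> \<le> (\<integral>\<^sup>+x. ?H x \<partial>lattice_measure \<epsilon>)"
    by (intro nn_integral_mono) (auto simp: indicator_def)
  also have "\<dots> = Lp_energy p (M \<Otimes>\<^sub>M lattice_measure \<epsilon>) v"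
    unfolding Lp_energy_def by (rule P2.nn_integral_snd[of "\<lambda>z. ennreal (norm (v z) powr p)"]) measurable
  also have "\<dots> < \<infinity>" using v by (simp add: Lp_space_iff)
  finally have "?H y * ennreal (\<epsilon> ^ CARD('n)) < \<infinity>" .
  then show "Lp_energy p M (\<lambda>\<omega>. v (\<omega>, y)) < \<infinity>"
    using \<epsilon> by (auto simp: Lp_energy_def ennreal_mult_less_top)
qed

text \<open>
  Such a function is the finite sum of its sections times the indicators of lattice points in
  \<open>S\<close>, so it lies in the span itself.
\<close>

lemma tensor_of_vanishing:
  fixes v :: "'w \<times> (real ^ 'n) \<Rightarrow> real"
  assumes "sigma_finite_measure M" and p: "0 < p" and \<epsilon>: "0 < \<epsilon>" and S: "bounded S"
    and v: "v \<in> Lp_space p (M \<Otimes>\<^sub>M lattice_measure \<epsilon>)"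
    and zero: "\<And>\<omega> y. \<omega> \<in> space M \<Longrightarrow> y \<in> scaled_lattice \<epsilon> - S \<Longrightarrow> v (\<omega>, y) = 0"
  shows "v \<in> tensor p M (lattice_measure \<epsilon>) (Lp_space p M) (Lp_lattice_0 p \<epsilon> S)"
proof -
  let ?A = "scaled_lattice \<epsilon> \<inter> S"
  have fin: "finite ?A" by (rule finite_lattice_bounded[OF S \<epsilon>])
  then obtain h :: "nat \<Rightarrow> real ^ 'n" where h: "bij_betw h {..<card ?A} ?A"
    using ex_bij_betw_nat_finite[OF fin] by (auto simp: atLeast0LessThan)
  define g where "g = (\<lambda>(\<omega>, x). \<Sum>j<card ?A. 1 *\<^sub>R (indicator {h j} x *\<^sub>R v (\<omega>, h j)))"
  have "g \<in> tensor_span (Lp_space p M) (Lp_lattice_0 p \<epsilon> S)"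
    unfolding tensor_span_def g_def mem_Collect_eq
  proof (intro exI conjI allI impI)
    fix j assume "j < card ?A"
    then have hj: "h j \<in> ?A" using h by (auto simp: bij_betw_def)
    show "(\<lambda>\<omega>. v (\<omega>, h j)) \<in> Lp_space p M" using hj by (intro lattice_section_Lp[OF assms(1) \<epsilon> v]) auto
    have hs: "{h j} \<in> sets (lattice_measure \<epsilon>)" using hj by (auto simp: sets_lattice_measure)
    have "Lp_energy p (lattice_measure \<epsilon>) (indicator {h j} :: real ^ 'n \<Rightarrow> real) = (\<integral>\<^sup>+x. indicator {h j} x \<partial>lattice_measure \<epsilon>)"
      unfolding Lp_energy_def using p by (intro nn_integral_cong) (auto simp: indicator_def)
    also have "\<dots> < \<infinity>" using hj hs by (simp add: emeasure_lattice_singleton)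
    finally show "(indicator {h j} :: real ^ 'n \<Rightarrow> real) \<in> Lp_lattice_0 p \<epsilon> S"
      using hs hj by (auto simp: Lp_lattice_0_def Lp_space_iff indicator_def)
  qed (rule refl)
  moreover have "Lp_norm p (M \<Otimes>\<^sub>M lattice_measure \<epsilon>) (\<lambda>z. v z - g z) = 0"
  proof -
    have "v z - g z = 0" if z: "z \<in> space (M \<Otimes>\<^sub>M lattice_measure \<epsilon>)" for z
    proof -
      obtain \<omega> x where zz: "z = (\<omega>, x)" "\<omega> \<in> space M" "x \<in> scaled_lattice \<epsilon>"
        using z by (auto simp: space_pair_measure)
      have "g z = (\<Sum>y\<in>?A. indicator {y} x *\<^sub>R v (\<omega>, y))"
        unfolding g_def zz using sum.reindex_bij_betw[OF h, of "\<lambda>y. indicator {y} x *\<^sub>R v (\<omega>, y)"] by simp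
      also have "\<dots> = (\<Sum>y\<in>?A. if x = y then v (\<omega>, y) else 0)"
        by (intro sum.cong) (auto simp: indicator_def)
      also have "\<dots> = (if x \<in> ?A then v (\<omega>, x) else 0)" using fin by (simp add: sum.delta')
      also have "\<dots> = v z" using zero[of \<omega> x] zz by auto
      finally show ?thesis by simp
    qed
    then have "(\<integral>z. norm (v z - g z) powr p \<partial>(M \<Otimes>\<^sub>M lattice_measure \<epsilon>)) = (\<integral>z. 0 \<partial>(M \<Otimes>\<^sub>M (lattice_measure \<epsilon> :: (real ^ 'n) measure)))"
      by (intro Bochner_Integration.integral_cong) auto
    then show ?thesis by (simp add: Lp_norm_def)
  qed
  ultimately show ?thesis
    using v unfolding tensor_def Lp_closure_def by (auto intro!: bexI[of _ g])
qed

lemma Lp_norm_add_bound: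
  assumes "1 \<le> p" "f \<in> Lp_space p N" "g \<in> Lp_space p N"
    and "Lp_norm p N f \<le> C1 * a" "Lp_norm p N g \<le> C2 * b" "0 \<le> a" "a \<le> a'" "0 \<le> b"
  shows "Lp_norm p N (\<lambda>x. f x + g x) \<le> 2 * (\<bar>C1\<bar> + \<bar>C2\<bar>) * (a' + b)"
proof -
  have "C1 * a \<le> \<bar>C1\<bar> * a" "C2 * b \<le> \<bar>C2\<bar> * b" using assms by (auto intro!: mult_right_mono)
  moreover have "\<bar>C1\<bar> * a \<le> (\<bar>C1\<bar> + \<bar>C2\<bar>) * a'" using assms by (intro mult_mono) auto
  moreover have "\<bar>C2\<bar> * b \<le> (\<bar>C1\<bar> + \<bar>C2\<bar>) * b" using assms by (intro mult_mono) auto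
  ultimately have "Lp_norm p N f + Lp_norm p N g \<le> (\<bar>C1\<bar> + \<bar>C2\<bar>) * (a' + b)"
    using assms(4,5) by (simp add: distrib_left)
  then have "2 * (Lp_norm p N f + Lp_norm p N g) \<le> 2 * ((\<bar>C1\<bar> + \<bar>C2\<bar>) * (a' + b))"
    by (rule mult_left_mono) simp
  from order_trans[OF Lp_norm_add_le[OF assms(1-3)] this] show ?thesis by (simp only: mult.assoc)
qed

lemma pair_bounded_linear_sum:
  fixes A :: "('a \<Rightarrow> 'b::euclidean_space) \<Rightarrow> 'c \<Rightarrow> 'd::euclidean_space"
  assumes p: "1 \<le> p" and A: "Lp_bounded_linear p N X N' A" and B: "Lp_bounded_linear p N Y N' B"
    and \<nu>: "\<And>f. f \<in> X \<Longrightarrow> Lp_norm p N f \<le> \<nu> f"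
    and Z: "\<And>f g. f \<in> X \<Longrightarrow> g \<in> Y \<Longrightarrow> (\<lambda>z. A f z + B g z) \<in> Z"
  shows "pair_bounded_linear X \<nu> Y (Lp_norm p N) p N' Z (\<lambda>f g z. A f z + B g z)"
  unfolding pair_bounded_linear_def
proof (intro conjI ballI allI)
  note A' = A[unfolded Lp_bounded_linear_def] and B' = B[unfolded Lp_bounded_linear_def]
  show "(\<lambda>z. A f z + B g z) \<in> Z" if "f \<in> X" "g \<in> Y" for f g using Z that .
  show "AE z in N'. A (\<lambda>x. f x + f' x) z + B (\<lambda>x. g x + g' x) z = A f z + B g z + (A f' z + B g' z)"
    if "f \<in> X" "f' \<in> X" "g \<in> Y" "g' \<in> Y" for f f' g g'
  proof -
    have "AE z in N'. A (\<lambda>x. f x + f' x) z = A f z + A f' z" "AE z in N'. B (\<lambda>x. g x + g' x) z = B g z + B g' z"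
      using A' B' that by auto
    then show ?thesis by eventually_elim simp
  qed
  show "AE z in N'. A (\<lambda>x. c *\<^sub>R f x) z + B (\<lambda>x. c *\<^sub>R g x) z = c *\<^sub>R (A f z + B g z)"
    if "f \<in> X" "g \<in> Y" for f g c
  proof -
    have "AE z in N'. A (\<lambda>x. c *\<^sub>R f x) z = c *\<^sub>R A f z" "AE z in N'. B (\<lambda>x. c *\<^sub>R g x) z = c *\<^sub>R B g z"
      using A' B' that by auto
    then show ?thesis by eventually_elim (simp add: scaleR_add_right)
  qed
  obtain C1 C2 where C: "\<forall>f\<in>X. Lp_norm p N' (A f) \<le> C1 * Lp_norm p N f" "\<forall>g\<in>Y. Lp_norm p N' (B g) \<le> C2 * Lp_norm p N g"
    using A' B' by blast
  show "\<exists>C. \<forall>f\<in>X. \<forall>g\<in>Y. Lp_norm p N' (\<lambda>z. A f z + B g z) \<le> C * (\<nu> f + Lp_norm p N g)"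
  proof (intro exI ballI)
    fix f g assume fg: "f \<in> X" "g \<in> Y"
    show "Lp_norm p N' (\<lambda>z. A f z + B g z) \<le> (2 * (\<bar>C1\<bar> + \<bar>C2\<bar>)) * (\<nu> f + Lp_norm p N g)"
      using fg A' B' C \<nu> by (intro Lp_norm_add_bound[OF p]) auto
  qed
qed

lemma Lp_bounded_linear_subset:
  "Lp_bounded_linear p N X N' A \<Longrightarrow> X' \<subseteq> X \<Longrightarrow> Lp_bounded_linear p N X' N' A"
  unfolding Lp_bounded_linear_def by (meson subsetD)

lemma Lp_norm_multiplier_le:
  fixes f :: "'c \<Rightarrow> real"
  assumes p: "0 < p" and m[measurable]: "m \<in> borel_measurable N'" "\<And>z. \<bar>m z\<bar> \<le> 1" and f: "f \<in> Lp_space p N'"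
  shows "(\<lambda>z. m z * f z) \<in> Lp_space p N'" "Lp_norm p N' (\<lambda>z. m z * f z) \<le> Lp_norm p N' f"
proof -
  have [measurable]: "f \<in> borel_measurable N'" using f by (simp add: Lp_space_iff)
  have le: "norm (m z * f z) \<le> norm (f z)" for z using m(2)[of z] by (simp add: abs_mult mult_left_le_one_le)
  show "(\<lambda>z. m z * f z) \<in> Lp_space p N'"
    using p le by (intro Lp_space_mono[OF _ _ f]) auto
  show "Lp_norm p N' (\<lambda>z. m z * f z) \<le> Lp_norm p N' f"
    using p le by (intro Lp_norm_mono_energy[OF p _ f] Lp_energy_mono) auto
qed

lemma Lp_bounded_linear_multiplier:
  fixes A :: "('a \<Rightarrow> 'b::euclidean_space) \<Rightarrow> 'c \<Rightarrow> real"
  assumes p: "0 < p" and A: "Lp_bounded_linear p N X N' A"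
    and m: "m \<in> borel_measurable N'" "\<And>z. \<bar>m z\<bar> \<le> 1"
  shows "Lp_bounded_linear p N X N' (\<lambda>f z. m z * A f z)"
  unfolding Lp_bounded_linear_def
proof (intro conjI ballI allI)
  note A' = A[unfolded Lp_bounded_linear_def]
  show "(\<lambda>z. m z * A f z) \<in> Lp_space p N'" if "f \<in> X" for f
    using A' that by (intro Lp_norm_multiplier_le(1)[OF p m]) auto
  show "AE z in N'. m z * A (\<lambda>x. f x + g x) z = m z * A f z + m z * A g z" if "f \<in> X" "g \<in> X" for f g
  proof -
    have "AE z in N'. A (\<lambda>x. f x + g x) z = A f z + A g z" using A' that by auto
    then show ?thesis by eventually_elim (simp add: distrib_left)
  qed
  show "AE z in N'. m z * A (\<lambda>x. c *\<^sub>R f x) z = c *\<^sub>R (m z * A f z)" if "f \<in> X" for f c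
  proof -
    have "AE z in N'. A (\<lambda>x. c *\<^sub>R f x) z = c *\<^sub>R A f z" using A' that by auto
    then show ?thesis by eventually_elim simp
  qed
  obtain C where C: "\<forall>f\<in>X. Lp_norm p N' (A f) \<le> C * Lp_norm p N f" using A' by blast
  show "\<exists>C. \<forall>f\<in>X. Lp_norm p N' (\<lambda>z. m z * A f z) \<le> C * Lp_norm p N f"
    using A' C Lp_norm_multiplier_le(2)[OF p m] by (intro exI[of _ C]) (meson order_trans)
qed

context measure_preserving_system
begin

text \<open>
  The discrete product rule gives
  $\nabla_i(\zeta v)(x) = \zeta(x + \varepsilon e_i) \nabla_i v(x) + v(x) \nabla_i \zeta(x)$.
  In the first term the cutoff tends to \<open>1\<close> in \<open>S\<close> and the limit vanishes outside; in the second
  $|\nabla_i\zeta| \le 1/\delta_\varepsilon$, and the last hypothesis makes it small.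
\<close>

lemma cutoff_two_scale:
  fixes v :: "real \<Rightarrow> 'w \<times> (real ^ 'n) \<Rightarrow> real"
  assumes p: "1 < p" and S: "open S" "- S \<noteq> {}"
    and \<delta>: "\<And>\<epsilon>. 0 < \<epsilon> \<Longrightarrow> 0 < \<delta> \<epsilon>" "(\<delta> \<longlongrightarrow> 0) (at_right 0)"
    and v: "\<And>\<epsilon>. 0 < \<epsilon> \<Longrightarrow> v \<epsilon> \<in> Lp_space p (M \<Otimes>\<^sub>M lattice_measure \<epsilon>)"
    and W: "two_scale_tendsto p M T v W" "AE z in M \<Otimes>\<^sub>M lborel. snd z \<notin> S \<longrightarrow> W z = 0"
    and Y: "two_scale_tendsto p M T (\<lambda>\<epsilon> z. c \<epsilon> *\<^sub>R discrete_gradient \<epsilon> (v \<epsilon>) z) Y"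
      "AE z in M \<Otimes>\<^sub>M lborel. snd z \<notin> S \<longrightarrow> Y z = 0"
    and small: "((\<lambda>\<epsilon>. \<bar>c \<epsilon>\<bar> / \<delta> \<epsilon> * Lp_norm p (M \<Otimes>\<^sub>M lattice_measure \<epsilon>) (v \<epsilon>)) \<longlongrightarrow> 0) (at_right 0)"
  shows "two_scale_tendsto p M T (\<lambda>\<epsilon> z. cutoff S (\<delta> \<epsilon>) (snd z) * v \<epsilon> z) W"
    "two_scale_tendsto p M T (\<lambda>\<epsilon> z. c \<epsilon> *\<^sub>R discrete_gradient \<epsilon> (\<lambda>z. cutoff S (\<delta> \<epsilon>) (snd z) * v \<epsilon> z) z) Y"
proof -
  have p0: "0 < p" "0 \<le> p" using p by auto
  have pos: "\<forall>\<^sub>F \<epsilon> in at_right (0::real). 0 < \<epsilon>" by (rule eventually_at_right_less)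
  have \<delta>_pos: "\<forall>\<^sub>F \<epsilon> in at_right 0. 0 < \<delta> \<epsilon>" using pos by eventually_elim (rule \<delta>(1))
  have shift_meas: "(\<lambda>z. cutoff S (\<delta> \<epsilon>) (lattice_floor \<epsilon> (snd z) + a)) \<in> borel_measurable (M \<Otimes>\<^sub>M lborel)" if "0 < \<epsilon>" for \<epsilon> a
  proof -
    note [measurable] = lattice_floor_borel[OF that]
    show ?thesis by measurable
  qed
  have shift_le: "\<bar>cutoff S (\<delta> \<epsilon>) x\<bar> \<le> 1" if "0 < \<epsilon>" for \<epsilon> x using cutoff_bounds(3)[OF \<delta>(1)[OF that]] .
  have shift_lim: "((\<lambda>\<epsilon>. cutoff S (\<delta> \<epsilon>) (lattice_floor \<epsilon> x + \<epsilon> *\<^sub>R a) *\<^sub>R w) \<longlongrightarrow> w) (at_right 0)"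
    if "x \<notin> S \<longrightarrow> w = 0" for x a and w :: "'z::euclidean_space"
  proof (cases "x \<in> S")
    case True
    have "((\<lambda>\<epsilon>. lattice_floor \<epsilon> x + \<epsilon> *\<^sub>R a) \<longlongrightarrow> x + 0 *\<^sub>R a) (at_right 0)"
      by (intro tendsto_intros lattice_floor_tendsto)
    then have "\<forall>\<^sub>F \<epsilon> in at_right 0. cutoff S (\<delta> \<epsilon>) (lattice_floor \<epsilon> x + \<epsilon> *\<^sub>R a) = 1"
      by (intro cutoff_eventually_one[OF S True \<delta>(2) \<delta>_pos]) simp
    then have "\<forall>\<^sub>F \<epsilon> in at_right 0. w = cutoff S (\<delta> \<epsilon>) (lattice_floor \<epsilon> x + \<epsilon> *\<^sub>R a) *\<^sub>R w"
      by eventually_elim simp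
    then show ?thesis by (rule Lim_transform_eventually[OF tendsto_const])
  qed (use that in simp)
  have "Lp_tendsto p (M \<Otimes>\<^sub>M lborel) (\<lambda>\<epsilon> z. cutoff S (\<delta> \<epsilon>) (lattice_floor \<epsilon> (snd z) + \<epsilon> *\<^sub>R 0) *\<^sub>R unfold T \<epsilon> (v \<epsilon>) z) W (at_right 0)"
  proof (rule Lp_tendsto_multiplier[OF p0(1) W(1)[unfolded two_scale_tendsto_def] shift_meas shift_le])
    show "AE z in M \<Otimes>\<^sub>M lborel. ((\<lambda>\<epsilon>. cutoff S (\<delta> \<epsilon>) (lattice_floor \<epsilon> (snd z) + \<epsilon> *\<^sub>R 0) *\<^sub>R W z) \<longlongrightarrow> W z) (at_right 0)"
      using W(2) by eventually_elim (rule shift_lim)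
  qed
  moreover have "unfold T \<epsilon> (\<lambda>z. cutoff S (\<delta> \<epsilon>) (snd z) * v \<epsilon> z) =
      (\<lambda>z. cutoff S (\<delta> \<epsilon>) (lattice_floor \<epsilon> (snd z) + \<epsilon> *\<^sub>R 0) *\<^sub>R unfold T \<epsilon> (v \<epsilon>) z)" for \<epsilon>
    by (simp add: fun_eq_iff unfold_eq unfold_map_def)
  ultimately show "two_scale_tendsto p M T (\<lambda>\<epsilon> z. cutoff S (\<delta> \<epsilon>) (snd z) * v \<epsilon> z) W"
    by (simp only: two_scale_tendsto_def)
  show "two_scale_tendsto p M T (\<lambda>\<epsilon> z. c \<epsilon> *\<^sub>R discrete_gradient \<epsilon> (\<lambda>z. cutoff S (\<delta> \<epsilon>) (snd z) * v \<epsilon> z) z) Y"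
    unfolding two_scale_tendsto_def
  proof (rule Lp_tendsto_vecI[OF p0(1)])
    fix i
    let ?e = "axis i 1 :: real ^ 'n"
    let ?m = "\<lambda>\<epsilon> z. cutoff S (\<delta> \<epsilon>) (lattice_floor \<epsilon> (snd z) + \<epsilon> *\<^sub>R ?e)"
    let ?g = "\<lambda>\<epsilon> z. unfold T \<epsilon> (\<lambda>z. c \<epsilon> *\<^sub>R discrete_gradient \<epsilon> (v \<epsilon>) z) z $ i"
    let ?b = "\<lambda>\<epsilon> z. c \<epsilon> * ((cutoff S (\<delta> \<epsilon>) (lattice_floor \<epsilon> (snd z) + \<epsilon> *\<^sub>R ?e) - cutoff S (\<delta> \<epsilon>) (lattice_floor \<epsilon> (snd z))) / \<epsilon>)"
    have eq: "unfold T \<epsilon> (\<lambda>z. c \<epsilon> *\<^sub>R discrete_gradient \<epsilon> (\<lambda>z. cutoff S (\<delta> \<epsilon>) (snd z) * v \<epsilon> z) z) z $ i =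
       ?m \<epsilon> z *\<^sub>R ?g \<epsilon> z + ?b \<epsilon> z * unfold T \<epsilon> (v \<epsilon>) z" for \<epsilon> z
      by (simp add: unfold_eq unfold_map_def split_beta discrete_gradient_def diff_divide_distrib algebra_simps)
    have "Lp_tendsto p (M \<Otimes>\<^sub>M lborel) ?g (\<lambda>z. Y z $ i) (at_right 0)"
      by (rule Lp_tendsto_component[OF p0(1) Y(1)[unfolded two_scale_tendsto_def]])
    then have 1: "Lp_tendsto p (M \<Otimes>\<^sub>M lborel) (\<lambda>\<epsilon> z. ?m \<epsilon> z *\<^sub>R ?g \<epsilon> z) (\<lambda>z. Y z $ i) (at_right 0)"
    proof (rule Lp_tendsto_multiplier[OF p0(1) _ shift_meas shift_le])
      show "AE z in M \<Otimes>\<^sub>M lborel. ((\<lambda>\<epsilon>. ?m \<epsilon> z *\<^sub>R Y z $ i) \<longlongrightarrow> Y z $ i) (at_right 0)"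
        using Y(2)
      proof eventually_elim
        case (elim z)
        show ?case by (rule shift_lim) (use elim in auto)
      qed
    qed
    have 2: "Lp_tendsto p (M \<Otimes>\<^sub>M lborel) (\<lambda>\<epsilon> z. ?b \<epsilon> z * unfold T \<epsilon> (v \<epsilon>) z) (\<lambda>z. 0) (at_right 0)"
    proof -
      have bd: "(\<lambda>z. ?b \<epsilon> z * unfold T \<epsilon> (v \<epsilon>) z) \<in> Lp_space p (M \<Otimes>\<^sub>M lborel) \<and>
          Lp_norm p (M \<Otimes>\<^sub>M lborel) (\<lambda>z. ?b \<epsilon> z * unfold T \<epsilon> (v \<epsilon>) z) \<le> \<bar>c \<epsilon>\<bar> / \<delta> \<epsilon> * Lp_norm p (M \<Otimes>\<^sub>M lattice_measure \<epsilon>) (v \<epsilon>)"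
        if \<epsilon>: "0 < \<epsilon>" for \<epsilon>
      proof -
        note [measurable] = lattice_floor_borel[OF \<epsilon>]
        have uv: "unfold T \<epsilon> (v \<epsilon>) \<in> Lp_space p (M \<Otimes>\<^sub>M lborel)" by (rule Lp_space_unfold[OF \<epsilon> v[OF \<epsilon>]])
        then have [measurable]: "unfold T \<epsilon> (v \<epsilon>) \<in> borel_measurable (M \<Otimes>\<^sub>M lborel)" by (simp add: Lp_space_iff)
        have b: "\<bar>?b \<epsilon> z\<bar> \<le> \<bar>c \<epsilon>\<bar> / \<delta> \<epsilon>" for z
        proof -
          have "\<bar>cutoff S (\<delta> \<epsilon>) (lattice_floor \<epsilon> (snd z) + \<epsilon> *\<^sub>R ?e) - cutoff S (\<delta> \<epsilon>) (lattice_floor \<epsilon> (snd z))\<bar> \<le> \<epsilon> / \<delta> \<epsilon>"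
            using cutoff_lipschitz[OF \<delta>(1)[OF \<epsilon>], of S "lattice_floor \<epsilon> (snd z) + \<epsilon> *\<^sub>R ?e" "lattice_floor \<epsilon> (snd z)"] \<epsilon>
            by (simp add: dist_norm)
          then have "\<bar>(cutoff S (\<delta> \<epsilon>) (lattice_floor \<epsilon> (snd z) + \<epsilon> *\<^sub>R ?e) - cutoff S (\<delta> \<epsilon>) (lattice_floor \<epsilon> (snd z))) / \<epsilon>\<bar> \<le> 1 / \<delta> \<epsilon>"
            using \<epsilon> \<delta>(1)[OF \<epsilon>] by (simp add: abs_divide field_simps)
          then have "\<bar>?b \<epsilon> z\<bar> \<le> \<bar>c \<epsilon>\<bar> * (1 / \<delta> \<epsilon>)" unfolding abs_mult by (intro mult_left_mono) auto
          then show ?thesis by simp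
        qed
        define k where "k = \<bar>c \<epsilon>\<bar> / \<delta> \<epsilon>"
        have k: "0 \<le> k" using \<delta>(1)[OF \<epsilon>] by (simp add: k_def)
        have ku: "(\<lambda>z. k *\<^sub>R unfold T \<epsilon> (v \<epsilon>) z) \<in> Lp_space p (M \<Otimes>\<^sub>M lborel)" by (rule Lp_space_scaleR[OF uv])
        have le: "norm (?b \<epsilon> z * unfold T \<epsilon> (v \<epsilon>) z) \<le> norm (k *\<^sub>R unfold T \<epsilon> (v \<epsilon>) z)" for z
        proof -
          have "norm (?b \<epsilon> z * unfold T \<epsilon> (v \<epsilon>) z) = norm (?b \<epsilon> z) * norm (unfold T \<epsilon> (v \<epsilon>) z)" by (rule norm_mult)
          also have "\<dots> \<le> k * norm (unfold T \<epsilon> (v \<epsilon>) z)"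
            by (rule mult_right_mono) (use b[of z] in \<open>simp_all only: k_def real_norm_def abs_ge_zero\<close>)
          also have "\<dots> = norm (k *\<^sub>R unfold T \<epsilon> (v \<epsilon>) z)" using k by (simp add: abs_mult)
          finally show ?thesis .
        qed
        have mem: "(\<lambda>z. ?b \<epsilon> z * unfold T \<epsilon> (v \<epsilon>) z) \<in> Lp_space p (M \<Otimes>\<^sub>M lborel)"
          by (rule Lp_space_mono[OF p0(2) _ ku le]) measurable
        have "Lp_norm p (M \<Otimes>\<^sub>M lborel) (\<lambda>z. ?b \<epsilon> z * unfold T \<epsilon> (v \<epsilon>) z) \<le> Lp_norm p (M \<Otimes>\<^sub>M lborel) (\<lambda>z. k *\<^sub>R unfold T \<epsilon> (v \<epsilon>) z)"
          using mem le by (intro Lp_norm_mono_energy[OF p0(1) _ ku] Lp_energy_mono p0) (auto simp: Lp_space_iff)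
        also have "\<dots> = k * Lp_norm p (M \<Otimes>\<^sub>M lborel) (unfold T \<epsilon> (v \<epsilon>))" using k by (simp only: Lp_norm_scaleR[OF p0(1)] abs_of_nonneg)
        also have "\<dots> \<le> k * Lp_norm p (M \<Otimes>\<^sub>M lattice_measure \<epsilon>) (v \<epsilon>)"
          using v[OF \<epsilon>]
          by (intro mult_left_mono[OF _ k] Lp_norm_mono_energy[OF p0(1)])
             (auto simp: Lp_energy_unfold[OF \<epsilon>] Lp_space_iff)
        finally show ?thesis using mem unfolding k_def by blast
      qed
      have "((\<lambda>\<epsilon>. Lp_norm p (M \<Otimes>\<^sub>M lborel) (\<lambda>z. ?b \<epsilon> z * unfold T \<epsilon> (v \<epsilon>) z)) \<longlongrightarrow> 0) (at_right 0)"
        by (rule tendsto_sandwich[OF _ _ tendsto_const small]) (use pos bd in \<open>auto elim!: eventually_mono\<close>)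
      moreover have "\<forall>\<^sub>F \<epsilon> in at_right 0. (\<lambda>z. ?b \<epsilon> z * unfold T \<epsilon> (v \<epsilon>) z) \<in> Lp_space p (M \<Otimes>\<^sub>M lborel)"
        using pos by eventually_elim (use bd in blast)
      ultimately show ?thesis by (simp add: Lp_tendsto_def)
    qed
    from Lp_tendsto_add[OF p0(1) 1 2]
    show "Lp_tendsto p (M \<Otimes>\<^sub>M lborel) (\<lambda>\<epsilon> z. unfold T \<epsilon> (\<lambda>z. c \<epsilon> *\<^sub>R discrete_gradient \<epsilon> (\<lambda>z. cutoff S (\<delta> \<epsilon>) (snd z) * v \<epsilon> z) z) z $ i)
       (\<lambda>z. Y z $ i) (at_right 0)"
      unfolding eq by simp
  qed
qed

end

section \<open>Recovery sequences supported in an open set\<close>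

lemma Lp_energy_sum_le:
  fixes f :: "nat \<Rightarrow> 'a \<Rightarrow> 'b::euclidean_space"
  assumes p: "0 \<le> p" and f: "\<And>j. j < m \<Longrightarrow> f j \<in> borel_measurable N"
  shows "Lp_energy p N (\<lambda>x. \<Sum>j<m. f j x) \<le> ennreal (real m powr p) * (\<Sum>j<m. Lp_energy p N (f j))"
proof (cases "m = 0")
  case True
  then show ?thesis by simp
next
  case False
  have pw: "norm (\<Sum>j<m. f j x) powr p \<le> real m powr p * (\<Sum>j<m. norm (f j x) powr p)" for x
  proof -
    let ?A = "(\<lambda>j. norm (f j x)) ` {..<m}"
    have "Max ?A \<in> ?A" using False by (intro Max_in) auto
    then obtain k where k: "k < m" "Max ?A = norm (f k x)" by blast
    have le: "norm (f j x) \<le> norm (f k x)" if "j < m" for j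
      using Max_ge[of ?A "norm (f j x)"] that k(2) by auto
    have "norm (\<Sum>j<m. f j x) \<le> (\<Sum>j<m. norm (f j x))" by (rule norm_sum)
    also have "\<dots> \<le> real m * norm (f k x)"
      using sum_bounded_above[of "{..<m}" "\<lambda>j. norm (f j x)" "norm (f k x)"] le by simp
    finally have "norm (\<Sum>j<m. f j x) powr p \<le> (real m * norm (f k x)) powr p" using p by (intro powr_mono2) auto
    also have "\<dots> = real m powr p * norm (f k x) powr p" by (simp add: powr_mult)
    also have "\<dots> \<le> real m powr p * (\<Sum>j<m. norm (f j x) powr p)"
      using k(1) by (intro mult_left_mono member_le_sum) auto
    finally show ?thesis .
  qed
  have "Lp_energy p N (\<lambda>x. \<Sum>j<m. f j x) \<le> (\<integral>\<^sup>+x. ennreal (real m powr p) * (\<Sum>j<m. ennreal (norm (f j x) powr p)) \<partial>N)"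
    unfolding Lp_energy_def using pw by (intro nn_integral_mono) (simp flip: ennreal_mult' add: sum_nonneg)
  also have "\<dots> = ennreal (real m powr p) * (\<integral>\<^sup>+x. (\<Sum>j<m. ennreal (norm (f j x) powr p)) \<partial>N)"
    using f by (intro nn_integral_cmult borel_measurable_sum) auto
  also have "(\<integral>\<^sup>+x. (\<Sum>j<m. ennreal (norm (f j x) powr p)) \<partial>N) = (\<Sum>j<m. Lp_energy p N (f j))"
    unfolding Lp_energy_def using f by (intro nn_integral_sum) auto
  finally show ?thesis .
qed

lemma is_weak_gradient_sum:
  fixes \<theta> :: "nat \<Rightarrow> real ^ 'n \<Rightarrow> real"
  assumes p: "1 \<le> p"
    and "\<And>j. j < m \<Longrightarrow> is_weak_gradient S (\<theta> j) (W j)"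
    and "\<And>j. j < m \<Longrightarrow> \<theta> j \<in> Lp_space p lborel" "\<And>j. j < m \<Longrightarrow> W j \<in> Lp_space p lborel"
  shows "is_weak_gradient S (\<lambda>x. \<Sum>j<m. a j *\<^sub>R \<theta> j x) (\<lambda>x. \<Sum>j<m. a j *\<^sub>R W j x)"
  using assms(2-)
proof (induction m)
  case 0
  then show ?case by (simp add: is_weak_gradient_zero)
next
  case (Suc m)
  have p0: "0 \<le> p" using p by simp
  have 1: "is_weak_gradient S (\<lambda>x. \<Sum>j<m. a j *\<^sub>R \<theta> j x) (\<lambda>x. \<Sum>j<m. a j *\<^sub>R W j x)" using Suc by auto
  have 2: "is_weak_gradient S (\<lambda>x. a m *\<^sub>R \<theta> m x) (\<lambda>x. a m *\<^sub>R W m x)"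
    using is_weak_gradient_scaleR[of S "\<theta> m" "W m" "a m"] Suc.prems by simp
  have \<theta>: "(\<lambda>x. a j *\<^sub>R \<theta> j x) \<in> Lp_space p lborel" and W: "(\<lambda>x. a j *\<^sub>R W j x) \<in> Lp_space p lborel"
    if "j < Suc m" for j
    using Suc.prems that by (blast intro: Lp_space_scaleR)+
  show ?case unfolding sum.lessThan_Suc
    by (rule is_weak_gradient_add[OF 1 2 Lp_space_sum[OF p0 \<theta>] Lp_space_sum[OF p0 W] \<theta> W p]) auto
qed

lemma is_weak_gradient_x_diff:
  fixes U U' :: "'w \<times> (real ^ 'n) \<Rightarrow> real"
  assumes p: "1 \<le> p" and "is_weak_gradient_x M U V" "is_weak_gradient_x M U' V'"
    and "U \<in> Lp_space p (M \<Otimes>\<^sub>M lborel)" "V \<in> Lp_space p (M \<Otimes>\<^sub>M lborel)"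
      "U' \<in> Lp_space p (M \<Otimes>\<^sub>M lborel)" "V' \<in> Lp_space p (M \<Otimes>\<^sub>M lborel)"
  shows "is_weak_gradient_x M (\<lambda>z. U z - U' z) (\<lambda>z. V z - V' z)"
  using assms(2,3) assms(4-7)[THEN Lp_space_AE_section[OF sigma_finite_lborel]]
  unfolding is_weak_gradient_x_def
  by eventually_elim (rule is_weak_gradient_diff[OF _ _ _ _ _ _ p])

lemma is_weak_gradient_x_tensor:
  fixes \<theta> :: "nat \<Rightarrow> real ^ 'n \<Rightarrow> real"
  assumes p: "1 \<le> p"
    and "\<And>j. j < m \<Longrightarrow> is_weak_gradient UNIV (\<theta> j) (W j)"
    and "\<And>j. j < m \<Longrightarrow> \<theta> j \<in> Lp_space p lborel" "\<And>j. j < m \<Longrightarrow> W j \<in> Lp_space p lborel"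
  shows "is_weak_gradient_x M (\<lambda>(\<omega>, x). \<Sum>j<m. a j \<omega> *\<^sub>R \<theta> j x) (\<lambda>(\<omega>, x). \<Sum>j<m. a j \<omega> *\<^sub>R W j x)"
  unfolding is_weak_gradient_x_def using is_weak_gradient_sum[OF assms] by simp

lemma tensor_sum_Lp:
  fixes \<theta> :: "nat \<Rightarrow> 'x \<Rightarrow> 'b::euclidean_space"
  assumes p: "0 \<le> p" and N: "sigma_finite_measure N"
    and "\<And>j. j < m \<Longrightarrow> a j \<in> Lp_space p M" "\<And>j. j < m \<Longrightarrow> \<theta> j \<in> Lp_space p N"
  shows "(\<lambda>(\<omega>, x). \<Sum>j<m. a j \<omega> *\<^sub>R \<theta> j x) \<in> Lp_space p (M \<Otimes>\<^sub>M N)"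
    "Lp_energy p (M \<Otimes>\<^sub>M N) (\<lambda>(\<omega>, x). \<Sum>j<m. a j \<omega> *\<^sub>R \<theta> j x) \<le>
      ennreal (real m powr p) * (\<Sum>j<m. Lp_energy p M (a j) * Lp_energy p N (\<theta> j))"
proof -
  have eq: "(\<lambda>(\<omega>, x). \<Sum>j<m. a j \<omega> *\<^sub>R \<theta> j x) = (\<lambda>z. \<Sum>j<m. (\<lambda>(\<omega>, x). a j \<omega> *\<^sub>R \<theta> j x) z)"
    by (simp add: fun_eq_iff)
  have Lp: "(\<lambda>(\<omega>, x). a j \<omega> *\<^sub>R \<theta> j x) \<in> Lp_space p (M \<Otimes>\<^sub>M N)" if "j < m" for j
    using assms that by (intro tensor_product_Lp') auto
  show "(\<lambda>(\<omega>, x). \<Sum>j<m. a j \<omega> *\<^sub>R \<theta> j x) \<in> Lp_space p (M \<Otimes>\<^sub>M N)"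
    unfolding eq by (intro Lp_space_sum p Lp) simp
  have "Lp_energy p (M \<Otimes>\<^sub>M N) (\<lambda>(\<omega>, x). \<Sum>j<m. a j \<omega> *\<^sub>R \<theta> j x) \<le>
      ennreal (real m powr p) * (\<Sum>j<m. Lp_energy p (M \<Otimes>\<^sub>M N) (\<lambda>(\<omega>, x). a j \<omega> *\<^sub>R \<theta> j x))"
    unfolding eq by (rule Lp_energy_sum_le[OF p]) (use Lp in \<open>auto simp: Lp_space_iff\<close>)
  also have "(\<Sum>j<m. Lp_energy p (M \<Otimes>\<^sub>M N) (\<lambda>(\<omega>, x). a j \<omega> *\<^sub>R \<theta> j x)) = (\<Sum>j<m. Lp_energy p M (a j) * Lp_energy p N (\<theta> j))"
    using assms by (intro sum.cong refl Lp_energy_tensor N) (auto simp: Lp_space_iff)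
  finally show "Lp_energy p (M \<Otimes>\<^sub>M N) (\<lambda>(\<omega>, x). \<Sum>j<m. a j \<omega> *\<^sub>R \<theta> j x) \<le>
      ennreal (real m powr p) * (\<Sum>j<m. Lp_energy p M (a j) * Lp_energy p N (\<theta> j))" .
qed

lemma ennreal_small_factor:
  fixes H :: ennreal
  assumes "H < \<infinity>" "0 < (d::real)" "0 < p"
  shows "\<exists>t>0. H * ennreal (t powr p) \<le> ennreal d"
proof -
  obtain h where h: "H = ennreal h" "0 \<le> h" using assms(1) by (cases H) auto
  define t where "t = (d / (h + 1)) powr (1 / p)"
  have "h * (d / (h + 1)) \<le> (h + 1) * (d / (h + 1))" using h assms by (intro mult_right_mono) auto
  also have "\<dots> = d" using h by simp
  finally have "h * (d / (h + 1)) \<le> d" .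
  moreover have "t powr p = d / (h + 1)" using h assms by (simp add: t_def powr_powr)
  ultimately have "H * ennreal (t powr p) \<le> ennreal d"
    using h assms by (simp flip: ennreal_mult add: ennreal_leI)
  moreover have "0 < t" using h assms by (simp add: t_def)
  ultimately show ?thesis by blast
qed

lemma Lp_energy_le_of_norm:
  assumes "0 < p" "f \<in> Lp_space p N" "Lp_norm p N f \<le> t"
  shows "Lp_energy p N f \<le> ennreal (t powr p)"
  using assms by (simp add: Lp_energy_eq_norm powr_mono2 ennreal_leI)

text \<open>
  First \<open>U\<close> is approximated by an element $g_0$ of the span, then each of its factors $\eta_j$ by
  a test function with \<open>W1p_0_approx\<close>. The gradient of the result \<open>g\<close> is defined as
  $\nabla U$ minus the gradients of the two errors $U - g_0$ and $g_0 - g$. It is close to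
  $\nabla U$ by construction, whichever weak gradients were chosen.
\<close>

lemma sobolev_tensor_test_approx:
  fixes U :: "'w \<times> (real ^ 'n) \<Rightarrow> real"
  assumes p: "1 < p" and S: "open S" and X: "X \<subseteq> Lp_space p M"
    and U: "U \<in> sobolev_tensor p M X (W1p_0 p S)" and \<delta>: "0 < \<delta>"
  shows "\<exists>g\<in>tensor_span X (test_functions S). \<exists>Z\<in>Lp_space p (M \<Otimes>\<^sub>M lborel). is_weak_gradient_x M g Z \<and>
    Lp_energy p (M \<Otimes>\<^sub>M lborel) (\<lambda>z. U z - g z) \<le> ennreal \<delta> \<and>
    Lp_energy p (M \<Otimes>\<^sub>M lborel) (\<lambda>z. weak_gradient_x p M U z - Z z) \<le> ennreal \<delta>"
proof -
  have p1: "1 \<le> p" "0 \<le> p" "0 < p" using p by auto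
  define d where "d = \<delta> / (2 powr p * 2)"
  have d: "0 < d" "2 powr p * (d + d) = \<delta>" using \<delta> by (auto simp: d_def)
  have U_W: "U \<in> Lp_W1p p M" using U by (simp add: sobolev_tensor_def)
  have U_Lp: "U \<in> Lp_space p (M \<Otimes>\<^sub>M lborel)" using U_W by (simp add: Lp_W1p_def)
  let ?V = "weak_gradient_x p M U"
  note V = weak_gradient_x_spec[OF U_W]
  have "0 < d powr (1 / p)" using d(1) by simp
  then have "\<exists>g0\<in>tensor_span X (W1p_0 p S). Lp_W1p_norm p M (\<lambda>z. U z - g0 z) < d powr (1 / p)"
    using U by (simp add: sobolev_tensor_def)
  then obtain g0 where g0: "g0 \<in> tensor_span X (W1p_0 p S)" "Lp_W1p_norm p M (\<lambda>z. U z - g0 z) < d powr (1 / p)" by blast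
  then obtain m :: nat and c \<phi> \<eta> where *: "\<forall>j<m. \<phi> j \<in> X \<and> \<eta> j \<in> W1p_0 p S"
    "g0 = (\<lambda>(\<omega>, x). \<Sum>j<m. c j *\<^sub>R (\<eta> j x *\<^sub>R \<phi> j \<omega>))"
    unfolding tensor_span_def by blast
  define a where "a j \<omega> = c j *\<^sub>R \<phi> j \<omega>" for j \<omega>
  have a: "a j \<in> Lp_space p M" if "j < m" for j
  proof -
    have "\<phi> j \<in> Lp_space p M" using *(1) X that by blast
    from Lp_space_scaleR[OF this, of "c j"] show ?thesis by (simp add: a_def[abs_def])
  qed
  define H where "H = ennreal (real m powr p) * (\<Sum>j<m. Lp_energy p M (a j))"
  have "H < \<infinity>" unfolding H_def using a by (auto simp: ennreal_mult_less_top Lp_space_iff)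
  then obtain t where t: "0 < t" "H * ennreal (t powr p) \<le> ennreal d"
    using ennreal_small_factor[OF _ d(1) p1(3)] by blast
  define good where "good j \<psi> W \<longleftrightarrow> \<psi> \<in> test_functions S \<and> W \<in> Lp_space p lborel \<and>
    is_weak_gradient UNIV (\<lambda>x. \<eta> j x - \<psi> x) W \<and>
    Lp_norm p lborel (\<lambda>x. \<eta> j x - \<psi> x) < t \<and> Lp_norm p lborel W < t" for j \<psi> W
  have "\<exists>\<psi> W. good j \<psi> W" if "j < m" for j
    using W1p_0_approx[OF S p _ t(1), of "\<eta> j"] *(1) that unfolding good_def by blast
  then obtain \<psi> W where good: "\<And>j. j < m \<Longrightarrow> good j (\<psi> j) (W j)" by metis
  have \<psi>: "\<psi> j \<in> test_functions S" and W: "W j \<in> Lp_space p lborel"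
    and grad: "is_weak_gradient UNIV (\<lambda>x. \<eta> j x - \<psi> j x) (W j)"
    and close: "Lp_norm p lborel (\<lambda>x. \<eta> j x - \<psi> j x) < t" "Lp_norm p lborel (W j) < t" if "j < m" for j
    using good[OF that] by (auto simp: good_def)
  have \<eta>: "\<eta> j \<in> Lp_space p lborel" if "j < m" for j using *(1) that by (auto simp: W1p_0_def W1p_def Lp_on_def)
  have \<psi>_Lp: "\<psi> j \<in> Lp_space p lborel" "classical_gradient (\<psi> j) \<in> Lp_space p lborel" if "j < m" for j
    using test_function_Lp(1)[OF \<psi>[OF that] p1(3)] classical_gradient_Lp[OF \<psi>[OF that] p1(3)] by auto
  have diff: "(\<lambda>x. \<eta> j x - \<psi> j x) \<in> Lp_space p lborel" if "j < m" for j
    using that by (intro Lp_space_diff p1 \<eta> \<psi>_Lp)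
  define g where "g = (\<lambda>(\<omega>, x). \<Sum>j<m. c j *\<^sub>R (\<psi> j x *\<^sub>R \<phi> j \<omega>))"
  define R where "R = (\<lambda>(\<omega>, x). \<Sum>j<m. a j \<omega> *\<^sub>R (\<eta> j x - \<psi> j x))"
  define Q where "Q = (\<lambda>(\<omega>, x). \<Sum>j<m. a j \<omega> *\<^sub>R W j x)"
  have g_eq: "g0 z - R z = g z" for z
  proof (cases z)
    case (Pair \<omega> x)
    have "(\<Sum>j<m. c j *\<^sub>R (\<eta> j x *\<^sub>R \<phi> j \<omega>)) - (\<Sum>j<m. a j \<omega> *\<^sub>R (\<eta> j x - \<psi> j x)) =
        (\<Sum>j<m. c j *\<^sub>R (\<psi> j x *\<^sub>R \<phi> j \<omega>))"
      unfolding sum_subtractf[symmetric] a_def by (intro sum.cong) (auto simp: algebra_simps)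
    then show ?thesis by (simp add: Pair *(2) g_def R_def)
  qed
  have R: "R \<in> Lp_space p (M \<Otimes>\<^sub>M lborel)" and R_le: "Lp_energy p (M \<Otimes>\<^sub>M lborel) R \<le>
      ennreal (real m powr p) * (\<Sum>j<m. Lp_energy p M (a j) * Lp_energy p lborel (\<lambda>x. \<eta> j x - \<psi> j x))"
    unfolding R_def using tensor_sum_Lp[OF p1(2) sigma_finite_lborel a diff] by auto
  have Q: "Q \<in> Lp_space p (M \<Otimes>\<^sub>M lborel)" and Q_le: "Lp_energy p (M \<Otimes>\<^sub>M lborel) Q \<le>
      ennreal (real m powr p) * (\<Sum>j<m. Lp_energy p M (a j) * Lp_energy p lborel (W j))"
    unfolding Q_def using tensor_sum_Lp[OF p1(2) sigma_finite_lborel a W] by auto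
  have small: "ennreal (real m powr p) * (\<Sum>j<m. Lp_energy p M (a j) * e j) \<le> ennreal d"
    if "\<And>j. j < m \<Longrightarrow> e j \<le> ennreal (t powr p)" for e
  proof -
    have "ennreal (real m powr p) * (\<Sum>j<m. Lp_energy p M (a j) * e j) \<le>
       ennreal (real m powr p) * (\<Sum>j<m. Lp_energy p M (a j) * ennreal (t powr p))"
      using that by (intro mult_left_mono sum_mono) auto
    also have "\<dots> = H * ennreal (t powr p)" by (simp add: H_def sum_distrib_right mult.assoc)
    finally show ?thesis using t(2) by simp
  qed
  have R_small: "Lp_energy p (M \<Otimes>\<^sub>M lborel) R \<le> ennreal d"
    by (rule order_trans[OF R_le small]) (rule Lp_energy_le_of_norm[OF p1(3) diff less_imp_le[OF close(1)]]; assumption)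
  have Q_small: "Lp_energy p (M \<Otimes>\<^sub>M lborel) Q \<le> ennreal d"
    by (rule order_trans[OF Q_le small]) (rule Lp_energy_le_of_norm[OF p1(3) W less_imp_le[OF close(2)]]; assumption)
  have RQ: "is_weak_gradient_x M R Q"
    unfolding R_def Q_def by (rule is_weak_gradient_x_tensor[OF p1(1) grad diff W])
  \<comment> \<open>weak gradients of the factors of \<open>g0\<close> on the whole space, needed to see that \<open>U - g0\<close> has one\<close>
  define W0 where "W0 j x = W j x + classical_gradient (\<psi> j) x" for j x
  have W0: "W0 j \<in> Lp_space p lborel" if "j < m" for j
    using Lp_space_add[OF p1(2) W[OF that] \<psi>_Lp(2)[OF that]] by (simp add: W0_def[abs_def])
  have grad0: "is_weak_gradient UNIV (\<eta> j) (W0 j)" if "j < m" for j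
    using is_weak_gradient_add[OF grad[OF that] classical_is_weak_gradient[OF \<psi>[OF that]] diff[OF that] W[OF that] \<psi>_Lp[OF that] p1(1)]
    by (simp add: W0_def[abs_def])
  have g0_eq: "g0 = (\<lambda>(\<omega>, x). \<Sum>j<m. a j \<omega> *\<^sub>R \<eta> j x)"
    by (simp add: *(2) a_def fun_eq_iff mult_ac)
  have g0_Lp: "g0 \<in> Lp_space p (M \<Otimes>\<^sub>M lborel)" unfolding g0_eq by (rule tensor_sum_Lp[OF p1(2) sigma_finite_lborel a \<eta>])
  have G0: "(\<lambda>(\<omega>, x). \<Sum>j<m. a j \<omega> *\<^sub>R W0 j x) \<in> Lp_space p (M \<Otimes>\<^sub>M lborel)"
    by (rule tensor_sum_Lp[OF p1(2) sigma_finite_lborel a W0])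
  have g0_grad: "is_weak_gradient_x M g0 (\<lambda>(\<omega>, x). \<Sum>j<m. a j \<omega> *\<^sub>R W0 j x)"
    unfolding g0_eq by (rule is_weak_gradient_x_tensor[OF p1(1) grad0 \<eta> W0])
  have Ug0_Lp: "(\<lambda>z. U z - g0 z) \<in> Lp_space p (M \<Otimes>\<^sub>M lborel)" by (rule Lp_space_diff[OF p1(2) U_Lp g0_Lp])
  have Ug0: "(\<lambda>z. U z - g0 z) \<in> Lp_W1p p M"
    unfolding Lp_W1p_def
    using Ug0_Lp is_weak_gradient_x_diff[OF p1(1) V(2) g0_grad U_Lp V(1) g0_Lp G0] Lp_space_diff[OF p1(2) V(1) G0] by blast
  define Z1 where "Z1 = weak_gradient_x p M (\<lambda>z. U z - g0 z)"
  note Z1 = weak_gradient_x_spec[OF Ug0, folded Z1_def]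
  have dp: "(d powr (1 / p)) powr p = d" using d(1) p1 by (simp add: powr_powr)
  have Ug0_small: "Lp_energy p (M \<Otimes>\<^sub>M lborel) (\<lambda>z. U z - g0 z) \<le> ennreal d"
    using Lp_energy_le_of_norm[OF p1(3) Ug0_Lp, of "d powr (1 / p)"] g0(2) Lp_W1p_norm_ge(1)[OF p1(3), of M "\<lambda>z. U z - g0 z"] dp by simp
  have Z1_small: "Lp_energy p (M \<Otimes>\<^sub>M lborel) Z1 \<le> ennreal d"
    using Lp_energy_le_of_norm[OF p1(3) Z1(1), of "d powr (1 / p)"] g0(2) Lp_W1p_norm_ge(2)[OF p1(3), of M "\<lambda>z. U z - g0 z"] dp
    by (simp add: Z1_def)
  \<comment> \<open>\<open>g = U - (U - g0) - R\<close>, so this is a weak gradient of \<open>g\<close>\<close>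
  define Z where "Z z = (?V z - Z1 z) - Q z" for z
  have VZ1: "(\<lambda>z. ?V z - Z1 z) \<in> Lp_space p (M \<Otimes>\<^sub>M lborel)" by (rule Lp_space_diff[OF p1(2) V(1) Z1(1)])
  have Z: "Z \<in> Lp_space p (M \<Otimes>\<^sub>M lborel)" unfolding Z_def[abs_def] by (rule Lp_space_diff[OF p1(2) VZ1 Q])
  have g0': "is_weak_gradient_x M g0 (\<lambda>z. ?V z - Z1 z)"
    using is_weak_gradient_x_diff[OF p1(1) V(2) Z1(2) U_Lp V(1) Ug0_Lp Z1(1)] by simp
  have gZ: "is_weak_gradient_x M g Z"
    using is_weak_gradient_x_diff[OF p1(1) g0' RQ g0_Lp VZ1 R Q] unfolding g_eq Z_def[abs_def] .
  have sum: "Lp_energy p (M \<Otimes>\<^sub>M lborel) (\<lambda>z. f z + h z) \<le> ennreal \<delta>"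
    if "f \<in> Lp_space p (M \<Otimes>\<^sub>M lborel)" "h \<in> Lp_space p (M \<Otimes>\<^sub>M lborel)"
      "Lp_energy p (M \<Otimes>\<^sub>M lborel) f \<le> ennreal d" "Lp_energy p (M \<Otimes>\<^sub>M lborel) h \<le> ennreal d"
    for f h :: "'w \<times> (real ^ 'n) \<Rightarrow> 'z::euclidean_space"
  proof -
    have "Lp_energy p (M \<Otimes>\<^sub>M lborel) (\<lambda>z. f z + h z) \<le> ennreal (2 powr p) * (Lp_energy p (M \<Otimes>\<^sub>M lborel) f + Lp_energy p (M \<Otimes>\<^sub>M lborel) h)"
      using that p1 by (intro Lp_energy_add) (auto simp: Lp_space_iff)
    also have "\<dots> \<le> ennreal (2 powr p) * (ennreal d + ennreal d)" using that by (intro mult_left_mono add_mono) auto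
    also have "\<dots> = ennreal (2 powr p * (d + d))" using d(1) by (simp add: ennreal_mult del: ennreal_plus add: ennreal_plus[symmetric])
    finally show ?thesis using d(2) by simp
  qed
  have "(\<lambda>z. U z - g z) = (\<lambda>z. (U z - g0 z) + R z)" unfolding g_eq[symmetric] by auto
  then have 1: "Lp_energy p (M \<Otimes>\<^sub>M lborel) (\<lambda>z. U z - g z) \<le> ennreal \<delta>"
    using sum[OF Ug0_Lp R Ug0_small R_small] by simp
  have "(\<lambda>z. ?V z - Z z) = (\<lambda>z. Z1 z + Q z)" by (simp add: Z_def fun_eq_iff)
  then have 2: "Lp_energy p (M \<Otimes>\<^sub>M lborel) (\<lambda>z. ?V z - Z z) \<le> ennreal \<delta>"
    using sum[OF Z1(1) Q Z1_small Q_small] by simp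
  have "g \<in> tensor_span X (test_functions S)"
    unfolding tensor_span_def g_def mem_Collect_eq using *(1) \<psi> by blast
  then show ?thesis using Z gZ 1 2 by blast
qed

text \<open>
  If for each tolerance suitable elements exist for all small \<open>\<epsilon>\<close>, then one family serves all
  tolerances: choose \<open>u \<epsilon>\<close> with error at most \<open>\<epsilon>\<close> above the infimum. This replaces a diagonal
  argument.
\<close>

lemma exists_near_minimiser:
  fixes e :: "real \<Rightarrow> 'v \<Rightarrow> ennreal"
  assumes ne: "\<And>\<epsilon>. 0 < \<epsilon> \<Longrightarrow> A \<epsilon> \<noteq> {}"
    and ev: "\<And>\<delta>::real. 0 < \<delta> \<Longrightarrow> \<forall>\<^sub>F \<epsilon> in at_right 0. \<exists>v\<in>A \<epsilon>. e \<epsilon> v \<le> ennreal \<delta>"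
  shows "\<exists>u. (\<forall>\<epsilon>>0. u \<epsilon> \<in> A \<epsilon>) \<and> ((\<lambda>\<epsilon>. e \<epsilon> (u \<epsilon>)) \<longlongrightarrow> 0) (at_right 0)"
proof -
  have "\<exists>v\<in>A \<epsilon>. e \<epsilon> v \<le> (INF w\<in>A \<epsilon>. e \<epsilon> w) + ennreal \<epsilon>" if "0 < \<epsilon>" for \<epsilon>
  proof (cases "(INF w\<in>A \<epsilon>. e \<epsilon> w) = \<infinity>")
    case True
    then show ?thesis using ne[OF that] by auto
  next
    case False
    then have "(INF w\<in>A \<epsilon>. e \<epsilon> w) < (INF w\<in>A \<epsilon>. e \<epsilon> w) + ennreal \<epsilon>"
      using that by (simp add: ennreal_add_left_cancel_less[of _ 0, simplified] less_top)
    then show ?thesis unfolding INF_less_iff by (auto intro: less_imp_le)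
  qed
  then obtain u where u: "\<And>\<epsilon>. 0 < \<epsilon> \<Longrightarrow> u \<epsilon> \<in> A \<epsilon>"
    "\<And>\<epsilon>. 0 < \<epsilon> \<Longrightarrow> e \<epsilon> (u \<epsilon>) \<le> (INF w\<in>A \<epsilon>. e \<epsilon> w) + ennreal \<epsilon>" by metis
  have "((\<lambda>\<epsilon>. e \<epsilon> (u \<epsilon>)) \<longlongrightarrow> 0) (at_right 0)"
  proof (rule ennreal_tendsto_zeroI)
    fix \<delta> :: real assume \<delta>: "0 < \<delta>"
    have "\<forall>\<^sub>F \<epsilon> in at_right 0. \<epsilon> < \<delta> / 2" using \<delta> by (intro eventually_at_rightI[of 0 "\<delta> / 2"]) auto
    moreover have "\<forall>\<^sub>F \<epsilon> in at_right 0. \<exists>v\<in>A \<epsilon>. e \<epsilon> v \<le> ennreal (\<delta> / 2)" using ev \<delta> by simp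
    ultimately show "\<forall>\<^sub>F \<epsilon> in at_right 0. e \<epsilon> (u \<epsilon>) \<le> ennreal \<delta>"
      using eventually_at_right_less[of "0::real"]
    proof eventually_elim
      case (elim \<epsilon>)
      then obtain v where v: "v \<in> A \<epsilon>" "e \<epsilon> v \<le> ennreal (\<delta> / 2)" by blast
      have "e \<epsilon> (u \<epsilon>) \<le> (INF w\<in>A \<epsilon>. e \<epsilon> w) + ennreal \<epsilon>" by (rule u(2)[OF elim(3)])
      also have "\<dots> \<le> ennreal (\<delta> / 2) + ennreal (\<delta> / 2)"
        using INF_lower[OF v(1), of "e \<epsilon>"] v(2) elim(1) by (intro add_mono) (auto intro: order_trans ennreal_leI)
      also have "\<dots> = ennreal \<delta>" using \<delta> by (simp flip: ennreal_plus)
      finally show ?case .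
    qed
  qed
  then show ?thesis using u(1) by blast
qed

lemma Lp_closure_superset:
  assumes "A \<subseteq> Lp_space p N"
  shows "A \<subseteq> Lp_closure p N A"
proof
  fix f assume f: "f \<in> A"
  have "Lp_norm p N (\<lambda>x. f x - f x) = 0" by (simp add: Lp_norm_def)
  then show "f \<in> Lp_closure p N A" using f assms unfolding Lp_closure_def by (auto intro!: bexI[of _ f])
qed

context measure_preserving_system
begin

definition lattice_functions_on :: "real \<Rightarrow> (real ^ 'n) set \<Rightarrow> real \<Rightarrow> ('w \<times> (real ^ 'n) \<Rightarrow> real) set" where
  "lattice_functions_on p S \<epsilon> = {v \<in> Lp_space p (M \<Otimes>\<^sub>M lattice_measure \<epsilon>).
     \<forall>\<omega>\<in>space M. \<forall>y\<in>scaled_lattice \<epsilon> - S. v (\<omega>, y) = 0}"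

lemma lattice_functions_on_tensor:
  assumes "0 < p" "0 < \<epsilon>" "bounded S" "v \<in> lattice_functions_on p S \<epsilon>"
  shows "v \<in> tensor p M (lattice_measure \<epsilon>) (Lp_space p M) (Lp_lattice_0 p \<epsilon> S)"
  using assms by (intro tensor_of_vanishing sigma_finite_measure_axioms) (auto simp: lattice_functions_on_def)

text \<open>
  The test functions involved are supported in one compact subset of \<open>S\<close>, at positive distance
  from the complement. Once the cells are smaller than this distance, a cell around a lattice
  point outside \<open>S\<close> misses the compact set.
\<close>

lemma folding_eventually_supported:
  fixes g :: "'w \<times> (real ^ 'n) \<Rightarrow> real"
  assumes S: "open S" and g: "g \<in> tensor_span X (test_functions S)"
  shows "\<forall>\<^sub>F \<epsilon> in at_right 0. \<forall>\<omega>. \<forall>y\<in>scaled_lattice \<epsilon> - S. folding_op T \<epsilon> g (\<omega>, y) = 0"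
proof -
  obtain m :: nat and c \<phi> \<psi> where *: "\<forall>j<m. \<phi> j \<in> X \<and> \<psi> j \<in> test_functions S"
    "g = (\<lambda>(\<omega>, x). \<Sum>j<m. c j *\<^sub>R (\<psi> j x *\<^sub>R \<phi> j \<omega>))"
    using g unfolding tensor_span_def by blast
  define K where "K = (\<Union>j\<in>{..<m}. closure {x. \<psi> j x \<noteq> 0})"
  have K: "compact K" "K \<subseteq> S" using *(1) by (auto simp: K_def test_functions_def intro!: compact_UN)
  obtain d where d: "0 < d" "\<forall>x\<in>K. \<forall>y\<in>- S. d \<le> dist x y"
    using separate_compact_closed[OF K(1), of "- S"] S K(2) by auto
  have g0: "g (\<omega>, x) = 0" if "x \<notin> K" for \<omega> x
  proof -
    have "\<psi> j x = 0" if "j < m" for j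
      using \<open>x \<notin> K\<close> that closure_subset[of "{x. \<psi> j x \<noteq> 0}"] by (auto simp: K_def)
    then show ?thesis by (simp add: *(2))
  qed
  have "\<forall>\<^sub>F \<epsilon> in at_right 0. \<epsilon> < d / real CARD('n)"
    using d(1) by (intro eventually_at_rightI[of 0 "d / real CARD('n)"]) auto
  then show ?thesis using eventually_at_right_less[of "0::real"]
  proof eventually_elim
    case (elim \<epsilon>)
    show ?case
    proof (intro allI ballI)
      fix \<omega> and y :: "real ^ 'n" assume y: "y \<in> scaled_lattice \<epsilon> - S"
      have "g (\<omega>', x) = 0" if x: "x \<in> cell \<epsilon> y" for \<omega>' x
      proof -
        have "lattice_floor \<epsilon> x = y" using lattice_floor_eq_iff[OF elim(2)] y x by blast
        then have "dist y x \<le> real CARD('n) * \<epsilon>" using dist_lattice_floor_le[OF elim(2), of x] by simp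
        also have "\<dots> < d" using elim by (simp add: field_simps)
        finally have "dist x y < d" by (simp add: dist_commute)
        then have "x \<notin> K" using d(2) y by force
        then show ?thesis by (rule g0)
      qed
      then have zero: "indicator (cell \<epsilon> y) x *\<^sub>R g (\<omega>', x) = 0" for \<omega>' x by (cases "x \<in> cell \<epsilon> y") auto
      have "(LINT x:cell \<epsilon> y|lborel. g (\<omega>', x)) = 0" for \<omega>'
        unfolding set_lebesgue_integral_def zero by simp
      then show "folding_op T \<epsilon> g (\<omega>, y) = 0"
        by (simp add: folding_op_def cell_average_def cell_eq_image[OF elim(2), symmetric])
    qed
  qed
qed

text \<open>
  The error of a lattice function is the sum of the distances of its unfolding to \<open>U\<close> and of the
  unfolding of its gradient to $\nabla U$. Foldings of the functions from
  \<open>sobolev_tensor_test_approx\<close> are eventually supported in \<open>S\<close> and have small error.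
\<close>

lemma supported_recovery_sequence:
  fixes U :: "'w \<times> (real ^ 'n) \<Rightarrow> real"
  assumes p: "1 < p" and S: "open S" and U: "U \<in> sobolev_tensor p M (Lp_inv p M T) (W1p_0 p S)"
  shows "\<exists>u. (\<forall>\<epsilon>>0. u \<epsilon> \<in> lattice_functions_on p S \<epsilon>) \<and> two_scale_tendsto p M T u U \<and>
    two_scale_tendsto p M T (\<lambda>\<epsilon>. discrete_gradient \<epsilon> (u \<epsilon>)) (weak_gradient_x p M U)"
proof -
  have p1: "1 \<le> p" "0 \<le> p" "0 < p" using p by auto
  have U_W: "U \<in> Lp_W1p p M" using U by (simp add: sobolev_tensor_def)
  have U_Lp: "U \<in> Lp_space p (M \<Otimes>\<^sub>M lborel)" using U_W by (simp add: Lp_W1p_def)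
  let ?V = "weak_gradient_x p M U"
  note V = weak_gradient_x_spec[OF U_W]
  have UV_meas: "U \<in> borel_measurable (M \<Otimes>\<^sub>M lborel)" "?V \<in> borel_measurable (M \<Otimes>\<^sub>M lborel)"
    using U_Lp V(1) by (auto simp: Lp_space_iff)
  define e where "e \<epsilon> v = Lp_energy p (M \<Otimes>\<^sub>M lborel) (\<lambda>z. unfold T \<epsilon> v z - U z) +
    Lp_energy p (M \<Otimes>\<^sub>M lborel) (\<lambda>z. unfold T \<epsilon> (discrete_gradient \<epsilon> v) z - ?V z)" for \<epsilon> v
  have "\<exists>u. (\<forall>\<epsilon>>0. u \<epsilon> \<in> lattice_functions_on p S \<epsilon>) \<and> ((\<lambda>\<epsilon>. e \<epsilon> (u \<epsilon>)) \<longlongrightarrow> 0) (at_right 0)"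
  proof (rule exists_near_minimiser)
    have "(\<lambda>z. 0) \<in> lattice_functions_on p S \<epsilon>" for \<epsilon> by (simp add: lattice_functions_on_def)
    then show "lattice_functions_on p S \<epsilon> \<noteq> {}" for \<epsilon> by blast
    fix \<delta> :: real assume \<delta>: "0 < \<delta>"
    define d where "d = \<delta> / (2 powr p * 4)"
    have d: "0 < d" "2 powr p * (d + d) = \<delta> / 2" using \<delta> by (auto simp: d_def)
    obtain g Z where g: "g \<in> tensor_span (Lp_inv p M T) (test_functions S)" and Z: "Z \<in> Lp_space p (M \<Otimes>\<^sub>M lborel)"
      and gZ: "is_weak_gradient_x M g Z"
      and gU: "Lp_energy p (M \<Otimes>\<^sub>M lborel) (\<lambda>z. U z - g z) \<le> ennreal d"
      and ZV: "Lp_energy p (M \<Otimes>\<^sub>M lborel) (\<lambda>z. ?V z - Z z) \<le> ennreal d"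
      using sobolev_tensor_test_approx[OF p S Lp_inv_Lp U d(1)] by blast
    have tf: "test_functions S \<subseteq> Lp_space p lborel" using test_function_Lp(1)[OF _ p1(3)] by blast
    have span: "tensor_span (Lp_inv p M T) (test_functions S) \<subseteq> Lp_space p (M \<Otimes>\<^sub>M lborel)"
      by (rule tensor_span_Lp[OF sigma_finite_lborel Lp_inv_Lp tf p1(2)])
    have g_Lp: "g \<in> Lp_space p (M \<Otimes>\<^sub>M lborel)" using span g by blast
    have "g \<in> tensor p M lborel (Lp_inv p M T) (test_functions S)"
      using Lp_closure_superset[OF span] g by (auto simp: tensor_def)
    note inv = tensor_invariant[OF p1(3) tf this]
    have c1: "\<forall>\<^sub>F \<epsilon> in at_right 0. Lp_energy p (M \<Otimes>\<^sub>M lborel) (\<lambda>z. unfold T \<epsilon> (folding_op T \<epsilon> g) z - g z) < ennreal d"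
      using folding_two_scale[OF p g_Lp] d(1) by (auto simp: two_scale_tendsto_def Lp_tendsto_iff_energy[OF p1(3)] intro: ennreal_tendsto_zeroD)
    have c2: "\<forall>\<^sub>F \<epsilon> in at_right 0. Lp_energy p (M \<Otimes>\<^sub>M lborel) (\<lambda>z. unfold T \<epsilon> (discrete_gradient \<epsilon> (folding_op T \<epsilon> g)) z - Z z) < ennreal d"
      using folding_gradient_two_scale[OF p g_Lp Z gZ inv] d(1) by (auto simp: two_scale_tendsto_def Lp_tendsto_iff_energy[OF p1(3)] intro: ennreal_tendsto_zeroD)
    have tri: "Lp_energy p (M \<Otimes>\<^sub>M lborel) (\<lambda>z. f z - l z) \<le> ennreal (\<delta> / 2)"
      if "f \<in> borel_measurable (M \<Otimes>\<^sub>M lborel)" "h \<in> borel_measurable (M \<Otimes>\<^sub>M lborel)" "l \<in> borel_measurable (M \<Otimes>\<^sub>M lborel)"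
        "Lp_energy p (M \<Otimes>\<^sub>M lborel) (\<lambda>z. f z - h z) < ennreal d" "Lp_energy p (M \<Otimes>\<^sub>M lborel) (\<lambda>z. l z - h z) \<le> ennreal d"
      for f h l :: "'w \<times> (real ^ 'n) \<Rightarrow> 'z::euclidean_space"
    proof -
      have "Lp_energy p (M \<Otimes>\<^sub>M lborel) (\<lambda>z. f z - l z) \<le>
          ennreal (2 powr p) * (Lp_energy p (M \<Otimes>\<^sub>M lborel) (\<lambda>z. f z - h z) + Lp_energy p (M \<Otimes>\<^sub>M lborel) (\<lambda>z. h z - l z))"
        by (rule Lp_energy_triangle[OF that(1-3) p1(2)])
      also have "\<dots> \<le> ennreal (2 powr p) * (ennreal d + ennreal d)"
        using that(4,5) Lp_energy_minus_commute[of p "M \<Otimes>\<^sub>M lborel" h l] by (intro mult_left_mono add_mono) auto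
      also have "\<dots> = ennreal (2 powr p * (d + d))" using d(1) by (simp add: ennreal_mult del: ennreal_plus add: ennreal_plus[symmetric])
      finally show ?thesis unfolding d(2) .
    qed
    show "\<forall>\<^sub>F \<epsilon> in at_right 0. \<exists>v\<in>lattice_functions_on p S \<epsilon>. e \<epsilon> v \<le> ennreal \<delta>"
      using c1 c2 folding_eventually_supported[OF S g] eventually_at_right_less[of "0::real"]
    proof eventually_elim
      case (elim \<epsilon>)
      have g_meas: "g \<in> borel_measurable (M \<Otimes>\<^sub>M lborel)" "Z \<in> borel_measurable (M \<Otimes>\<^sub>M lborel)" using g_Lp Z by (auto simp: Lp_space_iff)
      note f_meas = folding_measurable[OF elim(4) g_meas(1)]
      have "folding_op T \<epsilon> g \<in> lattice_functions_on p S \<epsilon>"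
        using folding_Lp(1)[OF p elim(4) g_Lp] elim(3) by (simp add: lattice_functions_on_def)
      moreover have "e \<epsilon> (folding_op T \<epsilon> g) \<le> ennreal (\<delta> / 2) + ennreal (\<delta> / 2)"
        unfolding e_def
        by (intro add_mono tri[OF _ g_meas(1) UV_meas(1) elim(1) gU] tri[OF _ g_meas(2) UV_meas(2) elim(2) ZV]
            unfold_measurable[OF elim(4)] f_meas discrete_gradient_measurable[OF elim(4)])
      moreover have "ennreal (\<delta> / 2) + ennreal (\<delta> / 2) = ennreal \<delta>" using \<delta> by (simp flip: ennreal_plus)
      ultimately show ?case by auto
    qed
  qed
  then obtain u where u: "\<And>\<epsilon>. 0 < \<epsilon> \<Longrightarrow> u \<epsilon> \<in> lattice_functions_on p S \<epsilon>" and lim: "((\<lambda>\<epsilon>. e \<epsilon> (u \<epsilon>)) \<longlongrightarrow> 0) (at_right 0)" by blast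
  have u_Lp: "u \<epsilon> \<in> Lp_space p (M \<Otimes>\<^sub>M lattice_measure \<epsilon>)" if "0 < \<epsilon>" for \<epsilon> using u[OF that] by (simp add: lattice_functions_on_def)
  have 1: "((\<lambda>\<epsilon>. Lp_energy p (M \<Otimes>\<^sub>M lborel) (\<lambda>z. unfold T \<epsilon> (u \<epsilon>) z - U z)) \<longlongrightarrow> 0) (at_right 0)"
    by (rule ennreal_tendsto_zero_mono[OF lim]) (simp add: e_def)
  have 2: "((\<lambda>\<epsilon>. Lp_energy p (M \<Otimes>\<^sub>M lborel) (\<lambda>z. unfold T \<epsilon> (discrete_gradient \<epsilon> (u \<epsilon>)) z - ?V z)) \<longlongrightarrow> 0) (at_right 0)"
    by (rule ennreal_tendsto_zero_mono[OF lim]) (simp add: e_def)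
  have "\<forall>\<^sub>F \<epsilon> in at_right 0. unfold T \<epsilon> (u \<epsilon>) \<in> Lp_space p (M \<Otimes>\<^sub>M lborel)"
    using eventually_at_right_less[of "0::real"] by eventually_elim (intro Lp_space_unfold u_Lp)
  then have "two_scale_tendsto p M T u U"
    using 1 U_Lp by (simp add: two_scale_tendsto_def Lp_tendsto_iff_energy[OF p1(3)])
  moreover have "\<forall>\<^sub>F \<epsilon> in at_right 0. unfold T \<epsilon> (discrete_gradient \<epsilon> (u \<epsilon>)) \<in> Lp_space p (M \<Otimes>\<^sub>M lborel)"
    using ennreal_tendsto_zeroD[OF 2 zero_less_one] eventually_at_right_less[of "0::real"]
  proof eventually_elim
    case (elim \<epsilon>)
    have m: "unfold T \<epsilon> (discrete_gradient \<epsilon> (u \<epsilon>)) \<in> borel_measurable (M \<Otimes>\<^sub>M lborel)"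
      using u_Lp[OF elim(2)] by (intro unfold_measurable[OF elim(2)] discrete_gradient_measurable[OF elim(2)]) (simp add: Lp_space_iff)
    then have "(\<lambda>z. unfold T \<epsilon> (discrete_gradient \<epsilon> (u \<epsilon>)) z - ?V z) \<in> Lp_space p (M \<Otimes>\<^sub>M lborel)"
      using elim(1) UV_meas by (auto simp: Lp_space_iff intro: less_trans)
    from Lp_space_add[OF p1(2) this V(1)] show ?case by simp
  qed
  then have "two_scale_tendsto p M T (\<lambda>\<epsilon>. discrete_gradient \<epsilon> (u \<epsilon>)) ?V"
    using 2 V(1) by (simp add: two_scale_tendsto_def Lp_tendsto_iff_energy[OF p1(3)])
  ultimately show ?thesis using u by blast
qed

end

section \<open>Recovery operators\<close>

context measure_preserving_system
begin

lemma pot_recoveryD: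
  fixes G :: "real \<Rightarrow> ('w \<times> (real ^ 'n) \<Rightarrow> real ^ 'n) \<Rightarrow> 'w \<times> (real ^ 'n) \<Rightarrow> real"
  assumes "pot_recovery_operators p M T \<gamma> G"
  defines "Y \<equiv> tensor p M lborel (Lp_pot p M T) (Lp_space p lborel)"
  shows "0 < \<epsilon> \<Longrightarrow> Lp_bounded_linear p (M \<Otimes>\<^sub>M lborel) Y (M \<Otimes>\<^sub>M lattice_measure \<epsilon>) (G \<epsilon>)"
    and "\<exists>C. \<forall>\<epsilon>\<in>{0<..1}. \<forall>\<xi>\<in>Y. Lp_norm p (M \<Otimes>\<^sub>M lattice_measure \<epsilon>) (G \<epsilon> \<xi>) \<le> C * Lp_norm p (M \<Otimes>\<^sub>M lborel) \<xi>"
    and "\<xi> \<in> Y \<Longrightarrow> two_scale_tendsto p M T (\<lambda>\<epsilon>. G \<epsilon> \<xi>) (\<lambda>_. 0)"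
    and "\<xi> \<in> Y \<Longrightarrow> two_scale_tendsto p M T (\<lambda>\<epsilon> z. (\<epsilon> powr \<gamma>) *\<^sub>R discrete_gradient \<epsilon> (G \<epsilon> \<xi>) z) \<xi>"
    and "0 < \<epsilon> \<Longrightarrow> \<xi> \<in> Y \<Longrightarrow> G \<epsilon> \<xi> \<in> Lp_space p (M \<Otimes>\<^sub>M lattice_measure \<epsilon>)"
  using assms(1) unfolding pot_recovery_operators_def Let_def Y_def[symmetric] Lp_bounded_linear_def by blast+

lemma inv_recoveryD:
  fixes F :: "real \<Rightarrow> ('w \<times> (real ^ 'n) \<Rightarrow> real) \<Rightarrow> 'w \<times> (real ^ 'n) \<Rightarrow> real"
  assumes "inv_recovery_operators p M T \<gamma> F"
  defines "X \<equiv> tensor p M lborel (Lp_inv p M T) (Lp_space p lborel)"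
  shows "0 < \<epsilon> \<Longrightarrow> Lp_bounded_linear p (M \<Otimes>\<^sub>M lborel) X (M \<Otimes>\<^sub>M lattice_measure \<epsilon>) (F \<epsilon>)"
    and "\<exists>C. \<forall>\<epsilon>\<in>{0<..1}. \<forall>U\<in>X. Lp_norm p (M \<Otimes>\<^sub>M lattice_measure \<epsilon>) (F \<epsilon> U) \<le> C * Lp_norm p (M \<Otimes>\<^sub>M lborel) U"
    and "U \<in> X \<Longrightarrow> two_scale_tendsto p M T (\<lambda>\<epsilon>. F \<epsilon> U) U"
    and "U \<in> X \<Longrightarrow> two_scale_tendsto p M T (\<lambda>\<epsilon> z. (\<epsilon> powr \<gamma>) *\<^sub>R discrete_gradient \<epsilon> (F \<epsilon> U) z) (\<lambda>_. 0)"
    and "0 < \<epsilon> \<Longrightarrow> U \<in> X \<Longrightarrow> F \<epsilon> U \<in> Lp_space p (M \<Otimes>\<^sub>M lattice_measure \<epsilon>)"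
  using assms(1) unfolding inv_recovery_operators_def Let_def X_def[symmetric] Lp_bounded_linear_def by blast+

lemma two_scale_tendsto_cong:
  assumes "two_scale_tendsto p M T u U" "\<And>\<epsilon>. 0 < \<epsilon> \<Longrightarrow> u' \<epsilon> = u \<epsilon>"
  shows "two_scale_tendsto p M T u' U"
proof -
  have ev: "\<forall>\<^sub>F \<epsilon> in at_right (0::real). u' \<epsilon> = u \<epsilon>"
    using eventually_at_right_less[of "0::real"] by eventually_elim (rule assms(2))
  have "\<forall>\<^sub>F \<epsilon> in at_right 0. unfold T \<epsilon> (u' \<epsilon>) \<in> Lp_space p (M \<Otimes>\<^sub>M lborel)"
    using ev assms(1)[unfolded two_scale_tendsto_def Lp_tendsto_def, THEN conjunct1] by eventually_elim simp
  moreover have "((\<lambda>\<epsilon>. Lp_norm p (M \<Otimes>\<^sub>M lborel) (\<lambda>z. unfold T \<epsilon> (u' \<epsilon>) z - U z)) \<longlongrightarrow> 0) (at_right 0)"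
  proof (rule Lim_transform_eventually)
    show "((\<lambda>\<epsilon>. Lp_norm p (M \<Otimes>\<^sub>M lborel) (\<lambda>z. unfold T \<epsilon> (u \<epsilon>) z - U z)) \<longlongrightarrow> 0) (at_right 0)"
      using assms(1) by (simp add: two_scale_tendsto_def Lp_tendsto_def)
    show "\<forall>\<^sub>F \<epsilon> in at_right 0. Lp_norm p (M \<Otimes>\<^sub>M lborel) (\<lambda>z. unfold T \<epsilon> (u \<epsilon>) z - U z) =
        Lp_norm p (M \<Otimes>\<^sub>M lborel) (\<lambda>z. unfold T \<epsilon> (u' \<epsilon>) z - U z)"
      using ev by eventually_elim simp
  qed
  ultimately show ?thesis using assms(1) by (simp add: two_scale_tendsto_def Lp_tendsto_def)
qed

lemma two_scale_gradient_add:
  fixes u v :: "real \<Rightarrow> 'w \<times> (real ^ 'n) \<Rightarrow> real"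
  assumes "0 < p"
    and "two_scale_tendsto p M T (\<lambda>\<epsilon> z. c \<epsilon> *\<^sub>R discrete_gradient \<epsilon> (u \<epsilon>) z) Y"
    and "two_scale_tendsto p M T (\<lambda>\<epsilon> z. c \<epsilon> *\<^sub>R discrete_gradient \<epsilon> (v \<epsilon>) z) Z"
  shows "two_scale_tendsto p M T (\<lambda>\<epsilon> z. c \<epsilon> *\<^sub>R discrete_gradient \<epsilon> (\<lambda>z. u \<epsilon> z + v \<epsilon> z) z) (\<lambda>z. Y z + Z z)"
  using two_scale_tendsto_add[OF assms] by (simp add: discrete_gradient_add scaleR_add_right)

lemma two_scale_norm_tendsto_zero:
  fixes v :: "real \<Rightarrow> 'w \<times> (real ^ 'n) \<Rightarrow> real"
  assumes p: "0 < p" and v: "\<And>\<epsilon>. 0 < \<epsilon> \<Longrightarrow> v \<epsilon> \<in> Lp_space p (M \<Otimes>\<^sub>M lattice_measure \<epsilon>)"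
    and lim: "two_scale_tendsto p M T v (\<lambda>_. 0)"
  shows "((\<lambda>\<epsilon>. Lp_norm p (M \<Otimes>\<^sub>M lattice_measure \<epsilon>) (v \<epsilon>)) \<longlongrightarrow> 0) (at_right 0)"
proof (rule tendsto_sandwich[OF _ _ tendsto_const])
  show "((\<lambda>\<epsilon>. Lp_norm p (M \<Otimes>\<^sub>M lborel) (unfold T \<epsilon> (v \<epsilon>))) \<longlongrightarrow> 0) (at_right 0)"
    using lim by (simp add: two_scale_tendsto_def Lp_tendsto_def)
  show "\<forall>\<^sub>F \<epsilon> in at_right 0. Lp_norm p (M \<Otimes>\<^sub>M lattice_measure \<epsilon>) (v \<epsilon>) \<le> Lp_norm p (M \<Otimes>\<^sub>M lborel) (unfold T \<epsilon> (v \<epsilon>))"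
    using eventually_at_right_less[of "0::real"]
  proof eventually_elim
    case (elim \<epsilon>)
    show ?case
      using v[OF elim] Lp_space_unfold[OF elim v[OF elim]]
      by (intro Lp_norm_mono_energy[OF p]) (auto simp: Lp_energy_unfold[OF elim] Lp_space_iff)
  qed
qed simp

lemma folding_bounded_linear:
  assumes p: "1 < p" and \<epsilon>: "0 < \<epsilon>" and X: "X \<subseteq> Lp_space p (M \<Otimes>\<^sub>M lborel)"
  shows "Lp_bounded_linear p (M \<Otimes>\<^sub>M lborel) X (M \<Otimes>\<^sub>M lattice_measure \<epsilon>) (folding_op T \<epsilon>)"
  unfolding Lp_bounded_linear_def
proof (intro conjI ballI allI)
  show "folding_op T \<epsilon> f \<in> Lp_space p (M \<Otimes>\<^sub>M lattice_measure \<epsilon>)" if "f \<in> X" for f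
    using that X by (intro folding_Lp(1)[OF p \<epsilon>]) auto
  show "AE z in M \<Otimes>\<^sub>M lattice_measure \<epsilon>. folding_op T \<epsilon> (\<lambda>x. f x + g x) z = folding_op T \<epsilon> f z + folding_op T \<epsilon> g z"
    if "f \<in> X" "g \<in> X" for f g using that X by (intro folding_add[OF p \<epsilon>]) auto
  show "AE z in M \<Otimes>\<^sub>M lattice_measure \<epsilon>. folding_op T \<epsilon> (\<lambda>x. c *\<^sub>R f x) z = c *\<^sub>R folding_op T \<epsilon> f z"
    for f c by (simp add: folding_scale)
  show "\<exists>C. \<forall>f\<in>X. Lp_norm p (M \<Otimes>\<^sub>M lattice_measure \<epsilon>) (folding_op T \<epsilon> f) \<le> C * Lp_norm p (M \<Otimes>\<^sub>M lborel) f"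
    using folding_Lp(2)[OF p \<epsilon>] X by (intro exI[of _ 1]) auto
qed

text \<open>
  The case without cutoff and with $\gamma = 0$: the given operators for \<open>\<xi>\<close> and the folding for
  \<open>U\<close>.
\<close>

proposition recovery_critical:
  fixes G :: "real \<Rightarrow> ('w \<times> (real ^ 'n) \<Rightarrow> real ^ 'n) \<Rightarrow> 'w \<times> (real ^ 'n) \<Rightarrow> real"
  assumes p: "1 < p" and G: "pot_recovery_operators p M T 0 G"
  defines "X \<equiv> sobolev_tensor p M (Lp_inv p M T) (W1p p UNIV)"
    and "Y \<equiv> tensor p M lborel (Lp_pot p M T) (Lp_space p lborel)"
  shows "0 < \<epsilon> \<Longrightarrow> pair_bounded_linear X (Lp_W1p_norm p M) Y (Lp_norm p (M \<Otimes>\<^sub>M lborel)) p (M \<Otimes>\<^sub>M lattice_measure \<epsilon>)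
      (Lp_space p (M \<Otimes>\<^sub>M lattice_measure \<epsilon>)) (\<lambda>U \<xi> z. folding_op T \<epsilon> U z + G \<epsilon> \<xi> z)" (is "_ \<Longrightarrow> ?linear")
    and "U \<in> X \<Longrightarrow> \<xi> \<in> Y \<Longrightarrow> two_scale_tendsto p M T (\<lambda>\<epsilon> z. folding_op T \<epsilon> U z + G \<epsilon> \<xi> z) U"
    and "U \<in> X \<Longrightarrow> \<xi> \<in> Y \<Longrightarrow> two_scale_tendsto p M T (\<lambda>\<epsilon>. discrete_gradient \<epsilon> (\<lambda>z. folding_op T \<epsilon> U z + G \<epsilon> \<xi> z))
      (\<lambda>z. weak_gradient_x p M U z + \<xi> z)"
    and "\<exists>C. \<forall>\<epsilon>\<in>{0<..1}. \<forall>U\<in>X. \<forall>\<xi>\<in>Y. Lp_norm p (M \<Otimes>\<^sub>M lattice_measure \<epsilon>) (\<lambda>z. folding_op T \<epsilon> U z + G \<epsilon> \<xi> z)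
      \<le> C * (Lp_W1p_norm p M U + Lp_norm p (M \<Otimes>\<^sub>M lborel) \<xi>)"
proof -
  note GD = pot_recoveryD[OF G, folded Y_def]
  have p1: "1 \<le> p" "0 < p" using p by auto
  have X_W: "X \<subseteq> Lp_W1p p M" by (auto simp: X_def sobolev_tensor_def)
  have X: "X \<subseteq> Lp_space p (M \<Otimes>\<^sub>M lborel)" using X_W by (auto simp: Lp_W1p_def)
  have "W1p p UNIV \<subseteq> Lp_space p (lborel :: (real ^ 'n) measure)" by (auto simp: W1p_def Lp_on_def)
  note inv = tensor_invariant[OF p1(2) this subsetD[OF sobolev_tensor_subset_tensor[OF p1(2)]]]
  show ?linear if \<epsilon>: "0 < \<epsilon>"
  proof (rule pair_bounded_linear_sum[OF p1(1) folding_bounded_linear[OF p \<epsilon> X] GD(1)[OF \<epsilon>]])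
    show "Lp_norm p (M \<Otimes>\<^sub>M lborel) f \<le> Lp_W1p_norm p M f" for f by (rule Lp_W1p_norm_ge(1)[OF p1(2)])
    show "(\<lambda>z. folding_op T \<epsilon> f z + G \<epsilon> g z) \<in> Lp_space p (M \<Otimes>\<^sub>M lattice_measure \<epsilon>)" if "f \<in> X" "g \<in> Y" for f g
      using that X p by (intro Lp_space_add folding_Lp(1)[OF p \<epsilon>] GD(5)[OF \<epsilon>]) auto
  qed
  show "two_scale_tendsto p M T (\<lambda>\<epsilon> z. folding_op T \<epsilon> U z + G \<epsilon> \<xi> z) U" if "U \<in> X" "\<xi> \<in> Y"
    using two_scale_tendsto_add[OF p1(2) folding_two_scale[OF p, of U] GD(3)[OF that(2)]] that X by auto
  show "two_scale_tendsto p M T (\<lambda>\<epsilon>. discrete_gradient \<epsilon> (\<lambda>z. folding_op T \<epsilon> U z + G \<epsilon> \<xi> z))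
      (\<lambda>z. weak_gradient_x p M U z + \<xi> z)" if "U \<in> X" "\<xi> \<in> Y"
  proof -
    have U: "U \<in> Lp_W1p p M" using X_W that by blast
    have "two_scale_tendsto p M T (\<lambda>\<epsilon>. discrete_gradient \<epsilon> (folding_op T \<epsilon> U)) (weak_gradient_x p M U)"
    proof (rule folding_gradient_two_scale[OF p _ weak_gradient_x_spec[OF U]])
      show "U \<in> Lp_space p (M \<Otimes>\<^sub>M lborel)" using U by (simp add: Lp_W1p_def)
      show "AE z in M \<Otimes>\<^sub>M lborel. U (T k (fst z), snd z) = U z" if "k \<in> int_lattice" for k
        using inv[OF _ that] \<open>U \<in> X\<close> by (simp add: X_def)
    qed
    moreover have "two_scale_tendsto p M T (\<lambda>\<epsilon>. discrete_gradient \<epsilon> (G \<epsilon> \<xi>)) \<xi>"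
      by (rule two_scale_tendsto_cong[OF GD(4)[OF that(2)]]) simp
    ultimately show ?thesis
      using two_scale_gradient_add[OF p1(2), of "\<lambda>_. 1" "\<lambda>\<epsilon>. folding_op T \<epsilon> U" _ "\<lambda>\<epsilon>. G \<epsilon> \<xi>"] by simp
  qed
  obtain C where C: "\<forall>\<epsilon>\<in>{0<..1}. \<forall>\<xi>\<in>Y. Lp_norm p (M \<Otimes>\<^sub>M lattice_measure \<epsilon>) (G \<epsilon> \<xi>) \<le> C * Lp_norm p (M \<Otimes>\<^sub>M lborel) \<xi>"
    using GD(2) by blast
  show "\<exists>C. \<forall>\<epsilon>\<in>{0<..1}. \<forall>U\<in>X. \<forall>\<xi>\<in>Y. Lp_norm p (M \<Otimes>\<^sub>M lattice_measure \<epsilon>) (\<lambda>z. folding_op T \<epsilon> U z + G \<epsilon> \<xi> z)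
      \<le> C * (Lp_W1p_norm p M U + Lp_norm p (M \<Otimes>\<^sub>M lborel) \<xi>)"
  proof (intro exI ballI)
    fix \<epsilon> :: real and U \<xi> assume *: "\<epsilon> \<in> {0<..1}" "U \<in> X" "\<xi> \<in> Y"
    then have \<epsilon>: "0 < \<epsilon>" by simp
    have U: "U \<in> Lp_space p (M \<Otimes>\<^sub>M lborel)" using * X by blast
    show "Lp_norm p (M \<Otimes>\<^sub>M lattice_measure \<epsilon>) (\<lambda>z. folding_op T \<epsilon> U z + G \<epsilon> \<xi> z)
      \<le> (2 * (\<bar>1\<bar> + \<bar>C\<bar>)) * (Lp_W1p_norm p M U + Lp_norm p (M \<Otimes>\<^sub>M lborel) \<xi>)"
      using * C folding_Lp[OF p \<epsilon> U] Lp_W1p_norm_ge(1)[OF p1(2), of M U]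
      by (intro Lp_norm_add_bound[OF p1(1) _ GD(5)[OF \<epsilon>], where a="Lp_norm p (M \<Otimes>\<^sub>M lborel) U"]) auto
  qed
qed

proposition recovery_subcritical:
  fixes G :: "real \<Rightarrow> ('w \<times> (real ^ 'n) \<Rightarrow> real ^ 'n) \<Rightarrow> 'w \<times> (real ^ 'n) \<Rightarrow> real"
    and F :: "real \<Rightarrow> ('w \<times> (real ^ 'n) \<Rightarrow> real) \<Rightarrow> 'w \<times> (real ^ 'n) \<Rightarrow> real"
  assumes p: "1 < p" and F: "inv_recovery_operators p M T \<gamma> F" and G: "pot_recovery_operators p M T \<gamma> G"
  defines "X \<equiv> tensor p M lborel (Lp_inv p M T) (Lp_space p lborel)"
    and "Y \<equiv> tensor p M lborel (Lp_pot p M T) (Lp_space p lborel)"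
  shows "0 < \<epsilon> \<Longrightarrow> pair_bounded_linear X (Lp_norm p (M \<Otimes>\<^sub>M lborel)) Y (Lp_norm p (M \<Otimes>\<^sub>M lborel)) p (M \<Otimes>\<^sub>M lattice_measure \<epsilon>)
      (Lp_space p (M \<Otimes>\<^sub>M lattice_measure \<epsilon>)) (\<lambda>U \<xi> z. F \<epsilon> U z + G \<epsilon> \<xi> z)" (is "_ \<Longrightarrow> ?linear")
    and "U \<in> X \<Longrightarrow> \<xi> \<in> Y \<Longrightarrow> two_scale_tendsto p M T (\<lambda>\<epsilon> z. F \<epsilon> U z + G \<epsilon> \<xi> z) U"
    and "U \<in> X \<Longrightarrow> \<xi> \<in> Y \<Longrightarrow> two_scale_tendsto p M T
        (\<lambda>\<epsilon> z. (\<epsilon> powr \<gamma>) *\<^sub>R discrete_gradient \<epsilon> (\<lambda>z. F \<epsilon> U z + G \<epsilon> \<xi> z) z) \<xi>"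
    and "\<exists>C. \<forall>\<epsilon>\<in>{0<..1}. \<forall>U\<in>X. \<forall>\<xi>\<in>Y. Lp_norm p (M \<Otimes>\<^sub>M lattice_measure \<epsilon>) (\<lambda>z. F \<epsilon> U z + G \<epsilon> \<xi> z)
      \<le> C * (Lp_norm p (M \<Otimes>\<^sub>M lborel) U + Lp_norm p (M \<Otimes>\<^sub>M lborel) \<xi>)"
proof -
  note GD = pot_recoveryD[OF G, folded Y_def]
  note FD = inv_recoveryD[OF F, folded X_def]
  have p1: "1 \<le> p" "0 < p" using p by auto
  show ?linear if \<epsilon>: "0 < \<epsilon>"
    by (rule pair_bounded_linear_sum[OF p1(1) FD(1)[OF \<epsilon>] GD(1)[OF \<epsilon>]])
       (use p in \<open>auto intro!: Lp_space_add FD(5)[OF \<epsilon>] GD(5)[OF \<epsilon>]\<close>)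
  show "two_scale_tendsto p M T (\<lambda>\<epsilon> z. F \<epsilon> U z + G \<epsilon> \<xi> z) U" if "U \<in> X" "\<xi> \<in> Y"
    using two_scale_tendsto_add[OF p1(2) FD(3)[OF that(1)] GD(3)[OF that(2)]] by simp
  show "two_scale_tendsto p M T (\<lambda>\<epsilon> z. (\<epsilon> powr \<gamma>) *\<^sub>R discrete_gradient \<epsilon> (\<lambda>z. F \<epsilon> U z + G \<epsilon> \<xi> z) z) \<xi>"
    if "U \<in> X" "\<xi> \<in> Y"
    using two_scale_gradient_add[OF p1(2) FD(4)[OF that(1)] GD(4)[OF that(2)]] by simp
  obtain C where C: "\<forall>\<epsilon>\<in>{0<..1}. \<forall>\<xi>\<in>Y. Lp_norm p (M \<Otimes>\<^sub>M lattice_measure \<epsilon>) (G \<epsilon> \<xi>) \<le> C * Lp_norm p (M \<Otimes>\<^sub>M lborel) \<xi>"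
    using GD(2) by blast
  obtain C' where C': "\<forall>\<epsilon>\<in>{0<..1}. \<forall>U\<in>X. Lp_norm p (M \<Otimes>\<^sub>M lattice_measure \<epsilon>) (F \<epsilon> U) \<le> C' * Lp_norm p (M \<Otimes>\<^sub>M lborel) U"
    using FD(2) by blast
  show "\<exists>C. \<forall>\<epsilon>\<in>{0<..1}. \<forall>U\<in>X. \<forall>\<xi>\<in>Y. Lp_norm p (M \<Otimes>\<^sub>M lattice_measure \<epsilon>) (\<lambda>z. F \<epsilon> U z + G \<epsilon> \<xi> z)
      \<le> C * (Lp_norm p (M \<Otimes>\<^sub>M lborel) U + Lp_norm p (M \<Otimes>\<^sub>M lborel) \<xi>)"
  proof (intro exI ballI)
    fix \<epsilon> :: real and U \<xi> assume *: "\<epsilon> \<in> {0<..1}" "U \<in> X" "\<xi> \<in> Y"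
    then have \<epsilon>: "0 < \<epsilon>" by simp
    show "Lp_norm p (M \<Otimes>\<^sub>M lattice_measure \<epsilon>) (\<lambda>z. F \<epsilon> U z + G \<epsilon> \<xi> z)
      \<le> (2 * (\<bar>C'\<bar> + \<bar>C\<bar>)) * (Lp_norm p (M \<Otimes>\<^sub>M lborel) U + Lp_norm p (M \<Otimes>\<^sub>M lborel) \<xi>)"
      using * C C' by (intro Lp_norm_add_bound[OF p1(1) FD(5)[OF \<epsilon>] GD(5)[OF \<epsilon>]]) auto
  qed
qed

text \<open>
  The part belonging to \<open>\<xi>\<close> tends to \<open>0\<close> with norm $N_\varepsilon$ and is cut off at distance
  $\delta_\varepsilon = N_\varepsilon^{1/2} + \varepsilon$, so that
  $N_\varepsilon/\delta_\varepsilon \le N_\varepsilon^{1/2} \to 0$; the summand \<open>\<epsilon>\<close> keeps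
  $\delta_\varepsilon$ positive. The part belonging to \<open>U\<close> comes from
  \<open>supported_recovery_sequence\<close>.
\<close>

proposition supported_recovery_critical:
  fixes G :: "real \<Rightarrow> ('w \<times> (real ^ 'n) \<Rightarrow> real ^ 'n) \<Rightarrow> 'w \<times> (real ^ 'n) \<Rightarrow> real"
  assumes p: "1 < p" and G: "pot_recovery_operators p M T 0 G" and S: "open S" "bounded S"
    and U: "U \<in> sobolev_tensor p M (Lp_inv p M T) (W1p_0 p S)"
    and \<xi>: "\<xi> \<in> tensor p M lborel (Lp_pot p M T) (Lp_on p S)"
  shows "\<exists>u. (\<forall>\<epsilon>>0. u \<epsilon> \<in> tensor p M (lattice_measure \<epsilon>) (Lp_space p M) (Lp_lattice_0 p \<epsilon> S)) \<and>
    two_scale_tendsto p M T u U \<and>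
    two_scale_tendsto p M T (\<lambda>\<epsilon>. discrete_gradient \<epsilon> (u \<epsilon>)) (\<lambda>z. weak_gradient_x p M U z + \<xi> z)"
proof -
  have p1: "0 \<le> p" "0 < p" using p by auto
  have neS: "- S \<noteq> {}" using S(2) not_bounded_UNIV by (metis Compl_empty_eq double_compl)
  note GD = pot_recoveryD[OF G]
  have "Lp_on p S \<subseteq> Lp_space p lborel" by (auto simp: Lp_on_def)
  then have \<xi>Y: "\<xi> \<in> tensor p M lborel (Lp_pot p M T) (Lp_space p lborel)"
    using \<xi> tensor_mono[OF order_refl] by blast
  have \<xi>0: "AE z in M \<Otimes>\<^sub>M lborel. snd z \<notin> S \<longrightarrow> \<xi> z = 0" by (rule tensor_vanish[OF p1(2) S(1) Lp_pot_Lp \<xi>])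
  define v where "v \<epsilon> = G \<epsilon> \<xi>" for \<epsilon>
  have v: "v \<epsilon> \<in> Lp_space p (M \<Otimes>\<^sub>M lattice_measure \<epsilon>)" if "0 < \<epsilon>" for \<epsilon> unfolding v_def by (rule GD(5)[OF that \<xi>Y])
  have v0: "two_scale_tendsto p M T v (\<lambda>_. 0)" using GD(3)[OF \<xi>Y] by (simp add: v_def[abs_def])
  have v1: "two_scale_tendsto p M T (\<lambda>\<epsilon> z. 1 *\<^sub>R discrete_gradient \<epsilon> (v \<epsilon>) z) \<xi>"
    by (rule two_scale_tendsto_cong[OF GD(4)[OF \<xi>Y]]) (simp add: v_def)
  define N where "N \<epsilon> = Lp_norm p (M \<Otimes>\<^sub>M lattice_measure \<epsilon>) (v \<epsilon>)" for \<epsilon>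
  have N: "(N \<longlongrightarrow> 0) (at_right 0)" "0 \<le> N \<epsilon>" for \<epsilon>
    using two_scale_norm_tendsto_zero[OF p1(2) v v0] by (auto simp: N_def[abs_def])
  define \<delta> where "\<delta> \<epsilon> = sqrt (N \<epsilon>) + \<epsilon>" for \<epsilon>
  have sq: "((\<lambda>\<epsilon>. sqrt (N \<epsilon>)) \<longlongrightarrow> 0) (at_right 0)" using tendsto_real_sqrt[OF N(1)] by simp
  have \<delta>: "0 < \<delta> \<epsilon>" if "0 < \<epsilon>" for \<epsilon> using that N(2) by (simp add: \<delta>_def add_nonneg_pos)
  have "((\<lambda>\<epsilon>. sqrt (N \<epsilon>) + \<epsilon>) \<longlongrightarrow> 0 + 0) (at_right 0)" by (intro tendsto_add sq tendsto_ident_at)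
  then have \<delta>0: "(\<delta> \<longlongrightarrow> 0) (at_right 0)" by (simp add: \<delta>_def[abs_def])
  have small: "((\<lambda>\<epsilon>. \<bar>1\<bar> / \<delta> \<epsilon> * Lp_norm p (M \<Otimes>\<^sub>M lattice_measure \<epsilon>) (v \<epsilon>)) \<longlongrightarrow> 0) (at_right 0)"
  proof (rule tendsto_sandwich[OF _ _ tendsto_const sq])
    show "\<forall>\<^sub>F \<epsilon> in at_right 0. 0 \<le> \<bar>1\<bar> / \<delta> \<epsilon> * Lp_norm p (M \<Otimes>\<^sub>M lattice_measure \<epsilon>) (v \<epsilon>)"
      using eventually_at_right_less[of "0::real"] by eventually_elim (use \<delta> in \<open>simp add: less_imp_le\<close>)
    show "\<forall>\<^sub>F \<epsilon> in at_right 0. \<bar>1\<bar> / \<delta> \<epsilon> * Lp_norm p (M \<Otimes>\<^sub>M lattice_measure \<epsilon>) (v \<epsilon>) \<le> sqrt (N \<epsilon>)"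
      using eventually_at_right_less[of "0::real"]
    proof eventually_elim
      case (elim \<epsilon>)
      have "N \<epsilon> = sqrt (N \<epsilon>) * sqrt (N \<epsilon>)" using N(2) by simp
      also have "\<dots> \<le> sqrt (N \<epsilon>) * \<delta> \<epsilon>" using elim N(2) by (intro mult_left_mono) (auto simp: \<delta>_def)
      finally show ?case using \<delta>[OF elim] by (simp add: N_def[symmetric] divide_le_eq)
    qed
  qed
  define w where "w \<epsilon> z = cutoff S (\<delta> \<epsilon>) (snd z) * v \<epsilon> z" for \<epsilon> z
  have w: "two_scale_tendsto p M T w (\<lambda>_. 0)" "two_scale_tendsto p M T (\<lambda>\<epsilon> z. 1 *\<^sub>R discrete_gradient \<epsilon> (w \<epsilon>) z) \<xi>"
    unfolding w_def[abs_def]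
    using cutoff_two_scale[OF p S(1) neS \<delta> \<delta>0 v v0 AE_I2 v1 \<xi>0 small] by simp_all
  have w_on: "w \<epsilon> \<in> lattice_functions_on p S \<epsilon>" if \<epsilon>: "0 < \<epsilon>" for \<epsilon>
  proof -
    have "(\<lambda>z. cutoff S (\<delta> \<epsilon>) (snd z)) \<in> borel_measurable (M \<Otimes>\<^sub>M lattice_measure \<epsilon>)"
      by (rule measurable_pair_lattice) simp
    from Lp_norm_multiplier_le(1)[OF p1(2) this cutoff_bounds(3)[OF \<delta>[OF \<epsilon>]] v[OF \<epsilon>]]
    show ?thesis by (simp add: lattice_functions_on_def w_def[abs_def] cutoff_outside)
  qed
  obtain u where u: "\<And>\<epsilon>. 0 < \<epsilon> \<Longrightarrow> u \<epsilon> \<in> lattice_functions_on p S \<epsilon>" "two_scale_tendsto p M T u U"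
    "two_scale_tendsto p M T (\<lambda>\<epsilon>. discrete_gradient \<epsilon> (u \<epsilon>)) (weak_gradient_x p M U)"
    using supported_recovery_sequence[OF p S(1) U] by blast
  have "(\<lambda>z. u \<epsilon> z + w \<epsilon> z) \<in> lattice_functions_on p S \<epsilon>" if "0 < \<epsilon>" for \<epsilon>
    using u(1)[OF that] w_on[OF that] Lp_space_add[OF p1(1), of "u \<epsilon>" _ "w \<epsilon>"] by (simp add: lattice_functions_on_def)
  then have "\<forall>\<epsilon>>0. (\<lambda>z. u \<epsilon> z + w \<epsilon> z) \<in> tensor p M (lattice_measure \<epsilon>) (Lp_space p M) (Lp_lattice_0 p \<epsilon> S)"
    using lattice_functions_on_tensor[OF p1(2) _ S(2)] by blast
  moreover have "two_scale_tendsto p M T (\<lambda>\<epsilon> z. u \<epsilon> z + w \<epsilon> z) U"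
    using two_scale_tendsto_add[OF p1(2) u(2) w(1)] by simp
  moreover have "two_scale_tendsto p M T (\<lambda>\<epsilon>. discrete_gradient \<epsilon> (\<lambda>z. u \<epsilon> z + w \<epsilon> z)) (\<lambda>z. weak_gradient_x p M U z + \<xi> z)"
    using two_scale_gradient_add[OF p1(2) _ w(2), of u "weak_gradient_x p M U"] u(3) by simp
  ultimately show ?thesis by (intro exI[of _ "\<lambda>\<epsilon> z. u \<epsilon> z + w \<epsilon> z"] conjI)
qed

text \<open>
  Here both parts can be cut off at distance $\varepsilon^{\gamma/2}$: the extra term in the
  gradient is of the order $\varepsilon^{\gamma - \gamma/2}$. The cutoff does not depend on
  \<open>U\<close> and \<open>\<xi>\<close>, so the operators stay linear.
\<close>

proposition supported_recovery_subcritical: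
  fixes G :: "real \<Rightarrow> ('w \<times> (real ^ 'n) \<Rightarrow> real ^ 'n) \<Rightarrow> 'w \<times> (real ^ 'n) \<Rightarrow> real"
    and F :: "real \<Rightarrow> ('w \<times> (real ^ 'n) \<Rightarrow> real) \<Rightarrow> 'w \<times> (real ^ 'n) \<Rightarrow> real"
  assumes p: "1 < p" and \<gamma>: "0 < \<gamma>" and F: "inv_recovery_operators p M T \<gamma> F" and G: "pot_recovery_operators p M T \<gamma> G"
    and S: "open S" "bounded S"
  defines "X \<equiv> tensor p M lborel (Lp_inv p M T) (Lp_on p S)"
    and "Y \<equiv> tensor p M lborel (Lp_pot p M T) (Lp_on p S)"
  shows "\<exists>u. (\<forall>\<epsilon>>0. pair_bounded_linear X (Lp_norm p (M \<Otimes>\<^sub>M lborel)) Y (Lp_norm p (M \<Otimes>\<^sub>M lborel)) p (M \<Otimes>\<^sub>M lattice_measure \<epsilon>)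
      (tensor p M (lattice_measure \<epsilon>) (Lp_space p M) (Lp_lattice_0 p \<epsilon> S)) (u \<epsilon>)) \<and>
    (\<forall>U\<in>X. \<forall>\<xi>\<in>Y. two_scale_tendsto p M T (\<lambda>\<epsilon>. u \<epsilon> U \<xi>) U \<and>
      two_scale_tendsto p M T (\<lambda>\<epsilon> z. (\<epsilon> powr \<gamma>) *\<^sub>R discrete_gradient \<epsilon> (u \<epsilon> U \<xi>) z) \<xi>) \<and>
    (\<exists>C. \<forall>\<epsilon>\<in>{0<..1}. \<forall>U\<in>X. \<forall>\<xi>\<in>Y. Lp_norm p (M \<Otimes>\<^sub>M lattice_measure \<epsilon>) (u \<epsilon> U \<xi>)
      \<le> C * (Lp_norm p (M \<Otimes>\<^sub>M lborel) U + Lp_norm p (M \<Otimes>\<^sub>M lborel) \<xi>))"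
proof -
  have p1: "1 \<le> p" "0 \<le> p" "0 < p" using p by auto
  have neS: "- S \<noteq> {}" using S(2) not_bounded_UNIV by (metis Compl_empty_eq double_compl)
  have on: "Lp_on p S \<subseteq> Lp_space p lborel" for S :: "(real ^ 'n) set" by (auto simp: Lp_on_def)
  have X: "X \<subseteq> tensor p M lborel (Lp_inv p M T) (Lp_space p lborel)" unfolding X_def by (intro tensor_mono on order_refl)
  have Y: "Y \<subseteq> tensor p M lborel (Lp_pot p M T) (Lp_space p lborel)"
    unfolding Y_def by (intro tensor_mono order_refl) (auto simp: Lp_on_def)
  note GD = pot_recoveryD[OF G] and FD = inv_recoveryD[OF F] and sub = recovery_subcritical[OF p F G]
  define m where "m \<epsilon> z = cutoff S (\<epsilon> powr (\<gamma> / 2)) (snd z)" for \<epsilon> and z :: "'w \<times> (real ^ 'n)"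
  define u where "u \<epsilon> U \<xi> z = m \<epsilon> z * F \<epsilon> U z + m \<epsilon> z * G \<epsilon> \<xi> z" for \<epsilon> U \<xi> z
  have u_eq: "u \<epsilon> U \<xi> = (\<lambda>z. cutoff S (\<epsilon> powr (\<gamma> / 2)) (snd z) * (F \<epsilon> U z + G \<epsilon> \<xi> z))" for \<epsilon> U \<xi>
    by (simp add: u_def m_def fun_eq_iff distrib_left)
  have m: "m \<epsilon> \<in> borel_measurable (M \<Otimes>\<^sub>M lattice_measure \<epsilon>)" for \<epsilon>
    unfolding m_def[abs_def] by (rule measurable_pair_lattice) simp
  have m_le: "\<bar>m \<epsilon> z\<bar> \<le> 1" if "0 < \<epsilon>" for \<epsilon> z unfolding m_def by (rule cutoff_bounds(3)) (use that in simp)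
  have sum_Lp: "(\<lambda>z. F \<epsilon> U z + G \<epsilon> \<xi> z) \<in> Lp_space p (M \<Otimes>\<^sub>M lattice_measure \<epsilon>)" if "0 < \<epsilon>" "U \<in> X" "\<xi> \<in> Y" for \<epsilon> U \<xi>
    using that X Y by (intro Lp_space_add[OF p1(2)] FD(5) GD(5)) auto
  obtain C where C: "\<And>\<epsilon> U \<xi>. \<epsilon> \<in> {0<..1} \<Longrightarrow> U \<in> X \<Longrightarrow> \<xi> \<in> Y \<Longrightarrow>
      Lp_norm p (M \<Otimes>\<^sub>M lattice_measure \<epsilon>) (\<lambda>z. F \<epsilon> U z + G \<epsilon> \<xi> z) \<le> C * (Lp_norm p (M \<Otimes>\<^sub>M lborel) U + Lp_norm p (M \<Otimes>\<^sub>M lborel) \<xi>)"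
  proof -
    obtain C where "\<forall>\<epsilon>\<in>{0<..1}. \<forall>U\<in>tensor p M lborel (Lp_inv p M T) (Lp_space p lborel).
        \<forall>\<xi>\<in>tensor p M lborel (Lp_pot p M T) (Lp_space p lborel).
        Lp_norm p (M \<Otimes>\<^sub>M lattice_measure \<epsilon>) (\<lambda>z. F \<epsilon> U z + G \<epsilon> \<xi> z) \<le> C * (Lp_norm p (M \<Otimes>\<^sub>M lborel) U + Lp_norm p (M \<Otimes>\<^sub>M lborel) \<xi>)"
      using sub(4) by blast
    then show ?thesis using that[of C] X Y by (meson subsetD)
  qed
  have "pair_bounded_linear X (Lp_norm p (M \<Otimes>\<^sub>M lborel)) Y (Lp_norm p (M \<Otimes>\<^sub>M lborel)) p (M \<Otimes>\<^sub>M lattice_measure \<epsilon>)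
      (tensor p M (lattice_measure \<epsilon>) (Lp_space p M) (Lp_lattice_0 p \<epsilon> S)) (u \<epsilon>)" if \<epsilon>: "0 < \<epsilon>" for \<epsilon>
    unfolding u_def[abs_def]
  proof (rule pair_bounded_linear_sum[OF p1(1)])
    show "Lp_bounded_linear p (M \<Otimes>\<^sub>M lborel) X (M \<Otimes>\<^sub>M lattice_measure \<epsilon>) (\<lambda>U z. m \<epsilon> z * F \<epsilon> U z)"
      by (rule Lp_bounded_linear_multiplier[OF p1(3) Lp_bounded_linear_subset[OF FD(1)[OF \<epsilon>] X] m m_le[OF \<epsilon>]])
    show "Lp_bounded_linear p (M \<Otimes>\<^sub>M lborel) Y (M \<Otimes>\<^sub>M lattice_measure \<epsilon>) (\<lambda>\<xi> z. m \<epsilon> z * G \<epsilon> \<xi> z)"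
      by (rule Lp_bounded_linear_multiplier[OF p1(3) Lp_bounded_linear_subset[OF GD(1)[OF \<epsilon>] Y] m m_le[OF \<epsilon>]])
    show "(\<lambda>z. m \<epsilon> z * F \<epsilon> U z + m \<epsilon> z * G \<epsilon> \<xi> z) \<in> tensor p M (lattice_measure \<epsilon>) (Lp_space p M) (Lp_lattice_0 p \<epsilon> S)"
      if "U \<in> X" "\<xi> \<in> Y" for U \<xi>
    proof (rule lattice_functions_on_tensor[OF p1(3) \<epsilon> S(2)])
      show "(\<lambda>z. m \<epsilon> z * F \<epsilon> U z + m \<epsilon> z * G \<epsilon> \<xi> z) \<in> lattice_functions_on p S \<epsilon>"
        using Lp_norm_multiplier_le(1)[OF p1(3) m m_le[OF \<epsilon>] sum_Lp[OF \<epsilon> that]]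
        by (simp add: lattice_functions_on_def distrib_left m_def cutoff_outside)
    qed
  qed simp
  moreover have "two_scale_tendsto p M T (\<lambda>\<epsilon>. u \<epsilon> U \<xi>) U \<and>
      two_scale_tendsto p M T (\<lambda>\<epsilon> z. (\<epsilon> powr \<gamma>) *\<^sub>R discrete_gradient \<epsilon> (u \<epsilon> U \<xi>) z) \<xi>" if U: "U \<in> X" and \<xi>: "\<xi> \<in> Y" for U \<xi>
  proof -
    let ?v = "\<lambda>\<epsilon> z. F \<epsilon> U z + G \<epsilon> \<xi> z"
    let ?K = "Lp_norm p (M \<Otimes>\<^sub>M lborel) U + Lp_norm p (M \<Otimes>\<^sub>M lborel) \<xi>"
    have U0: "AE z in M \<Otimes>\<^sub>M lborel. snd z \<notin> S \<longrightarrow> U z = 0" by (rule tensor_vanish[OF p1(3) S(1) Lp_inv_Lp U[unfolded X_def]])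
    have \<xi>0: "AE z in M \<Otimes>\<^sub>M lborel. snd z \<notin> S \<longrightarrow> \<xi> z = 0" by (rule tensor_vanish[OF p1(3) S(1) Lp_pot_Lp \<xi>[unfolded Y_def]])
    have UX: "U \<in> tensor p M lborel (Lp_inv p M T) (Lp_space p lborel)" and \<xi>Y: "\<xi> \<in> tensor p M lborel (Lp_pot p M T) (Lp_space p lborel)"
      using X Y U \<xi> by auto
    have pow: "((\<lambda>\<epsilon>::real. \<epsilon> powr (\<gamma> / 2)) \<longlongrightarrow> 0) (at_right 0)"
    proof -
      have "((\<lambda>\<epsilon>::real. \<epsilon> powr (\<gamma> / 2)) \<longlongrightarrow> 0 powr (\<gamma> / 2)) (at_right 0)"
        using \<gamma> eventually_at_right_less[of "0::real"]
        by (intro tendsto_powr' tendsto_ident_at tendsto_const) (auto elim!: eventually_mono)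
      then show ?thesis by simp
    qed
    have "((\<lambda>\<epsilon>::real. \<epsilon> powr (\<gamma> / 2) * (C * ?K)) \<longlongrightarrow> 0 * (C * ?K)) (at_right 0)"
      by (intro tendsto_mult_right pow)
    then have up: "((\<lambda>\<epsilon>::real. \<epsilon> powr (\<gamma> / 2) * (C * ?K)) \<longlongrightarrow> 0) (at_right 0)" by simp
    have small: "((\<lambda>\<epsilon>. \<bar>\<epsilon> powr \<gamma>\<bar> / \<epsilon> powr (\<gamma> / 2) * Lp_norm p (M \<Otimes>\<^sub>M lattice_measure \<epsilon>) (?v \<epsilon>)) \<longlongrightarrow> 0) (at_right 0)"
    proof (rule tendsto_sandwich[OF _ _ tendsto_const up])
      show "\<forall>\<^sub>F \<epsilon> in at_right 0. 0 \<le> \<bar>\<epsilon> powr \<gamma>\<bar> / \<epsilon> powr (\<gamma> / 2) * Lp_norm p (M \<Otimes>\<^sub>M lattice_measure \<epsilon>) (?v \<epsilon>)"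
        by simp
      have "\<forall>\<^sub>F \<epsilon> in at_right 0. \<epsilon> \<in> {0<..<1::real}" by (rule eventually_at_right_real) simp
      then show "\<forall>\<^sub>F \<epsilon> in at_right 0. \<bar>\<epsilon> powr \<gamma>\<bar> / \<epsilon> powr (\<gamma> / 2) * Lp_norm p (M \<Otimes>\<^sub>M lattice_measure \<epsilon>) (?v \<epsilon>)
          \<le> \<epsilon> powr (\<gamma> / 2) * (C * ?K)"
      proof eventually_elim
        case (elim \<epsilon>)
        have "\<bar>\<epsilon> powr \<gamma>\<bar> / \<epsilon> powr (\<gamma> / 2) = \<epsilon> powr (\<gamma> / 2)" by (simp add: powr_diff[symmetric])
        then show ?case using C[of \<epsilon> U \<xi>] elim U \<xi> by (simp add: mult_left_mono)
      qed
    qed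
    have pos: "0 < \<epsilon> powr (\<gamma> / 2)" if "0 < \<epsilon>" for \<epsilon> :: real using that by simp
    show ?thesis
      unfolding u_eq
      using cutoff_two_scale[OF p S(1) neS pos pow sum_Lp[OF _ U \<xi>] sub(2)[OF UX \<xi>Y] U0 sub(3)[OF UX \<xi>Y] \<xi>0 small] by blast
  qed
  moreover have "Lp_norm p (M \<Otimes>\<^sub>M lattice_measure \<epsilon>) (u \<epsilon> U \<xi>) \<le> C * (Lp_norm p (M \<Otimes>\<^sub>M lborel) U + Lp_norm p (M \<Otimes>\<^sub>M lborel) \<xi>)"
    if "\<epsilon> \<in> {0<..1}" "U \<in> X" "\<xi> \<in> Y" for \<epsilon> U \<xi>
  proof -
    have \<epsilon>: "0 < \<epsilon>" using that by simp
    have "Lp_norm p (M \<Otimes>\<^sub>M lattice_measure \<epsilon>) (u \<epsilon> U \<xi>) \<le> Lp_norm p (M \<Otimes>\<^sub>M lattice_measure \<epsilon>) (\<lambda>z. F \<epsilon> U z + G \<epsilon> \<xi> z)"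
      using Lp_norm_multiplier_le(2)[OF p1(3) m m_le[OF \<epsilon>] sum_Lp[OF \<epsilon> that(2,3)]] by (simp add: u_eq m_def)
    also have "\<dots> \<le> C * (Lp_norm p (M \<Otimes>\<^sub>M lborel) U + Lp_norm p (M \<Otimes>\<^sub>M lborel) \<xi>)" by (rule C[OF that])
    finally show ?thesis .
  qed
  ultimately show ?thesis by (intro exI[of _ u] conjI) blast+
qed

end

theorem corollary3p3:
  fixes M :: "'w measure"
    and T :: "real ^ 'n \<Rightarrow> 'w \<Rightarrow> 'w"
    and p q :: real
    and G :: "real \<Rightarrow> real \<Rightarrow> ('w \<times> (real ^ 'n) \<Rightarrow> real ^ 'n) \<Rightarrow> 'w \<times> (real ^ 'n) \<Rightarrow> real"
    and F :: "real \<Rightarrow> real \<Rightarrow> ('w \<times> (real ^ 'n) \<Rightarrow> real) \<Rightarrow> 'w \<times> (real ^ 'n) \<Rightarrow> real"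
  assumes "1 < p" and "1 < q" and "1 / p + 1 / q = 1"
    and "measure_preserving_system M T"
    and "\<And>\<gamma>. 0 \<le> \<gamma> \<Longrightarrow> \<gamma> < 1 \<Longrightarrow> pot_recovery_operators p M T \<gamma> (G \<gamma>)"
    and "\<And>\<gamma>. 0 < \<gamma> \<Longrightarrow> \<gamma> < 1 \<Longrightarrow> inv_recovery_operators p M T \<gamma> (F \<gamma>)"
  shows
    "(let X = sobolev_tensor p M (Lp_inv p M T) (W1p p UNIV);
          Y = tensor p M lborel (Lp_pot p M T) (Lp_space p lborel);
          u = (\<lambda>\<epsilon> U \<xi> z. folding_op T \<epsilon> U z + G 0 \<epsilon> \<xi> z)
      in (\<forall>\<epsilon>>0. pair_bounded_linear
            X (Lp_W1p_norm p M) Y (Lp_norm p (M \<Otimes>\<^sub>M lborel))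
            p (M \<Otimes>\<^sub>M lattice_measure \<epsilon>) (Lp_space p (M \<Otimes>\<^sub>M lattice_measure \<epsilon>)) (u \<epsilon>)) \<and>
         (\<forall>U\<in>X. \<forall>\<xi>\<in>Y.
            two_scale_tendsto p M T (\<lambda>\<epsilon>. u \<epsilon> U \<xi>) U \<and>
            two_scale_tendsto p M T (\<lambda>\<epsilon>. discrete_gradient \<epsilon> (u \<epsilon> U \<xi>))
              (\<lambda>z. weak_gradient_x p M U z + \<xi> z)) \<and>
         (\<exists>C. \<forall>\<epsilon>\<in>{0<..1}. \<forall>U\<in>X. \<forall>\<xi>\<in>Y.
            Lp_norm p (M \<Otimes>\<^sub>M lattice_measure \<epsilon>) (u \<epsilon> U \<xi>)
              \<le> C * (Lp_W1p_norm p M U + Lp_norm p (M \<Otimes>\<^sub>M lborel) \<xi>)))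
     \<and>
     (\<forall>\<gamma>\<in>{0<..<1}.
      let X = tensor p M lborel (Lp_inv p M T) (Lp_space p lborel);
          Y = tensor p M lborel (Lp_pot p M T) (Lp_space p lborel);
          u = (\<lambda>\<epsilon> U \<xi> z. F \<gamma> \<epsilon> U z + G \<gamma> \<epsilon> \<xi> z)
      in (\<forall>\<epsilon>>0. pair_bounded_linear
            X (Lp_norm p (M \<Otimes>\<^sub>M lborel)) Y (Lp_norm p (M \<Otimes>\<^sub>M lborel))
            p (M \<Otimes>\<^sub>M lattice_measure \<epsilon>) (Lp_space p (M \<Otimes>\<^sub>M lattice_measure \<epsilon>)) (u \<epsilon>)) \<and>
         (\<forall>U\<in>X. \<forall>\<xi>\<in>Y.
            two_scale_tendsto p M T (\<lambda>\<epsilon>. u \<epsilon> U \<xi>) U \<and>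
            two_scale_tendsto p M T
              (\<lambda>\<epsilon> z. (\<epsilon> powr \<gamma>) *\<^sub>R discrete_gradient \<epsilon> (u \<epsilon> U \<xi>) z) \<xi>) \<and>
         (\<exists>C. \<forall>\<epsilon>\<in>{0<..1}. \<forall>U\<in>X. \<forall>\<xi>\<in>Y.
            Lp_norm p (M \<Otimes>\<^sub>M lattice_measure \<epsilon>) (u \<epsilon> U \<xi>)
              \<le> C * (Lp_norm p (M \<Otimes>\<^sub>M lborel) U + Lp_norm p (M \<Otimes>\<^sub>M lborel) \<xi>)))
     \<and>
     (\<forall>S. open S \<and> bounded S \<and> lipschitz_boundary S \<longrightarrow>
       (\<forall>U\<in>sobolev_tensor p M (Lp_inv p M T) (W1p_0 p S).
        \<forall>\<xi>\<in>tensor p M lborel (Lp_pot p M T) (Lp_on p S).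
          \<exists>u. (\<forall>\<epsilon>>0. u \<epsilon> \<in> tensor p M (lattice_measure \<epsilon>) (Lp_space p M) (Lp_lattice_0 p \<epsilon> S)) \<and>
              two_scale_tendsto p M T u U \<and>
              two_scale_tendsto p M T (\<lambda>\<epsilon>. discrete_gradient \<epsilon> (u \<epsilon>))
                (\<lambda>z. weak_gradient_x p M U z + \<xi> z))
       \<and>
       (\<forall>\<gamma>\<in>{0<..<1}.
        let X = tensor p M lborel (Lp_inv p M T) (Lp_on p S);
            Y = tensor p M lborel (Lp_pot p M T) (Lp_on p S)
        in \<exists>u. (\<forall>\<epsilon>>0. pair_bounded_linear
                  X (Lp_norm p (M \<Otimes>\<^sub>M lborel)) Y (Lp_norm p (M \<Otimes>\<^sub>M lborel))
                  p (M \<Otimes>\<^sub>M lattice_measure \<epsilon>)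
                  (tensor p M (lattice_measure \<epsilon>) (Lp_space p M) (Lp_lattice_0 p \<epsilon> S)) (u \<epsilon>)) \<and>
               (\<forall>U\<in>X. \<forall>\<xi>\<in>Y.
                  two_scale_tendsto p M T (\<lambda>\<epsilon>. u \<epsilon> U \<xi>) U \<and>
                  two_scale_tendsto p M T
                    (\<lambda>\<epsilon> z. (\<epsilon> powr \<gamma>) *\<^sub>R discrete_gradient \<epsilon> (u \<epsilon> U \<xi>) z) \<xi>) \<and>
               (\<exists>C. \<forall>\<epsilon>\<in>{0<..1}. \<forall>U\<in>X. \<forall>\<xi>\<in>Y.
                  Lp_norm p (M \<Otimes>\<^sub>M lattice_measure \<epsilon>) (u \<epsilon> U \<xi>)
                    \<le> C * (Lp_norm p (M \<Otimes>\<^sub>M lborel) U + Lp_norm p (M \<Otimes>\<^sub>M lborel) \<xi>))))"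
proof -
  interpret measure_preserving_system M T by fact
  have G: "pot_recovery_operators p M T \<gamma> (G \<gamma>)" if "\<gamma> \<in> {0<..<1}" for \<gamma> using assms(5) that by simp
  have F: "inv_recovery_operators p M T \<gamma> (F \<gamma>)" if "\<gamma> \<in> {0<..<1}" for \<gamma> using assms(6) that by simp
  have "pot_recovery_operators p M T 0 (G 0)" by (rule assms(5)) simp_all
  note critical = recovery_critical[OF assms(1) this] supported_recovery_critical[OF assms(1) this]
  note subcritical = recovery_subcritical[OF assms(1) F G]
  show ?thesis
    unfolding Let_def
  proof (intro conjI ballI allI impI, goal_cases)
    case (1 \<epsilon>)
    then show ?case by (rule critical(1))
  next
    case (2 U \<xi>)
    then show ?case by (rule critical(2))
  next
    case (3 U \<xi>)
    then show ?case by (rule critical(3))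
  next
    case 4
    show ?case by (rule critical(4))
  next
    case (5 \<gamma> \<epsilon>)
    then show ?case by (intro subcritical(1))
  next
    case (6 \<gamma> U \<xi>)
    then show ?case by (intro subcritical(2))
  next
    case (7 \<gamma> U \<xi>)
    then show ?case by (intro subcritical(3))
  next
    case (8 \<gamma>)
    then show ?case by (intro subcritical(4))
  next
    case (9 S U \<xi>)
    then show ?case by (intro critical(5)) auto
  next
    case (10 S \<gamma>)
    then show ?case by (intro supported_recovery_subcritical[OF assms(1) _ F G]) auto
  qed
qed

end
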